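(* Let $n\ge2$, $\beta\in(1/2,1)$, $p\in[n,\infty]$, and let $w$ satisfy $\max\{2\beta-1,2-2\beta\}<w<2\beta$ and $1+\frac np+w<4\beta$. There exist constants $\varepsilon>0$ and $C>0$ such that, for all $\mathbb R^n$-valued $u_0,b_0\in G_n^{-(2\beta-1)}(\mathbb R^n)$ with $\nabla\cdot u_0=0$, $\nabla\cdot b_0=0$ and $\|u_0\|_{G_n^{-(2\beta-1)}(\mathbb R^n)}+\|b_0\|_{G_n^{-(2\beta-1)}(\mathbb R^n)}\le\varepsilon$, there is a unique mild solution $(u,b)$ on $(0,\infty)\times\mathbb R^n$ to the fractional magnetohydrodynamics equations $$\begin{cases}\partial_tu+(-\triangle)^\beta u+u\cdot\nabla u+\nabla p-b\cdot\nabla b=0,\\ \partial_tb+(-\triangle)^\beta b+u\cdot\nabla b-b\cdot\nabla u=0,\\ \nabla\cdot u=\nabla\cdot b=0,\\ u|_{t=0}=u_0,\quad b|_{t=0}=b_0\end{cases}$$ (here $p$ denotes the unknown pressure) satisfying, for all $t>0$ and for both $v=u$ and $v=b$, $$\|v(t)\|_{G_n^{-(2\beta-1)}(\mathbb R^n)}+t^{\frac{2\beta-1}{2\beta}}\|v(t)\|_{L^\infty(\mathbb R^n)}+t^{\frac{w}{2\beta}}\|v(t)\|_{\dot B^{w-(2\beta-1)}_{\infty,\infty}(\mathbb R^n)}\le C\bigl(\|u_0\|_{G_n^{-(2\beta-1)}(\mathbb R^n)}+\|b_0\|_{G_n^{-(2\beta-1)}(\mathbb R^n)}\bigr).$$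
   Context: $e^{-t(-\triangle)^\beta}f=K_t^\beta*f$ with $\widehat{K_t^\beta}(\xi)=e^{-t|\xi|^{2\beta}}$. $P=\{\delta_{j,k}+R_jR_k\}_{j,k=1,\dots,n}$ is the Helmholtz–Weyl (Leray) projection, with $R_j=\partial_j(-\triangle)^{-1/2}$. With $$B(u,v)(t)=\int_0^te^{-(t-s)(-\triangle)^\beta}P\nabla\cdot(u\otimes v)(s)\,ds,\qquad (\nabla\cdot(u\otimes v))_j=\sum_k\partial_k(u_kv_j),$$ a mild solution is a pair $(u,b)$ with $u=e^{-t(-\triangle)^\beta}u_0-B(u,u)+B(b,b)$ and $b=e^{-t(-\triangle)^\beta}b_0-B(u,b)+B(b,u)$. For $s>0$, $1\le p\le\infty$ (and the fixed $\beta$), $$G_p^{-s}(\mathbb R^n)=\Bigl\{f\in\mathcal S'(\mathbb R^n):|f|\in\mathcal S'(\mathbb R^n),\ \|f\|_{G_p^{-s}(\mathbb R^n)}=\sup_{t>0}t^{\frac{sn}{2p\beta}}\bigl\|e^{-t(-\triangle)^\beta}|f|\bigr\|_{L^\infty(\mathbb R^n)}<\infty\Bigr\};$$ for vector-valued $f$, $|f|$ is the Euclidean length. In particular the weight for $G_n^{-(2\beta-1)}$ is $t^{\frac{2\beta-1}{2\beta}}$. Homogeneous Besov norm: with $\phi\in C_0^\infty$ supported in $\{1/2\le|\xi|\le2\}$, $\sum_{j\in\mathbb Z}\phi(2^{-j}\xi)=1$ for $\xi\neq0$, $\widehat{\triangle_jf}(\xi)=\phi(2^{-j}\xi)\widehat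 f(\xi)$, one sets $\|f\|_{\dot B^s_{\infty,\infty}(\mathbb{R}^n)}=\sup_{j\in\mathbb Z}2^{sj}\|\triangle_jf\|_{L^\infty}$. *)

theory Defs
  imports "HOL-Analysis.Analysis" "HOL-Probability.Essential_Supremum"
begin

definition partial :: "'n \<Rightarrow> (real^'n \<Rightarrow> 'b::real_normed_vector) \<Rightarrow> real^'n \<Rightarrow> 'b" where
  "partial k f x = frechet_derivative f (at x) (axis k 1)"

primrec partials :: "'n list \<Rightarrow> (real^'n \<Rightarrow> 'b::real_normed_vector) \<Rightarrow> real^'n \<Rightarrow> 'b" where
  "partials [] f = f"
| "partials (k # ks) f = partial k (partials ks f)"

definition smooth :: "(real^'n \<Rightarrow> 'b::real_normed_vector) \<Rightarrow> bool" where
  "smooth f \<longleftrightarrow> (\<forall>ks. partials ks f differentiable_on UNIV)"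

definition test_function :: "(real^'n \<Rightarrow> 'b::real_normed_vector) \<Rightarrow> bool" where
  "test_function f \<longleftrightarrow> smooth f \<and> compact (closure {x. f x \<noteq> 0})"

definition schwartz_values :: "nat \<Rightarrow> (real^'n \<Rightarrow> complex) \<Rightarrow> real set" where
  "schwartz_values N f = {(1 + norm x) ^ N * norm (partials ks f x) | x ks. length ks \<le> N}"

definition schwartz_space :: "(real^'n \<Rightarrow> complex) set" where
  "schwartz_space = {f. smooth f \<and> (\<forall>N. bdd_above (schwartz_values N f))}"

text \<open>The seminorms \<open>Sup (schwartz_values N f)\<close> increase with \<open>N\<close> and generate the Schwartz
  topology, so a linear functional is continuous iff it is bounded by a multiple of one of them.\<close>

definition tempered_distribution :: "((real^'n \<Rightarrow> complex) \<Rightarrow> complex) \<Rightarrow> bool" where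
  "tempered_distribution T \<longleftrightarrow>
     (\<forall>f\<in>schwartz_space. \<forall>g\<in>schwartz_space. T (\<lambda>x. f x + g x) = T f + T g) \<and>
     (\<forall>c. \<forall>f\<in>schwartz_space. T (\<lambda>x. c * f x) = c * T f) \<and>
     (\<exists>N C. \<forall>f\<in>schwartz_space. norm (T f) \<le> C * Sup (schwartz_values N f))"

definition loc_integrable :: "(real^'n \<Rightarrow> 'b::euclidean_space) \<Rightarrow> bool" where
  "loc_integrable f \<longleftrightarrow>
     f \<in> borel_measurable lborel \<and> (\<forall>K. compact K \<longrightarrow> set_integrable lborel K f)"

text \<open>A function belongs to \<open>\<S>'\<close> if the distribution it defines on \<open>C\<^sub>c\<^sup>\<infinity>\<close> extends to a tempered
  distribution. Almost-everywhere classes are represented by Borel functions.\<close>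

definition tempered_function :: "(real^'n \<Rightarrow> real) \<Rightarrow> bool" where
  "tempered_function f \<longleftrightarrow> loc_integrable f \<and>
     (\<exists>T. tempered_distribution T \<and>
       (\<forall>\<psi>::real^'n \<Rightarrow> complex. test_function \<psi> \<longrightarrow> T \<psi> = (LINT x|lborel. f x *\<^sub>R \<psi> x)))"

definition divergence_free :: "(real^'n \<Rightarrow> real^'n) \<Rightarrow> bool" where
  "divergence_free f \<longleftrightarrow> (\<forall>\<psi>::real^'n \<Rightarrow> real. test_function \<psi> \<longrightarrow>
     (LINT x|lborel. (\<Sum>k\<in>UNIV. f x $ k * partial k \<psi> x)) = 0)"

definition conv :: "(real^'n \<Rightarrow> 'b::{banach,second_countable_topology}) \<Rightarrow> (real^'n \<Rightarrow> real)
    \<Rightarrow> real^'n \<Rightarrow> 'b" where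
  "conv k f x = (LINT y|lborel. f y *\<^sub>R k (x - y))"

definition convolvable :: "(real^'n \<Rightarrow> 'b::{banach,second_countable_topology}) \<Rightarrow> (real^'n \<Rightarrow> real)
    \<Rightarrow> bool" where
  "convolvable k f \<longleftrightarrow> (AE x in lborel. integrable lborel (\<lambda>y. f y *\<^sub>R k (x - y)))"

definition linf_norm :: "(real^'n \<Rightarrow> 'b::real_normed_vector) \<Rightarrow> ennreal" where
  "linf_norm f = esssup lborel (\<lambda>x. ennreal (norm (f x)))"

text \<open>Convention: the Fourier transform is \<open>\<integral> f(x) exp(-i x\<cdot>\<xi>) dx\<close>, so that \<open>\<partial>\<^sub>k\<close> has symbol \<open>i \<xi>\<^sub>k\<close>
  and \<open>(-\<triangle>)\<^sup>\<beta>\<close> has symbol \<open>\<bar>\<xi>\<bar>\<^bsup>2\<beta>\<^esup>\<close>.\<close>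

definition inverse_fourier :: "(real^'n \<Rightarrow> complex) \<Rightarrow> real^'n \<Rightarrow> complex" where
  "inverse_fourier m x =
     of_real (1 / (2 * pi) ^ CARD('n)) * (LINT \<xi>|lborel. exp (\<i> * of_real (x \<bullet> \<xi>)) * m \<xi>)"

definition heat_symbol :: "real \<Rightarrow> real \<Rightarrow> real^'n \<Rightarrow> complex" where
  "heat_symbol \<beta> t \<xi> = of_real (exp (- t * norm \<xi> powr (2 * \<beta>)))"

definition deriv_symbol :: "'n \<Rightarrow> real^'n \<Rightarrow> complex" where
  "deriv_symbol k \<xi> = \<i> * of_real (\<xi> $ k)"

definition riesz_symbol :: "'n \<Rightarrow> real^'n \<Rightarrow> complex" where
  "riesz_symbol k \<xi> = deriv_symbol k \<xi> / of_real (norm \<xi>)"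

definition leray_symbol :: "'n \<Rightarrow> 'n \<Rightarrow> real^'n \<Rightarrow> complex" where
  "leray_symbol j k \<xi> = (if j = k then 1 else 0) + riesz_symbol j \<xi> * riesz_symbol k \<xi>"

text \<open>The two symbols below satisfy \<open>m(-\<xi>) = cnj (m(\<xi>))\<close>, so the kernels are real and \<open>Re\<close> is only a
  change of type.\<close>

definition heat_kernel :: "real \<Rightarrow> real \<Rightarrow> real^'n \<Rightarrow> real" where
  "heat_kernel \<beta> t x = Re (inverse_fourier (heat_symbol \<beta> t) x)"

definition heat :: "real \<Rightarrow> real \<Rightarrow> (real^'n \<Rightarrow> real^'n) \<Rightarrow> real^'n \<Rightarrow> real^'n" where
  "heat \<beta> t f x = (\<chi> j. conv (heat_kernel \<beta> t) (\<lambda>y. f y $ j) x)"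

text \<open>\<open>oseen_kernel \<beta> t j k l\<close> is the kernel of \<open>exp(-t(-\<triangle>)\<^sup>\<beta>) P\<^sub>j\<^sub>k \<partial>\<^sub>l\<close>. For \<open>t > 0\<close> the symbol of the
  composite is integrable and its kernel lies in \<open>L\<^sup>1\<close>, so the composite acts on bounded functions,
  whereas \<open>P\<close> alone does not.\<close>

definition oseen_kernel :: "real \<Rightarrow> real \<Rightarrow> 'n \<Rightarrow> 'n \<Rightarrow> 'n \<Rightarrow> real^'n \<Rightarrow> real" where
  "oseen_kernel \<beta> t j k l x =
     Re (inverse_fourier (\<lambda>\<xi>. heat_symbol \<beta> t \<xi> * leray_symbol j k \<xi> * deriv_symbol l \<xi>) x)"

text \<open>\<open>heat_leray_div \<beta> t u v\<close> is \<open>exp(-t(-\<triangle>)\<^sup>\<beta>) P \<nabla>\<cdot>(u \<otimes> v)\<close>, where the \<open>k\<close>-th component of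
  \<open>\<nabla>\<cdot>(u \<otimes> v)\<close> is \<open>\<Sum>\<^sub>l \<partial>\<^sub>l (u\<^sub>l v\<^sub>k)\<close>.\<close>

definition heat_leray_div :: "real \<Rightarrow> real \<Rightarrow> (real^'n \<Rightarrow> real^'n) \<Rightarrow> (real^'n \<Rightarrow> real^'n)
    \<Rightarrow> real^'n \<Rightarrow> real^'n" where
  "heat_leray_div \<beta> t u v x =
     (\<chi> j. \<Sum>k\<in>UNIV. \<Sum>l\<in>UNIV. conv (oseen_kernel \<beta> t j k l) (\<lambda>y. u y $ l * v y $ k) x)"

text \<open>The convolution norm is set to \<open>top\<close> when the defining integral does not converge absolutely
  almost everywhere. For \<open>p = \<infinity>\<close> the exponent of \<open>t\<close> is \<open>0\<close>.\<close>

definition G_norm :: "real \<Rightarrow> ereal \<Rightarrow> real \<Rightarrow> (real^'n \<Rightarrow> 'b::euclidean_space) \<Rightarrow> ennreal" where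
  "G_norm \<beta> p s f = (SUP t\<in>{0<..}.
     ennreal (t powr real_of_ereal (ereal (s * real CARD('n)) / (2 * p * ereal \<beta>))) *
     (if convolvable (heat_kernel \<beta> t) (\<lambda>x. norm (f x))
      then linf_norm (conv (heat_kernel \<beta> t) (\<lambda>x. norm (f x))) else top))"

text \<open>\<open>G_space \<beta> p s\<close> is the space usually written with the superscript \<open>-s\<close>.\<close>

definition G_space :: "real \<Rightarrow> ereal \<Rightarrow> real \<Rightarrow> (real^'n \<Rightarrow> 'b::euclidean_space) set" where
  "G_space \<beta> p s = {f. f \<in> borel_measurable lborel \<and> (\<forall>e\<in>Basis. tempered_function (\<lambda>x. f x \<bullet> e)) \<and>
     tempered_function (\<lambda>x. norm (f x)) \<and> G_norm \<beta> p s f < top}"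

definition littlewood_paley :: "(real^'n \<Rightarrow> complex) \<Rightarrow> bool" where
  "littlewood_paley \<phi> \<longleftrightarrow> test_function \<phi> \<and> closure {\<xi>. \<phi> \<xi> \<noteq> 0} \<subseteq> {\<xi>. 1/2 \<le> norm \<xi> \<and> norm \<xi> \<le> 2} \<and>
     (\<forall>\<xi>. \<xi> \<noteq> 0 \<longrightarrow> ((\<lambda>j::int. \<phi> ((2 powi (- j)) *\<^sub>R \<xi>)) has_sum 1) UNIV)"

definition lp_kernel :: "(real^'n \<Rightarrow> complex) \<Rightarrow> int \<Rightarrow> real^'n \<Rightarrow> complex" where
  "lp_kernel \<phi> j = inverse_fourier (\<lambda>\<xi>. \<phi> ((2 powi (- j)) *\<^sub>R \<xi>))"

definition lp_block :: "(real^'n \<Rightarrow> complex) \<Rightarrow> int \<Rightarrow> (real^'n \<Rightarrow> real^'n) \<Rightarrow> real^'n \<Rightarrow> complex^'n" where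
  "lp_block \<phi> j f x = (\<chi> i. conv (lp_kernel \<phi> j) (\<lambda>y. f y $ i) x)"

text \<open>Homogeneous Besov norm with both integrability indices infinite. The Littlewood-Paley blocks
  are written as absolutely convergent convolutions, as is possible for bounded \<open>f\<close>.\<close>

definition besov_norm :: "(real^'n \<Rightarrow> complex) \<Rightarrow> real \<Rightarrow> (real^'n \<Rightarrow> real^'n) \<Rightarrow> ennreal" where
  "besov_norm \<phi> s f = (SUP j::int. ennreal (2 powr (s * of_int j)) *
     (if \<forall>i. convolvable (lp_kernel \<phi> j) (\<lambda>y. f y $ i) then linf_norm (lp_block \<phi> j f) else top))"

definition duhamel :: "real \<Rightarrow> (real \<Rightarrow> real^'n \<Rightarrow> real^'n) \<Rightarrow> (real \<Rightarrow> real^'n \<Rightarrow> real^'n)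
    \<Rightarrow> real \<Rightarrow> real^'n \<Rightarrow> real^'n" where
  "duhamel \<beta> u v t x = (LINT s:{0<..<t}|lborel. heat_leray_div \<beta> (t - s) (u s) (v s) x)"

definition duhamel_defined :: "real \<Rightarrow> (real \<Rightarrow> real^'n \<Rightarrow> real^'n) \<Rightarrow> (real \<Rightarrow> real^'n \<Rightarrow> real^'n)
    \<Rightarrow> real \<Rightarrow> bool" where
  "duhamel_defined \<beta> u v t \<longleftrightarrow> (AE x in lborel. \<forall>j k l.
     set_integrable lborel ({0<..<t} \<times> UNIV)
       (\<lambda>(s, y). u s y $ l * v s y $ k * oseen_kernel \<beta> (t - s) j k l (x - y)))"

text \<open>\<open>duhamel \<beta> u v\<close> is the bilinear term \<open>B(u,v)\<close>. The joint measurability and absolute convergence clauses make its integrals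
  meaningful, since the Lebesgue integral of a non-integrable function is \<open>0\<close> by convention.\<close>

definition mild_solution :: "real \<Rightarrow> (real^'n \<Rightarrow> real^'n) \<Rightarrow> (real^'n \<Rightarrow> real^'n)
    \<Rightarrow> (real \<Rightarrow> real^'n \<Rightarrow> real^'n) \<Rightarrow> (real \<Rightarrow> real^'n \<Rightarrow> real^'n) \<Rightarrow> bool" where
  "mild_solution \<beta> u0 b0 u b \<longleftrightarrow>
     (\<forall>v\<in>{u, b}. set_borel_measurable borel ({0<..} \<times> UNIV) (\<lambda>(t, x). v t x)) \<and>
     (\<forall>t>0. (\<forall>f\<in>{u0, b0}. \<forall>j. convolvable (heat_kernel \<beta> t) (\<lambda>y. f y $ j)) \<and>
       (\<forall>v\<in>{u, b}. \<forall>v'\<in>{u, b}. duhamel_defined \<beta> v v' t) \<and>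
       (AE x in lborel. u t x = heat \<beta> t u0 x - duhamel \<beta> u u t x + duhamel \<beta> b b t x) \<and>
       (AE x in lborel. b t x = heat \<beta> t b0 x - duhamel \<beta> u b t x + duhamel \<beta> b u t x))"

definition mhd_norm :: "(real^'n \<Rightarrow> complex) \<Rightarrow> real \<Rightarrow> real \<Rightarrow> real \<Rightarrow> (real^'n \<Rightarrow> real^'n) \<Rightarrow> ennreal" where
  "mhd_norm \<phi> \<beta> w t f =
     G_norm \<beta> (ereal (real CARD('n))) (2 * \<beta> - 1) f +
     ennreal (t powr ((2 * \<beta> - 1) / (2 * \<beta>))) * linf_norm f +
     ennreal (t powr (w / (2 * \<beta>))) * besov_norm \<phi> (w - (2 * \<beta> - 1)) f"

end

theory Submission
  imports Defs "HOL-Probability.Probability" "HOL-Real_Asymp.Real_Asymp"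
begin

text \<open>The solution is the fixed point of a Picard iteration for the pair \<open>(u, b)\<close> in the norm
\<open>sup\<^sub>t t\<^sup>a \<parallel>v(t)\<parallel>\<^sub>\<infinity>\<close> with \<open>a = (2\<beta>-1)/(2\<beta>)\<close>. The kernel of \<open>exp(-\<tau>(-\<triangle>)\<^sup>\<beta>) P \<nabla>\<cdot>\<close> has \<open>L\<^sup>1\<close> norm of order
\<open>\<tau> powr (-1/(2\<beta>))\<close>, so the bilinear term of two fields of size \<open>s powr (-a)\<close> is at most a multiple
of \<open>\<integral> (t-s) powr (-1/(2\<beta>)) * s powr (-2a) ds\<close> over \<open>0 < s < t\<close>. This Beta integral converges exactly
for \<open>1/2 < \<beta> < 1\<close> and equals a constant times \<open>t powr (-a)\<close>: the norm is critical, and for small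
data the map contracts by one half. The data enter because a bound on their gauge norm is, after
removal of null sets, a bound on \<open>t\<^sup>a exp(-t(-\<triangle>)\<^sup>\<beta>) \<bar>u\<^sub>0\<bar>\<close> at every point.

All kernel estimates are reduced to Gaussians by subordination: \<open>exp(-t \<rho>\<^sup>\<beta>)\<close> is a positive average
of the functions \<open>exp(-d \<rho>)\<close>. In the form \<open>subordination_le\<close> it says that an inequality between two
weighted integrals of \<open>exp(-d \<rho>)\<close>, valid for all \<open>d > 0\<close>, survives the passage to \<open>exp(-t \<rho>\<^sup>\<beta>)\<close>.
Tested with \<open>\<rho> = \<bar>\<xi>\<bar>\<^sup>2\<close> it transfers \<open>L\<^sup>1\<close> bounds (\<open>stable_kernel_L1\<close>) and positivity
(\<open>heat_kernel_nonneg\<close>) from the heat equation to the fractional one.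

The other two norms are carried along by the same iteration. With \<open>\<sigma> = w - (2\<beta>-1)\<close>, which lies in
\<open>(0,1)\<close>, the Besov norm is bounded by a Hoelder seminorm (\<open>besov_norm_le_hoelder\<close>), and the latter
propagates with weight \<open>t powr (-a - \<sigma>/(2\<beta>))\<close> (\<open>duhamel_hoelder\<close>). The gauge norm propagates since
convolution with the positive heat kernel commutes with convolution by the modulus of the Oseen
kernel (\<open>duhamel_gauge\<close>). Each of these bounds defines a set of fields closed under the iteration
and under its limit. The divergence vanishes because \<open>\<Sum>\<^sub>j \<xi>\<^sub>j P\<^sub>j\<^sub>k(\<xi>) = 0\<close>.

For uniqueness, a mild solution obeying the bound is replaced, at each time off a null set, by a
Borel representative bounded everywhere. One application of the Picard map turns this representative
into an exact fixed point, and two fixed points in the region of contraction coincide.\<close>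

section \<open>Gaussian integrals\<close>

text \<open>Fubini in coordinates, which reduces Gaussian integrals to one variable.\<close>

lemma has_bochner_integral_prod_Basis:
  fixes f :: "'a::euclidean_space \<Rightarrow> real \<Rightarrow> complex"
  assumes "\<And>b. b \<in> Basis \<Longrightarrow> integrable lborel (f b)"
  shows "has_bochner_integral lborel (\<lambda>x. \<Prod>b\<in>Basis. f b (x \<bullet> b)) (\<Prod>b\<in>Basis. LINT t|lborel. f b t)"
proof -
  interpret product_sigma_finite "\<lambda>_::'a. lborel :: real measure" by standard
  define g where "g = (\<lambda>x. \<Prod>b\<in>Basis. f b (x \<bullet> b))"
  have fm [measurable]: "f b \<in> borel_measurable borel" if "b \<in> Basis" for b
    using assms[OF that] by simp
  have gm: "g \<in> borel_measurable borel"
    unfolding g_def by (intro borel_measurable_prod measurable_compose[OF _ fm]) auto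
  have tm: "(\<lambda>h. \<Sum>b\<in>Basis. h b *\<^sub>R b) \<in> (\<Pi>\<^sub>M b\<in>Basis. lborel) \<rightarrow>\<^sub>M (borel :: 'a measure)"
    by simp
  have eq: "g (\<Sum>b\<in>Basis. h b *\<^sub>R b) = (\<Prod>b\<in>Basis. f b (h b))" for h
    unfolding g_def by (intro prod.cong refl) (simp add: inner_sum_left_Basis)
  have i: "integrable (\<Pi>\<^sub>M b\<in>Basis. lborel) (\<lambda>h. \<Prod>b\<in>Basis. f b (h b))"
    by (rule product_integrable_prod) (use assms in auto)
  have "integrable lborel g"
    by (subst lborel_eq) (use i in \<open>simp add: integrable_distr_eq[OF tm gm] eq\<close>)
  moreover have "integral\<^sup>L lborel g = (\<Prod>b\<in>Basis. LINT t|lborel. f b t)"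
    by (subst lborel_eq) (use assms in \<open>simp add: integral_distr[OF tm gm] eq product_integral_prod\<close>)
  ultimately show ?thesis by (simp add: has_bochner_integral_iff g_def)
qed

lemma gaussian_fourier_1d:
  fixes c y :: real
  assumes c: "0 < c"
  shows "has_bochner_integral lborel (\<lambda>x. iexp (x * y) * of_real (exp (- c * x\<^sup>2)))
           (of_real (sqrt (pi / c) * exp (- y\<^sup>2 / (4 * c))) :: complex)"
proof -
  have "char std_normal_distribution t = (LINT x|lborel. std_normal_density x *\<^sub>R iexp (t * x))" for t
    unfolding char_def by (subst integral_density) auto
  then have 1: "(LINT x|lborel. std_normal_density x *\<^sub>R iexp (t * x)) = of_real (exp (- t\<^sup>2 / 2))" for t
    by (simp add: char_std_normal_distribution)
  define r where "r = sqrt (2 * c)"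
  have r: "r > 0" "r\<^sup>2 = 2 * c" using c by (auto simp: r_def)
  have i1: "integrable lborel (\<lambda>x. std_normal_density x *\<^sub>R iexp (t * x))" for t
    by (rule Bochner_Integration.integrable_bound[OF integrable_normal_density[of 1 0]]) auto
  have h: "has_bochner_integral lborel (\<lambda>x. std_normal_density x *\<^sub>R iexp ((y/r) * x)) (of_real (exp (- (y/r)\<^sup>2 / 2)))"
    using i1[of "y/r"] 1[of "y/r"] unfolding has_bochner_integral_iff by blast
  have "has_bochner_integral lborel (\<lambda>x. std_normal_density (0 + r * x) *\<^sub>R iexp ((y/r) * (0 + r * x)))
      (of_real (exp (- (y/r)\<^sup>2 / 2)) /\<^sub>R \<bar>r\<bar>)"
    by (subst lborel_has_bochner_integral_real_affine_iff[symmetric]) (use r h in auto)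
  then have "has_bochner_integral lborel (\<lambda>x. (sqrt (2 * pi)) *\<^sub>R (std_normal_density (0 + r * x) *\<^sub>R iexp ((y/r) * (0 + r * x))))
      (sqrt (2 * pi) *\<^sub>R (of_real (exp (- (y/r)\<^sup>2 / 2)) /\<^sub>R \<bar>r\<bar>))"
    by (rule has_bochner_integral_scaleR_right)
  moreover have "sqrt (2 * pi) *\<^sub>R (std_normal_density (0 + r * x) *\<^sub>R iexp ((y/r) * (0 + r * x)))
     = iexp (x * y) * of_real (exp (- c * x\<^sup>2))" for x
    using r by (simp add: std_normal_density_def power_mult_distrib scaleR_conv_of_real field_simps real_sqrt_mult)
  moreover have "sqrt (2 * pi) *\<^sub>R (of_real (exp (- (y/r)\<^sup>2 / 2)) /\<^sub>R \<bar>r\<bar>) = (of_real (sqrt (pi / c) * exp (- y\<^sup>2 / (4 * c))) :: complex)"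
  proof -
    have "sqrt (2*pi) / r = sqrt (pi / c)" unfolding r_def by (simp add: real_sqrt_divide real_sqrt_mult)
    moreover have "- (y/r)\<^sup>2 / 2 = - y\<^sup>2 / (4 * c)" using r by (simp add: power_divide)
    ultimately show ?thesis using r by (simp add: scaleR_conv_of_real field_simps)
  qed
  ultimately show ?thesis by simp
qed

text \<open>Integration by parts: \<open>\<i> y exp(\<i> x y) exp(-c x\<^sup>2) - 2 c x exp(\<i> x y) exp(-c x\<^sup>2)\<close> is an exact
derivative.\<close>

lemma gaussian_moment_fourier_1d:
  fixes c y :: real
  assumes c: "0 < c"
  shows "has_bochner_integral lborel (\<lambda>x. iexp (x * y) * of_real (x * exp (- c * x\<^sup>2)))
           (\<i> * of_real (y / (2 * c) * (sqrt (pi / c) * exp (- y\<^sup>2 / (4 * c)))) :: complex)"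
proof -
  let ?F = "\<lambda>x::real. iexp (x * y) * of_real (exp (- c * x\<^sup>2)) :: complex"
  let ?f = "\<lambda>x::real. iexp (x * y) * of_real (x * exp (- c * x\<^sup>2)) :: complex"
  have i0: "integrable lborel ?F" using gaussian_fourier_1d[OF c, of y] by (auto simp: has_bochner_integral_iff)
  define s where "s = 1 / sqrt (2 * c)"
  have s: "s > 0" "s\<^sup>2 = 1 / (2*c)" using c by (auto simp: s_def power_divide)
  have "integrable lborel (\<lambda>x. sqrt (2 * pi * s\<^sup>2) * (normal_density 0 s x * x))"
    using integrable_normal_moment_nz_1[OF s(1), of 0] by simp
  moreover have "sqrt (2 * pi * s\<^sup>2) * (normal_density 0 s x * x) = x * exp (- c * x\<^sup>2)" for x
    using s c by (simp add: normal_density_def)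
  ultimately have "integrable lborel (\<lambda>x. x * exp (- c * x\<^sup>2))" by simp
  then have i1: "integrable lborel ?f"
    by (rule Bochner_Integration.integrable_bound) (auto simp: norm_mult)
  let ?G = "\<lambda>x. \<i> * of_real y * ?F x - 2 * of_real c * ?f x"
  have iG: "integrable lborel ?G" using i0 i1 by simp
  have lim: "(?F \<longlongrightarrow> 0) at_top" "(?F \<longlongrightarrow> 0) at_bot"
  proof -
    have "((\<lambda>x. exp (- c * x\<^sup>2)) \<longlongrightarrow> 0) at_top" "((\<lambda>x. exp (- c * x\<^sup>2)) \<longlongrightarrow> 0) at_bot"
      using c by real_asymp+
    moreover have "norm (?F x) = exp (- c * x\<^sup>2)" for x by (simp only: norm_mult norm_exp_i_times norm_of_real) simp
    ultimately show "(?F \<longlongrightarrow> 0) at_top" "(?F \<longlongrightarrow> 0) at_bot"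
      by (auto intro: tendsto_norm_zero_cancel simp only:)
  qed
  have "(LBINT x=-\<infinity>..\<infinity>. ?G x) = 0 - 0"
  proof (rule interval_integral_FTC_integrable[of _ _ ?F])
    show "(?F has_vector_derivative ?G x) (at x)" for x
    proof -
      have "((\<lambda>z. exp (\<i> * (z * of_real y)) * exp (- of_real c * z\<^sup>2)) has_field_derivative ?G x) (at (of_real x))"
        by (auto intro!: derivative_eq_intros simp: algebra_simps of_real_exp power2_eq_square simp flip: exp_of_real)
      from has_vector_derivative_real_field[OF this]
      show ?thesis by (simp add: of_real_exp)
    qed
    show "isCont ?G x" for x by (intro continuous_intros)
    show "set_integrable lborel (einterval (-\<infinity>) \<infinity>) ?G" using iG by (simp add: set_integrable_def)
    show "((?F \<circ> real_of_ereal) \<longlongrightarrow> 0) (at_right (-\<infinity>))" "((?F \<circ> real_of_ereal) \<longlongrightarrow> 0) (at_left \<infinity>)"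
      using lim by (simp_all add: ereal_tendsto_simps1 ereal_tendsto_simps)
  qed simp
  then have "(LINT x|lborel. ?G x) = 0"
    by (simp add: interval_lebesgue_integral_def set_lebesgue_integral_def)
  moreover have "(LINT x|lborel. ?G x) = \<i> * of_real y * (LINT x|lborel. ?F x) - 2 * of_real c * (LINT x|lborel. ?f x)"
    using i0 i1 by simp
  ultimately have "2 * of_real c * (LINT x|lborel. ?f x) = \<i> * of_real y * (LINT x|lborel. ?F x)" by simp
  then have "(LINT x|lborel. ?f x) = \<i> * of_real (y / (2 * c)) * (LINT x|lborel. ?F x)"
    using c by (simp add: field_simps)
  moreover have "(LINT x|lborel. ?F x) = of_real (sqrt (pi / c) * exp (- y\<^sup>2 / (4 * c)))"
    using gaussian_fourier_1d[OF c, of y] by (auto simp: has_bochner_integral_iff)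
  ultimately show ?thesis using i1 by (simp add: has_bochner_integral_iff)
qed


abbreviation gauss_symbol :: "real \<Rightarrow> 'a::real_normed_vector \<Rightarrow> complex" where
  "gauss_symbol d x \<equiv> of_real (exp (- d * (norm x)\<^sup>2))"

lemma prod_Basis_iexp_gaussian:
  fixes x y :: "'a::euclidean_space"
  shows "(\<Prod>b\<in>Basis. iexp ((x \<bullet> b) * (y \<bullet> b)) * of_real (exp (- c * (x \<bullet> b)\<^sup>2)))
    = (iexp (x \<bullet> y) * gauss_symbol c x :: complex)"
proof -
  have n2: "(norm x)\<^sup>2 = (\<Sum>b\<in>Basis. (x \<bullet> b)\<^sup>2)"
    unfolding power2_norm_eq_inner by (subst euclidean_inner) (simp add: power2_eq_square)
  have "\<i> * of_real (x \<bullet> y) = (\<Sum>b\<in>Basis. \<i> * of_real ((x \<bullet> b) * (y \<bullet> b)))"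
    by (subst euclidean_inner) (simp add: sum_distrib_left)
  moreover have "(gauss_symbol c x :: complex) = (\<Prod>b\<in>Basis. of_real (exp (- c * (x \<bullet> b)\<^sup>2)))"
    unfolding n2 sum_distrib_left exp_sum[OF finite_Basis] by simp
  ultimately show ?thesis by (simp only: prod.distrib exp_sum[OF finite_Basis])
qed

lemma prod_Basis_gaussian:
  fixes y :: "'a::euclidean_space"
  shows "(\<Prod>b\<in>(Basis::'a set). of_real (r * exp (- (y \<bullet> b)\<^sup>2 / d)))
    = (of_real (r ^ DIM('a) * exp (- (norm y)\<^sup>2 / d)) :: complex)"
proof -
  have n2: "(norm y)\<^sup>2 = (\<Sum>b\<in>Basis. (y \<bullet> b)\<^sup>2)"
    unfolding power2_norm_eq_inner by (subst euclidean_inner) (simp add: power2_eq_square)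
  have "exp (- (norm y)\<^sup>2 / d) = (\<Prod>b\<in>Basis. exp (- (y \<bullet> b)\<^sup>2 / d))"
    unfolding n2 sum_negf[symmetric] sum_divide_distrib exp_sum[OF finite_Basis] ..
  then show ?thesis by (simp only: of_real_prod[symmetric] prod.distrib prod_constant)
qed

lemma gaussian_fourier:
  fixes y :: "'a::euclidean_space"
  assumes c: "0 < c"
  shows "has_bochner_integral lborel (\<lambda>x. iexp (x \<bullet> y) * gauss_symbol c x)
           (of_real (sqrt (pi / c) ^ DIM('a) * exp (- (norm y)\<^sup>2 / (4 * c))) :: complex)"
proof -
  define f where "f = (\<lambda>b t. iexp (t * (y \<bullet> b)) * of_real (exp (- c * t\<^sup>2)) :: complex)"
  have f: "has_bochner_integral lborel (f b) (of_real (sqrt (pi / c) * exp (- (y \<bullet> b)\<^sup>2 / (4 * c))))" for b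
    unfolding f_def by (rule gaussian_fourier_1d[OF c])
  have "has_bochner_integral lborel (\<lambda>x. \<Prod>b\<in>Basis. f b (x \<bullet> b)) (\<Prod>b\<in>(Basis::'a set). LINT t|lborel. f b t)"
    by (rule has_bochner_integral_prod_Basis) (use f in \<open>auto simp: has_bochner_integral_iff\<close>)
  moreover have "(\<Prod>b\<in>Basis. f b (x \<bullet> b)) = iexp (x \<bullet> y) * gauss_symbol c x" for x
    unfolding f_def by (rule prod_Basis_iexp_gaussian)
  moreover have "(\<Prod>b\<in>(Basis::'a set). LINT t|lborel. f b t) = of_real (sqrt (pi / c) ^ DIM('a) * exp (- (norm y)\<^sup>2 / (4 * c)))"
    using f unfolding has_bochner_integral_iff by (simp only: prod_Basis_gaussian)
  ultimately show ?thesis by simp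
qed

lemma gaussian_moment_fourier:
  fixes y :: "'a::euclidean_space"
  assumes c: "0 < c" and b: "b \<in> Basis"
  shows "has_bochner_integral lborel (\<lambda>x. iexp (x \<bullet> y) * of_real ((x \<bullet> b) * exp (- c * (norm x)\<^sup>2)))
           (\<i> * of_real ((y \<bullet> b) / (2 * c) * (sqrt (pi / c) ^ DIM('a) * exp (- (norm y)\<^sup>2 / (4 * c)))) :: complex)"
proof -
  define f where "f = (\<lambda>b t. iexp (t * (y \<bullet> b)) * of_real (exp (- c * t\<^sup>2)) :: complex)"
  define g where "g = (\<lambda>b' t. f b' t * (if b' = b then of_real t else 1))"
  have f: "has_bochner_integral lborel (f b) (of_real (sqrt (pi / c) * exp (- (y \<bullet> b)\<^sup>2 / (4 * c))))" for b
    unfolding f_def by (rule gaussian_fourier_1d[OF c])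
  have g: "has_bochner_integral lborel (g b') (of_real (sqrt (pi / c) * exp (- (y \<bullet> b')\<^sup>2 / (4 * c))) *
       (if b' = b then \<i> * of_real ((y \<bullet> b) / (2 * c)) else 1))" for b'
    using gaussian_moment_fourier_1d[OF c, of "y \<bullet> b"] f[of b'] unfolding g_def f_def
    by (auto simp: mult_ac)
  have "has_bochner_integral lborel (\<lambda>x. \<Prod>b\<in>Basis. g b (x \<bullet> b)) (\<Prod>b\<in>(Basis::'a set). LINT t|lborel. g b t)"
    by (rule has_bochner_integral_prod_Basis) (use g in \<open>auto simp: has_bochner_integral_iff\<close>)
  moreover have "(\<Prod>b\<in>Basis. f b (x \<bullet> b)) = iexp (x \<bullet> y) * gauss_symbol c x" for x
    unfolding f_def by (rule prod_Basis_iexp_gaussian)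
  then have "(\<Prod>b\<in>Basis. g b (x \<bullet> b)) = iexp (x \<bullet> y) * of_real ((x \<bullet> b) * exp (- c * (norm x)\<^sup>2))" for x
    using b by (simp add: g_def prod.distrib prod.delta)
  moreover have "(\<Prod>b\<in>(Basis::'a set). LINT t|lborel. f b t) = of_real (sqrt (pi / c) ^ DIM('a) * exp (- (norm y)\<^sup>2 / (4 * c)))"
    using f unfolding has_bochner_integral_iff by (simp only: prod_Basis_gaussian)
  then have "(\<Prod>b'\<in>(Basis::'a set). LINT t|lborel. g b' t) = \<i> * of_real ((y \<bullet> b) / (2 * c) * (sqrt (pi / c) ^ DIM('a) * exp (- (norm y)\<^sup>2 / (4 * c))))"
    using b g f unfolding has_bochner_integral_iff by (simp add: prod.distrib prod.delta mult_ac)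
  ultimately show ?thesis by simp
qed

lemma integrable_pair_bound:
  fixes h :: "'a::euclidean_space \<Rightarrow> 'b::euclidean_space \<Rightarrow> 'c::{banach, second_countable_topology}"
  assumes [measurable]: "(\<lambda>(x, y). h x y) \<in> borel_measurable (lborel \<Otimes>\<^sub>M lborel)"
    and F: "integrable lborel F" and G: "integrable lborel G"
    and b: "\<And>x y. norm (h x y) \<le> F x * G y"
  shows "integrable (lborel \<Otimes>\<^sub>M lborel) (\<lambda>(x, y). h x y)"
proof -
  have [measurable]: "F \<in> borel_measurable borel" "G \<in> borel_measurable borel" using F G by auto
  have "integrable (lborel \<Otimes>\<^sub>M lborel) (\<lambda>(x, y). F x * G y)"
    by (rule lborel_pair.Fubini_integrable) (use F G in \<open>auto simp: abs_mult\<close>)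
  then show ?thesis
    by (rule Bochner_Integration.integrable_bound) (auto intro!: order_trans[OF b])
qed

lemma lborel_has_bochner_integral_affine:
  fixes f :: "'a::euclidean_space \<Rightarrow> 'b::{banach, second_countable_topology}"
  assumes "has_bochner_integral lborel f I" and c: "c \<noteq> 0"
  shows "has_bochner_integral lborel (\<lambda>x. f (t + c *\<^sub>R x)) (I /\<^sub>R \<bar>c\<bar> ^ DIM('a))"
proof -
  have [measurable]: "f \<in> borel_measurable borel" using assms by (auto simp: has_bochner_integral_iff)
  have i: "integrable lborel f" and I: "I = integral\<^sup>L lborel f" using assms by (auto simp: has_bochner_integral_iff)
  have "integrable (density (distr lborel borel (\<lambda>x. t + c *\<^sub>R x)) (\<lambda>_. ennreal (\<bar>c\<bar> ^ DIM('a)))) f"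
    using i lborel_affine[OF c, of t] by simp
  then have "integrable (distr lborel borel (\<lambda>x. t + c *\<^sub>R x)) (\<lambda>x. \<bar>c\<bar> ^ DIM('a) *\<^sub>R f x)"
    by (subst (asm) integrable_density) auto
  then have "integrable (distr lborel borel (\<lambda>x. t + c *\<^sub>R x)) (\<lambda>x. (inverse (\<bar>c\<bar> ^ DIM('a))) *\<^sub>R (\<bar>c\<bar> ^ DIM('a) *\<^sub>R f x))"
    by (rule integrable_scaleR_right)
  then have 1: "integrable lborel (\<lambda>x. f (t + c *\<^sub>R x))"
    using c by (simp add: integrable_distr_eq)
  have "I = integral\<^sup>L (density (distr lborel borel (\<lambda>x. t + c *\<^sub>R x)) (\<lambda>_. ennreal (\<bar>c\<bar> ^ DIM('a)))) f"
    using I lborel_affine[OF c, of t] by simp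
  also have "\<dots> = \<bar>c\<bar> ^ DIM('a) *\<^sub>R (LINT x|lborel. f (t + c *\<^sub>R x))"
    by (subst integral_density) (auto simp: integral_distr)
  finally show ?thesis using 1 c by (simp add: has_bochner_integral_iff)
qed

lemma lborel_integrable_affine:
  fixes f :: "'a::euclidean_space \<Rightarrow> 'b::{banach, second_countable_topology}"
  assumes "integrable lborel f" "c \<noteq> 0"
  shows "integrable lborel (\<lambda>x. f (t + c *\<^sub>R x))"
  using lborel_has_bochner_integral_affine[of f _ c t] assms has_bochner_integral_iff by blast

lemma lborel_integral_affine:
  fixes f :: "'a::euclidean_space \<Rightarrow> 'b::{banach, second_countable_topology}"
  assumes c: "c \<noteq> 0"
  shows "(LINT x|lborel. f (t + c *\<^sub>R x)) = (LINT x|lborel. f x) /\<^sub>R \<bar>c\<bar> ^ DIM('a)"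
proof (cases "integrable lborel f")
  case True
  then show ?thesis using lborel_has_bochner_integral_affine[of f _ c t] c has_bochner_integral_iff by blast
next
  case False
  have "\<not> integrable lborel (\<lambda>x. f (t + c *\<^sub>R x))"
  proof
    assume "integrable lborel (\<lambda>x. f (t + c *\<^sub>R x))"
    from lborel_integrable_affine[OF this, of "inverse c" "- (inverse c *\<^sub>R t)"] c False
    show False by (simp add: algebra_simps)
  qed
  then show ?thesis using False by (simp add: not_integrable_integral_eq)
qed

section \<open>Fourier inversion and convolution\<close>

definition fourier :: "(real^'n \<Rightarrow> complex) \<Rightarrow> real^'n \<Rightarrow> complex" where
  "fourier f \<xi> = (LINT x|lborel. exp (- (\<i> * of_real (x \<bullet> \<xi>))) * f x)"

lemma integrable_exp_i_mult:
  fixes f :: "'a::euclidean_space \<Rightarrow> complex"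
  assumes "integrable lborel f"
  shows "integrable lborel (\<lambda>x. iexp (y \<bullet> x) * f x)" "integrable lborel (\<lambda>x. exp (- (\<i> * of_real (x \<bullet> y))) * f x)"
   by (rule Bochner_Integration.integrable_bound[OF assms]; use assms in \<open>auto simp: norm_mult\<close>)+

lemma inverse_fourier_convolution:
  fixes k1 m2 :: "real^'n \<Rightarrow> complex"
  assumes k1: "integrable lborel k1" and m2: "integrable lborel m2"
  shows "inverse_fourier (\<lambda>\<xi>. fourier k1 \<xi> * m2 \<xi>) x = (LINT y|lborel. k1 y * inverse_fourier m2 (x - y))"
proof -
  have [measurable]: "k1 \<in> borel_measurable borel" "m2 \<in> borel_measurable borel" using assms by auto
  have i: "integrable (lborel \<Otimes>\<^sub>M lborel) (\<lambda>(y, \<xi>). k1 y * (iexp ((x - y) \<bullet> \<xi>) * m2 \<xi>))"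
    by (rule integrable_pair_bound[of _ "\<lambda>y. norm (k1 y)" "\<lambda>\<xi>. norm (m2 \<xi>)"]) (use assms in \<open>auto simp: norm_mult\<close>)
  have "(LINT y|lborel. k1 y * (LINT \<xi>|lborel. iexp ((x - y) \<bullet> \<xi>) * m2 \<xi>))
      = (LINT y|lborel. LINT \<xi>|lborel. k1 y * (iexp ((x - y) \<bullet> \<xi>) * m2 \<xi>))"
    by simp
  also have "\<dots> = (LINT \<xi>|lborel. LINT y|lborel. k1 y * (iexp ((x - y) \<bullet> \<xi>) * m2 \<xi>))"
    using lborel_pair.Fubini_integral[OF i] by simp
  also have "\<dots> = (LINT \<xi>|lborel. iexp (x \<bullet> \<xi>) * (fourier k1 \<xi> * m2 \<xi>))"
  proof (rule Bochner_Integration.integral_cong[OF refl])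
    fix \<xi>
    have "(LINT y|lborel. k1 y * (iexp ((x - y) \<bullet> \<xi>) * m2 \<xi>))
       = (LINT y|lborel. (exp (- (\<i> * of_real (y \<bullet> \<xi>))) * k1 y) * (iexp (x \<bullet> \<xi>) * m2 \<xi>))"
      by (rule Bochner_Integration.integral_cong) (simp_all add: inner_diff_left algebra_simps exp_diff exp_minus field_simps)
    then show "(LINT y|lborel. k1 y * (iexp ((x - y) \<bullet> \<xi>) * m2 \<xi>)) = iexp (x \<bullet> \<xi>) * (fourier k1 \<xi> * m2 \<xi>)"
      by (simp add: fourier_def)
  qed
  finally show ?thesis unfolding inverse_fourier_def
    by (simp add: mult.left_commute[of "k1 _"])
qed

text \<open>Damp the inversion integral by \<open>exp(-d \<bar>x\<bar>\<^sup>2)\<close>. By Fubini the damped integral is the mean of \<open>m\<close>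
against a Gaussian of width \<open>sqrt d\<close> centred at \<open>z\<close>, and both sides converge as \<open>d\<close> tends to \<open>0\<close>:
one by integrability of the inverse transform, the other by continuity of \<open>m\<close>.\<close>

lemma fourier_inversion:
  fixes m :: "real^'n \<Rightarrow> complex"
  assumes m: "integrable lborel m" and b: "\<And>\<xi>. norm (m \<xi>) \<le> B" and c: "continuous_on UNIV m"
    and k: "integrable lborel (inverse_fourier m)"
  shows "fourier (inverse_fourier m) z = m z"
proof -
  let ?e = "\<lambda>x. exp (- (\<i> * of_real (x \<bullet> z))) :: complex"
  let ?k = "inverse_fourier m" and ?n = "CARD('n)"
  have [measurable]: "m \<in> borel_measurable borel" "?k \<in> borel_measurable borel" using m k by auto
  define d where "d = (\<lambda>i::nat. 1 / real (Suc i))"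
  have d: "d i > 0" for i by (simp add: d_def)
  have d0: "d \<longlonglongrightarrow> 0" unfolding d_def by real_asymp
  define I where "I = (\<lambda>i. LINT x|lborel. ?e x * ?k x * gauss_symbol (d i) x)"
  have "I \<longlonglongrightarrow> (LINT x|lborel. ?e x * ?k x)"
    unfolding I_def
  proof (rule integral_dominated_convergence[where w = "\<lambda>x. norm (?k x)"])
    show "AE x in lborel. (\<lambda>i. ?e x * ?k x * gauss_symbol (d i) x) \<longlonglongrightarrow>
              ?e x * ?k x"
    proof (rule AE_I2)
      fix x :: "real^'n"
      have "(\<lambda>i. ?e x * ?k x * gauss_symbol (d i) x) \<longlonglongrightarrow>
              ?e x * ?k x * gauss_symbol 0 x"
        by (intro tendsto_intros d0)
      then show "(\<lambda>i. ?e x * ?k x * gauss_symbol (d i) x) \<longlonglongrightarrow>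
              ?e x * ?k x" by simp
    qed
    show "AE x in lborel. norm (?e x * ?k x * gauss_symbol (d i) x) \<le> norm (?k x)" for i
      using d[of i] by (auto simp: norm_mult mult_left_le intro!: mult_nonneg_nonneg)
  qed (use k in auto)
  then have lim1: "I \<longlonglongrightarrow> fourier ?k z" by (simp add: fourier_def)
  have gi: "integrable lborel (\<lambda>x::real^'n. exp (- c * (norm x)\<^sup>2))" if "c > 0" for c
  proof -
    have "integrable lborel (\<lambda>x::real^'n. iexp (x \<bullet> 0) * gauss_symbol c x :: complex)"
      using gaussian_fourier[OF that, of "0::real^'n"] by (auto simp: has_bochner_integral_iff)
    from integrable_Re[OF this] show ?thesis by simp
  qed
  have Ieq: "I i = (LINT \<eta>|lborel. m (z + (2 * sqrt (d i)) *\<^sub>R \<eta>) * gauss_symbol 1 \<eta>) * of_real (1 / sqrt pi ^ ?n)" for i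
  proof -
    have i: "integrable (lborel \<Otimes>\<^sub>M lborel) (\<lambda>(x, \<xi>). ?e x * (iexp (x \<bullet> \<xi>) * m \<xi>) * gauss_symbol (d i) x)"
      by (rule integrable_pair_bound[of _ "\<lambda>x. exp (- d i * (norm x)\<^sup>2)" "\<lambda>\<xi>. norm (m \<xi>)"])
         (use m gi[OF d] in \<open>auto simp: norm_mult\<close>)
    have "I i = of_real (1 / (2 * pi) ^ ?n) * (LINT x|lborel. LINT \<xi>|lborel. ?e x * (iexp (x \<bullet> \<xi>) * m \<xi>) * gauss_symbol (d i) x)"
    proof -
      have "?e x * ?k x * gauss_symbol (d i) x = of_real (1 / (2 * pi) ^ ?n) *
         (LINT \<xi>|lborel. ?e x * (iexp (x \<bullet> \<xi>) * m \<xi>) * gauss_symbol (d i) x)" for x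
        unfolding inverse_fourier_def integral_mult_left_zero integral_mult_right_zero by (simp only: mult_ac)
      then show ?thesis unfolding I_def by (simp only: integral_mult_right_zero)
    qed
    also have "\<dots> = of_real (1 / (2 * pi) ^ ?n) * (LINT \<xi>|lborel. LINT x|lborel. ?e x * (iexp (x \<bullet> \<xi>) * m \<xi>) * gauss_symbol (d i) x)"
      using lborel_pair.Fubini_integral[OF i] by simp
    also have "(LINT \<xi>|lborel. LINT x|lborel. ?e x * (iexp (x \<bullet> \<xi>) * m \<xi>) * gauss_symbol (d i) x)
       = (LINT \<xi>|lborel. m \<xi> * of_real (sqrt (pi / d i) ^ ?n * exp (- (norm (\<xi> - z))\<^sup>2 / (4 * d i))))"
    proof (rule Bochner_Integration.integral_cong[OF refl])
      fix \<xi> :: "real^'n"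
      have "(LINT x|lborel. ?e x * (iexp (x \<bullet> \<xi>) * m \<xi>) * gauss_symbol (d i) x)
         = (LINT x|lborel. m \<xi> * (iexp (x \<bullet> (\<xi> - z)) * gauss_symbol (d i) x))"
        by (rule Bochner_Integration.integral_cong) (simp_all add: inner_diff_right exp_diff exp_minus field_simps)
      also have "\<dots> = m \<xi> * of_real (sqrt (pi / d i) ^ ?n * exp (- (norm (\<xi> - z))\<^sup>2 / (4 * d i)))"
        using gaussian_fourier[OF d, of "\<xi> - z" i] by (simp add: has_bochner_integral_iff)
      finally show "(LINT x|lborel. ?e x * (iexp (x \<bullet> \<xi>) * m \<xi>) * gauss_symbol (d i) x)
         = m \<xi> * of_real (sqrt (pi / d i) ^ ?n * exp (- (norm (\<xi> - z))\<^sup>2 / (4 * d i)))" .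
    qed
    also have "(LINT \<xi>|lborel. m \<xi> * of_real (sqrt (pi / d i) ^ ?n * exp (- (norm (\<xi> - z))\<^sup>2 / (4 * d i))))
       = (2 * sqrt (d i)) ^ ?n *\<^sub>R (LINT \<eta>|lborel. m (z + (2 * sqrt (d i)) *\<^sub>R \<eta>) * of_real (sqrt (pi / d i) ^ ?n * exp (- 1 * (norm \<eta>)\<^sup>2)))"
    proof -
      have "(LINT \<eta>|lborel. m (z + (2 * sqrt (d i)) *\<^sub>R \<eta>) * of_real (sqrt (pi / d i) ^ ?n * exp (- (norm (z + (2 * sqrt (d i)) *\<^sub>R \<eta> - z))\<^sup>2 / (4 * d i))))
        = (LINT \<xi>|lborel. m \<xi> * of_real (sqrt (pi / d i) ^ ?n * exp (- (norm (\<xi> - z))\<^sup>2 / (4 * d i)))) /\<^sub>R \<bar>2 * sqrt (d i)\<bar> ^ DIM(real^'n)"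
        by (rule lborel_integral_affine[of _ "\<lambda>\<xi>. m \<xi> * of_real (sqrt (pi / d i) ^ ?n * exp (- (norm (\<xi> - z))\<^sup>2 / (4 * d i)))"]) (use d[of i] in auto)
      moreover have "exp (- (norm (z + (2 * sqrt (d i)) *\<^sub>R \<eta> - z))\<^sup>2 / (4 * d i)) = exp (- 1 * (norm \<eta>)\<^sup>2)" for \<eta>
        using d[of i] by (simp add: power_mult_distrib)
      ultimately have "(LINT \<eta>|lborel. m (z + (2 * sqrt (d i)) *\<^sub>R \<eta>) * of_real (sqrt (pi / d i) ^ ?n * exp (- 1 * (norm \<eta>)\<^sup>2)))
        = (LINT \<xi>|lborel. m \<xi> * of_real (sqrt (pi / d i) ^ ?n * exp (- (norm (\<xi> - z))\<^sup>2 / (4 * d i)))) /\<^sub>R (2 * sqrt (d i)) ^ ?n"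
        using d[of i] by simp
      moreover have "(2 * sqrt (d i)) ^ ?n \<noteq> 0" using d[of i] by simp
      moreover have "A = X /\<^sub>R r \<Longrightarrow> r \<noteq> 0 \<Longrightarrow> X = r *\<^sub>R A" for A X :: complex and r :: real
        by simp
      ultimately show ?thesis by blast
    qed
    finally have e: "I i = of_real (1 / (2 * pi) ^ ?n) * ((2 * sqrt (d i)) ^ ?n *\<^sub>R (LINT \<eta>|lborel. m (z + (2 * sqrt (d i)) *\<^sub>R \<eta>) * of_real (sqrt (pi / d i) ^ ?n * exp (- 1 * (norm \<eta>)\<^sup>2))))" .
    have "(LINT \<eta>|lborel. m (z + (2 * sqrt (d i)) *\<^sub>R \<eta>) * of_real (sqrt (pi / d i) ^ ?n * exp (- 1 * (norm \<eta>)\<^sup>2)))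
      = (LINT \<eta>|lborel. m (z + (2 * sqrt (d i)) *\<^sub>R \<eta>) * gauss_symbol 1 \<eta> * of_real (sqrt (pi / d i) ^ ?n))"
      by (rule Bochner_Integration.integral_cong) (auto simp: mult_ac)
    also have "\<dots> = (LINT \<eta>|lborel. m (z + (2 * sqrt (d i)) *\<^sub>R \<eta>) * gauss_symbol 1 \<eta>) * of_real (sqrt (pi / d i) ^ ?n)"
      by (rule integral_mult_left_zero)
    finally have "I i = (LINT \<eta>|lborel. m (z + (2 * sqrt (d i)) *\<^sub>R \<eta>) * gauss_symbol 1 \<eta>) * of_real (1 / (2 * pi) ^ ?n * (2 * sqrt (d i)) ^ ?n * sqrt (pi / d i) ^ ?n)"
      unfolding e by (simp only: scaleR_conv_of_real of_real_mult mult_ac)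
    moreover have "1 / (2 * pi) ^ ?n * (2 * sqrt (d i)) ^ ?n * sqrt (pi / d i) ^ ?n = 1 / sqrt pi ^ ?n"
    proof -
      have "1 / (2 * pi) * (2 * sqrt (d i)) * sqrt (pi / d i) = 1 / sqrt pi"
        using d[of i] by (simp add: real_sqrt_divide field_simps)
      then have "(1 / (2 * pi) * (2 * sqrt (d i)) * sqrt (pi / d i)) ^ ?n = (1 / sqrt pi) ^ ?n" by simp
      then show ?thesis by (simp only: power_mult_distrib power_one_over)
    qed
    ultimately show ?thesis by (simp only:)
  qed
  have "(\<lambda>i. LINT \<eta>|lborel. m (z + (2 * sqrt (d i)) *\<^sub>R \<eta>) * gauss_symbol 1 \<eta>)
     \<longlonglongrightarrow> (LINT \<eta>|lborel. m z * of_real (exp (- 1 * (norm (\<eta>::real^'n))\<^sup>2)))"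
  proof (rule integral_dominated_convergence[where w = "\<lambda>\<eta>. B * exp (- 1 * (norm \<eta>)\<^sup>2)"])
    show "AE \<eta> in lborel. (\<lambda>i. m (z + (2 * sqrt (d i)) *\<^sub>R \<eta>) * gauss_symbol 1 \<eta>) \<longlonglongrightarrow> m z * gauss_symbol 1 \<eta>"
    proof (rule AE_I2)
      fix \<eta> :: "real^'n"
      have "(\<lambda>i. z + (2 * sqrt (d i)) *\<^sub>R \<eta>) \<longlonglongrightarrow> z + (2 * sqrt 0) *\<^sub>R \<eta>" by (intro tendsto_intros d0)
      then have "(\<lambda>i. m (z + (2 * sqrt (d i)) *\<^sub>R \<eta>)) \<longlonglongrightarrow> m z"
        using c by (intro isCont_tendsto_compose[of _ m]) (auto simp: continuous_on_eq_continuous_at)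
      then show "(\<lambda>i. m (z + (2 * sqrt (d i)) *\<^sub>R \<eta>) * gauss_symbol 1 \<eta>) \<longlonglongrightarrow> m z * gauss_symbol 1 \<eta>"
        by (intro tendsto_intros)
    qed
    show "integrable lborel (\<lambda>\<eta>::real^'n. B * exp (- 1 * (norm \<eta>)\<^sup>2))" using gi[of 1] by simp
  qed (use b in \<open>auto simp: norm_mult\<close>)
  moreover have "(LINT \<eta>|lborel. m z * of_real (exp (- 1 * (norm (\<eta>::real^'n))\<^sup>2))) = m z * of_real (sqrt pi ^ ?n)"
  proof -
    have "(LINT \<eta>|lborel. (of_real (exp (- 1 * (norm (\<eta>::real^'n))\<^sup>2)) :: complex)) = of_real (sqrt pi ^ ?n)"
      using gaussian_fourier[of 1 "0::real^'n"] by (simp add: has_bochner_integral_iff)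
    then show ?thesis by (simp only: integral_mult_right_zero)
  qed
  ultimately have L: "(\<lambda>i. LINT \<eta>|lborel. m (z + (2 * sqrt (d i)) *\<^sub>R \<eta>) * gauss_symbol 1 \<eta>)
      \<longlonglongrightarrow> m z * of_real (sqrt pi ^ ?n)" by (simp only:)
  have "I \<longlonglongrightarrow> m z * of_real (sqrt pi ^ ?n) * of_real (1 / sqrt pi ^ ?n)"
    using tendsto_mult[OF L tendsto_const[of "of_real (1 / sqrt pi ^ ?n)"]] by (simp only: Ieq[symmetric])
  moreover have "m z * of_real (sqrt pi ^ ?n) * of_real (1 / sqrt pi ^ ?n) = m z" by simp
  ultimately have "I \<longlonglongrightarrow> m z" by (simp only:)
  then show ?thesis using lim1 LIMSEQ_unique by blast
qed

section \<open>Subordination as a comparison principle\<close>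

lemma set_integrable_powr_0_1:
  assumes "a > -1" shows "set_integrable lborel {0<..1} (\<lambda>s. s powr a :: real)"
proof -
  have "(\<lambda>s. s powr a) integrable_on {0..1}" using integrable_on_powr_from_0[of a 1] assms by simp
  then have "(\<lambda>s. s powr a) absolutely_integrable_on {0..1}"
    by (rule nonnegative_absolutely_integrable_1) simp
  then have "set_integrable lebesgue {0<..1} (\<lambda>s. s powr a)"
    by (rule set_integrable_subset) auto
  then show ?thesis unfolding set_integrable_def by (subst (asm) integrable_completion) auto
qed

lemma set_integrable_powr_1_inf:
  assumes "a < -1" shows "set_integrable lborel {1<..} (\<lambda>s. s powr a :: real)"
proof -
  have "(\<lambda>s. s powr a) integrable_on {1..}" using has_integral_powr_to_inf[of a 1] assms by auto
  then have "(\<lambda>s. s powr a) absolutely_integrable_on {1..}"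
    by (rule nonnegative_absolutely_integrable_1) simp
  then have "set_integrable lebesgue {1<..} (\<lambda>s. s powr a)"
    by (rule set_integrable_subset) auto
  then show ?thesis unfolding set_integrable_def by (subst (asm) integrable_completion) auto
qed

abbreviation levy_density :: "real \<Rightarrow> real \<Rightarrow> real" where
  "levy_density \<beta> s \<equiv> indicator {0<..} s * s powr (-1 - \<beta>)"

text \<open>The factor \<open>1 - exp(-l s)\<close> is \<open>O(s)\<close> at \<open>0\<close> and bounded at infinity, which compensates the Levy
density \<open>s powr (-1-\<beta>)\<close>.\<close>

lemma integrable_stable_exponent:
  fixes \<beta> l :: real
  assumes "0 < \<beta>" "\<beta> < 1" "0 \<le> l"
  shows "integrable lborel (\<lambda>s. (1 - exp (- l * s)) * levy_density \<beta> s)"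
proof -
  have 1: "integrable lborel (\<lambda>s. l * (indicator {0<..1} s *\<^sub>R s powr - \<beta>) + indicator {1<..} s *\<^sub>R s powr (-1-\<beta>))"
    using set_integrable_powr_0_1[of "-\<beta>"] set_integrable_powr_1_inf[of "-1-\<beta>"] assms
    by (simp add: set_integrable_def)
  show ?thesis
  proof (rule Bochner_Integration.integrable_bound[OF 1])
    have "norm ((1 - exp (- l * s)) * levy_density \<beta> s)
      \<le> norm (l * (indicator {0<..1} s *\<^sub>R s powr - \<beta>) + indicator {1<..} s *\<^sub>R s powr (-1-\<beta>))" for s :: real
    proof -
      have e: "0 \<le> 1 - exp (- l * s)" "1 - exp (- l * s) \<le> 1" "1 - exp (- l * s) \<le> l * s" if "s > 0"
        using that assms exp_ge_add_one_self[of "- l * s"] by auto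
      consider "s \<le> 0" | "0 < s" "s \<le> 1" | "s > 1" by linarith
      then show ?thesis
      proof cases
        case 2
        have "(1 - exp (- l * s)) * s powr (-1 - \<beta>) \<le> (l * s) * s powr (-1 - \<beta>)"
          using e 2 by (intro mult_right_mono) auto
        also have "\<dots> = l * s powr (-\<beta>)" using 2 by (simp add: powr_diff powr_minus field_simps)
        finally show ?thesis using 2 e assms by (simp add: abs_mult)
      next
        case 3
        then show ?thesis using e mult_right_mono[of "1 - exp (- l * s)" 1 "s powr (-1 - \<beta>)"] by (simp add: abs_mult)
      qed auto
    qed
    then show "AE s in lborel. norm ((1 - exp (- l * s)) * levy_density \<beta> s)
      \<le> norm (l * (indicator {0<..1} s *\<^sub>R s powr - \<beta>) + indicator {1<..} s *\<^sub>R s powr (-1-\<beta>))" by simp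
  qed simp
qed

definition stable_const :: "real \<Rightarrow> real" where
  "stable_const \<beta> = (LINT s|lborel. (1 - exp (- s)) * levy_density \<beta> s)"

text \<open>The Levy representation of the Bernstein function \<open>l powr \<beta>\<close>, obtained by the substitution
\<open>s \<mapsto> l s\<close>.\<close>

lemma stable_exponent:
  fixes \<beta> l :: real
  assumes \<beta>: "0 < \<beta>" "\<beta> < 1" and l: "0 \<le> l"
  shows "(LINT s|lborel. (1 - exp (- l * s)) * levy_density \<beta> s) = stable_const \<beta> * l powr \<beta>"
proof (cases "l = 0")
  case False
  with l have l: "l > 0" by simp
  have "(LINT s|lborel. (1 - exp (- s)) * levy_density \<beta> s)
      = \<bar>l\<bar> *\<^sub>R (LINT s|lborel. (1 - exp (- (0 + l * s))) * (indicator {0<..} (0 + l * s) * (0 + l * s) powr (-1 - \<beta>)))"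
    by (rule lborel_integral_real_affine) (use l in simp)
  also have "\<dots> = \<bar>l\<bar> *\<^sub>R (LINT s|lborel. l powr (-1 - \<beta>) * ((1 - exp (- l * s)) * levy_density \<beta> s))"
    using l by (intro arg_cong2[of _ _ _ _ "(*\<^sub>R)"] refl Bochner_Integration.integral_cong)
       (auto simp: powr_mult indicator_def zero_less_mult_iff)
  also have "\<dots> = l powr (- \<beta>) * (LINT s|lborel. (1 - exp (- l * s)) * levy_density \<beta> s)"
  proof -
    have "\<bar>l\<bar> * l powr (-1 - \<beta>) = l powr (- \<beta>)" using l by (simp add: powr_diff powr_minus field_simps)
    then show ?thesis unfolding integral_mult_right_zero real_scaleR_def by (simp only: mult.assoc[symmetric])
  qed
  finally show ?thesis using l unfolding stable_const_def by (simp add: powr_minus field_simps)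
qed simp

lemma stable_const_pos:
  assumes \<beta>: "0 < \<beta>" "\<beta> < 1" shows "stable_const \<beta> > 0"
proof -
  let ?f = "\<lambda>s::real. (1 - exp (- s)) * levy_density \<beta> s"
  have i: "integrable lborel ?f" using integrable_stable_exponent[OF \<beta>, of 1] by simp
  have nn: "?f s \<ge> 0" for s by (auto simp: indicator_def)
  have "stable_const \<beta> \<ge> 0" unfolding stable_const_def using nn by (intro integral_nonneg_AE) auto
  moreover have "stable_const \<beta> \<noteq> 0"
  proof
    assume "stable_const \<beta> = 0"
    then have "AE s in lborel. ?f s = 0"
      unfolding stable_const_def using integral_nonneg_eq_0_iff_AE[OF i] nn by auto
    then have "AE s in lborel. s \<notin> {0<..<1::real}"
      by eventually_elim (auto simp: indicator_def)
    then have "emeasure lborel {0<..<1::real} = 0"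
      by (subst (asm) AE_iff_measurable[of "{0<..<1}"]) auto
    then show False by simp
  qed
  ultimately show ?thesis by simp
qed

text \<open>The densities \<open>n\<close> below are integrable truncations of a Levy density on the positive half-line.\<close>

definition laplace :: "(real \<Rightarrow> real) \<Rightarrow> real \<Rightarrow> real" where
  "laplace n l = (LINT s|lborel. exp (- l * s) * n s)"

context
  fixes n :: "real \<Rightarrow> real"
  assumes n_nonneg: "\<And>s. 0 \<le> n s" and n_neg: "\<And>s. s \<le> 0 \<Longrightarrow> n s = 0" and n_int: "integrable lborel n"
begin

lemma n_measurable: "n \<in> borel_measurable borel"
  using n_int by simp

lemma laplace_measurable [measurable]: "laplace n \<in> borel_measurable borel"
proof -
  note n_measurable [measurable]
  show ?thesis unfolding laplace_def by measurable
qed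

lemma laplace_integrable: "0 \<le> l \<Longrightarrow> integrable lborel (\<lambda>s. exp (- l * s) * n s)"
proof (rule Bochner_Integration.integrable_bound[OF n_int])
  note n_measurable [measurable]
  show "(\<lambda>s. exp (- l * s) * n s) \<in> borel_measurable lborel" by measurable
  assume l: "0 \<le> l"
  have "norm (exp (- l * s) * n s) \<le> norm (n s)" for s
    using l n_neg[of s] by (cases "s \<le> 0") (auto simp: abs_mult intro!: mult_left_le_one_le)
  then show "AE s in lborel. norm (exp (- l * s) * n s) \<le> norm (n s)" by simp
qed

lemma laplace_bounds: assumes "0 \<le> l" shows "0 \<le> laplace n l" "laplace n l \<le> laplace n 0"
proof -
  show "0 \<le> laplace n l" unfolding laplace_def using n_nonneg by (intro integral_nonneg_AE) auto
  have "exp (- l * s) * n s \<le> exp (- 0 * s) * n s" for s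
    using assms n_neg[of s] n_nonneg[of s] by (cases "s \<le> 0") (auto intro!: mult_left_le_one_le)
  then show "laplace n l \<le> laplace n 0"
    unfolding laplace_def using laplace_integrable[OF assms] laplace_integrable[of 0] by (intro integral_mono) auto
qed

context
  fixes M :: "'a measure" and q \<rho> :: "'a \<Rightarrow> real"
  assumes M: "sigma_finite_measure M" and q [measurable]: "q \<in> borel_measurable M"
    and \<rho> [measurable]: "\<rho> \<in> borel_measurable M" and \<rho>_nonneg: "\<And>x. 0 \<le> \<rho> x"
    and int: "\<And>d. 0 < d \<Longrightarrow> integrable M (\<lambda>x. q x * exp (- d * \<rho> x))"
begin

lemma laplace_power_integrable:
  assumes "0 < d" shows "integrable M (\<lambda>x. q x * laplace n (\<rho> x) ^ k * exp (- d * \<rho> x))"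
proof (rule Bochner_Integration.integrable_bound)
  show "integrable M (\<lambda>x. laplace n 0 ^ k * (q x * exp (- d * \<rho> x)))" using int[OF assms] by simp
  have "norm (q x * laplace n (\<rho> x) ^ k * exp (- d * \<rho> x)) \<le> norm (laplace n 0 ^ k * (q x * exp (- d * \<rho> x)))" for x
  proof -
    have "laplace n (\<rho> x) ^ k \<le> laplace n 0 ^ k" "0 \<le> laplace n (\<rho> x) ^ k"
      using laplace_bounds[OF \<rho>_nonneg[of x]] by (auto intro: power_mono)
    then have "laplace n (\<rho> x) ^ k * norm (q x * exp (- d * \<rho> x)) \<le> laplace n 0 ^ k * norm (q x * exp (- d * \<rho> x))"
      "0 \<le> laplace n 0 ^ k"
      by (auto intro!: mult_right_mono)
    then show ?thesis using laplace_bounds[OF \<rho>_nonneg[of x]] by (simp add: abs_mult mult_ac)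
  qed
  then show "AE x in M. norm (q x * laplace n (\<rho> x) ^ k * exp (- d * \<rho> x)) \<le> norm (laplace n 0 ^ k * (q x * exp (- d * \<rho> x)))"
    by simp
qed measurable

text \<open>A factor \<open>laplace n \<rho>\<close> amounts to averaging the damping parameter over \<open>d + s\<close> with density \<open>n\<close>. An
inequality that holds for every damping parameter thus passes from one power to the next.\<close>

lemma laplace_power_Suc:
  assumes d: "0 < d"
  shows "has_bochner_integral lborel (\<lambda>s. n s * (LINT x|M. q x * laplace n (\<rho> x) ^ k * exp (- (d + s) * \<rho> x)))
     (LINT x|M. q x * laplace n (\<rho> x) ^ Suc k * exp (- d * \<rho> x))"
proof -
  note n_measurable [measurable]
  interpret M: sigma_finite_measure M by (rule M)
  interpret pair_sigma_finite M "lborel :: real measure" by standard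
  let ?h = "\<lambda>x s. n s * (q x * laplace n (\<rho> x) ^ k * exp (- (d + s) * \<rho> x))"
  have e: "?h x s = (q x * laplace n (\<rho> x) ^ k * exp (- d * \<rho> x)) * (exp (- \<rho> x * s) * n s)" for x s
    by (simp add: algebra_simps exp_add exp_diff exp_minus field_simps)
  have in1: "(LINT s|lborel. ?h x s) = q x * laplace n (\<rho> x) ^ Suc k * exp (- d * \<rho> x)" for x
    unfolding e by (simp add: laplace_def)
  have i: "integrable (M \<Otimes>\<^sub>M lborel) (\<lambda>(x, s). ?h x s)"
  proof (rule Fubini_integrable)
    have "(LINT s|lborel. norm (?h x s)) = norm (q x * laplace n (\<rho> x) ^ Suc k * exp (- d * \<rho> x))" for x
    proof -
      have "(LINT s|lborel. norm (?h x s)) = (LINT s|lborel. norm (q x * laplace n (\<rho> x) ^ k * exp (- d * \<rho> x)) * (exp (- \<rho> x * s) * n s))"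
        unfolding e using n_nonneg by (intro Bochner_Integration.integral_cong) (auto simp: abs_mult)
      also have "\<dots> = norm (q x * laplace n (\<rho> x) ^ k * exp (- d * \<rho> x)) * laplace n (\<rho> x)"
        unfolding laplace_def by (rule integral_mult_right_zero)
      finally show ?thesis using laplace_bounds[OF \<rho>_nonneg[of x]] by (simp add: abs_mult mult_ac)
    qed
    then show "integrable M (\<lambda>x. LINT s|lborel. norm (case (x, s) of (x, s) \<Rightarrow> ?h x s))"
      using integrable_norm[OF laplace_power_integrable[OF d, of "Suc k"]] by simp
    show "AE x in M. integrable lborel (\<lambda>s. case (x, s) of (x, s) \<Rightarrow> ?h x s)"
      unfolding e prod.case using laplace_integrable[OF \<rho>_nonneg] by (intro AE_I2 integrable_mult_right) auto
  qed measurable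
  have "integrable lborel (\<lambda>s. LINT x|M. ?h x s)"
    using integrable_snd[OF i] by simp
  moreover have "(LINT s|lborel. LINT x|M. ?h x s) = (LINT x|M. LINT s|lborel. ?h x s)"
    using Fubini_integral[OF i] by simp
  ultimately show ?thesis unfolding in1 by (simp add: has_bochner_integral_iff)
qed

text \<open>The exponential series has nonnegative coefficients, so inequalities for all powers give one for
\<open>exp(t laplace n \<rho>)\<close>.\<close>

lemma laplace_exp_sums:
  assumes d: "0 < d"
  shows "(\<lambda>k. t ^ k / fact k * (LINT x|M. q x * laplace n (\<rho> x) ^ k * exp (- d * \<rho> x)))
     sums (LINT x|M. q x * exp (t * laplace n (\<rho> x)) * exp (- d * \<rho> x))"
proof -
  let ?f = "\<lambda>k x. t ^ k / fact k * (q x * laplace n (\<rho> x) ^ k * exp (- d * \<rho> x))"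
  have s: "(\<lambda>k. ?f k x) sums (q x * exp (t * laplace n (\<rho> x)) * exp (- d * \<rho> x))" for x
  proof -
    have "(\<lambda>k. (q x * exp (- d * \<rho> x)) * ((t * laplace n (\<rho> x)) ^ k /\<^sub>R fact k)) sums ((q x * exp (- d * \<rho> x)) * exp (t * laplace n (\<rho> x)))"
      by (intro sums_mult exp_converges)
    then show ?thesis by (simp add: field_simps power_mult_distrib)
  qed
  have i: "integrable M (?f k)" for k using laplace_power_integrable[OF d, of k] by simp
  have sn: "(\<lambda>k. norm (?f k x)) sums (norm (q x * exp (- d * \<rho> x)) * exp (\<bar>t\<bar> * laplace n (\<rho> x)))" for x
  proof -
    have "(\<lambda>k. norm (q x * exp (- d * \<rho> x)) * ((\<bar>t\<bar> * laplace n (\<rho> x)) ^ k /\<^sub>R fact k)) sums (norm (q x * exp (- d * \<rho> x)) * exp (\<bar>t\<bar> * laplace n (\<rho> x)))"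
      by (intro sums_mult exp_converges)
    then show ?thesis using laplace_bounds[OF \<rho>_nonneg[of x]]
      by (simp add: field_simps power_mult_distrib abs_mult power_abs)
  qed
  have "(\<lambda>k. integral\<^sup>L M (?f k)) sums (LINT x|M. (\<Sum>k. ?f k x))"
  proof (rule sums_integral[OF i])
    show "AE x in M. summable (\<lambda>k. norm (?f k x))" using sn by (auto simp: summable_def)
    show "summable (\<lambda>k. LINT x|M. norm (?f k x))"
    proof (rule summable_comparison_test')
      show "summable (\<lambda>k. ((\<bar>t\<bar> * laplace n 0) ^ k /\<^sub>R fact k) * (LINT x|M. norm (q x * exp (- d * \<rho> x))))"
        by (intro summable_mult2 sums_summable[OF exp_converges])
      fix k :: nat
      have "norm (LINT x|M. norm (?f k x)) = (LINT x|M. norm (?f k x))" by simp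
      also have "\<dots> \<le> (LINT x|M. ((\<bar>t\<bar> * laplace n 0) ^ k /\<^sub>R fact k) * norm (q x * exp (- d * \<rho> x)))"
      proof (rule integral_mono)
        show "integrable M (\<lambda>x. ((\<bar>t\<bar> * laplace n 0) ^ k /\<^sub>R fact k) * norm (q x * exp (- d * \<rho> x)))"
          by (intro integrable_mult_right integrable_norm int d)
        fix x
        have b: "0 \<le> laplace n (\<rho> x) ^ k" "laplace n (\<rho> x) ^ k \<le> laplace n 0 ^ k"
          using laplace_bounds[OF \<rho>_nonneg[of x]] by (auto intro: power_mono)
        have "norm (?f k x) = (\<bar>t\<bar> ^ k / fact k) * laplace n (\<rho> x) ^ k * norm (q x * exp (- d * \<rho> x))"
          using laplace_bounds(1)[OF \<rho>_nonneg[of x]] by (simp add: abs_mult power_abs)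
        also have "\<dots> \<le> (\<bar>t\<bar> ^ k / fact k) * laplace n 0 ^ k * norm (q x * exp (- d * \<rho> x))"
          using b by (intro mult_right_mono mult_left_mono) auto
        finally show "norm (?f k x) \<le> ((\<bar>t\<bar> * laplace n 0) ^ k /\<^sub>R fact k) * norm (q x * exp (- d * \<rho> x))"
          by (simp add: field_simps power_mult_distrib)
      qed (rule integrable_norm[OF i])
      finally show "norm (LINT x|M. norm (?f k x)) \<le> ((\<bar>t\<bar> * laplace n 0) ^ k /\<^sub>R fact k) * (LINT x|M. norm (q x * exp (- d * \<rho> x)))"
        by simp
    qed
  qed
  then show ?thesis using sums_unique[OF s] by simp
qed

end
end

text \<open>With Levy densities cut off near \<open>0\<close>, \<open>laplace n 0 - laplace n \<rho>\<close> converges to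
\<open>stable_const \<beta> * \<rho> powr \<beta>\<close>, and \<open>exp(-t \<rho> powr \<beta>)\<close> is the limit of compound Poisson exponentials.
The factor \<open>exp(-d \<rho>)\<close> supplies the dominating function.\<close>

lemma integral_stable_limit:
  fixes q \<rho> :: "'a \<Rightarrow> real"
  assumes q [measurable]: "q \<in> borel_measurable M"
    and \<rho> [measurable]: "\<rho> \<in> borel_measurable M" and \<rho>_nonneg: "\<And>x. 0 \<le> \<rho> x"
    and int: "integrable M (\<lambda>x. q x * exp (- d * \<rho> x))"
    and \<beta>: "0 < \<beta>" "\<beta> < 1" and t: "0 < t"
    and n: "n = (\<lambda>i::nat. \<lambda>s. indicator {1 / real (Suc i)<..} s * s powr (-1 - \<beta>))"
    and n_props: "\<And>i. integrable lborel (n i)"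
  shows "(\<lambda>i. exp (- t / stable_const \<beta> * laplace (n i) 0) *
       (LINT x|M. q x * exp (t / stable_const \<beta> * laplace (n i) (\<rho> x)) * exp (- d * \<rho> x)))
     \<longlonglongrightarrow> (LINT x|M. q x * exp (- t * \<rho> x powr \<beta>) * exp (- d * \<rho> x))"
proof -
  let ?c = "t / stable_const \<beta>"
  have c: "?c > 0" using t stable_const_pos[OF \<beta>] by simp
  have n_nonneg: "n i s \<ge> 0" for i s by (auto simp: n indicator_def)
  have n_neg: "n i s = 0" if "s \<le> 0" for i s
  proof -
    have "1 / real (Suc i) > 0" by simp
    then have "\<not> (1 / real (Suc i) < s)" using that by linarith
    then show ?thesis by (simp add: n)
  qed
  note [measurable] = laplace_measurable[OF n_nonneg n_neg n_props]
  have lim: "(\<lambda>i. laplace (n i) 0 - laplace (n i) l) \<longlonglongrightarrow> stable_const \<beta> * l powr \<beta>" if l: "l \<ge> 0" for l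
  proof -
    have "laplace (n i) 0 - laplace (n i) l = (LINT s|lborel. (1 - exp (- l * s)) * n i s)" for i
      unfolding laplace_def
      using laplace_integrable[of "n i" l, OF n_nonneg n_neg n_props] laplace_integrable[of "n i" 0, OF n_nonneg n_neg n_props] l
      by (simp add: algebra_simps flip: Bochner_Integration.integral_diff)
    moreover have "(\<lambda>i. LINT s|lborel. (1 - exp (- l * s)) * n i s) \<longlonglongrightarrow> (LINT s|lborel. (1 - exp (- l * s)) * levy_density \<beta> s)"
    proof (rule integral_dominated_convergence[OF _ _ integrable_stable_exponent[OF \<beta> l]])
      show "AE s in lborel. (\<lambda>i. (1 - exp (- l * s)) * n i s) \<longlonglongrightarrow> (1 - exp (- l * s)) * levy_density \<beta> s"
      proof (rule AE_I2)
        fix s :: real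
        have "eventually (\<lambda>i. (1 - exp (- l * s)) * n i s = (1 - exp (- l * s)) * levy_density \<beta> s) sequentially"
        proof (cases "s > 0")
          case True
          have "(\<lambda>i. 1 / real (Suc i)) \<longlonglongrightarrow> 0" by real_asymp
          then have "eventually (\<lambda>i. 1 / real (Suc i) < s) sequentially" using True by (rule order_tendstoD)
          then show ?thesis by eventually_elim (use True in \<open>simp add: n\<close>)
        qed (use n_neg in auto)
        then show "(\<lambda>i. (1 - exp (- l * s)) * n i s) \<longlonglongrightarrow> (1 - exp (- l * s)) * levy_density \<beta> s"
          by (rule tendsto_eventually)
      qed
      show "AE s in lborel. norm ((1 - exp (- l * s)) * n i s) \<le> (1 - exp (- l * s)) * levy_density \<beta> s" for i
      proof (rule AE_I2)
        fix s :: real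
        show "norm ((1 - exp (- l * s)) * n i s) \<le> (1 - exp (- l * s)) * levy_density \<beta> s"
          using n_neg[of s i] l by (cases "s \<le> 0") (auto simp: n abs_mult indicator_def)
      qed
    qed (simp_all add: n)
    ultimately show ?thesis using stable_exponent[OF \<beta> l] by simp
  qed
  have "(\<lambda>i. LINT x|M. q x * exp (- ?c * (laplace (n i) 0 - laplace (n i) (\<rho> x))) * exp (- d * \<rho> x))
     \<longlonglongrightarrow> (LINT x|M. q x * exp (- t * \<rho> x powr \<beta>) * exp (- d * \<rho> x))"
  proof (rule integral_dominated_convergence[OF _ _ integrable_norm[OF int]])
    show "AE x in M. (\<lambda>i. q x * exp (- ?c * (laplace (n i) 0 - laplace (n i) (\<rho> x))) * exp (- d * \<rho> x)) \<longlonglongrightarrow>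
         q x * exp (- t * \<rho> x powr \<beta>) * exp (- d * \<rho> x)"
    proof (rule AE_I2)
      fix x
      have "(\<lambda>i. q x * exp (- ?c * (laplace (n i) 0 - laplace (n i) (\<rho> x))) * exp (- d * \<rho> x)) \<longlonglongrightarrow>
         q x * exp (- ?c * (stable_const \<beta> * \<rho> x powr \<beta>)) * exp (- d * \<rho> x)"
        by (intro tendsto_intros lim \<rho>_nonneg)
      then show "(\<lambda>i. q x * exp (- ?c * (laplace (n i) 0 - laplace (n i) (\<rho> x))) * exp (- d * \<rho> x)) \<longlonglongrightarrow>
         q x * exp (- t * \<rho> x powr \<beta>) * exp (- d * \<rho> x)" using stable_const_pos[OF \<beta>] by simp
    qed
    show "AE x in M. norm (q x * exp (- ?c * (laplace (n i) 0 - laplace (n i) (\<rho> x))) * exp (- d * \<rho> x)) \<le> norm (q x * exp (- d * \<rho> x))" for i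
    proof (rule AE_I2)
      fix x
      have "exp (- ?c * (laplace (n i) 0 - laplace (n i) (\<rho> x))) \<le> 1"
        using c laplace_bounds(2)[of "n i" "\<rho> x", OF n_nonneg n_neg n_props \<rho>_nonneg] by (simp add: mult_le_0_iff del: times_divide_eq_left)
      then have "\<bar>q x\<bar> * exp (- ?c * (laplace (n i) 0 - laplace (n i) (\<rho> x))) * exp (- d * \<rho> x) \<le> \<bar>q x\<bar> * 1 * exp (- d * \<rho> x)"
        by (intro mult_right_mono mult_left_mono) auto
      then show "norm (q x * exp (- ?c * (laplace (n i) 0 - laplace (n i) (\<rho> x))) * exp (- d * \<rho> x)) \<le> norm (q x * exp (- d * \<rho> x))"
        by (simp only: real_norm_def abs_mult abs_exp_cancel mult_1_right)
    qed
  qed measurable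
  moreover have "(LINT x|M. q x * exp (- ?c * (laplace (n i) 0 - laplace (n i) (\<rho> x))) * exp (- d * \<rho> x))
    = exp (- t / stable_const \<beta> * laplace (n i) 0) * (LINT x|M. q x * exp (?c * laplace (n i) (\<rho> x)) * exp (- d * \<rho> x))" for i
    unfolding integral_mult_right_zero[symmetric]
    by (rule Bochner_Integration.integral_cong) (simp_all add: right_diff_distrib exp_diff exp_minus field_simps)
  ultimately show ?thesis by simp
qed

lemma integral_damping_limit:
  fixes q \<rho> :: "'a \<Rightarrow> real"
  assumes int: "integrable M q" and \<rho> [measurable]: "\<rho> \<in> borel_measurable M" and \<rho>_nonneg: "\<And>x. 0 \<le> \<rho> x"
  shows "(\<lambda>i. LINT x|M. q x * exp (- (1 / real (Suc i)) * \<rho> x)) \<longlonglongrightarrow> integral\<^sup>L M q"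
proof (rule integral_dominated_convergence[OF _ _ integrable_norm[OF int]])
  have [measurable]: "q \<in> borel_measurable M" using int by simp
  show "(\<lambda>x. q x * exp (- (1 / real (Suc i)) * \<rho> x)) \<in> borel_measurable M" "q \<in> borel_measurable M" for i by measurable
  show "AE x in M. (\<lambda>i. q x * exp (- (1 / real (Suc i)) * \<rho> x)) \<longlonglongrightarrow> q x"
  proof (rule AE_I2)
    fix x
    have "(\<lambda>i. 1 / real (Suc i)) \<longlonglongrightarrow> 0" by real_asymp
    then have "(\<lambda>i. q x * exp (- (1 / real (Suc i)) * \<rho> x)) \<longlonglongrightarrow> q x * exp (- 0 * \<rho> x)"
      by (intro tendsto_intros)
    then show "(\<lambda>i. q x * exp (- (1 / real (Suc i)) * \<rho> x)) \<longlonglongrightarrow> q x" by simp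
  qed
  show "AE x in M. norm (q x * exp (- (1 / real (Suc i)) * \<rho> x)) \<le> norm (q x)" for i
    using \<rho>_nonneg by (auto simp: abs_mult intro!: mult_left_le)
qed

text \<open>Bochner subordination as a comparison principle. The weights \<open>q1\<close>, \<open>q2\<close> may change sign, so
positivity of the mixing measure is what matters; it is seen through truncated Levy densities and
the exponential series, and the stable density itself never appears.\<close>

theorem subordination_le:
  fixes q1 \<rho>1 :: "'a \<Rightarrow> real" and q2 \<rho>2 :: "'b \<Rightarrow> real"
  assumes M1: "sigma_finite_measure M1" and q1: "q1 \<in> borel_measurable M1"
    and \<rho>1: "\<rho>1 \<in> borel_measurable M1" "\<And>x. 0 \<le> \<rho>1 x"
    and int1: "\<And>d. 0 < d \<Longrightarrow> integrable M1 (\<lambda>x. q1 x * exp (- d * \<rho>1 x))"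
    and M2: "sigma_finite_measure M2" and q2: "q2 \<in> borel_measurable M2"
    and \<rho>2: "\<rho>2 \<in> borel_measurable M2" "\<And>x. 0 \<le> \<rho>2 x"
    and int2: "\<And>d. 0 < d \<Longrightarrow> integrable M2 (\<lambda>x. q2 x * exp (- d * \<rho>2 x))"
    and le: "\<And>d. 0 < d \<Longrightarrow> (LINT x|M1. q1 x * exp (- d * \<rho>1 x)) \<le> (LINT x|M2. q2 x * exp (- d * \<rho>2 x))"
    and \<beta>: "0 < \<beta>" "\<beta> < 1" and t: "0 < t"
    and st1: "integrable M1 (\<lambda>x. q1 x * exp (- t * \<rho>1 x powr \<beta>))"
    and st2: "integrable M2 (\<lambda>x. q2 x * exp (- t * \<rho>2 x powr \<beta>))"
  shows "(LINT x|M1. q1 x * exp (- t * \<rho>1 x powr \<beta>)) \<le> (LINT x|M2. q2 x * exp (- t * \<rho>2 x powr \<beta>))"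
proof -
  define n where "n = (\<lambda>i::nat. \<lambda>s. indicator {1 / real (Suc i)<..} s * s powr (-1 - \<beta>) :: real)"
  have n_nonneg: "n i s \<ge> 0" for i s by (auto simp: n_def indicator_def)
  have n_neg: "n i s = 0" if "s \<le> 0" for i s
  proof -
    have "1 / real (Suc i) > 0" by simp
    then have "\<not> (1 / real (Suc i) < s)" using that by linarith
    then show ?thesis by (simp add: n_def)
  qed
  have n_int: "integrable lborel (n i)" for i
  proof -
    define e where "e = 1 / real (Suc i)"
    have e: "e > 0" by (simp add: e_def)
    have "integrable lborel (\<lambda>s. (1 / (1 - exp (- 1 * e))) * ((1 - exp (- 1 * s)) * levy_density \<beta> s))"
      by (intro integrable_mult_right integrable_stable_exponent \<beta>) simp
    then show ?thesis
    proof (rule Bochner_Integration.integrable_bound)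
      have "norm (n i s) \<le> norm ((1 / (1 - exp (- 1 * e))) * ((1 - exp (- 1 * s)) * levy_density \<beta> s))" for s
      proof (cases "s > e")
        case True
        have "1 \<le> (1 - exp (- s)) / (1 - exp (- e))" using True e by simp
        then have "1 * s powr (-1-\<beta>) \<le> (1 - exp (- s)) / (1 - exp (- e)) * s powr (-1-\<beta>)" by (intro mult_right_mono) auto
        then show ?thesis using True e by (simp add: n_def e_def[symmetric] del: of_nat_Suc)
      qed (simp add: n_def e_def[symmetric] del: of_nat_Suc)
      then show "AE s in lborel. norm (n i s) \<le> norm ((1 / (1 - exp (- 1 * e))) * ((1 - exp (- 1 * s)) * levy_density \<beta> s))" by simp
    qed (simp add: n_def)
  qed
  have pow: "(LINT x|M1. q1 x * laplace (n i) (\<rho>1 x) ^ k * exp (- d * \<rho>1 x)) \<le> (LINT x|M2. q2 x * laplace (n i) (\<rho>2 x) ^ k * exp (- d * \<rho>2 x))"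
    if "0 < d" for i k d
    using that
  proof (induction k arbitrary: d)
    case 0
    then show ?case using le by simp
  next
    case (Suc k)
    note h1 = laplace_power_Suc[of "n i" M1 q1 \<rho>1 d k, OF n_nonneg n_neg n_int M1 q1 \<rho>1 int1 Suc.prems]
    note h2 = laplace_power_Suc[of "n i" M2 q2 \<rho>2 d k, OF n_nonneg n_neg n_int M2 q2 \<rho>2 int2 Suc.prems]
    have "(LINT s|lborel. n i s * (LINT x|M1. q1 x * laplace (n i) (\<rho>1 x) ^ k * exp (- (d + s) * \<rho>1 x)))
        \<le> (LINT s|lborel. n i s * (LINT x|M2. q2 x * laplace (n i) (\<rho>2 x) ^ k * exp (- (d + s) * \<rho>2 x)))"
    proof (rule integral_mono)
      fix s
      show "n i s * (LINT x|M1. q1 x * laplace (n i) (\<rho>1 x) ^ k * exp (- (d + s) * \<rho>1 x)) \<le> n i s * (LINT x|M2. q2 x * laplace (n i) (\<rho>2 x) ^ k * exp (- (d + s) * \<rho>2 x))"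
        using Suc.IH[of "d + s"] Suc.prems n_nonneg[of i s] n_neg[of s i]
        by (cases "s \<le> 0") (auto intro!: mult_left_mono)
    qed (use h1 h2 in \<open>auto simp: has_bochner_integral_iff\<close>)
    then show ?case
      using has_bochner_integral_integral_eq[OF h1] has_bochner_integral_integral_eq[OF h2] by (simp only:)
  qed
  let ?c = "t / stable_const \<beta>"
  have c: "?c > 0" using t stable_const_pos[OF \<beta>] by simp
  have ex: "(LINT x|M1. q1 x * exp (?c * laplace (n i) (\<rho>1 x)) * exp (- d * \<rho>1 x)) \<le> (LINT x|M2. q2 x * exp (?c * laplace (n i) (\<rho>2 x)) * exp (- d * \<rho>2 x))"
    if d: "0 < d" for i d
  proof (rule sums_le[OF _ laplace_exp_sums[OF n_nonneg n_neg n_int M1 q1 \<rho>1 int1 d] laplace_exp_sums[OF n_nonneg n_neg n_int M2 q2 \<rho>2 int2 d]])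
    show "?c ^ k / fact k * (LINT x|M1. q1 x * laplace (n i) (\<rho>1 x) ^ k * exp (- d * \<rho>1 x)) \<le> ?c ^ k / fact k * (LINT x|M2. q2 x * laplace (n i) (\<rho>2 x) ^ k * exp (- d * \<rho>2 x))" for k
      using pow[OF d] c by (intro mult_left_mono) auto
  qed
  have dm: "(LINT x|M1. q1 x * exp (- t * \<rho>1 x powr \<beta>) * exp (- d * \<rho>1 x)) \<le> (LINT x|M2. q2 x * exp (- t * \<rho>2 x powr \<beta>) * exp (- d * \<rho>2 x))"
    if d: "0 < d" for d
    by (rule LIMSEQ_le[OF integral_stable_limit[OF q1 \<rho>1 int1[OF d] \<beta> t n_def n_int] integral_stable_limit[OF q2 \<rho>2 int2[OF d] \<beta> t n_def n_int]])
       (use ex[OF d] in \<open>auto intro!: mult_left_mono\<close>)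
  show ?thesis
    by (rule LIMSEQ_le[OF integral_damping_limit[OF st1 \<rho>1] integral_damping_limit[OF st2 \<rho>2]])
       (intro exI allI impI dm, simp)
qed

section \<open>L1 bounds for subordinated kernels\<close>

lemma inverse_fourier_measurable [measurable]:
  assumes [measurable]: "(\<lambda>(p, \<xi>). m p \<xi>) \<in> borel_measurable (M \<Otimes>\<^sub>M lborel)" and [measurable]: "X \<in> M \<rightarrow>\<^sub>M borel"
  shows "(\<lambda>p. inverse_fourier (m p) (X p)) \<in> borel_measurable M"
  unfolding inverse_fourier_def by measurable

lemma inverse_fourier_measurable1 [measurable]:
  assumes [measurable]: "m \<in> borel_measurable borel"
  shows "inverse_fourier m \<in> borel_measurable borel"
  unfolding inverse_fourier_def by measurable

lemma inverse_fourier_bound: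
  fixes m :: "real^'n \<Rightarrow> complex"
  shows "norm (inverse_fourier m x) \<le> 1 / (2 * pi) ^ CARD('n) * (LINT \<xi>|lborel. norm (m \<xi>))"
proof -
  have "norm (LINT \<xi>|lborel. iexp (x \<bullet> \<xi>) * m \<xi>) \<le> (LINT \<xi>|lborel. norm (iexp (x \<bullet> \<xi>) * m \<xi>))"
    by (rule integral_norm_bound)
  also have "\<dots> = (LINT \<xi>|lborel. norm (m \<xi>))" by (simp add: norm_mult)
  finally show ?thesis unfolding inverse_fourier_def norm_mult norm_of_real by (intro mult_mono) auto
qed

text \<open>The pairing that turns \<open>L\<^sup>1\<close> bounds of kernels into inequalities between integrals of their symbols.\<close>

lemma integral_mult_inverse_fourier:
  fixes h :: "real^'n \<Rightarrow> complex"
  assumes h: "integrable lborel h" and m: "integrable lborel m"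
  shows "(LINT x|lborel. h x * inverse_fourier m x) =
    (LINT \<xi>|lborel. of_real (1 / (2 * pi) ^ CARD('n)) * (LINT x|lborel. iexp (x \<bullet> \<xi>) * h x) * m \<xi>)"
proof -
  have [measurable]: "h \<in> borel_measurable borel" "m \<in> borel_measurable borel" using assms by auto
  have i: "integrable (lborel \<Otimes>\<^sub>M lborel) (\<lambda>(x, \<xi>). h x * (iexp (x \<bullet> \<xi>) * m \<xi>))"
    by (rule integrable_pair_bound[of _ "\<lambda>y. norm (h y)" "\<lambda>\<xi>. norm (m \<xi>)"]) (use assms in \<open>auto simp: norm_mult\<close>)
  have "(LINT x|lborel. h x * inverse_fourier m x) = of_real (1 / (2 * pi) ^ CARD('n)) * (LINT x|lborel. LINT \<xi>|lborel. h x * (iexp (x \<bullet> \<xi>) * m \<xi>))"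
    unfolding inverse_fourier_def integral_mult_right_zero[symmetric] by (simp only: mult.left_commute)
  also have "\<dots> = of_real (1 / (2 * pi) ^ CARD('n)) * (LINT \<xi>|lborel. LINT x|lborel. h x * (iexp (x \<bullet> \<xi>) * m \<xi>))"
    using lborel_pair.Fubini_integral[OF i] by simp
  also have "\<dots> = (LINT \<xi>|lborel. of_real (1 / (2 * pi) ^ CARD('n)) * (LINT x|lborel. iexp (x \<bullet> \<xi>) * h x) * m \<xi>)"
    unfolding integral_mult_right_zero[symmetric] integral_mult_left_zero[symmetric] by (simp only: mult_ac)
  finally show ?thesis .
qed

lemma norm_powr_eq: "(norm x)\<^sup>2 powr \<beta> = norm x powr (2 * \<beta>)" for x :: "'a::real_normed_vector"
  by (cases "x = 0") (auto simp: powr_powr simp flip: powr_numeral)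

lemma cball_borel_measurable [measurable]: "cball (x::'a::euclidean_space) r \<in> sets borel"
  by (rule borel_closed[OF closed_cball])

text \<open>Monotone convergence along growing balls.\<close>

lemma integrable_bounded_on_balls:
  fixes f :: "'a::euclidean_space \<Rightarrow> real"
  assumes [measurable]: "f \<in> borel_measurable borel"
    and b: "\<And>k::nat. integrable lborel (\<lambda>x. indicator (cball 0 (real k)) x * \<bar>f x\<bar>)" "\<And>k::nat. (LINT x|lborel. indicator (cball 0 (real k)) x * \<bar>f x\<bar>) \<le> B"
  shows "integrable lborel f \<and> (LINT x|lborel. \<bar>f x\<bar>) \<le> B"
proof -
  have B: "B \<ge> 0" using b(2)[of 0] by (rule order_trans[rotated]) (auto intro!: integral_nonneg_AE)
  have mono: "incseq (\<lambda>(k::nat) x. ennreal (indicator (cball 0 (real k)) x * \<bar>f x\<bar>))"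
    by (auto simp: incseq_def le_fun_def indicator_def)
  have "(SUP k::nat. ennreal (indicator (cball 0 (real k)) x * \<bar>f x\<bar>)) = ennreal \<bar>f x\<bar>" for x
  proof (rule antisym)
    show "(SUP k::nat. ennreal (indicator (cball 0 (real k)) x * \<bar>f x\<bar>)) \<le> ennreal \<bar>f x\<bar>"
      by (auto intro!: SUP_least simp: indicator_def)
    obtain k :: nat where "norm x \<le> real k" using real_arch_simple by blast
    then show "ennreal \<bar>f x\<bar> \<le> (SUP k::nat. ennreal (indicator (cball 0 (real k)) x * \<bar>f x\<bar>))"
      by (intro SUP_upper2[of k]) (auto simp: indicator_def)
  qed
  then have "(\<integral>\<^sup>+x. ennreal \<bar>f x\<bar> \<partial>lborel) = (\<integral>\<^sup>+x. (SUP k::nat. ennreal (indicator (cball 0 (real k)) x * \<bar>f x\<bar>)) \<partial>lborel)"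
    by simp
  also have "\<dots> = (SUP k::nat. \<integral>\<^sup>+x. ennreal (indicator (cball 0 (real k)) x * \<bar>f x\<bar>) \<partial>lborel)"
    by (rule nn_integral_monotone_convergence_SUP[OF mono]) simp
  also have "\<dots> \<le> ennreal B"
  proof (rule SUP_least)
    fix k :: nat
    show "(\<integral>\<^sup>+x. ennreal (indicator (cball 0 (real k)) x * \<bar>f x\<bar>) \<partial>lborel) \<le> ennreal B"
      by (subst nn_integral_eq_integral[OF b(1)]) (use b(2) in \<open>auto intro: ennreal_leI\<close>)
  qed
  finally have nn: "(\<integral>\<^sup>+x. ennreal \<bar>f x\<bar> \<partial>lborel) \<le> ennreal B" .
  have i: "integrable lborel f"
    by (rule integrableI_bounded) (use nn in \<open>auto simp: top.not_eq_extremum intro: le_less_trans\<close>)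
  show ?thesis
  proof
    show "integrable lborel f" by (rule i)
    have "ennreal (LINT x|lborel. \<bar>f x\<bar>) \<le> ennreal B"
      using nn by (subst nn_integral_eq_integral[symmetric]) (use i in auto)
    then show "(LINT x|lborel. \<bar>f x\<bar>) \<le> B" using B by simp
  qed
qed

abbreviation gauss_kernel :: "(real^'n \<Rightarrow> complex) \<Rightarrow> real \<Rightarrow> real^'n \<Rightarrow> real" where
  "gauss_kernel a d x \<equiv> Re (inverse_fourier (\<lambda>\<xi>. a \<xi> * gauss_symbol d \<xi>) x)"

abbreviation stable_kernel :: "(real^'n \<Rightarrow> complex) \<Rightarrow> real \<Rightarrow> real \<Rightarrow> real^'n \<Rightarrow> real" where
  "stable_kernel a \<beta> t x \<equiv> Re (inverse_fourier (\<lambda>\<xi>. a \<xi> * heat_symbol \<beta> t \<xi>) x)"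

text \<open>On a ball, the \<open>L\<^sup>1\<close> norm of a kernel is its integral against a sign function \<open>h\<close>. On the Fourier
side this is an integral of the symbol against a bounded weight, to which \<open>subordination_le\<close> applies
with \<open>\<rho> = \<bar>\<xi>\<bar>\<^sup>2\<close>; for the Gaussian family the same pairing is at most the \<open>L\<^sup>1\<close> norm of the Gaussian
kernel.\<close>

theorem stable_kernel_L1:
  fixes a :: "real^'n \<Rightarrow> complex" and q2 \<rho>2 :: "'b \<Rightarrow> real"
  assumes a [measurable]: "a \<in> borel_measurable borel"
    and ia: "\<And>d. 0 < d \<Longrightarrow> integrable lborel (\<lambda>\<xi>. a \<xi> * gauss_symbol d \<xi>)"
    and ist: "integrable lborel (\<lambda>\<xi>. a \<xi> * heat_symbol \<beta> t \<xi>)"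
    and g_int: "\<And>d. 0 < d \<Longrightarrow> integrable lborel (\<lambda>x. gauss_kernel a d x)"
    and g_le: "\<And>d. 0 < d \<Longrightarrow> (LINT x|lborel. \<bar>gauss_kernel a d x\<bar>)
         \<le> (LINT y|N. q2 y * exp (- d * \<rho>2 y))"
    and \<beta>: "0 < \<beta>" "\<beta> < 1" and t: "0 < t"
    and N: "sigma_finite_measure N" and q2: "q2 \<in> borel_measurable N"
    and \<rho>2: "\<rho>2 \<in> borel_measurable N" "\<And>x. 0 \<le> \<rho>2 x"
    and int2: "\<And>d. 0 < d \<Longrightarrow> integrable N (\<lambda>x. q2 x * exp (- d * \<rho>2 x))"
    and st2: "integrable N (\<lambda>x. q2 x * exp (- t * \<rho>2 x powr \<beta>))"
  shows "integrable lborel (\<lambda>x. stable_kernel a \<beta> t x) \<and>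
     (LINT x|lborel. \<bar>stable_kernel a \<beta> t x\<bar>) \<le> (LINT y|N. q2 y * exp (- t * \<rho>2 y powr \<beta>))"
proof -
  define Kr where "Kr = (\<lambda>x. stable_kernel a \<beta> t x)"
  have [measurable]: "heat_symbol \<beta> t \<in> borel_measurable (borel :: (real^'n) measure)" unfolding heat_symbol_def by measurable
  have Om [measurable]: "Kr \<in> borel_measurable borel"
    unfolding Kr_def by measurable
  have "integrable lborel Kr \<and> (LINT x|lborel. \<bar>Kr x\<bar>) \<le> (LINT y|N. q2 y * exp (- t * \<rho>2 y powr \<beta>))"
  proof (rule integrable_bounded_on_balls)
    fix k :: nat
    \<comment> \<open>the sign of the kernel on a ball, so that \<open>h * Kr\<close> integrates to the truncated \<open>L\<^sup>1\<close> norm\<close>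
    define h :: "real^'n \<Rightarrow> real" where "h = (\<lambda>x. indicator (cball 0 (real k)) x * sgn (Kr x))"
    have hm [measurable]: "h \<in> borel_measurable borel" unfolding h_def by measurable
    have h1: "\<bar>h x\<bar> \<le> 1" for x by (auto simp: h_def indicator_def sgn_if)
    have ball: "integrable lborel (indicator (cball (0::real^'n) (real k)) :: _ \<Rightarrow> real)"
      by (rule integrable_real_indicator) (use emeasure_bounded_finite[OF bounded_cball] in auto)
    have hi: "integrable lborel h"
      by (rule Bochner_Integration.integrable_bound[OF ball]) (auto simp: h_def indicator_def sgn_if)
    define H where "H = (\<lambda>\<xi>. of_real (1 / (2 * pi) ^ CARD('n)) * (LINT x|lborel. iexp (x \<bullet> \<xi>) * of_real (h x)) :: complex)"
    have Hm [measurable]: "H \<in> borel_measurable borel" unfolding H_def by measurable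
    define HB where "HB = 1 / (2 * pi) ^ CARD('n) * (LINT x|lborel. \<bar>h x\<bar>)"
    have HB: "norm (H \<xi>) \<le> HB" for \<xi>
    proof -
      have "norm (LINT x|lborel. iexp (x \<bullet> \<xi>) * of_real (h x) :: complex) \<le> (LINT x|lborel. norm (iexp (x \<bullet> \<xi>) * of_real (h x) :: complex))"
        by (rule integral_norm_bound)
      also have "\<dots> = (LINT x|lborel. \<bar>h x\<bar>)" by (simp add: norm_mult)
      finally show ?thesis unfolding H_def HB_def norm_mult norm_of_real by (intro mult_mono) auto
    qed
    define q1 where "q1 = (\<lambda>\<xi>. Re (H \<xi> * a \<xi>))"
    \<comment> \<open>applied below to the Gaussian and to the stable factor\<close>
    have dual: "integrable lborel (\<lambda>\<xi>. q1 \<xi> * F \<xi>) \<and> (LINT \<xi>|lborel. q1 \<xi> * F \<xi>) = (LINT x|lborel. h x * Re (inverse_fourier (\<lambda>\<xi>. a \<xi> * of_real (F \<xi>)) x))"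
      if F: "integrable lborel (\<lambda>\<xi>. a \<xi> * of_real (F \<xi>))" and [measurable]: "F \<in> borel_measurable borel" for F :: "real^'n \<Rightarrow> real"
    proof -
      have hc: "integrable lborel (\<lambda>x. complex_of_real (h x))" using hi by simp
      have HF: "integrable lborel (\<lambda>\<xi>. H \<xi> * (a \<xi> * of_real (F \<xi>)))"
      proof (rule Bochner_Integration.integrable_bound)
        show "integrable lborel (\<lambda>\<xi>. HB * norm (a \<xi> * of_real (F \<xi>)))" using F by (intro integrable_mult_right integrable_norm)
        have "norm (H \<xi> * (a \<xi> * of_real (F \<xi>))) \<le> norm (HB * norm (a \<xi> * of_real (F \<xi>)))" for \<xi>
          unfolding norm_mult real_norm_def abs_mult abs_abs abs_norm_cancel
          by (intro mult_right_mono order_trans[OF HB]) auto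
        then show "AE \<xi> in lborel. norm (H \<xi> * (a \<xi> * of_real (F \<xi>))) \<le> norm (HB * norm (a \<xi> * of_real (F \<xi>)))" by simp
      qed measurable
      have e: "q1 \<xi> * F \<xi> = Re (H \<xi> * (a \<xi> * of_real (F \<xi>)))" for \<xi>
      proof -
        have "Re (z * of_real r) = Re z * r" for z r by simp
        then show ?thesis unfolding q1_def mult.assoc[symmetric] by (simp only:)
      qed
      have "(LINT \<xi>|lborel. q1 \<xi> * F \<xi>) = Re (LINT \<xi>|lborel. H \<xi> * (a \<xi> * of_real (F \<xi>)))"
        unfolding e by (rule integral_Re[OF HF])
      also have "(LINT \<xi>|lborel. H \<xi> * (a \<xi> * of_real (F \<xi>))) = (LINT x|lborel. of_real (h x) * inverse_fourier (\<lambda>\<xi>. a \<xi> * of_real (F \<xi>)) x)"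
        unfolding H_def by (rule integral_mult_inverse_fourier[OF hc F, symmetric])
      also have "Re \<dots> = (LINT x|lborel. Re (of_real (h x) * inverse_fourier (\<lambda>\<xi>. a \<xi> * of_real (F \<xi>)) x))"
      proof (rule integral_Re[symmetric])
        define IB where "IB = 1 / (2 * pi) ^ CARD('n) * (LINT \<xi>|lborel. norm (a \<xi> * of_real (F \<xi>)))"
        have IB: "norm (inverse_fourier (\<lambda>\<xi>. a \<xi> * of_real (F \<xi>)) x) \<le> IB" for x
          unfolding IB_def by (rule inverse_fourier_bound)
        show "integrable lborel (\<lambda>x. of_real (h x) * inverse_fourier (\<lambda>\<xi>. a \<xi> * of_real (F \<xi>)) x)"
        proof (rule Bochner_Integration.integrable_bound)
          show "integrable lborel (\<lambda>x. h x * IB)" using hi by simp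
          have "norm (of_real (h x) * inverse_fourier (\<lambda>\<xi>. a \<xi> * of_real (F \<xi>)) x) \<le> norm (h x * IB)" for x
            unfolding norm_mult norm_of_real real_norm_def abs_mult by (intro mult_left_mono order_trans[OF IB]) auto
          then show "AE x in lborel. norm (of_real (h x) * inverse_fourier (\<lambda>\<xi>. a \<xi> * of_real (F \<xi>)) x) \<le> norm (h x * IB)" by simp
        qed measurable
      qed
      finally show ?thesis using integrable_Re[OF HF] unfolding e by simp
    qed
    have F1: "integrable lborel (\<lambda>\<xi>. q1 \<xi> * exp (- d * (norm \<xi>)\<^sup>2))"
      "(LINT \<xi>|lborel. q1 \<xi> * exp (- d * (norm \<xi>)\<^sup>2)) \<le> (LINT y|N. q2 y * exp (- d * \<rho>2 y))" if d: "0 < d" for d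
    proof -
      note D = dual[OF ia[OF d]]
      show "integrable lborel (\<lambda>\<xi>. q1 \<xi> * exp (- d * (norm \<xi>)\<^sup>2))" using D by simp
      have "(LINT \<xi>|lborel. q1 \<xi> * exp (- d * (norm \<xi>)\<^sup>2)) = (LINT x|lborel. h x * gauss_kernel a d x)"
        using D by simp
      also have "\<dots> \<le> (LINT x|lborel. \<bar>gauss_kernel a d x\<bar>)"
      proof (rule integral_mono')
        show "integrable lborel (\<lambda>x. \<bar>gauss_kernel a d x\<bar>)"
          using g_int[OF d] by simp
        show "h x * gauss_kernel a d x \<le> \<bar>gauss_kernel a d x\<bar>" for x
        proof -
          have "h x * R \<le> \<bar>R\<bar>" for R
            using mult_right_mono[OF h1[of x], of "\<bar>R\<bar>"] abs_ge_self[of "h x * R"] by (simp add: abs_mult)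
          then show ?thesis .
        qed
      qed simp
      also have "\<dots> \<le> (LINT y|N. q2 y * exp (- d * \<rho>2 y))"
        by (rule g_le[OF d])
      finally show "(LINT \<xi>|lborel. q1 \<xi> * exp (- d * (norm \<xi>)\<^sup>2)) \<le> (LINT y|N. q2 y * exp (- d * \<rho>2 y))" .
    qed
    have st1: "integrable lborel (\<lambda>\<xi>. q1 \<xi> * exp (- t * (norm \<xi>)\<^sup>2 powr \<beta>))"
      "(LINT \<xi>|lborel. q1 \<xi> * exp (- t * (norm \<xi>)\<^sup>2 powr \<beta>)) = (LINT x|lborel. h x * Kr x)"
      using dual[of "\<lambda>\<xi>. exp (- t * norm \<xi> powr (2 * \<beta>))"] ist unfolding norm_powr_eq Kr_def heat_symbol_def by simp_all
    have "(LINT \<xi>|lborel. q1 \<xi> * exp (- t * (norm \<xi>)\<^sup>2 powr \<beta>)) \<le> (LINT y|N. q2 y * exp (- t * \<rho>2 y powr \<beta>))"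
      by (rule subordination_le[OF _ _ _ _ F1(1) N q2 \<rho>2 int2 F1(2) \<beta> t st1(1) st2])
         (auto simp: q1_def sigma_finite_lborel)
    moreover have e: "h x * Kr x = indicator (cball 0 (real k)) x * \<bar>Kr x\<bar>" for x
      by (simp add: h_def sgn_if)
    ultimately show "(LINT x|lborel. indicator (cball 0 (real k)) x * \<bar>Kr x\<bar>) \<le> (LINT y|N. q2 y * exp (- t * \<rho>2 y powr \<beta>))"
      using st1(2) by simp
    show "integrable lborel (\<lambda>x. indicator (cball 0 (real k)) x * \<bar>Kr x\<bar>)"
    proof -
      define IB where "IB = 1 / (2 * pi) ^ CARD('n) * (LINT \<xi>|lborel. norm (a \<xi> * heat_symbol \<beta> t \<xi>))"
      have IB: "\<bar>Kr x\<bar> \<le> IB" for x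
        unfolding Kr_def IB_def by (rule order_trans[OF abs_Re_le_cmod inverse_fourier_bound])
      show ?thesis
      proof (rule Bochner_Integration.integrable_bound[of _ "\<lambda>x. indicator (cball 0 (real k)) x * IB"])
        show "integrable lborel (\<lambda>x::real^'n. indicator (cball 0 (real k)) x * IB)" using ball by simp
        show "AE x in lborel. norm (indicator (cball 0 (real k)) x * \<bar>Kr x\<bar>) \<le> norm (indicator (cball 0 (real k)) x * IB)"
          using IB by (auto simp: indicator_def intro: order_trans[OF _ abs_ge_self])
      qed measurable
    qed
  qed measurable
  then show ?thesis unfolding Kr_def .
qed

lemma integrable_inverse_1_plus_sq: "integrable lborel (\<lambda>x::real. 1 / (1 + x\<^sup>2))"
  using integrable_inverse_1_plus_square by (simp add: set_integrable_def inverse_eq_divide)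

lemma integrable_decay:
  fixes f :: "'a::euclidean_space \<Rightarrow> 'b::{banach, second_countable_topology}"
  assumes [measurable]: "f \<in> borel_measurable borel" and b: "\<And>x. norm (f x) * (1 + (norm x)\<^sup>2) ^ DIM('a) \<le> C"
  shows "integrable lborel f"
proof -
  have "integrable lborel (\<lambda>x::'a. \<Prod>b\<in>Basis. (complex_of_real (1 / (1 + (x \<bullet> b)\<^sup>2))))"
    by (rule has_bochner_integral_prod_Basis[where f = "\<lambda>_ t. complex_of_real (1 / (1 + t\<^sup>2))", THEN integrable.intros];
        rule integrable_of_real[OF integrable_inverse_1_plus_sq])
  from integrable_Re[OF this] have i: "integrable lborel (\<lambda>x::'a. C * (\<Prod>b\<in>Basis. 1 / (1 + (x \<bullet> b)\<^sup>2)))"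
    by (intro integrable_mult_right) (simp only: of_real_prod[symmetric] Re_complex_of_real)
  show ?thesis
  proof (rule Bochner_Integration.integrable_bound[OF i])
    have "norm (f x) \<le> norm (C * (\<Prod>b\<in>Basis. 1 / (1 + (x \<bullet> b)\<^sup>2)))" for x
    proof -
      have p: "0 < (\<Prod>b\<in>Basis. 1 + (x \<bullet> b)\<^sup>2)" by (intro prod_pos) (auto intro: add_pos_nonneg)
      have "(\<Prod>b\<in>Basis. 1 + (x \<bullet> b)\<^sup>2) \<le> (\<Prod>b\<in>(Basis::'a set). 1 + (norm x)\<^sup>2)"
        by (intro prod_mono) (auto simp: abs_le_square_iff[symmetric] Basis_le_norm)
      then have "norm (f x) * (\<Prod>b\<in>Basis. 1 + (x \<bullet> b)\<^sup>2) \<le> norm (f x) * (1 + (norm x)\<^sup>2) ^ DIM('a)"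
        by (intro mult_left_mono) auto
      also have "\<dots> \<le> C" by (rule b)
      finally have "norm (f x) \<le> C / (\<Prod>b\<in>Basis. 1 + (x \<bullet> b)\<^sup>2)" using p by (simp add: field_simps)
      also have "\<dots> = C * (\<Prod>b\<in>Basis. 1 / (1 + (x \<bullet> b)\<^sup>2))" by (simp add: prod_dividef)
      finally show ?thesis by simp
    qed
    then show "AE x in lborel. norm (f x) \<le> norm (C * (\<Prod>b\<in>Basis. 1 / (1 + (x \<bullet> b)\<^sup>2)))" by simp
  qed simp
qed

lemma poly_exp_bounded:
  fixes t g :: real
  assumes t: "t > 0" and g: "g > 0"
  shows "\<exists>C. \<forall>r\<ge>0. (1 + r\<^sup>2) ^ N * exp (- t * r powr g) \<le> C"
proof -
  obtain k :: nat where k: "2 * real N \<le> real k * g"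
    using real_arch_simple[of "2 * real N / g"] g by (auto simp: field_simps)
  have "(1 + r\<^sup>2) ^ N * exp (- t * r powr g) \<le> 2 ^ N * (1 + fact k / t ^ k)" if r: "r \<ge> 0" for r
  proof (cases "r \<le> 1")
    case True
    then have "(1 + r\<^sup>2) ^ N \<le> 2 ^ N" using r by (intro power_mono) (auto simp: power_le_one)
    moreover have "exp (- t * r powr g) \<le> 1" using t by simp
    ultimately have "(1 + r\<^sup>2) ^ N * exp (- t * r powr g) \<le> 2 ^ N * 1" by (intro mult_mono) auto
    also have "\<dots> \<le> 2 ^ N * (1 + fact k / t ^ k)" using t by (intro mult_left_mono) auto
    finally show ?thesis .
  next
    case False
    then have r: "r > 1" by simp
    have "1 + r\<^sup>2 \<le> 2 * r\<^sup>2" using r by (simp add: one_le_power)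
    then have "(1 + r\<^sup>2) ^ N \<le> (2 * r\<^sup>2) ^ N" by (intro power_mono) auto
    also have "\<dots> = 2 ^ N * r powr (2 * real N)" using r powr_realpow[of r "2 * N"]
      by (simp add: power_mult_distrib power_mult)
    also have "\<dots> \<le> 2 ^ N * r powr (real k * g)" using r k by (intro mult_left_mono powr_mono) auto
    also have "r powr (real k * g) = (t * r powr g) ^ k / t ^ k" using r t powr_power[of r g k]
      by (simp add: power_mult_distrib)
    finally have 1: "(1 + r\<^sup>2) ^ N \<le> 2 ^ N * ((t * r powr g) ^ k / t ^ k)" .
    have y: "t * r powr g \<ge> 0" using t by simp
    have "(t * r powr g) ^ k / fact k \<le> exp (t * r powr g)"
    proof -
      have "(\<Sum>i\<in>{k}. (t * r powr g) ^ i /\<^sub>R fact i) \<le> (\<Sum>i. (t * r powr g) ^ i /\<^sub>R fact i)"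
        using y by (intro sum_le_suminf summable_exp_generic) auto
      then show ?thesis by (simp add: exp_def field_simps)
    qed
    then have 2: "(t * r powr g) ^ k \<le> fact k * exp (t * r powr g)" by (simp add: field_simps)
    have "(1 + r\<^sup>2) ^ N * exp (- t * r powr g) \<le> (2 ^ N * ((fact k * exp (t * r powr g)) / t ^ k)) * exp (- t * r powr g)"
      using t by (intro mult_right_mono order_trans[OF 1] mult_left_mono divide_right_mono 2) auto
    also have "\<dots> = 2 ^ N * (fact k / t ^ k)" by (simp add: exp_minus field_simps)
    also have "\<dots> \<le> 2 ^ N * (1 + fact k / t ^ k)" by (intro mult_left_mono) auto
    finally show ?thesis .
  qed
  then show ?thesis by blast
qed

lemma integrable_poly_exp:
  fixes a :: "real^'n \<Rightarrow> complex"
  assumes [measurable]: "a \<in> borel_measurable borel" and a: "\<And>x. norm (a x) \<le> A * (1 + (norm x)\<^sup>2) ^ N"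
    and t: "t > 0" and g: "g > 0"
  shows "integrable lborel (\<lambda>x. a x * of_real (exp (- t * norm x powr g)))"
proof -
  obtain C where C: "\<And>r. r \<ge> 0 \<Longrightarrow> (1 + r\<^sup>2) ^ (N + CARD('n)) * exp (- t * r powr g) \<le> C"
    using poly_exp_bounded[OF t g] by blast
  have A: "A \<ge> 0" using order_trans[OF norm_ge_zero a[of 0]] by simp
  show ?thesis
  proof (rule integrable_decay[where C = "A * C"])
    fix x :: "real^'n"
    have "norm (a x * of_real (exp (- t * norm x powr g))) * (1 + (norm x)\<^sup>2) ^ DIM(real^'n)
      = norm (a x) * ((1 + (norm x)\<^sup>2) ^ CARD('n) * exp (- t * norm x powr g))"
      by (simp add: norm_mult)
    also have "\<dots> \<le> (A * (1 + (norm x)\<^sup>2) ^ N) * ((1 + (norm x)\<^sup>2) ^ CARD('n) * exp (- t * norm x powr g))"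
      by (intro mult_right_mono a) auto
    also have "\<dots> = A * ((1 + (norm x)\<^sup>2) ^ (N + CARD('n)) * exp (- t * norm x powr g))" by (simp add: power_add)
    also have "\<dots> \<le> A * C" by (intro mult_left_mono C A) auto
    finally show "norm (a x * of_real (exp (- t * norm x powr g))) * (1 + (norm x)\<^sup>2) ^ DIM(real^'n) \<le> A * C" .
  qed measurable
qed

lemma integrable_poly_gauss:
  fixes a :: "real^'n \<Rightarrow> complex"
  assumes "a \<in> borel_measurable borel" and "\<And>x. norm (a x) \<le> A * (1 + (norm x)\<^sup>2) ^ N" and "t > 0"
  shows "integrable lborel (\<lambda>x. a x * gauss_symbol t x)"
  using integrable_poly_exp[OF assms, of 2] by simp

lemma integrable_poly_heat_symbol:
  fixes a :: "real^'n \<Rightarrow> complex"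
  assumes "a \<in> borel_measurable borel" and "\<And>x. norm (a x) \<le> A * (1 + (norm x)\<^sup>2) ^ N" and "t > 0" "\<beta> > 0"
  shows "integrable lborel (\<lambda>x. a x * heat_symbol \<beta> t x)"
  using integrable_poly_exp[OF assms(1-3), of "2 * \<beta>"] assms(4) by (simp add: heat_symbol_def)

section \<open>Gaussian kernels\<close>

definition gauss :: "real \<Rightarrow> real^'n \<Rightarrow> real" where
  "gauss s x = exp (- (norm x)\<^sup>2 / (4 * s)) / sqrt (4 * pi * s) ^ CARD('n)"

lemma gauss_nonneg: "s > 0 \<Longrightarrow> 0 \<le> gauss s x" by (simp add: gauss_def)

lemma gauss_measurable1 [measurable]: "gauss s \<in> borel_measurable borel"
  unfolding gauss_def by measurable

lemma inverse_fourier_gauss: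
  fixes x :: "real^'n"
  assumes s: "s > 0"
  shows "inverse_fourier (\<lambda>\<xi>. gauss_symbol s \<xi>) x = of_real (gauss s x)"
proof -
  have "1 / (2 * pi) * sqrt (pi / s) = 1 / sqrt (4 * pi * s)"
    using s by (simp add: real_sqrt_divide real_sqrt_mult field_simps)
  then have "(1 / (2 * pi) * sqrt (pi / s)) ^ CARD('n) = (1 / sqrt (4 * pi * s)) ^ CARD('n)" by simp
  then have "1 / (2 * pi) ^ CARD('n) * sqrt (pi / s) ^ CARD('n) = 1 / sqrt (4 * pi * s) ^ CARD('n)"
    by (simp only: power_mult_distrib power_one_over)
  then have "1 / (2 * pi) ^ CARD('n) * (sqrt (pi / s) ^ CARD('n) * exp (- (norm x)\<^sup>2 / (4 * s))) = gauss s x"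
    unfolding gauss_def mult.assoc[symmetric] by simp
  moreover have "inverse_fourier (\<lambda>\<xi>. gauss_symbol s \<xi>) x
      = of_real (1 / (2 * pi) ^ CARD('n) * (sqrt (pi / s) ^ CARD('n) * exp (- (norm x)\<^sup>2 / (4 * s))))"
    using has_bochner_integral_integral_eq[OF gaussian_fourier[OF s, of x]]
    unfolding inverse_fourier_def inner_commute[of x] by simp
  ultimately show ?thesis by simp
qed

lemma fourier_gauss:
  fixes \<xi> :: "real^'n"
  assumes s: "s > 0"
  shows "has_bochner_integral lborel (\<lambda>x. exp (- (\<i> * of_real (x \<bullet> \<xi>))) * of_real (gauss s x)) (gauss_symbol s \<xi>)"
proof -
  have c: "1 / (4 * s) > 0" using s by simp
  have "has_bochner_integral lborel (\<lambda>x. of_real (1 / sqrt (4 * pi * s) ^ CARD('n)) * (iexp (x \<bullet> (- \<xi>)) * of_real (exp (- (1 / (4 * s)) * (norm x)\<^sup>2))))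
     (of_real (1 / sqrt (4 * pi * s) ^ CARD('n)) * of_real (sqrt (pi / (1 / (4 * s))) ^ CARD('n) * exp (- (norm (-\<xi>))\<^sup>2 / (4 * (1 / (4 * s))))))"
    using gaussian_fourier[OF c, of "-\<xi>"] unfolding DIM_cart DIM_real mult_1_right
    by (intro has_bochner_integral_mult_right)
  moreover have "of_real (1 / sqrt (4 * pi * s) ^ CARD('n)) * (iexp (x \<bullet> (- \<xi>)) * of_real (exp (- (1 / (4 * s)) * (norm x)\<^sup>2)))
      = exp (- (\<i> * of_real (x \<bullet> \<xi>))) * of_real (gauss s x)" for x :: "real^'n"
    by (simp add: gauss_def)
  moreover have "of_real (1 / sqrt (4 * pi * s) ^ CARD('n)) * of_real (sqrt (pi / (1 / (4 * s))) ^ CARD('n) * exp (- (norm (-\<xi>))\<^sup>2 / (4 * (1 / (4 * s)))))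
     = (gauss_symbol s \<xi> :: complex)"
  proof -
    have "1 / sqrt (4 * pi * s) ^ CARD('n) * (sqrt (pi / (1 / (4 * s))) ^ CARD('n) * exp (- (norm (-\<xi>))\<^sup>2 / (4 * (1 / (4 * s))))) = exp (- s * (norm \<xi>)\<^sup>2)"
      using s by (simp add: mult_ac)
    then show ?thesis by (simp only: of_real_mult[symmetric])
  qed
  ultimately show ?thesis by simp
qed

lemma gauss_integral:
  assumes s: "s > 0"
  shows "integrable lborel (gauss s :: real^'n \<Rightarrow> real)" "(LINT x|lborel. gauss s (x::real^'n)) = 1"
proof -
  have h: "has_bochner_integral lborel (\<lambda>x. complex_of_real (gauss s (x::real^'n))) 1"
    using fourier_gauss[OF s, of "0::real^'n"] by simp
  show "integrable lborel (gauss s :: real^'n \<Rightarrow> real)"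
    using integrable_Re[OF integrable.intros[OF h]] by simp
  show "(LINT x|lborel. gauss s (x::real^'n)) = 1"
    using has_bochner_integral_integral_eq[OF h] by simp
qed

lemma le_one_plus_sq: "r \<le> 1 + r\<^sup>2" for r :: real
  using zero_le_power2[of "r - 1/2"] by (simp add: power2_eq_square algebra_simps)

definition gauss_moment :: "'n::finite itself \<Rightarrow> real" where
  "gauss_moment _ = (LINT x|lborel. norm x * gauss 1 (x::real^'n))"

lemma gauss_moment:
  assumes s: "s > 0"
  shows "has_bochner_integral lborel (\<lambda>x::real^'n. norm x * gauss s x) (sqrt s * gauss_moment TYPE('n::finite))"
proof -
  have "integrable lborel (\<lambda>x::real^'n. complex_of_real (norm x) * gauss_symbol (1/4) x)"
    by (rule integrable_poly_gauss[where A = 1 and N = 1]) (auto simp: le_one_plus_sq)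
  from integrable_Re[OF this] have "integrable lborel (\<lambda>x::real^'n. (1 / sqrt (4 * pi * 1) ^ CARD('n)) * (norm x * exp (- (1/4) * (norm x)\<^sup>2)))"
    by simp
  then have "has_bochner_integral lborel (\<lambda>x::real^'n. norm x * gauss 1 x) (gauss_moment TYPE('n::finite))"
    unfolding gauss_moment_def has_bochner_integral_iff gauss_def by (simp add: mult_ac)
  from lborel_has_bochner_integral_affine[OF this, of "1 / sqrt s" 0] s
  have "has_bochner_integral lborel (\<lambda>x::real^'n. norm ((1 / sqrt s) *\<^sub>R x) * gauss 1 ((1 / sqrt s) *\<^sub>R x)) (gauss_moment TYPE('n::finite) /\<^sub>R (1 / sqrt s) ^ CARD('n))"
    by simp
  from has_bochner_integral_mult_right[OF this, of "sqrt s / sqrt s ^ CARD('n)"]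
  have "has_bochner_integral lborel (\<lambda>x::real^'n. sqrt s / sqrt s ^ CARD('n) * (norm ((1 / sqrt s) *\<^sub>R x) * gauss 1 ((1 / sqrt s) *\<^sub>R x)))
      (sqrt s / sqrt s ^ CARD('n) * (gauss_moment TYPE('n::finite) /\<^sub>R (1 / sqrt s) ^ CARD('n)))" by simp
  moreover have "sqrt s / sqrt s ^ CARD('n) * (norm ((1 / sqrt s) *\<^sub>R x) * gauss 1 ((1 / sqrt s) *\<^sub>R x)) = norm x * gauss s x" for x :: "real^'n"
    using s by (simp add: gauss_def power_divide real_sqrt_mult power_mult_distrib mult.commute[of s])
  moreover have "sqrt s / sqrt s ^ CARD('n) * (gauss_moment TYPE('n::finite) /\<^sub>R (1 / sqrt s) ^ CARD('n)) = sqrt s * gauss_moment TYPE('n::finite)"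
    using s by (simp add: power_divide)
  ultimately show ?thesis by simp
qed

lemma gauss_moment_nonneg: "gauss_moment TYPE('n::finite) \<ge> 0"
  unfolding gauss_moment_def by (intro integral_nonneg_AE) (auto simp: gauss_nonneg)

section \<open>Symbols of integrable kernels\<close>

text \<open>Convolution operators with kernel of \<open>L\<^sup>1\<close> norm at most \<open>A\<close>, described by their symbols; the bounds
multiply under products of symbols.\<close>

definition l1_multiplier :: "(real^'n \<Rightarrow> complex) \<Rightarrow> real \<Rightarrow> bool" where
  "l1_multiplier m A \<longleftrightarrow> (\<exists>k. integrable lborel k \<and> (\<forall>\<xi>. fourier k \<xi> = m \<xi>) \<and> (LINT x|lborel. norm (k x)) \<le> A)"

lemma convolution_L1:
  fixes k1 k2 :: "real^'n \<Rightarrow> complex"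
  assumes k1: "integrable lborel k1" and k2: "integrable lborel k2"
  defines "k \<equiv> \<lambda>x. LINT y|lborel. k1 y * k2 (x - y)"
  shows "integrable (lborel \<Otimes>\<^sub>M lborel) (\<lambda>(y, x). k1 y * k2 (x - y))" "integrable lborel k"
    "(LINT x|lborel. norm (k x)) \<le> (LINT x|lborel. norm (k1 x)) * (LINT x|lborel. norm (k2 x))"
proof -
  have [measurable]: "k1 \<in> borel_measurable borel" "k2 \<in> borel_measurable borel" using assms by auto
  have sh: "integrable lborel (\<lambda>x. k2 (x - y))" "(LINT x|lborel. norm (k2 (x - y))) = (LINT x|lborel. norm (k2 x))" for y
    using lborel_integrable_affine[OF k2, of 1 "- y"] lborel_integral_affine[of 1 "\<lambda>x. norm (k2 x)" "- y"] by simp_all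
  have e: "(LINT x|lborel. norm (k1 y * k2 (x - y))) = norm (k1 y) * (LINT x|lborel. norm (k2 x))" for y
    unfolding norm_mult integral_mult_right_zero sh(2) ..
  show i: "integrable (lborel \<Otimes>\<^sub>M lborel) (\<lambda>(y, x). k1 y * k2 (x - y))"
    by (rule lborel_pair.Fubini_integrable) (use k1 sh in \<open>auto simp: e simp flip: norm_mult\<close>)
  have "integrable (lborel \<Otimes>\<^sub>M lborel) (\<lambda>(y, x). norm (k1 y * k2 (x - y)))"
    using integrable_norm[OF i] by (simp add: case_prod_unfold)
  note in2 = this
  show "integrable lborel k" using lborel_pair.integrable_snd[OF i] by (simp add: k_def)
  then have "(LINT x|lborel. norm (k x)) \<le> (LINT x|lborel. LINT y|lborel. norm (k1 y * k2 (x - y)))"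
    unfolding k_def by (intro integral_mono integrable_norm integral_norm_bound)
      (use lborel_pair.integrable_snd[OF in2] in auto)
  also have "\<dots> = (LINT y|lborel. LINT x|lborel. norm (k1 y * k2 (x - y)))"
    using lborel_pair.Fubini_integral[OF in2] by simp
  also have "\<dots> = (LINT x|lborel. norm (k1 x)) * (LINT x|lborel. norm (k2 x))" unfolding e by simp
  finally show "(LINT x|lborel. norm (k x)) \<le> (LINT x|lborel. norm (k1 x)) * (LINT x|lborel. norm (k2 x))" .
qed

lemma fourier_convolution:
  fixes k1 k2 :: "real^'n \<Rightarrow> complex"
  assumes k1: "integrable lborel k1" and k2: "integrable lborel k2"
  shows "fourier (\<lambda>x. LINT y|lborel. k1 y * k2 (x - y)) \<xi> = fourier k1 \<xi> * fourier k2 \<xi>"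
proof -
  have [measurable]: "k1 \<in> borel_measurable borel" "k2 \<in> borel_measurable borel" using assms by auto
  have i: "integrable (lborel \<Otimes>\<^sub>M lborel) (\<lambda>(y, x). exp (- (\<i> * of_real (x \<bullet> \<xi>))) * (k1 y * k2 (x - y)))"
    by (rule Bochner_Integration.integrable_bound[OF convolution_L1(1)[OF k1 k2]]) (auto simp: norm_mult)
  have "fourier (\<lambda>x. LINT y|lborel. k1 y * k2 (x - y)) \<xi> = (LINT x|lborel. LINT y|lborel. exp (- (\<i> * of_real (x \<bullet> \<xi>))) * (k1 y * k2 (x - y)))"
    unfolding fourier_def by simp
  also have "\<dots> = (LINT y|lborel. LINT x|lborel. exp (- (\<i> * of_real (x \<bullet> \<xi>))) * (k1 y * k2 (x - y)))"
    using lborel_pair.Fubini_integral[OF i] by simp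
  also have "\<dots> = (LINT y|lborel. exp (- (\<i> * of_real (y \<bullet> \<xi>))) * k1 y * fourier k2 \<xi>)"
  proof (rule Bochner_Integration.integral_cong[OF refl])
    fix y
    have "(LINT x|lborel. exp (- (\<i> * of_real (x \<bullet> \<xi>))) * (k1 y * k2 (x - y)))
      = (LINT x|lborel. exp (- (\<i> * of_real ((y + 1 *\<^sub>R x) \<bullet> \<xi>))) * (k1 y * k2 ((y + 1 *\<^sub>R x) - y)))"
      by (subst lborel_integral_affine[of 1 "\<lambda>x. exp (- (\<i> * of_real (x \<bullet> \<xi>))) * (k1 y * k2 (x - y))" y]) simp_all
    also have "\<dots> = (LINT x|lborel. exp (- (\<i> * of_real (y \<bullet> \<xi>))) * k1 y * (exp (- (\<i> * of_real (x \<bullet> \<xi>))) * k2 x))"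
      by (rule Bochner_Integration.integral_cong) (simp_all add: inner_add_left algebra_simps exp_diff exp_minus field_simps)
    finally show "(LINT x|lborel. exp (- (\<i> * of_real (x \<bullet> \<xi>))) * (k1 y * k2 (x - y))) = exp (- (\<i> * of_real (y \<bullet> \<xi>))) * k1 y * fourier k2 \<xi>"
      by (simp add: fourier_def)
  qed
  finally show ?thesis by (simp add: fourier_def)
qed

lemma l1_multiplier_mult:
  assumes "l1_multiplier m1 A1" "l1_multiplier m2 A2"
  shows "l1_multiplier (\<lambda>\<xi>. m1 \<xi> * m2 \<xi>) (A1 * A2)"
proof -
  obtain k1 k2 where k: "integrable lborel k1" "\<And>\<xi>. fourier k1 \<xi> = m1 \<xi>" "(LINT x|lborel. norm (k1 x)) \<le> A1"
    "integrable lborel k2" "\<And>\<xi>. fourier k2 \<xi> = m2 \<xi>" "(LINT x|lborel. norm (k2 x)) \<le> A2"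
    using assms by (auto simp: l1_multiplier_def)
  have "(LINT x|lborel. norm (k1 x)) * (LINT x|lborel. norm (k2 x)) \<le> A1 * A2"
    using k by (intro mult_mono) (auto intro: order_trans[rotated])
  then show ?thesis unfolding l1_multiplier_def
    using convolution_L1[OF k(1,4)] fourier_convolution[OF k(1,4)] k(2,5) order_trans by (intro exI conjI) auto
qed

text \<open>The kernel is \<open>-x\<^sub>l/(2s)\<close> times the Gaussian, whose first moment is of order \<open>sqrt s\<close>.\<close>

lemma l1_multiplier_deriv_gauss:
  fixes l :: "'n::finite"
  assumes s: "s > 0"
  shows "l1_multiplier (\<lambda>\<xi>::real^'n. deriv_symbol l \<xi> * gauss_symbol s \<xi>) (gauss_moment TYPE('n::finite) / 2 * s powr (-1/2))"
proof -
  define k where "k = (\<lambda>x::real^'n. complex_of_real (- (x $ l) / (2 * s) * gauss s x))"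
  have m: "has_bochner_integral lborel (\<lambda>x::real^'n. norm x * gauss s x) (sqrt s * gauss_moment TYPE('n::finite))"
    by (rule gauss_moment[OF s])
  then have mi: "integrable lborel (\<lambda>x::real^'n. norm x * gauss s x / (2 * s))" by (auto simp: has_bochner_integral_iff)
  have kb: "norm (k x) \<le> norm x * gauss s x / (2 * s)" for x
    unfolding k_def norm_of_real using s component_le_norm_cart[of x l] gauss_nonneg[OF s, of x]
    by (auto simp: abs_mult divide_right_mono mult_right_mono)
  have ki: "integrable lborel k"
  proof (rule Bochner_Integration.integrable_bound[OF mi])
    show "k \<in> borel_measurable lborel" unfolding k_def by measurable
    show "AE x in lborel. norm (k x) \<le> norm (norm x * gauss s x / (2 * s))"
      by (intro AE_I2 order_trans[OF kb]) (simp only: real_norm_def abs_ge_self)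
  qed
  have "(LINT x|lborel. norm (k x)) \<le> (LINT x|lborel. norm (x::real^'n) * gauss s x / (2 * s))"
    by (intro integral_mono integrable_norm ki mi kb)
  also have "\<dots> = sqrt s * gauss_moment TYPE('n::finite) / (2 * s)" using m by (simp add: has_bochner_integral_iff)
  also have "\<dots> = gauss_moment TYPE('n::finite) / 2 * s powr (-1/2)"
    using s by (simp add: powr_minus powr_half_sqrt real_div_sqrt field_simps)
  finally have kn: "(LINT x|lborel. norm (k x)) \<le> gauss_moment TYPE('n::finite) / 2 * s powr (-1/2)" .
  have "fourier k \<xi> = deriv_symbol l \<xi> * gauss_symbol s \<xi>" for \<xi>
  proof -
    have c: "1 / (4 * s) > 0" using s by simp
    have b: "axis l (1::real) \<in> Basis" by simp
    have f: "fourier k \<xi> = (LINT x|lborel. of_real (- 1 / (2 * s) * (1 / sqrt (4 * pi * s) ^ CARD('n))) * (iexp (x \<bullet> (- \<xi>)) * of_real ((x \<bullet> axis l 1) * exp (- (1 / (4 * s)) * (norm x)\<^sup>2))))"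
      unfolding fourier_def k_def by (rule Bochner_Integration.integral_cong) (simp_all add: gauss_def cart_eq_inner_axis)
    have "sqrt (pi / (1 / (4 * s))) = sqrt (4 * pi * s)" by (simp add: mult_ac)
    then show ?thesis unfolding f integral_mult_right_zero has_bochner_integral_integral_eq[OF gaussian_moment_fourier[OF c b]]
      using s by (simp add: deriv_symbol_def cart_eq_inner_axis field_simps)
  qed
  with ki kn show ?thesis unfolding l1_multiplier_def by blast
qed

text \<open>The extra Gaussian makes the symbol integrable, and its inverse transform is then the convolution
of the \<open>L\<^sup>1\<close> kernel with a Gaussian of mass one.\<close>

lemma l1_multiplier_inverse_fourier:
  assumes m: "l1_multiplier m A" and s: "s > 0"
  shows "integrable lborel (inverse_fourier (\<lambda>\<xi>. m \<xi> * gauss_symbol s \<xi>))"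
    "(LINT x|lborel. norm (inverse_fourier (\<lambda>\<xi>. m \<xi> * gauss_symbol s \<xi>) x)) \<le> A"
proof -
  obtain k where k: "integrable lborel k" "\<And>\<xi>. fourier k \<xi> = m \<xi>" "(LINT x|lborel. norm (k x)) \<le> A"
    using m by (auto simp: l1_multiplier_def)
  have g: "integrable lborel (\<lambda>x. complex_of_real (gauss s x))" by (rule integrable_of_real[OF gauss_integral(1)[OF s]])
  have m2: "integrable lborel (\<lambda>\<xi>::real^'a. gauss_symbol s \<xi>)"
    using integrable_poly_gauss[of "\<lambda>_. 1" 1 0 s] s by simp
  have e: "inverse_fourier (\<lambda>\<xi>. m \<xi> * gauss_symbol s \<xi>) = (\<lambda>x. LINT y|lborel. k y * of_real (gauss s (x - y)))"
    using inverse_fourier_convolution[OF k(1) m2] unfolding k(2) inverse_fourier_gauss[OF s] by (intro ext)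
  show "integrable lborel (inverse_fourier (\<lambda>\<xi>. m \<xi> * gauss_symbol s \<xi>))"
    unfolding e by (rule convolution_L1(2)[OF k(1) g])
  have "(LINT x|lborel. norm (inverse_fourier (\<lambda>\<xi>. m \<xi> * gauss_symbol s \<xi>) x)) \<le> (LINT x|lborel. norm (k x)) * (LINT x|lborel. norm (complex_of_real (gauss s (x::real^'a))))"
    unfolding e by (rule convolution_L1(3)[OF k(1) g])
  also have "\<dots> = (LINT x|lborel. norm (k x))" using s by (simp add: gauss_integral gauss_nonneg)
  finally show "(LINT x|lborel. norm (inverse_fourier (\<lambda>\<xi>. m \<xi> * gauss_symbol s \<xi>) x)) \<le> A" using k(3) by simp
qed

section \<open>Translates and Riesz transforms of Gaussians\<close>

text \<open>The fundamental theorem of calculus along the segment from \<open>x\<close> to \<open>x + h\<close>.\<close>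

lemma gauss_translate_le_int:
  fixes h x :: "real^'n"
  assumes s: "s > 0"
  shows "\<bar>gauss s (x + h) - gauss s x\<bar> \<le> (LINT \<theta>|lborel. indicator {0..1} \<theta> * (norm h * (norm (x + \<theta> *\<^sub>R h) * gauss s (x + \<theta> *\<^sub>R h) / (2 * s))))"
proof -
  define f where "f = (\<lambda>\<theta>. gauss s (x + \<theta> *\<^sub>R h))"
  define f' where "f' = (\<lambda>\<theta>. - ((x + \<theta> *\<^sub>R h) \<bullet> h) / (2 * s) * gauss s (x + \<theta> *\<^sub>R h))"
  have D: "(f has_vector_derivative f' \<theta>) (at \<theta> within {0..1})" for \<theta>
  proof -
    have q: "(norm (x + \<theta> *\<^sub>R h))\<^sup>2 = x \<bullet> x + 2 * \<theta> * (x \<bullet> h) + \<theta>\<^sup>2 * (h \<bullet> h)" for \<theta>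
      unfolding power2_norm_eq_inner by (simp add: inner_simps inner_commute power2_eq_square algebra_simps)
    have "((\<lambda>\<theta>. exp (- (x \<bullet> x + 2 * \<theta> * (x \<bullet> h) + \<theta>\<^sup>2 * (h \<bullet> h)) / (4 * s)) / sqrt (4 * pi * s) ^ CARD('n)) has_real_derivative f' \<theta>) (at \<theta> within {0..1})"
      unfolding f'_def gauss_def q using s
      by (auto intro!: derivative_eq_intros simp: inner_simps inner_commute field_simps)
    then show ?thesis
      unfolding f_def gauss_def q has_real_derivative_iff_has_vector_derivative .
  qed
  have c: "continuous_on {0..1} f'" unfolding f'_def gauss_def using s by (intro continuous_intros) auto
  have i: "integrable lborel (\<lambda>\<theta>. indicator {0..1} \<theta> *\<^sub>R f' \<theta>)"
    using borel_integrable_atLeastAtMost'[OF c] by (simp add: set_integrable_def)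
  have cg: "continuous_on {0..1} (\<lambda>\<theta>. norm h * (norm (x + \<theta> *\<^sub>R h) * gauss s (x + \<theta> *\<^sub>R h) / (2 * s)))"
    unfolding gauss_def using s by (intro continuous_intros) auto
  have ig: "integrable lborel (\<lambda>\<theta>. indicator {0..1} \<theta> * (norm h * (norm (x + \<theta> *\<^sub>R h) * gauss s (x + \<theta> *\<^sub>R h) / (2 * s))))"
    using borel_integrable_atLeastAtMost'[OF cg] by (simp add: set_integrable_def)
  have "gauss s (x + h) - gauss s x = f 1 - f 0" by (simp add: f_def)
  also have "\<dots> = (LINT \<theta>|lborel. indicator {0..1} \<theta> *\<^sub>R f' \<theta>)"
    by (rule integral_FTC_atLeastAtMost[OF _ D c, symmetric]) simp
  finally have "\<bar>gauss s (x + h) - gauss s x\<bar> \<le> (LINT \<theta>|lborel. norm (indicator {0..1} \<theta> *\<^sub>R f' \<theta>))"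
    using integral_norm_bound[of lborel "\<lambda>\<theta>. indicator {0..1} \<theta> *\<^sub>R f' \<theta>"] by simp
  also have "\<dots> \<le> (LINT \<theta>|lborel. indicator {0..1} \<theta> * (norm h * (norm (x + \<theta> *\<^sub>R h) * gauss s (x + \<theta> *\<^sub>R h) / (2 * s))))"
  proof (rule integral_mono[OF integrable_norm[OF i] ig])
    fix \<theta> :: real
    have "\<bar>f' \<theta>\<bar> = \<bar>(x + \<theta> *\<^sub>R h) \<bullet> h\<bar> * (gauss s (x + \<theta> *\<^sub>R h) / (2 * s))"
      unfolding f'_def using s gauss_nonneg[where 'a='n, OF s] by (simp add: abs_mult)
    also have "\<dots> \<le> (norm (x + \<theta> *\<^sub>R h) * norm h) * (gauss s (x + \<theta> *\<^sub>R h) / (2 * s))"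
      using s gauss_nonneg[where 'a='n, OF s] by (intro mult_right_mono Cauchy_Schwarz_ineq2) auto
    finally have "\<bar>f' \<theta>\<bar> \<le> norm h * (norm (x + \<theta> *\<^sub>R h) * gauss s (x + \<theta> *\<^sub>R h) / (2 * s))"
      by (simp add: mult_ac)
    then show "norm (indicator {0..1} \<theta> *\<^sub>R f' \<theta>) \<le> indicator {0..1} \<theta> * (norm h * (norm (x + \<theta> *\<^sub>R h) * gauss s (x + \<theta> *\<^sub>R h) / (2 * s)))"
      by (auto simp: indicator_def)
  qed
  finally show ?thesis .
qed

lemma gauss_translate_int:
  fixes h :: "real^'n"
  assumes s: "s > 0"
  shows "integrable lborel (\<lambda>x. gauss s (x + h) - gauss s x)"
    "(LINT x|lborel. \<bar>gauss s (x + h) - gauss s x\<bar>) \<le> 2"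
    "(LINT x|lborel. \<bar>gauss s (x + h) - gauss s x\<bar>) \<le> norm h * (gauss_moment TYPE('n) / 2) * s powr (-1/2)"
proof -
  have gh: "integrable lborel (\<lambda>x. gauss s (x + h))" "(LINT x|lborel. gauss s (x + h)) = 1"
    using lborel_integrable_affine[OF gauss_integral(1)[OF s], of 1 h] lborel_integral_affine[of 1 "gauss s" h] gauss_integral(2)[OF s]
    by (simp_all add: add.commute)
  show i: "integrable lborel (\<lambda>x. gauss s (x + h) - gauss s x)"
    by (rule Bochner_Integration.integrable_diff[OF gh(1) gauss_integral(1)[OF s]])
  have "(LINT x|lborel. \<bar>gauss s (x + h) - gauss s x\<bar>) \<le> (LINT x|lborel. gauss s (x + h) + gauss s x)"
  proof (rule integral_mono[OF integrable_abs[OF i] Bochner_Integration.integrable_add[OF gh(1) gauss_integral(1)[OF s]]])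
    show "\<bar>gauss s (x + h) - gauss s x\<bar> \<le> gauss s (x + h) + gauss s x" for x
      using gauss_nonneg[where 'a='n, OF s, of x] gauss_nonneg[where 'a='n, OF s, of "x + h"] by linarith
  qed
  then show "(LINT x|lborel. \<bar>gauss s (x + h) - gauss s x\<bar>) \<le> 2" using gh gauss_integral[where 'n='n, OF s] by simp
  define g where "g = (\<lambda>x::real^'n. norm h * (norm x * gauss s x / (2 * s)))"
  have gm [measurable]: "g \<in> borel_measurable borel" unfolding g_def by measurable
  have gnn: "g x \<ge> 0" for x using s gauss_nonneg[where 'a='n, OF s] by (simp add: g_def)
  have gi: "has_bochner_integral lborel g (norm h * (sqrt s * gauss_moment TYPE('n) / (2 * s)))"
    unfolding g_def by (intro has_bochner_integral_mult_right has_bochner_integral_divide gauss_moment s)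
  have sq: "sqrt s * gauss_moment TYPE('n) / (2 * s) = gauss_moment TYPE('n) / 2 * s powr (-1/2)"
    using s by (simp add: powr_minus powr_half_sqrt real_div_sqrt field_simps)
  have ip: "integrable (lborel \<Otimes>\<^sub>M lborel) (\<lambda>(\<theta>, x). indicator {0..1} \<theta> * g (x + \<theta> *\<^sub>R h))"
  proof (rule lborel_pair.Fubini_integrable)
    have sh: "integrable lborel (\<lambda>x. g (x + \<theta> *\<^sub>R h))" "(LINT x|lborel. g (x + \<theta> *\<^sub>R h)) = integral\<^sup>L lborel g" for \<theta> :: real
      using lborel_integrable_affine[of g 1 "\<theta> *\<^sub>R h"] lborel_integral_affine[of 1 g "\<theta> *\<^sub>R h"] gi
      by (auto simp add: add.commute has_bochner_integral_iff)
    show "AE \<theta> in lborel. integrable lborel (\<lambda>x. case (\<theta>, x) of (\<theta>, x) \<Rightarrow> indicator {0..1} \<theta> * g (x + \<theta> *\<^sub>R h))"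
      using sh by simp
    have "(LINT x|lborel. norm (indicator {0..1} \<theta> * g (x + \<theta> *\<^sub>R h))) = indicator {0..1} \<theta> * integral\<^sup>L lborel g" for \<theta> :: real
      using gnn sh(2) by (simp add: abs_mult)
    then show "integrable lborel (\<lambda>\<theta>::real. LINT x|lborel. norm (case (\<theta>, x) of (\<theta>, x) \<Rightarrow> indicator {0..1} \<theta> * g (x + \<theta> *\<^sub>R h)))"
      by simp
  qed measurable
  have ip2: "integrable lborel (\<lambda>x. LINT \<theta>|lborel. indicator {0..1} \<theta> * g (x + \<theta> *\<^sub>R h))"
    using lborel_pair.integrable_snd[OF ip] by simp
  have "(LINT x|lborel. \<bar>gauss s (x + h) - gauss s x\<bar>) \<le> (LINT x|lborel. LINT \<theta>|lborel. indicator {0..1} \<theta> * g (x + \<theta> *\<^sub>R h))"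
    using gauss_translate_le_int[OF s, of _ h] i ip2 unfolding g_def by (intro integral_mono) auto
  also have "\<dots> = (LINT \<theta>|lborel. LINT x|lborel. indicator {0..1} \<theta> * g (x + \<theta> *\<^sub>R h))"
    using lborel_pair.Fubini_integral[OF ip] by simp
  also have "\<dots> = (LINT \<theta>|lborel. indicator {0..1::real} \<theta> * integral\<^sup>L lborel g)"
  proof -
    have "(LINT x|lborel. g (x + \<theta> *\<^sub>R h)) = integral\<^sup>L lborel g" for \<theta> :: real
      using lborel_integral_affine[of 1 g "\<theta> *\<^sub>R h"] by (simp add: add.commute)
    then show ?thesis by (simp only: integral_mult_right_zero)
  qed
  also have "\<dots> = integral\<^sup>L lborel g" using content_real[of 0 1] by simp
  also have "\<dots> = norm h * (gauss_moment TYPE('n) / 2) * s powr (-1/2)"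
    using has_bochner_integral_integral_eq[OF gi] unfolding sq by simp
  finally show "(LINT x|lborel. \<bar>gauss s (x + h) - gauss s x\<bar>) \<le> norm h * (gauss_moment TYPE('n) / 2) * s powr (-1/2)" .
qed

text \<open>Interpolation between the bound \<open>2\<close> and the Lipschitz bound \<open>X\<close>, since \<open>min 2 X \<le> 2 * X powr \<sigma>\<close>.\<close>

lemma gauss_modulus:
  fixes h :: "real^'n"
  assumes s: "s > 0" and sg: "0 < \<sigma>" "\<sigma> \<le> 1"
  shows "(LINT x|lborel. \<bar>gauss s (x + h) - gauss s x\<bar>) \<le> 2 * (gauss_moment TYPE('n) / 2) powr \<sigma> * norm h powr \<sigma> * s powr (- \<sigma> / 2)"
proof -
  define X where "X = norm h * (gauss_moment TYPE('n) / 2) * s powr (-1/2)"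
  define I where "I = (LINT x|lborel. \<bar>gauss s (x + h) - gauss s x\<bar>)"
  have X: "X \<ge> 0" unfolding X_def using gauss_moment_nonneg[where 'n='n] by auto
  have I: "I \<le> 2" "I \<le> X" unfolding I_def X_def using gauss_translate_int[OF s, of h] by auto
  have "I \<le> 2 * X powr \<sigma>"
  proof (cases "X \<ge> 1")
    case True
    then have "1 \<le> X powr \<sigma>" using sg by (simp add: ge_one_powr_ge_zero)
    then show ?thesis using I by linarith
  next
    case False
    have "X powr 1 \<le> X powr \<sigma>" using False X sg by (intro powr_mono') auto
    then show ?thesis using I X by simp
  qed
  also have "X powr \<sigma> = norm h powr \<sigma> * (gauss_moment TYPE('n) / 2) powr \<sigma> * s powr (- \<sigma> / 2)"
  proof -
    have "X powr \<sigma> = (norm h * (gauss_moment TYPE('n) / 2)) powr \<sigma> * (s powr (-1/2)) powr \<sigma>"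
      unfolding X_def by (rule powr_mult)
    also have "(norm h * (gauss_moment TYPE('n) / 2)) powr \<sigma> = norm h powr \<sigma> * (gauss_moment TYPE('n) / 2) powr \<sigma>"
      by (rule powr_mult)
    finally show ?thesis by (simp add: powr_powr)
  qed
  finally show ?thesis unfolding I_def by (simp add: mult_ac)
qed

lemma exp_tail_integral:
  fixes c d :: real
  assumes "c > 0"
  shows "has_bochner_integral lborel (\<lambda>r. indicator {d<..} r * exp (- c * r)) (exp (- c * d) / c)"
proof -
  have H: "((\<lambda>r. exp (- c * r)) has_integral exp (- c * d) / c) {d..}"
    by (rule has_integral_exp_minus_to_infinity[OF assms])
  then have "((\<lambda>r. exp (- c * r)) has_integral exp (- c * d) / c) {d<..}"
    by (subst (asm) has_integral_spike_set_eq[of _ "{d<..}"]) (auto intro: negligible_subset[OF negligible_sing[of d]] simp: not_less)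
  then have H2: "((\<lambda>r. exp (- c * r)) has_integral exp (- c * d) / c) {d<..}" .
  then have "(\<lambda>r. exp (- c * r)) absolutely_integrable_on {d<..}"
    by (intro nonnegative_absolutely_integrable_1) (auto simp: integrable_on_def)
  then have si: "set_integrable lborel {d<..} (\<lambda>r. exp (- c * r))"
    unfolding set_integrable_def by (subst (asm) integrable_completion) auto
  have "(LINT r:{d<..}|lborel. exp (- c * r)) = exp (- c * d) / c"
    using set_borel_integral_eq_integral(2)[OF si] integral_unique[OF H2] by simp
  then show ?thesis using si unfolding set_integrable_def set_lebesgue_integral_def has_bochner_integral_iff by simp
qed

lemma powr_tail_integral:
  fixes d :: real
  assumes "d > 0"
  shows "has_bochner_integral lborel (\<lambda>r. indicator {d<..} r * r powr (-3/2)) (2 * d powr (-1/2))"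
proof -
  have H: "((\<lambda>r. r powr (-3/2)) has_integral 2 * d powr (-1/2)) {d..}"
    using has_integral_powr_to_inf[of "-3/2" d] assms by (simp add: field_simps)
  then have H2: "((\<lambda>r. r powr (-3/2)) has_integral 2 * d powr (-1/2)) {d<..}"
    by (subst (asm) has_integral_spike_set_eq[of _ "{d<..}"]) (auto intro: negligible_subset[OF negligible_sing[of d]] simp: not_less)
  then have "(\<lambda>r. r powr (-3/2)) absolutely_integrable_on {d<..}"
    by (intro nonnegative_absolutely_integrable_1) (auto simp: integrable_on_def)
  then have si: "set_integrable lborel {d<..} (\<lambda>r. r powr (-3/2) :: real)"
    unfolding set_integrable_def by (subst (asm) integrable_completion) auto
  have "(LINT r:{d<..}|lborel. r powr (-3/2)) = 2 * d powr (-1/2)"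
    using set_borel_integral_eq_integral(2)[OF si] integral_unique[OF H2] by simp
  then show ?thesis using si unfolding set_integrable_def set_lebesgue_integral_def has_bochner_integral_iff by simp
qed

lemma deriv_symbol_measurable [measurable]: "deriv_symbol l \<in> borel_measurable borel"
  unfolding deriv_symbol_def by measurable

lemma riesz_symbol_measurable [measurable]: "riesz_symbol l \<in> borel_measurable borel"
  unfolding riesz_symbol_def by measurable

lemma leray_symbol_measurable [measurable]: "leray_symbol j k \<in> borel_measurable borel"
  unfolding leray_symbol_def by measurable

lemma norm_deriv_symbol: "norm (deriv_symbol l \<xi>) \<le> norm \<xi>"
  unfolding deriv_symbol_def norm_mult by (simp add: component_le_norm_cart)

lemma norm_riesz_symbol: "norm (riesz_symbol l \<xi>) \<le> 1"
  using norm_deriv_symbol[of l \<xi>] unfolding riesz_symbol_def norm_divide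
  by (cases "\<xi> = 0") (auto simp: divide_le_eq_1)

lemma norm_leray_symbol: "norm (leray_symbol j k \<xi>) \<le> 2"
proof -
  have "norm (riesz_symbol j \<xi> * riesz_symbol k \<xi>) \<le> 1 * 1"
    unfolding norm_mult by (intro mult_mono norm_riesz_symbol) auto
  then show ?thesis unfolding leray_symbol_def by (intro norm_triangle_le) (auto simp: norm_mult)
qed

text \<open>From \<open>exp(-d \<bar>\<xi>\<bar>\<^sup>2) / \<bar>\<xi>\<bar>\<^sup>2 = \<integral> exp(-r \<bar>\<xi>\<bar>\<^sup>2) dr\<close> over \<open>r > d\<close>: the singular symbol of two Riesz
transforms becomes a superposition of derivatives of Gaussians.\<close>

lemma riesz_riesz_deriv_superposition:
  fixes \<xi> :: "real^'n"
  assumes d: "d > 0"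
  shows "has_bochner_integral lborel (\<lambda>r. indicator {d<..} r *\<^sub>R (deriv_symbol j \<xi> * deriv_symbol k \<xi> * deriv_symbol l \<xi> * gauss_symbol r \<xi>))
     (riesz_symbol j \<xi> * riesz_symbol k \<xi> * deriv_symbol l \<xi> * gauss_symbol d \<xi>)"
proof (cases "\<xi> = 0")
  case True
  then show ?thesis by (simp add: deriv_symbol_def has_bochner_integral_zero)
next
  case False
  then have p: "(norm \<xi>)\<^sup>2 > 0" by simp
  have "has_bochner_integral lborel (\<lambda>r. (deriv_symbol j \<xi> * deriv_symbol k \<xi> * deriv_symbol l \<xi>) * complex_of_real (indicator {d<..} r * exp (- (norm \<xi>)\<^sup>2 * r)))
     ((deriv_symbol j \<xi> * deriv_symbol k \<xi> * deriv_symbol l \<xi>) * complex_of_real (exp (- (norm \<xi>)\<^sup>2 * d) / (norm \<xi>)\<^sup>2))"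
    by (intro has_bochner_integral_mult_right has_bochner_integral_of_real exp_tail_integral p)
  moreover have "(deriv_symbol j \<xi> * deriv_symbol k \<xi> * deriv_symbol l \<xi>) * complex_of_real (exp (- (norm \<xi>)\<^sup>2 * d) / (norm \<xi>)\<^sup>2)
     = riesz_symbol j \<xi> * riesz_symbol k \<xi> * deriv_symbol l \<xi> * gauss_symbol d \<xi>"
    using p by (simp add: riesz_symbol_def power2_eq_square mult_ac)
  moreover have "(deriv_symbol j \<xi> * deriv_symbol k \<xi> * deriv_symbol l \<xi>) * complex_of_real (indicator {d<..} r * exp (- (norm \<xi>)\<^sup>2 * r))
     = indicator {d<..} r *\<^sub>R (deriv_symbol j \<xi> * deriv_symbol k \<xi> * deriv_symbol l \<xi> * gauss_symbol r \<xi>)" for r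
    by (simp add: scaleR_conv_of_real mult_ac)
  ultimately show ?thesis by simp
qed

text \<open>The Gaussian is split into four equal parts: three absorb one derivative each, the fourth makes the
symbol integrable.\<close>

lemma triple_deriv_gauss_L1:
  fixes j k l :: "'n::finite"
  assumes r: "r > 0"
  defines "m \<equiv> \<lambda>\<xi>::real^'n. deriv_symbol j \<xi> * deriv_symbol k \<xi> * deriv_symbol l \<xi> * gauss_symbol r \<xi>"
  shows "integrable lborel (inverse_fourier m)" "(LINT x|lborel. norm (inverse_fourier m x)) \<le> 8 * (gauss_moment TYPE('n) / 2) ^ 3 * r powr (-3/2)"
proof -
  let ?g = "\<lambda>l \<xi>::real^'n. deriv_symbol l \<xi> * gauss_symbol (r/4) \<xi>"
  have r4: "r / 4 > 0" using r by simp
  note M = l1_multiplier_mult[OF l1_multiplier_mult[OF l1_multiplier_deriv_gauss[OF r4, of j] l1_multiplier_deriv_gauss[OF r4, of k]] l1_multiplier_deriv_gauss[OF r4, of l]]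
  have e: "?g j \<xi> * ?g k \<xi> * ?g l \<xi> * gauss_symbol (r/4) \<xi> = m \<xi>" for \<xi>
  proof -
    have "exp (- r * (norm \<xi>)\<^sup>2) = exp (- (r/4) * (norm \<xi>)\<^sup>2) * exp (- (r/4) * (norm \<xi>)\<^sup>2) * exp (- (r/4) * (norm \<xi>)\<^sup>2) * exp (- (r/4) * (norm \<xi>)\<^sup>2)"
      by (simp add: exp_add[symmetric])
    then show ?thesis unfolding m_def by (simp only: of_real_mult mult_ac)
  qed
  show "integrable lborel (inverse_fourier m)"
    using l1_multiplier_inverse_fourier(1)[OF M r4] unfolding e by simp
  have "(LINT x|lborel. norm (inverse_fourier m x)) \<le> gauss_moment TYPE('n) / 2 * (r/4) powr (-1/2) * (gauss_moment TYPE('n) / 2 * (r/4) powr (-1/2)) * (gauss_moment TYPE('n) / 2 * (r/4) powr (-1/2))"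
    using l1_multiplier_inverse_fourier(2)[OF M r4] unfolding e by simp
  also have "(r/4) powr (-1/2) = 2 * r powr (-1/2)"
    using r by (simp add: powr_divide powr_minus powr_half_sqrt field_simps)
  also have "gauss_moment TYPE('n) / 2 * (2 * r powr (-1/2)) * (gauss_moment TYPE('n) / 2 * (2 * r powr (-1/2))) * (gauss_moment TYPE('n) / 2 * (2 * r powr (-1/2)))
     = 8 * (gauss_moment TYPE('n) / 2) ^ 3 * (r powr (-1/2) * r powr (-1/2) * r powr (-1/2))"
    by (simp add: power3_eq_cube)
  also have "r powr (-1/2) * r powr (-1/2) * r powr (-1/2) = r powr (-3/2)"
  proof -
    have "-1/2 + -1/2 + -1/2 = (-3/2 :: real)" by simp
    then show ?thesis by (simp only: powr_add[symmetric])
  qed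
  finally show "(LINT x|lborel. norm (inverse_fourier m x)) \<le> 8 * (gauss_moment TYPE('n) / 2) ^ 3 * r powr (-3/2)" .
qed

text \<open>The superposition is integrated in \<open>L\<^sup>1\<close>, where third derivatives cost \<open>r powr (-3/2)\<close>; this is
integrable at infinity, so no singular integral enters.\<close>

lemma riesz_riesz_deriv_gauss_L1:
  fixes j k l :: "'n::finite"
  assumes d: "d > 0"
  defines "m \<equiv> \<lambda>\<xi>::real^'n. riesz_symbol j \<xi> * riesz_symbol k \<xi> * deriv_symbol l \<xi> * gauss_symbol d \<xi>"
  shows "integrable lborel (inverse_fourier m)" "(LINT x|lborel. norm (inverse_fourier m x)) \<le> 16 * (gauss_moment TYPE('n) / 2) ^ 3 * d powr (-1/2)"
proof -
  define m3 where "m3 = (\<lambda>r (\<xi>::real^'n). deriv_symbol j \<xi> * deriv_symbol k \<xi> * deriv_symbol l \<xi> * gauss_symbol r \<xi> :: complex)"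
  define C where "C = 8 * (gauss_moment TYPE('n) / 2) ^ 3"
  have m3m [measurable]: "(\<lambda>(r, \<xi>). m3 r \<xi>) \<in> borel_measurable (borel \<Otimes>\<^sub>M borel)" unfolding m3_def by measurable
  define P where "P = (\<lambda>r x. indicator {d<..} r *\<^sub>R inverse_fourier (m3 r) x)"
  have [measurable]: "(\<lambda>(r, x). inverse_fourier (m3 r) x) \<in> borel_measurable (lborel \<Otimes>\<^sub>M lborel)"
    unfolding case_prod_unfold by (rule inverse_fourier_measurable) measurable
  have Pm [measurable]: "(\<lambda>(r, x). P r x) \<in> borel_measurable (lborel \<Otimes>\<^sub>M lborel)"
    unfolding P_def by measurable
  have S: "has_bochner_integral lborel (\<lambda>r. indicator {d<..} r *\<^sub>R m3 r \<xi>) (m \<xi>)" for \<xi>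
    unfolding m3_def m_def by (rule riesz_riesz_deriv_superposition[OF d])
  have rep: "inverse_fourier m x = (LINT r|lborel. P r x)" for x
  proof -
    have i: "integrable (lborel \<Otimes>\<^sub>M lborel) (\<lambda>(\<xi>, r). indicator {d<..} r *\<^sub>R (iexp (x \<bullet> \<xi>) * m3 r \<xi>))"
    proof (rule lborel_pair.Fubini_integrable)
      have "(LINT r|lborel. norm (indicator {d<..} r *\<^sub>R (iexp (x \<bullet> \<xi>) * m3 r \<xi>))) = norm (m \<xi>)" for \<xi>
      proof (cases "\<xi> = 0")
        case True
        then show ?thesis by (simp add: m3_def m_def deriv_symbol_def)
      next
        case False
        then have p: "(norm \<xi>)\<^sup>2 > 0" by simp
        have "(LINT r|lborel. norm (indicator {d<..} r *\<^sub>R (iexp (x \<bullet> \<xi>) * m3 r \<xi>)))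
          = (LINT r|lborel. norm (deriv_symbol j \<xi> * deriv_symbol k \<xi> * deriv_symbol l \<xi>) * (indicator {d<..} r * exp (- (norm \<xi>)\<^sup>2 * r)))"
          by (rule Bochner_Integration.integral_cong) (auto simp: m3_def norm_mult indicator_def mult_ac)
        also have "\<dots> = norm (deriv_symbol j \<xi> * deriv_symbol k \<xi> * deriv_symbol l \<xi>) * (exp (- (norm \<xi>)\<^sup>2 * d) / (norm \<xi>)\<^sup>2)"
          using has_bochner_integral_integral_eq[OF exp_tail_integral[OF p, of d]] by simp
        also have "\<dots> = norm (m \<xi>)"
          using p by (simp add: m_def riesz_symbol_def norm_mult norm_divide power2_eq_square mult_ac)
        finally show ?thesis .
      qed
      moreover have "integrable lborel m"
        unfolding m_def
      proof (rule integrable_poly_gauss[where A = 1 and N = 1])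
        fix \<xi> :: "real^'n"
        have "norm (riesz_symbol j \<xi> * riesz_symbol k \<xi> * deriv_symbol l \<xi>) \<le> 1 * 1 * norm \<xi>"
          unfolding norm_mult by (intro mult_mono norm_riesz_symbol norm_deriv_symbol) auto
        then show "norm (riesz_symbol j \<xi> * riesz_symbol k \<xi> * deriv_symbol l \<xi>) \<le> 1 * (1 + (norm \<xi>)\<^sup>2) ^ 1"
          using le_one_plus_sq[of "norm \<xi>"] by simp
      qed (use d in auto)
      ultimately show "integrable lborel (\<lambda>\<xi>. LINT r|lborel. norm (case (\<xi>, r) of (\<xi>, r) \<Rightarrow> indicator {d<..} r *\<^sub>R (iexp (x \<bullet> \<xi>) * m3 r \<xi>)))"
        by simp
      have "integrable lborel (\<lambda>r. indicator {d<..} r *\<^sub>R (iexp (x \<bullet> \<xi>) * m3 r \<xi>))" for \<xi>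
        using integrable_mult_right[OF integrable.intros[OF S[of \<xi>]], of "iexp (x \<bullet> \<xi>)"] by simp
      then show "AE \<xi> in lborel. integrable lborel (\<lambda>r. case (\<xi>, r) of (\<xi>, r) \<Rightarrow> indicator {d<..} r *\<^sub>R (iexp (x \<bullet> \<xi>) * m3 r \<xi>))"
        by simp
    qed measurable
    have "inverse_fourier m x = of_real (1 / (2 * pi) ^ CARD('n)) * (LINT \<xi>|lborel. LINT r|lborel. indicator {d<..} r *\<^sub>R (iexp (x \<bullet> \<xi>) * m3 r \<xi>))"
    proof -
      have "iexp (x \<bullet> \<xi>) * m \<xi> = (LINT r|lborel. indicator {d<..} r *\<^sub>R (iexp (x \<bullet> \<xi>) * m3 r \<xi>))" for \<xi>
        unfolding has_bochner_integral_integral_eq[OF S[of \<xi>], symmetric] integral_mult_right_zero[symmetric] by simp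
      then show ?thesis unfolding inverse_fourier_def by simp
    qed
    also have "\<dots> = of_real (1 / (2 * pi) ^ CARD('n)) * (LINT r|lborel. LINT \<xi>|lborel. indicator {d<..} r *\<^sub>R (iexp (x \<bullet> \<xi>) * m3 r \<xi>))"
      using lborel_pair.Fubini_integral[OF i] by simp
    also have "\<dots> = (LINT r|lborel. P r x)"
      unfolding P_def inverse_fourier_def by (simp add: scaleR_conv_of_real mult_ac flip: integral_mult_right_zero)
    finally show ?thesis .
  qed
  have Pn: "integrable lborel (P r)" "(LINT x|lborel. norm (P r x)) \<le> C * (indicator {d<..} r * r powr (-3/2))" for r
  proof -
    have "integrable lborel (P r) \<and> (LINT x|lborel. norm (P r x)) \<le> C * (indicator {d<..} r * r powr (-3/2))"
    proof (cases "r > d")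
      case True
      then show ?thesis using triple_deriv_gauss_L1[of r j k l] d unfolding P_def m3_def C_def by simp
    qed (simp add: P_def)
    then show "integrable lborel (P r)" "(LINT x|lborel. norm (P r x)) \<le> C * (indicator {d<..} r * r powr (-3/2))" by auto
  qed
  have tail: "has_bochner_integral lborel (\<lambda>r. C * (indicator {d<..} r * r powr (-3/2))) (C * (2 * d powr (-1/2)))"
    by (intro has_bochner_integral_mult_right powr_tail_integral d)
  have nPi: "integrable lborel (\<lambda>r. LINT x|lborel. norm (P r x))"
  proof (rule Bochner_Integration.integrable_bound[OF integrable.intros[OF tail]])
    show "AE r in lborel. norm (LINT x|lborel. norm (P r x)) \<le> norm (C * (indicator {d<..} r * r powr (-3/2)))"
    proof (rule AE_I2)
      fix r
      have "0 \<le> (LINT x|lborel. norm (P r x))" by simp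
      then show "norm (LINT x|lborel. norm (P r x)) \<le> norm (C * (indicator {d<..} r * r powr (-3/2)))"
        using Pn(2)[of r] unfolding real_norm_def by linarith
    qed
  qed measurable
  have Pi: "integrable (lborel \<Otimes>\<^sub>M lborel) (\<lambda>(r, x). P r x)"
    by (rule lborel_pair.Fubini_integrable) (use Pn(1) nPi in auto)
  have Pi2: "integrable (lborel \<Otimes>\<^sub>M lborel) (\<lambda>(r, x). norm (P r x))"
    using integrable_norm[OF Pi] by (simp add: case_prod_unfold)
  show "integrable lborel (inverse_fourier m)"
    using lborel_pair.integrable_snd[OF Pi] unfolding rep[abs_def] by simp
  then have "(LINT x|lborel. norm (inverse_fourier m x)) \<le> (LINT x|lborel. LINT r|lborel. norm (P r x))"
    unfolding rep by (intro integral_mono integrable_norm integral_norm_bound)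
      (use lborel_pair.integrable_snd[OF Pi2] in auto)
  also have "\<dots> = (LINT r|lborel. LINT x|lborel. norm (P r x))"
    using lborel_pair.Fubini_integral[OF Pi2] by simp
  also have "\<dots> \<le> (LINT r|lborel. C * (indicator {d<..} r * r powr (-3/2)))"
    by (intro integral_mono nPi integrable.intros[OF tail] Pn(2))
  also have "\<dots> = C * (2 * d powr (-1/2))" by (rule has_bochner_integral_integral_eq[OF tail])
  finally show "(LINT x|lborel. norm (inverse_fourier m x)) \<le> 16 * (gauss_moment TYPE('n) / 2) ^ 3 * d powr (-1/2)"
    by (simp add: C_def)
qed

lemma inverse_fourier_add:
  assumes "integrable lborel m1" "integrable lborel m2"
  shows "inverse_fourier (\<lambda>\<xi>. m1 \<xi> + m2 \<xi>) x = inverse_fourier m1 x + inverse_fourier m2 x"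
  unfolding inverse_fourier_def using integrable_exp_i_mult(1)[OF assms(1), of x] integrable_exp_i_mult(1)[OF assms(2), of x]
  by (simp add: distrib_left)

definition oseen_const :: "'n::finite itself \<Rightarrow> real" where
  "oseen_const _ = gauss_moment TYPE('n) + 16 * (gauss_moment TYPE('n) / 2) ^ 3"

lemma oseen_gauss_L1:
  fixes j k l :: "'n::finite"
  assumes d: "d > 0"
  defines "m \<equiv> \<lambda>\<xi>::real^'n. leray_symbol j k \<xi> * deriv_symbol l \<xi> * gauss_symbol d \<xi>"
  shows "integrable lborel (inverse_fourier m)" "(LINT x|lborel. norm (inverse_fourier m x)) \<le> oseen_const TYPE('n) * d powr (-1/2)"
proof -
  let ?c = "(if j = k then 1 else 0) :: complex"
  define m1 where "m1 = (\<lambda>\<xi>::real^'n. ?c * (deriv_symbol l \<xi> * gauss_symbol d \<xi>))"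
  define m2 where "m2 = (\<lambda>\<xi>::real^'n. riesz_symbol j \<xi> * riesz_symbol k \<xi> * deriv_symbol l \<xi> * gauss_symbol d \<xi>)"
  have i0: "integrable lborel (\<lambda>\<xi>::real^'n. deriv_symbol l \<xi> * gauss_symbol d \<xi>)"
    by (rule integrable_poly_gauss[where A = 1 and N = 1])
       (use d in \<open>auto intro: order_trans[OF norm_deriv_symbol] le_one_plus_sq\<close>)
  have i1: "integrable lborel m1" unfolding m1_def by (intro integrable_mult_right i0)
  have i2: "integrable lborel m2"
    unfolding m2_def
  proof (rule integrable_poly_gauss[where A = 1 and N = 1])
    fix \<xi> :: "real^'n"
    have "norm (riesz_symbol j \<xi> * riesz_symbol k \<xi> * deriv_symbol l \<xi>) \<le> 1 * 1 * norm \<xi>"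
      unfolding norm_mult by (intro mult_mono norm_riesz_symbol norm_deriv_symbol) auto
    then show "norm (riesz_symbol j \<xi> * riesz_symbol k \<xi> * deriv_symbol l \<xi>) \<le> 1 * (1 + (norm \<xi>)\<^sup>2) ^ 1"
      using le_one_plus_sq[of "norm \<xi>"] by simp
  qed (use d in auto)
  have "m = (\<lambda>\<xi>. m1 \<xi> + m2 \<xi>)" unfolding m_def m1_def m2_def leray_symbol_def by (auto simp: algebra_simps)
  then have e: "inverse_fourier m x = inverse_fourier m1 x + inverse_fourier m2 x" for x
    using inverse_fourier_add[OF i1 i2] by simp
  have d2: "d / 2 > 0" using d by simp
  have "deriv_symbol l \<xi> * gauss_symbol (d/2) \<xi> * gauss_symbol (d/2) \<xi> = deriv_symbol l \<xi> * gauss_symbol d \<xi>" for \<xi> :: "real^'n"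
    by (simp add: mult.assoc flip: of_real_mult exp_add)
  note D = l1_multiplier_inverse_fourier[OF l1_multiplier_deriv_gauss[OF d2, of l] d2, unfolded this]
  have e1: "inverse_fourier m1 x = ?c * inverse_fourier (\<lambda>\<xi>. deriv_symbol l \<xi> * gauss_symbol d \<xi>) x" for x
    unfolding m1_def inverse_fourier_def by simp
  have j1: "integrable lborel (inverse_fourier m1)" unfolding e1[abs_def] by (intro integrable_mult_right D)
  have "(LINT x|lborel. norm (inverse_fourier m1 x)) \<le> gauss_moment TYPE('n) / 2 * (d/2) powr (-1/2)"
    unfolding e1 using D(2) gauss_moment_nonneg[where 'n='n] by (auto simp: norm_mult)
  also have "\<dots> \<le> gauss_moment TYPE('n) * d powr (-1/2)"
  proof -
    have "(d/2) powr (-1/2) = sqrt 2 * d powr (-1/2)"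
      using d by (simp add: powr_divide powr_minus powr_half_sqrt field_simps)
    also have "\<dots> \<le> 2 * d powr (-1/2)" using sqrt2_less_2 by (intro mult_right_mono) auto
    finally have "gauss_moment TYPE('n) / 2 * (d/2) powr (-1/2) \<le> gauss_moment TYPE('n) / 2 * (2 * d powr (-1/2))"
      using gauss_moment_nonneg[where 'n='n] by (intro mult_left_mono) auto
    then show ?thesis by simp
  qed
  finally have n1: "(LINT x|lborel. norm (inverse_fourier m1 x)) \<le> gauss_moment TYPE('n) * d powr (-1/2)" .
  note R = riesz_riesz_deriv_gauss_L1[OF d, of j k l, folded m2_def]
  show im: "integrable lborel (inverse_fourier m)" unfolding e[abs_def] using j1 R(1) by simp
  have "(LINT x|lborel. norm (inverse_fourier m x)) \<le> (LINT x|lborel. norm (inverse_fourier m1 x) + norm (inverse_fourier m2 x))"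
    unfolding e using j1 R(1) by (intro integral_mono norm_triangle_ineq) auto
  also have "\<dots> = (LINT x|lborel. norm (inverse_fourier m1 x)) + (LINT x|lborel. norm (inverse_fourier m2 x))"
    using j1 R(1) by simp
  also have "\<dots> \<le> oseen_const TYPE('n) * d powr (-1/2)"
    using n1 R(2) by (simp add: oseen_const_def distrib_right)
  finally show "(LINT x|lborel. norm (inverse_fourier m x)) \<le> oseen_const TYPE('n) * d powr (-1/2)" .
qed

section \<open>Scaling of stable integrals\<close>

text \<open>This is \<open>Gamma (p/g) / g\<close>.\<close>

definition stable_gamma :: "real \<Rightarrow> real \<Rightarrow> real" where
  "stable_gamma p g = (LINT r|lborel. indicator {0<..} r * r powr (p - 1) * exp (- (r powr g)))"

lemma stable_gamma_integrable:
  fixes p g :: real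
  assumes p: "p > 0" and g: "g > 0"
  shows "integrable lborel (\<lambda>r. indicator {0<..} r * r powr (p - 1) * exp (- (r powr g)))"
proof -
  obtain N :: nat where N: "p + 1 \<le> real N" using real_arch_simple by blast
  obtain C where C: "\<And>r. r \<ge> 0 \<Longrightarrow> (1 + r\<^sup>2) ^ N * exp (- 1 * r powr g) \<le> C"
    using poly_exp_bounded[of 1 g] g by auto
  have C0: "C \<ge> 0" using C[of 0] by simp
  have 1: "integrable lborel (\<lambda>r. indicator {0<..1} r *\<^sub>R r powr (p - 1) + C * (indicator {1<..} r *\<^sub>R r powr -2))"
    using set_integrable_powr_0_1[of "p - 1"] set_integrable_powr_1_inf[of "-2"] p by (simp add: set_integrable_def)
  show ?thesis
  proof (rule Bochner_Integration.integrable_bound[OF 1])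
    have "norm (indicator {0<..} r * r powr (p - 1) * exp (- (r powr g))) \<le> norm (indicator {0<..1} r *\<^sub>R r powr (p - 1) + C * (indicator {1<..} r *\<^sub>R r powr -2))" for r :: real
    proof -
      consider "r \<le> 0" | "0 < r" "r \<le> 1" | "r > 1" by linarith
      then show ?thesis
      proof cases
        case 2
        then show ?thesis using mult_left_mono[of "exp (- (r powr g))" 1 "r powr (p - 1)"] by (simp add: abs_mult)
      next
        case 3
        have "r powr (p + 1) \<le> r powr (real (2 * N))" using 3 N by (intro powr_mono) auto
        also have "\<dots> = (r\<^sup>2) ^ N" using 3 by (subst powr_realpow) (auto simp: power_mult)
        also have "\<dots> \<le> (1 + r\<^sup>2) ^ N" by (intro power_mono) auto
        finally have "r powr (p + 1) * exp (- (r powr g)) \<le> (1 + r\<^sup>2) ^ N * exp (- 1 * r powr g)"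
          by (simp add: mult_right_mono)
        also have "\<dots> \<le> C" using C 3 by simp
        finally have "(r powr (p + 1) * exp (- (r powr g))) * r powr -2 \<le> C * r powr -2" by (intro mult_right_mono) auto
        moreover have "r powr (p + 1) * r powr -2 = r powr (p - 1)" by (simp add: powr_add[symmetric])
        ultimately have "r powr (p - 1) * exp (- (r powr g)) \<le> C * r powr -2" by (simp add: mult_ac)
        then show ?thesis using 3 C0 by (simp add: abs_mult)
      qed auto
    qed
    then show "AE r in lborel. norm (indicator {0<..} r * r powr (p - 1) * exp (- (r powr g))) \<le> norm (indicator {0<..1} r *\<^sub>R r powr (p - 1) + C * (indicator {1<..} r *\<^sub>R r powr -2))" by simp
  qed simp
qed

lemma stable_gamma_pos:
  assumes p: "p > 0" and g: "g > 0" shows "stable_gamma p g > 0"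
proof -
  let ?f = "\<lambda>r::real. indicator {0<..} r * r powr (p - 1) * exp (- (r powr g))"
  have nn: "?f r \<ge> 0" for r by simp
  have "stable_gamma p g \<ge> 0" unfolding stable_gamma_def using nn by (intro integral_nonneg_AE) auto
  moreover have "stable_gamma p g \<noteq> 0"
  proof
    assume "stable_gamma p g = 0"
    then have "AE r in lborel. ?f r = 0"
      unfolding stable_gamma_def using integral_nonneg_eq_0_iff_AE[OF stable_gamma_integrable[OF p g]] nn by auto
    then have "AE r in lborel. r \<notin> {0<..<1::real}"
      by eventually_elim (auto simp: indicator_def)
    then have "emeasure lborel {0<..<1::real} = 0"
      by (subst (asm) AE_iff_measurable[of "{0<..<1}"]) auto
    then show False by simp
  qed
  ultimately show ?thesis by simp
qed

lemma stable_gamma_scale: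
  assumes p: "p > 0" and g: "g > 0" and t: "t > 0"
  shows "has_bochner_integral lborel (\<lambda>r. indicator {0<..} r * r powr (p - 1) * exp (- t * (r powr g))) (t powr (- p / g) * stable_gamma p g)"
proof -
  define c where "c = t powr (1 / g)"
  have c: "c > 0" using t by (simp add: c_def)
  have cg: "c powr g = t" using t g by (simp add: c_def powr_powr)
  have h: "has_bochner_integral lborel (\<lambda>r. indicator {0<..} r * r powr (p - 1) * exp (- (r powr g))) (stable_gamma p g)"
    unfolding has_bochner_integral_iff stable_gamma_def using stable_gamma_integrable[OF p g] by simp
  have "has_bochner_integral lborel (\<lambda>r. indicator {0<..} (0 + c *\<^sub>R r) * (0 + c *\<^sub>R r) powr (p - 1) * exp (- ((0 + c *\<^sub>R r) powr g))) (stable_gamma p g /\<^sub>R \<bar>c\<bar> ^ DIM(real))"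
    using lborel_has_bochner_integral_affine[OF h, of c 0] c by simp
  then have "has_bochner_integral lborel (\<lambda>r. c powr (1 - p) * (indicator {0<..} (0 + c *\<^sub>R r) * (0 + c *\<^sub>R r) powr (p - 1) * exp (- ((0 + c *\<^sub>R r) powr g)))) (c powr (1 - p) * (stable_gamma p g /\<^sub>R \<bar>c\<bar> ^ DIM(real)))"
    by (rule has_bochner_integral_mult_right)
  moreover have "c powr (1 - p) * (indicator {0<..} (0 + c *\<^sub>R r) * (0 + c *\<^sub>R r) powr (p - 1) * exp (- ((0 + c *\<^sub>R r) powr g)))
     = indicator {0<..} r * r powr (p - 1) * exp (- t * (r powr g))" for r
  proof (cases "r > 0")
    case True
    have "c powr (1 - p) * c powr (p - 1) = 1" using c by (simp flip: powr_add)
    then have "c powr (1 - p) * ((c * r) powr (p - 1) * exp (- ((c * r) powr g))) = r powr (p - 1) * exp (- t * (r powr g))"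
      using True c by (simp add: powr_mult cg mult.assoc[symmetric])
    then show ?thesis using True c by simp
  next
    case False
    then have "\<not> 0 < c * r" using c by (simp add: zero_less_mult_iff)
    then show ?thesis using False by simp
  qed
  moreover have "c powr (1 - p) * (stable_gamma p g /\<^sub>R \<bar>c\<bar> ^ DIM(real)) = t powr (- p / g) * stable_gamma p g"
  proof -
    have "c powr (1 - p) / c = c powr (- p)" using c by (simp add: powr_diff powr_minus field_simps)
    also have "\<dots> = t powr (- p / g)" by (simp add: c_def powr_powr)
    finally show ?thesis using c by (simp add: field_simps)
  qed
  ultimately show ?thesis by (simp only:)
qed

section \<open>Heat and Oseen kernels\<close>

text \<open>The Gaussian bound \<open>A * d powr (-p)\<close> is itself \<open>A / Gamma p\<close> times the integral of
\<open>r powr (p-1) * exp(-d r)\<close>, a legitimate right-hand side for \<open>stable_kernel_L1\<close> with \<open>\<rho> r = r\<close>;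
scaling then gives the power of \<open>t\<close>.\<close>

theorem stable_kernel_L1_power:
  fixes a :: "real^'n \<Rightarrow> complex"
  assumes a: "a \<in> borel_measurable borel" and ab: "\<And>\<xi>. norm (a \<xi>) \<le> B * (1 + (norm \<xi>)\<^sup>2) ^ N"
    and g: "\<And>d. 0 < d \<Longrightarrow> integrable lborel (\<lambda>x. gauss_kernel a d x) \<and>
       (LINT x|lborel. \<bar>gauss_kernel a d x\<bar>) \<le> A * d powr (- p)"
    and \<beta>: "0 < \<beta>" "\<beta> < 1" and t: "0 < t" and p: "p > 0"
  shows "integrable lborel (\<lambda>x. stable_kernel a \<beta> t x)"
     "(LINT x|lborel. \<bar>stable_kernel a \<beta> t x\<bar>) \<le> A * (stable_gamma p \<beta> / stable_gamma p 1) * t powr (- p / \<beta>)"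
proof -
  \<comment> \<open>the density whose Laplace transform is \<open>A * d powr (-p)\<close>; here \<open>stable_gamma p 1 = Gamma p\<close>\<close>
  define q where "q = (\<lambda>r::real. A / stable_gamma p 1 * (indicator {0<..} r * r powr (p - 1)))"
  have g1: "stable_gamma p 1 > 0" using stable_gamma_pos[OF p, of 1] by simp
  have 1: "has_bochner_integral lborel (\<lambda>r. q r * exp (- d * \<bar>r\<bar>)) (A * d powr (- p))" if d: "d > 0" for d
  proof -
    have "has_bochner_integral lborel (\<lambda>r. A / stable_gamma p 1 * (indicator {0<..} r * r powr (p - 1) * exp (- d * (r powr 1)))) (A / stable_gamma p 1 * (d powr (- p / 1) * stable_gamma p 1))"
      by (intro has_bochner_integral_mult_right stable_gamma_scale p d) simp
    moreover have "A / stable_gamma p 1 * (indicator {0<..} r * r powr (p - 1) * exp (- d * (r powr 1))) = q r * exp (- d * \<bar>r\<bar>)" for r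
      by (cases "r > 0") (simp_all add: q_def)
    ultimately show ?thesis using g1 by simp
  qed
  have 2: "has_bochner_integral lborel (\<lambda>r. q r * exp (- t * \<bar>r\<bar> powr \<beta>)) (A * (stable_gamma p \<beta> / stable_gamma p 1) * t powr (- p / \<beta>))"
  proof -
    have "has_bochner_integral lborel (\<lambda>r. A / stable_gamma p 1 * (indicator {0<..} r * r powr (p - 1) * exp (- t * (r powr \<beta>)))) (A / stable_gamma p 1 * (t powr (- p / \<beta>) * stable_gamma p \<beta>))"
      by (intro has_bochner_integral_mult_right stable_gamma_scale p t \<beta>)
    moreover have "A / stable_gamma p 1 * (indicator {0<..} r * r powr (p - 1) * exp (- t * (r powr \<beta>))) = q r * exp (- t * \<bar>r\<bar> powr \<beta>)" for r
      by (cases "r > 0") (simp_all add: q_def)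
    ultimately show ?thesis by (simp add: mult_ac)
  qed
  have qm: "q \<in> borel_measurable lborel" unfolding q_def by measurable
  have "integrable lborel (\<lambda>x. stable_kernel a \<beta> t x) \<and>
     (LINT x|lborel. \<bar>stable_kernel a \<beta> t x\<bar>) \<le> (LINT r|lborel. q r * exp (- t * \<bar>r\<bar> powr \<beta>))"
  proof (rule stable_kernel_L1[OF a])
    show "integrable lborel (\<lambda>\<xi>. a \<xi> * gauss_symbol d \<xi>)" if "0 < d" for d
      by (rule integrable_poly_gauss[OF a ab that])
    show "integrable lborel (\<lambda>\<xi>. a \<xi> * heat_symbol \<beta> t \<xi>)"
      by (rule integrable_poly_heat_symbol[OF a ab t \<beta>(1)])
    show "integrable lborel (\<lambda>r. q r * exp (- d * \<bar>r\<bar>))" if "0 < d" for d using 1[OF that] by (auto simp: has_bochner_integral_iff)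
    show "integrable lborel (\<lambda>r. q r * exp (- t * \<bar>r\<bar> powr \<beta>))" using 2 by (auto simp: has_bochner_integral_iff)
    show "integrable lborel (\<lambda>x. gauss_kernel a d x)" if "0 < d" for d
      using g[OF that] by simp
    show "(LINT x|lborel. \<bar>gauss_kernel a d x\<bar>) \<le> (LINT r|lborel. q r * exp (- d * \<bar>r\<bar>))" if "0 < d" for d
      using g[OF that] has_bochner_integral_integral_eq[OF 1[OF that]] by simp
  qed (use \<beta> t qm sigma_finite_lborel in auto)
  then show "integrable lborel (\<lambda>x. stable_kernel a \<beta> t x)"
     "(LINT x|lborel. \<bar>stable_kernel a \<beta> t x\<bar>) \<le> A * (stable_gamma p \<beta> / stable_gamma p 1) * t powr (- p / \<beta>)"
    unfolding has_bochner_integral_integral_eq[OF 2] by auto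
qed

lemma heat_symbol_measurable [measurable]: "(\<lambda>(t, \<xi>). heat_symbol \<beta> t \<xi>) \<in> borel_measurable (borel \<Otimes>\<^sub>M borel)"
  unfolding heat_symbol_def by measurable

lemma heat_symbol_measurable1 [measurable]: "heat_symbol \<beta> t \<in> borel_measurable borel"
  unfolding heat_symbol_def by measurable

lemma heat_symbol_integrable:
  fixes dummy :: "'n::finite"
  assumes "t > 0" "\<beta> > 0" shows "integrable lborel (heat_symbol \<beta> t :: real^'n \<Rightarrow> complex)"
  using integrable_poly_heat_symbol[of "\<lambda>_. 1" 1 0 t \<beta>] assms by simp

lemma heat_symbol_add: "heat_symbol \<beta> (s + t) \<xi> = heat_symbol \<beta> s \<xi> * heat_symbol \<beta> t \<xi>"
proof -
  have "- (s + t) * norm \<xi> powr (2 * \<beta>) = - s * norm \<xi> powr (2 * \<beta>) + - t * norm \<xi> powr (2 * \<beta>)"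
    by (simp add: algebra_simps)
  then show ?thesis unfolding heat_symbol_def by (simp only: exp_add of_real_mult)
qed

lemma norm_heat_symbol: "t \<ge> 0 \<Longrightarrow> norm (heat_symbol \<beta> t \<xi>) \<le> 1"
  unfolding heat_symbol_def by simp

lemma inverse_fourier_real:
  fixes m :: "real^'n \<Rightarrow> complex"
  assumes m: "\<And>\<xi>. m (- \<xi>) = cnj (m \<xi>)"
  shows "inverse_fourier m x = of_real (Re (inverse_fourier m x))"
proof -
  have "cnj (LINT \<xi>|lborel. iexp (x \<bullet> \<xi>) * m \<xi>) = (LINT \<xi>|lborel. cnj (iexp (x \<bullet> \<xi>) * m \<xi>))"
    by (rule Bochner_Integration.integral_cnj[symmetric])
  also have "\<dots> = (LINT \<xi>|lborel. iexp (x \<bullet> (0 + (-1) *\<^sub>R \<xi>)) * m (0 + (-1) *\<^sub>R \<xi>))"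
    by (simp add: m exp_cnj)
  also have "\<dots> = (LINT \<xi>|lborel. iexp (x \<bullet> \<xi>) * m \<xi>)"
    by (subst lborel_integral_affine[of "-1" "\<lambda>\<xi>. iexp (x \<bullet> \<xi>) * m \<xi>" 0]) simp_all
  finally have "cnj (inverse_fourier m x) = inverse_fourier m x" unfolding inverse_fourier_def by simp
  then show ?thesis by (metis Reals_cnj_iff of_real_Re)
qed

lemma inverse_fourier_continuous:
  fixes m :: "real^'n \<Rightarrow> complex"
  assumes m: "integrable lborel m"
  shows "continuous_on UNIV (inverse_fourier m)"
proof -
  have [measurable]: "m \<in> borel_measurable borel" using m by simp
  have "(\<lambda>i. inverse_fourier m (X i)) \<longlonglongrightarrow> inverse_fourier m x" if X: "X \<longlonglongrightarrow> x" for X x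
    unfolding inverse_fourier_def
  proof (intro tendsto_mult_left integral_dominated_convergence[where w = "\<lambda>\<xi>. norm (m \<xi>)"])
    show "AE \<xi> in lborel. (\<lambda>i. iexp (X i \<bullet> \<xi>) * m \<xi>) \<longlonglongrightarrow> iexp (x \<bullet> \<xi>) * m \<xi>"
      by (intro AE_I2 tendsto_intros X)
  qed (use m in \<open>auto simp: norm_mult\<close>)
  then show ?thesis by (simp add: continuous_on_sequentially comp_def)
qed

lemma heat_kernel_complex:
  fixes x :: "real^'n"
  shows "inverse_fourier (heat_symbol \<beta> t) x = of_real (heat_kernel \<beta> t x)"
  unfolding heat_kernel_def by (rule inverse_fourier_real) (simp add: heat_symbol_def)

lemma oseen_kernel_complex:
  fixes x :: "real^'n"
  shows "inverse_fourier (\<lambda>\<xi>. heat_symbol \<beta> t \<xi> * leray_symbol j k \<xi> * deriv_symbol l \<xi>) x = of_real (oseen_kernel \<beta> t j k l x)"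
  unfolding oseen_kernel_def
  by (rule inverse_fourier_real) (simp add: heat_symbol_def leray_symbol_def riesz_symbol_def deriv_symbol_def)

lemma heat_kernel_measurable [measurable (raw)]:
  assumes [measurable]: "f \<in> borel_measurable M" "g \<in> borel_measurable M"
  shows "(\<lambda>x. heat_kernel \<beta> (f x) (g x)) \<in> borel_measurable M"
  unfolding heat_kernel_def by measurable

lemma oseen_kernel_measurable [measurable (raw)]:
  assumes [measurable]: "f \<in> borel_measurable M" "g \<in> borel_measurable M"
  shows "(\<lambda>x. oseen_kernel \<beta> (f x) j k l (g x)) \<in> borel_measurable M"
  unfolding oseen_kernel_def by measurable

lemma heat_kernel_continuous:
  fixes dummy :: "'n::finite"
  assumes "t > 0" "\<beta> > 0"
  shows "continuous_on UNIV (heat_kernel \<beta> t :: real^'n \<Rightarrow> real)"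
  unfolding heat_kernel_def[abs_def] by (intro continuous_intros inverse_fourier_continuous heat_symbol_integrable assms)

text \<open>Gaussians have mass one, and a constant is the right-hand side of \<open>stable_kernel_L1\<close> for \<open>\<rho> = 0\<close> on
a one-point space.\<close>

lemma heat_kernel_L1:
  fixes dummy :: "'n::finite"
  assumes \<beta>: "0 < \<beta>" "\<beta> < 1" and t: "t > 0"
  shows "integrable lborel (heat_kernel \<beta> t :: real^'n \<Rightarrow> real)" "(LINT x|lborel. \<bar>heat_kernel \<beta> t (x::real^'n)\<bar>) \<le> 1"
proof -
  have "integrable lborel (\<lambda>x::real^'n. Re (inverse_fourier (\<lambda>\<xi>. 1 * heat_symbol \<beta> t \<xi>) x)) \<and>
     (LINT x|lborel. \<bar>Re (inverse_fourier (\<lambda>\<xi>. 1 * heat_symbol \<beta> t \<xi>) (x::real^'n))\<bar>) \<le> (LINT r|count_space {()}. 1 * exp (- t * 0 powr \<beta>))"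
  proof (rule stable_kernel_L1[where ?\<rho>2.0 = "\<lambda>_. 0" and ?q2.0 = "\<lambda>_. 1"])
    have e: "Re (inverse_fourier (\<lambda>\<xi>. 1 * gauss_symbol d \<xi>) x) = gauss d x" if "d > 0" for d and x :: "real^'n"
      using inverse_fourier_gauss[OF that, of x] by simp
    show "integrable lborel (\<lambda>x::real^'n. Re (inverse_fourier (\<lambda>\<xi>. 1 * gauss_symbol d \<xi>) x))" if "0 < d" for d
      using e[OF that] gauss_integral[OF that] by simp
    show "(LINT x|lborel. \<bar>Re (inverse_fourier (\<lambda>\<xi>. 1 * gauss_symbol d \<xi>) (x::real^'n))\<bar>) \<le> (LINT y|count_space {()}. 1 * exp (- d * 0))" if "0 < d" for d
      using e[OF that] gauss_integral[where 'n='n, OF that] gauss_nonneg[where 'a='n, OF that] by (simp add: lebesgue_integral_count_space_finite abs_of_nonneg)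
    show "integrable lborel (\<lambda>\<xi>::real^'n. 1 * gauss_symbol d \<xi>)" if "0 < d" for d
      using integrable_poly_gauss[of "\<lambda>_. 1" 1 0 d] that by simp
    show "integrable lborel (\<lambda>\<xi>::real^'n. 1 * heat_symbol \<beta> t \<xi>)" using heat_symbol_integrable t \<beta> by simp
  qed (use \<beta> t in \<open>auto intro!: sigma_finite_measure_count_space_finite integrable_count_space\<close>)
  then show "integrable lborel (heat_kernel \<beta> t :: real^'n \<Rightarrow> real)" "(LINT x|lborel. \<bar>heat_kernel \<beta> t (x::real^'n)\<bar>) \<le> 1"
    unfolding heat_kernel_def[abs_def] by (auto simp: lebesgue_integral_count_space_finite)
qed

text \<open>For fixed \<open>x\<close>, the integral of \<open>cos(x \<bullet> \<xi>) exp(-d \<bar>\<xi>\<bar>\<^sup>2)\<close> is a positive multiple of a Gaussian for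
every \<open>d\<close>. Comparison with the zero weight carries this sign over.\<close>

lemma heat_kernel_nonneg:
  fixes x :: "real^'n"
  assumes \<beta>: "0 < \<beta>" "\<beta> < 1" and t: "t > 0"
  shows "0 \<le> heat_kernel \<beta> t x"
proof -
  define q where "q = (\<lambda>\<xi>::real^'n. Re (iexp (x \<bullet> \<xi>)))"
  have qm: "q \<in> borel_measurable borel" unfolding q_def by measurable
  have *: "Re (inverse_fourier (\<lambda>\<xi>. of_real (F \<xi>)) x) = 1 / (2 * pi) ^ CARD('n) * (LINT \<xi>|lborel. q \<xi> * F \<xi>) \<and> integrable lborel (\<lambda>\<xi>. q \<xi> * F \<xi>)"
    if "integrable lborel (\<lambda>\<xi>. complex_of_real (F \<xi>))" for F
  proof -
    note i = integrable_exp_i_mult(1)[OF that, of x]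
    have e: "q \<xi> * F \<xi> = Re (iexp (x \<bullet> \<xi>) * of_real (F \<xi>))" for \<xi> by (simp add: q_def)
    have "Re (inverse_fourier (\<lambda>\<xi>. of_real (F \<xi>)) x) = 1 / (2 * pi) ^ CARD('n) * Re (LINT \<xi>|lborel. iexp (x \<bullet> \<xi>) * of_real (F \<xi>))"
    proof -
      have "Re (of_real c * z) = c * Re z" for c z by simp
      then show ?thesis unfolding inverse_fourier_def by (simp only:)
    qed
    then show ?thesis unfolding e using integral_Re[OF i] integrable_Re[OF i] by simp
  qed
  have gi: "integrable lborel (\<lambda>\<xi>::real^'n. gauss_symbol d \<xi>)" if "0 < d" for d
    using integrable_poly_gauss[of "\<lambda>_. 1" 1 0 d] that by simp
  have hi: "integrable lborel (\<lambda>\<xi>::real^'n. complex_of_real (exp (- t * (norm \<xi>)\<^sup>2 powr \<beta>)))"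
    using heat_symbol_integrable[where 'n='n, OF t \<beta>(1)] unfolding heat_symbol_def[abs_def] norm_powr_eq by simp
  have pos: "0 \<le> (LINT \<xi>|lborel. q \<xi> * exp (- d * (norm \<xi>)\<^sup>2))" if "0 < d" for d
  proof -
    let ?I = "LINT \<xi>|lborel. q \<xi> * exp (- d * (norm \<xi>)\<^sup>2)"
    have k: "1 / (2 * pi) ^ CARD('n) > 0" by simp
    have "Re (inverse_fourier (\<lambda>\<xi>. gauss_symbol d \<xi>) x) = 1 / (2 * pi) ^ CARD('n) * ?I"
      using *[OF gi[OF that]] by (rule conjunct1)
    then have "gauss d x = 1 / (2 * pi) ^ CARD('n) * ?I"
      unfolding inverse_fourier_gauss[OF that] Re_complex_of_real .
    then show ?thesis using mult_pos_neg[OF k, of ?I] gauss_nonneg[OF that, of x] by linarith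
  qed
  have "(LINT r|count_space {()}. 0 * exp (- t * 0 powr \<beta>)) \<le> (LINT \<xi>|lborel. q \<xi> * exp (- t * (norm \<xi>)\<^sup>2 powr \<beta>))"
    by (rule subordination_le[where ?q1.0 = "\<lambda>_. 0" and ?\<rho>1.0 = "\<lambda>_. 0"])
       (use \<beta> t pos *[OF gi] *[OF hi] qm in \<open>auto intro!: sigma_finite_measure_count_space_finite sigma_finite_lborel\<close>)
  then show ?thesis using *[OF hi] unfolding heat_kernel_def heat_symbol_def[abs_def] norm_powr_eq by simp
qed

text \<open>Fourier inversion turns products of symbols into convolutions of kernels, hence the semigroup laws
below.\<close>

lemma fourier_heat_kernel:
  fixes \<xi> :: "real^'n"
  assumes \<beta>: "0 < \<beta>" "\<beta> < 1" and t: "t > 0"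
  shows "fourier (\<lambda>x. of_real (heat_kernel \<beta> t x)) \<xi> = heat_symbol \<beta> t \<xi>"
proof -
  have "fourier (inverse_fourier (heat_symbol \<beta> t)) \<xi> = heat_symbol \<beta> t \<xi>"
  proof (rule fourier_inversion[where B = 1])
    show "continuous_on UNIV (heat_symbol \<beta> t :: real^'n \<Rightarrow> complex)"
      unfolding heat_symbol_def using \<beta> by (intro continuous_intros continuous_on_powr') auto
    show "integrable lborel (inverse_fourier (heat_symbol \<beta> t) :: real^'n \<Rightarrow> complex)"
      unfolding heat_kernel_complex[abs_def] by (rule integrable_of_real[OF heat_kernel_L1(1)[OF \<beta> t]])
  qed (use heat_symbol_integrable[OF t \<beta>(1)] t in \<open>auto intro!: norm_heat_symbol\<close>)
  then show ?thesis unfolding heat_kernel_complex[abs_def] .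
qed

lemma heat_kernel_convolution:
  fixes m :: "real^'n \<Rightarrow> complex"
  assumes \<beta>: "0 < \<beta>" "\<beta> < 1" and s: "s > 0" and m: "integrable lborel m"
  shows "inverse_fourier (\<lambda>\<xi>. heat_symbol \<beta> s \<xi> * m \<xi>) x = (LINT y|lborel. of_real (heat_kernel \<beta> s y) * inverse_fourier m (x - y))"
  using inverse_fourier_convolution[OF integrable_of_real[OF heat_kernel_L1(1)[OF \<beta> s]] m] unfolding fourier_heat_kernel[OF \<beta> s] .

lemma heat_kernel_semigroup:
  fixes x :: "real^'n"
  assumes \<beta>: "0 < \<beta>" "\<beta> < 1" and s: "s > 0" and t: "t > 0"
  shows "heat_kernel \<beta> (s + t) x = (LINT y|lborel. heat_kernel \<beta> s y * heat_kernel \<beta> t (x - y))"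
proof -
  have "complex_of_real (heat_kernel \<beta> (s + t) x) = inverse_fourier (\<lambda>\<xi>. heat_symbol \<beta> s \<xi> * heat_symbol \<beta> t \<xi>) x"
    unfolding heat_kernel_complex[symmetric] by (simp add: heat_symbol_add[abs_def])
  also have "\<dots> = (LINT y|lborel. of_real (heat_kernel \<beta> s y) * of_real (heat_kernel \<beta> t (x - y)))"
    unfolding heat_kernel_convolution[OF \<beta> s heat_symbol_integrable[OF t \<beta>(1)]] heat_kernel_complex ..
  also have "\<dots> = of_real (LINT y|lborel. heat_kernel \<beta> s y * heat_kernel \<beta> t (x - y))"
    by (simp flip: of_real_mult)
  finally show ?thesis by (simp only: of_real_eq_iff)
qed

lemma oseen_symbol_bound: "norm (leray_symbol j k \<xi> * deriv_symbol l \<xi>) \<le> 2 * (1 + (norm \<xi>)\<^sup>2) ^ 1"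
proof -
  have "norm (leray_symbol j k \<xi> * deriv_symbol l \<xi>) \<le> 2 * norm \<xi>"
    unfolding norm_mult by (intro mult_mono norm_leray_symbol norm_deriv_symbol) auto
  then show ?thesis using le_one_plus_sq[of "norm \<xi>"] by simp
qed

lemma oseen_symbol_integrable:
  fixes j k l :: "'n::finite"
  assumes t: "t > 0" and \<beta>: "\<beta> > 0"
  shows "integrable lborel (\<lambda>\<xi>::real^'n. heat_symbol \<beta> t \<xi> * leray_symbol j k \<xi> * deriv_symbol l \<xi>)"
  using integrable_poly_heat_symbol[OF _ oseen_symbol_bound[of j k _ l] t \<beta>] by (simp add: mult_ac)

text \<open>Half of the time may be spent on smoothing by the heat kernel, whose translates are easy to
compare.\<close>

lemma oseen_kernel_semigroup:
  fixes x :: "real^'n"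
  assumes \<beta>: "0 < \<beta>" "\<beta> < 1" and s: "s > 0" and t: "t > 0"
  shows "oseen_kernel \<beta> (s + t) j k l x = (LINT y|lborel. heat_kernel \<beta> s y * oseen_kernel \<beta> t j k l (x - y))"
proof -
  have "complex_of_real (oseen_kernel \<beta> (s + t) j k l x) = inverse_fourier (\<lambda>\<xi>. heat_symbol \<beta> s \<xi> * (heat_symbol \<beta> t \<xi> * leray_symbol j k \<xi> * deriv_symbol l \<xi>)) x"
    unfolding oseen_kernel_complex[symmetric] by (simp add: heat_symbol_add[abs_def] mult_ac)
  also have "\<dots> = (LINT y|lborel. of_real (heat_kernel \<beta> s y) * of_real (oseen_kernel \<beta> t j k l (x - y)))"
    unfolding heat_kernel_convolution[OF \<beta> s oseen_symbol_integrable[OF t \<beta>(1)]] oseen_kernel_complex ..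
  also have "\<dots> = of_real (LINT y|lborel. heat_kernel \<beta> s y * oseen_kernel \<beta> t j k l (x - y))"
    by (simp flip: of_real_mult)
  finally show ?thesis by (simp only: of_real_eq_iff)
qed

text \<open>The Gaussian bound of order \<open>d powr (-1/2)\<close>, subordinated with \<open>p = 1/2\<close>.\<close>

lemma oseen_kernel_L1:
  fixes dummy :: "'n::finite"
  assumes \<beta>: "0 < \<beta>" "\<beta> < 1"
  shows "\<exists>C>0. \<forall>t>0. \<forall>j k l::'n. integrable lborel (oseen_kernel \<beta> t j k l) \<and> (LINT x|lborel. \<bar>oseen_kernel \<beta> t j k l x\<bar>) \<le> C * t powr (- (1 / (2 * \<beta>)))"
proof -
  define C where "C = oseen_const TYPE('n) * (stable_gamma (1/2) \<beta> / stable_gamma (1/2) 1)"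
  have *: "integrable lborel (oseen_kernel \<beta> t j k l) \<and> (LINT x|lborel. \<bar>oseen_kernel \<beta> t j k l x\<bar>) \<le> (\<bar>C\<bar> + 1) * t powr (- (1 / (2 * \<beta>)))" if t: "t > 0" for t and j k l :: 'n
  proof -
    have e: "oseen_kernel \<beta> t j k l = (\<lambda>x. Re (inverse_fourier (\<lambda>\<xi>. leray_symbol j k \<xi> * deriv_symbol l \<xi> * heat_symbol \<beta> t \<xi>) x))"
      unfolding oseen_kernel_def[abs_def] by (simp add: mult_ac)
    have g: "integrable lborel (\<lambda>x. Re (inverse_fourier (\<lambda>\<xi>. leray_symbol j k \<xi> * deriv_symbol l \<xi> * gauss_symbol d \<xi>) x)) \<and>
       (LINT x|lborel. \<bar>Re (inverse_fourier (\<lambda>\<xi>. leray_symbol j k \<xi> * deriv_symbol l \<xi> * gauss_symbol d \<xi>) x)\<bar>) \<le> oseen_const TYPE('n) * d powr (- (1/2))"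
      if d: "0 < d" for d
    proof
      note G = oseen_gauss_L1[OF d, of j k l]
      show gi: "integrable lborel (\<lambda>x. Re (inverse_fourier (\<lambda>\<xi>. leray_symbol j k \<xi> * deriv_symbol l \<xi> * gauss_symbol d \<xi>) x))"
        by (rule integrable_Re[OF G(1)])
      have "(LINT x|lborel. \<bar>Re (inverse_fourier (\<lambda>\<xi>. leray_symbol j k \<xi> * deriv_symbol l \<xi> * gauss_symbol d \<xi>) x)\<bar>)
         \<le> (LINT x|lborel. norm (inverse_fourier (\<lambda>\<xi>. leray_symbol j k \<xi> * deriv_symbol l \<xi> * gauss_symbol d \<xi>) x))"
        by (intro integral_mono integrable_norm G(1) integrable_abs gi abs_Re_le_cmod)
      also have "\<dots> \<le> oseen_const TYPE('n) * d powr (-1/2)" by (rule G(2))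
      finally show "(LINT x|lborel. \<bar>Re (inverse_fourier (\<lambda>\<xi>. leray_symbol j k \<xi> * deriv_symbol l \<xi> * gauss_symbol d \<xi>) x)\<bar>) \<le> oseen_const TYPE('n) * d powr (- (1/2))" by simp
    qed
    have S: "integrable lborel (oseen_kernel \<beta> t j k l)" "(LINT x|lborel. \<bar>oseen_kernel \<beta> t j k l x\<bar>) \<le> C * t powr (- (1/2) / \<beta>)"
      using stable_kernel_L1_power[OF _ oseen_symbol_bound g \<beta> t] unfolding e C_def by auto
    have "C * t powr (- (1/2) / \<beta>) \<le> (\<bar>C\<bar> + 1) * t powr (- (1 / (2 * \<beta>)))"
      by (simp add: mult_right_mono)
    then show ?thesis using S by auto
  qed
  show ?thesis by (rule exI[of _ "\<bar>C\<bar> + 1"]) (use * in auto)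
qed

text \<open>The difference of two translates has symbol \<open>exp(\<i> h \<bullet> \<xi>) - 1\<close> times the heat symbol, so the
Gaussian modulus of order \<open>d powr (-\<sigma>/2)\<close> is subordinated.\<close>

lemma heat_kernel_modulus:
  fixes dummy :: "'n::finite"
  assumes \<beta>: "0 < \<beta>" "\<beta> < 1" and sg: "0 < \<sigma>" "\<sigma> \<le> 1"
  shows "\<exists>C>0. \<forall>t>0. \<forall>h::real^'n. (LINT x|lborel. \<bar>heat_kernel \<beta> t (x + h) - heat_kernel \<beta> t x\<bar>) \<le> C * norm h powr \<sigma> * t powr (- (\<sigma> / (2 * \<beta>)))"
proof -
  define A where "A = 2 * (gauss_moment TYPE('n) / 2) powr \<sigma>"
  define C where "C = A * (stable_gamma (\<sigma>/2) \<beta> / stable_gamma (\<sigma>/2) 1)"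
  have *: "(LINT x|lborel. \<bar>heat_kernel \<beta> t (x + h) - heat_kernel \<beta> t x\<bar>) \<le> (\<bar>C\<bar> + 1) * norm h powr \<sigma> * t powr (- (\<sigma> / (2 * \<beta>)))" if t: "t > 0" for t and h :: "real^'n"
  proof -
    define a where "a = (\<lambda>\<xi>::real^'n. iexp (h \<bullet> \<xi>) - 1)"
    have am: "a \<in> borel_measurable borel" unfolding a_def by measurable
    have ab: "norm (a \<xi>) \<le> 2 * (1 + (norm \<xi>)\<^sup>2) ^ 0" for \<xi>
      unfolding a_def using norm_triangle_ineq4[of "iexp (h \<bullet> \<xi>)" 1] by simp
    have e: "Re (inverse_fourier (\<lambda>\<xi>. a \<xi> * m \<xi>) x) = Re (inverse_fourier m (x + h)) - Re (inverse_fourier m x)" if m: "integrable lborel m" for m x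
    proof -
      have "iexp (x \<bullet> \<xi>) * (a \<xi> * m \<xi>) = iexp ((x + h) \<bullet> \<xi>) * m \<xi> - iexp (x \<bullet> \<xi>) * m \<xi>" for \<xi>
        by (simp add: a_def inner_add_left exp_add algebra_simps)
      then have "inverse_fourier (\<lambda>\<xi>. a \<xi> * m \<xi>) x = inverse_fourier m (x + h) - inverse_fourier m x"
        unfolding inverse_fourier_def using integrable_exp_i_mult(1)[OF m, of "x + h"] integrable_exp_i_mult(1)[OF m, of x]
        by (simp add: right_diff_distrib)
      then show ?thesis by simp
    qed
    have gi: "integrable lborel (\<lambda>\<xi>::real^'n. gauss_symbol d \<xi>)" if "0 < d" for d
      using integrable_poly_gauss[of "\<lambda>_. 1" 1 0 d] that by simp
    have g: "integrable lborel (\<lambda>x. gauss_kernel a d x) \<and>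
       (LINT x|lborel. \<bar>gauss_kernel a d x\<bar>) \<le> (A * norm h powr \<sigma>) * d powr (- (\<sigma>/2))"
      if d: "0 < d" for d
      unfolding e[OF gi[OF d]] inverse_fourier_gauss[OF d] Re_complex_of_real A_def
      using gauss_translate_int(1)[OF d, of h] gauss_modulus[OF d sg, of h] by simp
    have S: "(LINT x|lborel. \<bar>heat_kernel \<beta> t (x + h) - heat_kernel \<beta> t x\<bar>) \<le> (A * norm h powr \<sigma>) * (stable_gamma (\<sigma>/2) \<beta> / stable_gamma (\<sigma>/2) 1) * t powr (- (\<sigma>/2) / \<beta>)"
      using stable_kernel_L1_power(2)[OF am ab g \<beta> t] sg unfolding e[OF heat_symbol_integrable[OF t \<beta>(1)]] heat_kernel_def by simp
    also have "\<dots> = C * norm h powr \<sigma> * t powr (- (\<sigma> / (2 * \<beta>)))" by (simp add: C_def mult_ac)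
    also have "\<dots> \<le> (\<bar>C\<bar> + 1) * norm h powr \<sigma> * t powr (- (\<sigma> / (2 * \<beta>)))"
      by (intro mult_right_mono) auto
    finally show ?thesis .
  qed
  show ?thesis by (rule exI[of _ "\<bar>C\<bar> + 1"]) (use * in auto)
qed

section \<open>Test functions and integration by parts\<close>

lemma partial_has_vector_derivative:
  fixes f :: "real^'n \<Rightarrow> 'b::real_normed_vector"
  assumes "f differentiable at (x + \<theta> *\<^sub>R axis k 1)"
  shows "((\<lambda>\<theta>. f (x + \<theta> *\<^sub>R axis k 1)) has_vector_derivative partial k f (x + \<theta> *\<^sub>R axis k 1)) (at \<theta> within S)"
proof -
  let ?D = "frechet_derivative f (at (x + \<theta> *\<^sub>R axis k 1))"
  have D: "(f has_derivative ?D) (at (x + \<theta> *\<^sub>R axis k 1))" using assms frechet_derivative_works by blast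
  have "((\<lambda>\<theta>. x + \<theta> *\<^sub>R axis k 1) has_derivative (\<lambda>h. h *\<^sub>R axis k (1::real))) (at \<theta> within S)"
    by (auto intro!: derivative_eq_intros)
  from has_derivative_compose[OF this D]
  have "((\<lambda>\<theta>. f (x + \<theta> *\<^sub>R axis k 1)) has_derivative (\<lambda>h. ?D (h *\<^sub>R axis k 1))) (at \<theta> within S)" .
  moreover have "?D (h *\<^sub>R axis k 1) = h *\<^sub>R partial k f (x + \<theta> *\<^sub>R axis k 1)" for h
    unfolding partial_def using D has_derivative_bounded_linear bounded_linear.linear linear_scale by blast
  ultimately show ?thesis unfolding has_vector_derivative_def by simp
qed

definition c1_compact :: "(real^'n \<Rightarrow> 'b::real_normed_vector) \<Rightarrow> bool" where
  "c1_compact f \<longleftrightarrow> (\<forall>x. f differentiable at x) \<and> (\<forall>k. continuous_on UNIV (partial k f)) \<and> (\<exists>R. \<forall>x. norm x > R \<longrightarrow> f x = 0)"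

lemma c1_compact_continuous: "c1_compact f \<Longrightarrow> continuous_on UNIV f"
  unfolding c1_compact_def by (simp add: continuous_at_imp_continuous_on differentiable_imp_continuous_within)

lemma partial_eq_0:
  assumes "norm x > R" "\<And>x. norm x > R \<Longrightarrow> f x = 0"
  shows "partial k f x = 0"
proof -
  have "open {x::real^'n. norm x > R}" by (intro open_Collect_less continuous_intros)
  then have "(f has_derivative (\<lambda>_. 0)) (at x)"
    by (rule has_derivative_transform_within_open[OF has_derivative_const[of 0]]) (use assms in auto)
  then have "frechet_derivative f (at x) = (\<lambda>_. 0)" using frechet_derivative_at by metis
  then show ?thesis by (simp add: partial_def)
qed

lemma integrable_continuous_vanishing:
  fixes f :: "'a::euclidean_space \<Rightarrow> 'b::euclidean_space"
  assumes c: "continuous_on UNIV f" and R: "\<And>x. norm x > R \<Longrightarrow> f x = 0"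
  shows "integrable lborel f" "\<exists>B. \<forall>x. norm (f x) \<le> B"
proof -
  have "set_integrable lborel (cball 0 R) f"
    unfolding set_integrable_def by (rule borel_integrable_compact) (auto intro: continuous_on_subset[OF c])
  moreover have "indicator (cball 0 R) x *\<^sub>R f x = f x" for x
    using R[of x] by (auto simp: indicator_def)
  ultimately show "integrable lborel f" by (simp add: set_integrable_def)
  have "bounded (f ` cball 0 R)" using compact_continuous_image[OF continuous_on_subset[OF c] compact_cball]
    by (intro compact_imp_bounded) auto
  then obtain B where "\<forall>y\<in>f ` cball 0 R. norm y \<le> B" unfolding bounded_iff by blast
  then have B: "norm (f x) \<le> B" if "x \<in> cball 0 R" for x using that by blast
  have "norm (f x) \<le> max B 0" for x using B[of x] R[of x] by (cases "norm x > R") auto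
  then show "\<exists>B. \<forall>x. norm (f x) \<le> B" by blast
qed

lemma c1_compact_integrable:
  fixes f :: "real^'n \<Rightarrow> 'b::euclidean_space"
  assumes f: "c1_compact f"
  shows "integrable lborel f" "integrable lborel (partial k f)" "\<exists>B. \<forall>x. norm (f x) \<le> B" "\<exists>B. \<forall>x. norm (partial k f x) \<le> B"
proof -
  obtain R where R: "\<And>x. norm x > R \<Longrightarrow> f x = 0" using f by (auto simp: c1_compact_def)
  have c: "continuous_on UNIV (partial k f)" using f by (simp add: c1_compact_def)
  show "integrable lborel f" "\<exists>B. \<forall>x. norm (f x) \<le> B"
    using integrable_continuous_vanishing[OF c1_compact_continuous[OF f] R] by auto
  show "integrable lborel (partial k f)" "\<exists>B. \<forall>x. norm (partial k f x) \<le> B"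
    using integrable_continuous_vanishing[OF c partial_eq_0[OF _ R]] by auto
qed

lemma has_vector_derivative_sequentially:
  assumes g: "(g has_vector_derivative v) (at 0)" and d: "d \<longlonglongrightarrow> 0" "\<And>i. d i \<noteq> 0"
  shows "(\<lambda>i. (1 / d i) *\<^sub>R (g (d i) - g 0)) \<longlonglongrightarrow> v"
proof -
  have "((\<lambda>y. norm ((g y - g 0) - (y - 0) *\<^sub>R v) / norm (y - 0)) \<longlongrightarrow> 0) (at 0)"
    using g unfolding has_vector_derivative_def has_derivative_iff_norm by blast
  moreover have "filterlim d (at 0) sequentially"
    using d by (simp add: filterlim_at)
  ultimately have L: "(\<lambda>i. norm ((g (d i) - g 0) - (d i - 0) *\<^sub>R v) / norm (d i - 0)) \<longlonglongrightarrow> 0"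
    by (rule filterlim_compose)
  have "norm ((g (d i) - g 0) - (d i - 0) *\<^sub>R v) / norm (d i - 0) = norm ((1 / d i) *\<^sub>R (g (d i) - g 0) - v)" for i
  proof -
    have "(1 / d i) *\<^sub>R (g (d i) - g 0) - v = (1 / d i) *\<^sub>R ((g (d i) - g 0) - (d i - 0) *\<^sub>R v)"
      using d(2)[of i] by (simp add: scaleR_diff_right)
    then show ?thesis by simp
  qed
  with L have "(\<lambda>i. norm ((1 / d i) *\<^sub>R (g (d i) - g 0) - v)) \<longlonglongrightarrow> 0" by simp
  then show ?thesis by (rule LIM_zero_cancel[OF tendsto_norm_zero_cancel])
qed

text \<open>Difference quotients have integral \<open>0\<close> by translation invariance; they are supported in a fixed
ball and converge boundedly.\<close>

lemma integral_partial_eq_0: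
  fixes f :: "real^'n \<Rightarrow> 'b::euclidean_space"
  assumes f: "c1_compact f"
  shows "(LINT x|lborel. partial k f x) = 0"
proof -
  let ?e = "axis k 1 :: real^'n"
  obtain R where R: "\<And>x. norm x > R \<Longrightarrow> f x = 0" using f by (auto simp: c1_compact_def)
  obtain B where B: "\<And>x. norm (partial k f x) \<le> B" using c1_compact_integrable(4)[OF f] by blast
  have df: "f differentiable at x" for x using f by (simp add: c1_compact_def)
  have fi: "integrable lborel f" by (rule c1_compact_integrable[OF f])
  have fm [measurable]: "f \<in> borel_measurable borel" "partial k f \<in> borel_measurable borel"
    using c1_compact_integrable(1,2)[OF f] by auto
  define d where "d = (\<lambda>i::nat. 1 / real (Suc i))"
  have d: "d i > 0" "d i \<le> 1" for i by (auto simp: d_def)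
  have d0: "d \<longlonglongrightarrow> 0" unfolding d_def by real_asymp
  define Q where "Q = (\<lambda>i x. (1 / d i) *\<^sub>R (f (x + d i *\<^sub>R ?e) - f x))"
  have Q0: "(LINT x|lborel. Q i x) = 0" for i
  proof -
    have "integrable lborel (\<lambda>x. f (x + d i *\<^sub>R ?e))" "(LINT x|lborel. f (x + d i *\<^sub>R ?e)) = integral\<^sup>L lborel f"
      using lborel_integrable_affine[OF fi, of 1 "d i *\<^sub>R ?e"] lborel_integral_affine[of 1 f "d i *\<^sub>R ?e"] by (simp_all add: add.commute)
    then show ?thesis using fi by (simp add: Q_def)
  qed
  have "(\<lambda>i. LINT x|lborel. Q i x) \<longlonglongrightarrow> (LINT x|lborel. partial k f x)"
  proof (rule integral_dominated_convergence[where w = "\<lambda>x. B * indicator (cball 0 (R + 1)) x"])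
    show "integrable lborel (\<lambda>x::real^'n. B * indicator (cball 0 (R + 1)) x)"
      using emeasure_bounded_finite[OF bounded_cball] by (intro integrable_mult_right integrable_real_indicator) auto
    show "AE x in lborel. (\<lambda>i. Q i x) \<longlonglongrightarrow> partial k f x"
    proof (rule AE_I2)
      fix x
      have "((\<lambda>\<theta>. f (x + \<theta> *\<^sub>R ?e)) has_vector_derivative partial k f (x + 0 *\<^sub>R ?e)) (at 0)"
        by (rule partial_has_vector_derivative[OF df])
      moreover have "d i \<noteq> 0" for i using d(1)[of i] by simp
      ultimately have "(\<lambda>i. (1 / d i) *\<^sub>R (f (x + d i *\<^sub>R ?e) - f (x + 0 *\<^sub>R ?e))) \<longlonglongrightarrow> partial k f (x + 0 *\<^sub>R ?e)"
        using d0 by (intro has_vector_derivative_sequentially)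
      then show "(\<lambda>i. Q i x) \<longlonglongrightarrow> partial k f x" by (simp add: Q_def)
    qed
    show "AE x in lborel. norm (Q i x) \<le> B * indicator (cball 0 (R + 1)) x" for i
    proof (rule AE_I2)
      fix x
      show "norm (Q i x) \<le> B * indicator (cball 0 (R + 1)) x"
      proof (cases "x \<in> cball 0 (R + 1)")
        case True
        have "norm (f (x + d i *\<^sub>R ?e) - f (x + 0 *\<^sub>R ?e)) \<le> B * norm (d i - 0)"
        proof (rule differentiable_bound[where S = UNIV])
          show "((\<lambda>\<theta>. f (x + \<theta> *\<^sub>R ?e)) has_derivative (\<lambda>h. h *\<^sub>R partial k f (x + \<theta> *\<^sub>R ?e))) (at \<theta> within UNIV)" for \<theta>
            using partial_has_vector_derivative[OF df] unfolding has_vector_derivative_def .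
          show "onorm (\<lambda>h. h *\<^sub>R partial k f (x + \<theta> *\<^sub>R ?e)) \<le> B" for \<theta>
            by (rule onorm_le) (simp add: mult.commute[of B] mult_left_mono B)
        qed auto
        then have "norm (Q i x) \<le> (1 / d i) * (B * d i)"
          unfolding Q_def norm_scaleR using d[of i] by (intro mult_mono) auto
        then show ?thesis using True d[of i] by simp
      next
        case False
        then have nx: "norm x > R + 1" by simp
        have "norm x \<le> norm (x + d i *\<^sub>R ?e) + norm (d i *\<^sub>R ?e)" using norm_triangle_ineq4[of "x + d i *\<^sub>R ?e" "d i *\<^sub>R ?e"] by simp
        then have "norm (x + d i *\<^sub>R ?e) > R" using d[of i] nx by simp
        then show ?thesis using R[of x] R[of "x + d i *\<^sub>R ?e"] nx False by (simp add: Q_def)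
      qed
    qed
  qed (unfold Q_def, measurable)
  then have "(\<lambda>i. 0) \<longlonglongrightarrow> (LINT x|lborel. partial k f x)" unfolding Q0 .
  then show ?thesis by (rule LIMSEQ_unique) (rule tendsto_const)
qed

text \<open>Integration by parts, that is, \<open>integral_partial_eq_0\<close> for the product of \<open>f\<close> with a character.\<close>

lemma c1_compact_fourier_partial:
  fixes f :: "real^'n \<Rightarrow> complex"
  assumes f: "c1_compact f"
  shows "(LINT x|lborel. iexp (y \<bullet> x) * partial k f x) = - \<i> * of_real (y $ k) * (LINT x|lborel. iexp (y \<bullet> x) * f x)"
proof -
  let ?E = "\<lambda>x. iexp (y \<bullet> x) :: complex"
  have df: "(f has_derivative frechet_derivative f (at x)) (at x)" for x
    using f frechet_derivative_works unfolding c1_compact_def by blast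
  have D: "((\<lambda>x. ?E x * f x) has_derivative (\<lambda>h. ?E x * frechet_derivative f (at x) h + (\<i> * of_real (y \<bullet> h) * ?E x) * f x)) (at x)" for x
  proof -
    have "((\<lambda>x. \<i> * of_real (y \<bullet> x)) has_derivative (\<lambda>h. \<i> * of_real (y \<bullet> h))) (at x)"
      by (auto intro!: derivative_eq_intros)
    from has_derivative_compose[OF this has_field_derivative_imp_has_derivative[OF DERIV_exp]]
    have "(?E has_derivative (\<lambda>h. \<i> * of_real (y \<bullet> h) * ?E x)) (at x)" by (simp add: mult.commute)
    from has_derivative_mult[OF this df] show ?thesis .
  qed
  then have P: "partial k (\<lambda>x. ?E x * f x) x = ?E x * partial k f x + \<i> * of_real (y $ k) * (?E x * f x)" for x
    using frechet_derivative_at[OF D[of x], symmetric] by (simp add: partial_def inner_axis mult_ac)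
  have "c1_compact (\<lambda>x. ?E x * f x)"
    unfolding c1_compact_def
  proof (intro conjI allI)
    show "(\<lambda>x. ?E x * f x) differentiable at x" for x using D unfolding differentiable_def by blast
    show "continuous_on UNIV (partial k (\<lambda>x. ?E x * f x))" for k
    proof -
      have P: "partial k (\<lambda>x. ?E x * f x) x = ?E x * partial k f x + \<i> * of_real (y $ k) * (?E x * f x)" for x
        using frechet_derivative_at[OF D[of x], symmetric] by (simp add: partial_def inner_axis mult_ac)
      have "continuous_on UNIV (partial k f)" using f by (simp add: c1_compact_def)
      then show ?thesis unfolding P[abs_def] by (intro continuous_intros c1_compact_continuous[OF f])
    qed
    show "\<exists>R. \<forall>x. R < norm x \<longrightarrow> ?E x * f x = 0" using f by (auto simp: c1_compact_def)
  qed
  from integral_partial_eq_0[OF this, of k]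
  have "(LINT x|lborel. ?E x * partial k f x + \<i> * of_real (y $ k) * (?E x * f x)) = 0" unfolding P .
  moreover have "integrable lborel (\<lambda>x. ?E x * partial k f x)" "integrable lborel (\<lambda>x. ?E x * f x)"
    using integrable_exp_i_mult(1) c1_compact_integrable(1,2)[OF f] by blast+
  ultimately show ?thesis by (simp add: add_eq_0_iff)
qed

lemma partials_append_partial: "partials ks (partial k f) = partials (ks @ [k]) f"
  by (induction ks) auto

lemma smooth_partial: "smooth f \<Longrightarrow> smooth (partial k f)"
  unfolding smooth_def by (simp add: partials_append_partial)

lemma smooth_partials: "smooth f \<Longrightarrow> smooth (partials ks f)"
  by (induction ks) (auto simp: smooth_partial)

lemma smooth_differentiable: "smooth f \<Longrightarrow> f differentiable at x"
  unfolding smooth_def using partials.simps(1) by (metis differentiable_on_def UNIV_I)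

lemma partials_eq_0:
  assumes "norm x > R" "\<And>x. norm x > R \<Longrightarrow> f x = 0"
  shows "partials ks f x = 0"
  using assms(1) by (induction ks arbitrary: x) (auto simp: assms(2) intro: partial_eq_0)

lemma test_function_vanish:
  assumes "test_function f" shows "\<exists>R. \<forall>x. norm x > R \<longrightarrow> f x = 0"
proof -
  have "bounded (closure {x. f x \<noteq> 0})" using assms compact_imp_bounded by (auto simp: test_function_def)
  then have "bounded {x. f x \<noteq> 0}" using bounded_subset closure_subset by blast
  then obtain R where "\<forall>x\<in>{x. f x \<noteq> 0}. norm x \<le> R" by (auto simp: bounded_iff)
  then show ?thesis by (intro exI[of _ R]) force
qed

lemma test_function_c1_compact:
  assumes f: "test_function f" shows "c1_compact (partials ks f)"
proof -
  have s: "smooth (partials ks f)" using f smooth_partials by (auto simp: test_function_def)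
  obtain R where R: "\<And>x. norm x > R \<Longrightarrow> f x = 0" using test_function_vanish[OF f] by blast
  show ?thesis unfolding c1_compact_def
  proof (intro conjI allI)
    show "partials ks f differentiable at x" for x using smooth_differentiable[OF s] .
    show "continuous_on UNIV (partial k (partials ks f))" for k
      using smooth_differentiable[OF smooth_partial[OF s, of k]]
      by (simp add: continuous_at_imp_continuous_on differentiable_imp_continuous_within)
    show "\<exists>R. \<forall>x. R < norm x \<longrightarrow> partials ks f x = 0" using partials_eq_0[of R _ f ks] R by blast
  qed
qed

lemma c1_compact_of_real:
  fixes f :: "real^'n \<Rightarrow> real"
  assumes f: "c1_compact f"
  shows "c1_compact (\<lambda>x. complex_of_real (f x))" "partial k (\<lambda>x. complex_of_real (f x)) x = of_real (partial k f x)"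
proof -
  have D: "((\<lambda>x. complex_of_real (f x)) has_derivative (\<lambda>h. of_real (frechet_derivative f (at x) h))) (at x)" for x
    using f frechet_derivative_works unfolding c1_compact_def by (intro has_derivative_of_real) blast
  have P: "partial k (\<lambda>x. complex_of_real (f x)) x = of_real (partial k f x)" for k x
    using frechet_derivative_at[OF D[of x], symmetric] by (simp add: partial_def)
  then show "partial k (\<lambda>x. complex_of_real (f x)) x = of_real (partial k f x)" .
  show "c1_compact (\<lambda>x. complex_of_real (f x))" unfolding c1_compact_def P[abs_def]
    using f D by (auto simp: c1_compact_def differentiable_def intro!: continuous_intros)
qed

lemma partial_shift:
  assumes "f differentiable at (x + y)"
  shows "partial k (\<lambda>x. f (x + y)) x = partial k f (x + y)"
proof -
  have D: "(f has_derivative frechet_derivative f (at (x + y))) (at (x + y))" using assms frechet_derivative_works by blast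
  have "((\<lambda>x. x + y) has_derivative (\<lambda>h. h)) (at x)" by (auto intro!: derivative_eq_intros)
  from has_derivative_compose[OF this D] have "((\<lambda>x. f (x + y)) has_derivative frechet_derivative f (at (x + y))) (at x)" .
  from frechet_derivative_at[OF this, symmetric] show ?thesis by (simp add: partial_def)
qed

lemma partials_shift: "smooth f \<Longrightarrow> partials ks (\<lambda>x. f (x + y)) = (\<lambda>x. partials ks f (x + y))"
proof (induction ks)
  case (Cons k ks)
  then show ?case using smooth_differentiable[OF smooth_partials[OF Cons.prems]] by (auto simp: partial_shift)
qed simp

lemma test_function_shift:
  assumes f: "test_function f" shows "test_function (\<lambda>x. f (x + y))"
proof -
  have s: "smooth f" using f by (simp add: test_function_def)
  have "smooth (\<lambda>x. f (x + y))"
    unfolding smooth_def partials_shift[OF s]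
  proof (intro allI)
    fix ks
    show "(\<lambda>x. partials ks f (x + y)) differentiable_on UNIV"
      unfolding differentiable_on_def
    proof
      fix x
      have "(\<lambda>x. x + y) differentiable at x" by (intro derivative_intros)
      then show "(\<lambda>x. partials ks f (x + y)) differentiable at x"
        using differentiable_compose[of "partials ks f" "\<lambda>x. x + y" x UNIV] smooth_differentiable[OF smooth_partials[OF s]] differentiable_at_withinI by blast
    qed
  qed
  moreover have "bounded {x. f (x + y) \<noteq> 0}"
  proof -
    obtain R where R: "\<And>x. norm x > R \<Longrightarrow> f x = 0" using test_function_vanish[OF f] by blast
    have "norm x \<le> R + norm y" if "f (x + y) \<noteq> 0" for x
    proof -
      have "norm (x + y) \<le> R" using R[of "x + y"] that by force
      then show ?thesis using norm_triangle_ineq4[of "x + y" y] by simp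
    qed
    then show ?thesis by (auto simp: bounded_iff)
  qed
  ultimately show ?thesis by (simp add: test_function_def)
qed

section \<open>Littlewood-Paley kernels and the Besov norm\<close>

lemma inverse_fourier_partials_replicate:
  fixes f :: "real^'n \<Rightarrow> complex"
  assumes f: "test_function f"
  shows "inverse_fourier (partials (replicate m k) f) x = (- \<i> * of_real (x $ k)) ^ m * inverse_fourier f x"
proof (induction m)
  case (Suc m)
  have "inverse_fourier (partials (replicate (Suc m) k) f) x = - \<i> * of_real (x $ k) * inverse_fourier (partials (replicate m k) f) x"
    using c1_compact_fourier_partial[OF test_function_c1_compact[OF f, of "replicate m k"], of x k]
    by (simp add: inverse_fourier_def)
  then show ?case by (simp add: Suc)
qed simp

text \<open>Each \<open>x\<^sub>k\<^sup>m\<close> times the transform is the transform of a pure derivative, hence bounded; the largest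
coordinate controls the norm.\<close>

lemma inverse_fourier_test_decay:
  fixes f :: "real^'n \<Rightarrow> complex"
  assumes f: "test_function f"
  shows "\<exists>C. \<forall>x. norm (inverse_fourier f x) * (1 + (norm x)\<^sup>2) ^ N \<le> C"
proof -
  have "\<exists>C. \<forall>x. \<bar>x $ k\<bar> ^ m * norm (inverse_fourier f x) \<le> C" for k m
  proof -
    have "\<bar>x $ k\<bar> ^ m * norm (inverse_fourier f x) = norm (inverse_fourier (partials (replicate m k) f) x)" for x
      unfolding inverse_fourier_partials_replicate[OF f] by (simp add: norm_mult norm_power)
    then show ?thesis using inverse_fourier_bound[of "partials (replicate m k) f"] by metis
  qed
  then obtain C where C: "\<And>k m x. \<bar>x $ k\<bar> ^ m * norm (inverse_fourier f x) \<le> C k m" by metis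
  have "norm (inverse_fourier f x) * (1 + (norm x)\<^sup>2) ^ N \<le> (1 + real CARD('n)) ^ N * (C undefined 0 + (\<Sum>k\<in>UNIV. C k (2 * N)))" for x
  proof -
    define M where "M = Max (insert 1 (range (\<lambda>k. \<bar>x $ k\<bar>)))"
    have M: "1 \<le> M" "\<And>k. \<bar>x $ k\<bar> \<le> M" and Min: "M \<in> insert 1 (range (\<lambda>k. \<bar>x $ k\<bar>))"
    proof -
      have fin: "finite (insert 1 (range (\<lambda>k. \<bar>x $ k\<bar>)))" by simp
      show "1 \<le> M" "\<bar>x $ k\<bar> \<le> M" for k unfolding M_def using Max_ge[OF fin] by blast+
      show "M \<in> insert 1 (range (\<lambda>k. \<bar>x $ k\<bar>))" unfolding M_def by (rule Max_in[OF fin]) simp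
    qed
    have "(norm x)\<^sup>2 = (\<Sum>k\<in>UNIV. (x $ k)\<^sup>2)"
      by (simp add: norm_vec_def L2_set_def sum_nonneg)
    also have "\<dots> \<le> (\<Sum>k\<in>(UNIV::'n set). M\<^sup>2)"
      using M by (intro sum_mono) (metis abs_ge_zero abs_le_square_iff abs_of_nonneg order_trans zero_le_one)
    finally have "1 + (norm x)\<^sup>2 \<le> (1 + real CARD('n)) * M\<^sup>2"
      using one_le_power[OF M(1), of 2] by (simp add: distrib_right)
    then have "(1 + (norm x)\<^sup>2) ^ N \<le> ((1 + real CARD('n)) * M\<^sup>2) ^ N" by (intro power_mono) auto
    also have "\<dots> = (1 + real CARD('n)) ^ N * M ^ (2 * N)" by (simp add: power_mult_distrib power_mult)
    also have "M ^ (2 * N) \<le> 1 + (\<Sum>k\<in>UNIV. \<bar>x $ k\<bar> ^ (2 * N))"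
    proof (cases "M = 1")
      case True
      then show ?thesis by (simp add: sum_nonneg)
    next
      case False
      then obtain k where "M = \<bar>x $ k\<bar>" using Min by auto
      then have "M ^ (2 * N) \<le> (\<Sum>k\<in>UNIV. \<bar>x $ k\<bar> ^ (2 * N))"
        using member_le_sum[of k UNIV "\<lambda>k. \<bar>x $ k\<bar> ^ (2 * N)"] by simp
      then show ?thesis by simp
    qed
    finally have "(1 + (norm x)\<^sup>2) ^ N \<le> (1 + real CARD('n)) ^ N * (1 + (\<Sum>k\<in>UNIV. \<bar>x $ k\<bar> ^ (2 * N)))"
      by (simp add: mult_left_mono)
    then have "norm (inverse_fourier f x) * (1 + (norm x)\<^sup>2) ^ N \<le> norm (inverse_fourier f x) * ((1 + real CARD('n)) ^ N * (1 + (\<Sum>k\<in>UNIV. \<bar>x $ k\<bar> ^ (2 * N))))"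
      by (intro mult_left_mono) auto
    also have "\<dots> = (1 + real CARD('n)) ^ N * (\<bar>x $ undefined\<bar> ^ 0 * norm (inverse_fourier f x) + (\<Sum>k\<in>UNIV. \<bar>x $ k\<bar> ^ (2 * N) * norm (inverse_fourier f x)))"
      unfolding sum_distrib_right[symmetric] by (simp add: distrib_left distrib_right mult.left_commute mult.commute)
    also have "\<dots> \<le> (1 + real CARD('n)) ^ N * (C undefined 0 + (\<Sum>k\<in>UNIV. C k (2 * N)))"
      by (intro mult_left_mono add_mono C sum_mono) auto
    finally show ?thesis .
  qed
  then show ?thesis by blast
qed

lemma lp_kernel_scale:
  fixes \<phi> :: "real^'n \<Rightarrow> complex"
  shows "lp_kernel \<phi> j x = of_real ((2 powi j) ^ CARD('n)) * inverse_fourier \<phi> ((2 powi j) *\<^sub>R x)"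
proof -
  have p: "(2::real) powi j \<noteq> 0" by simp
  have "(LINT \<xi>|lborel. iexp (x \<bullet> (0 + (2 powi j) *\<^sub>R \<xi>)) * \<phi> ((2 powi - j) *\<^sub>R (0 + (2 powi j) *\<^sub>R \<xi>)))
     = (LINT \<xi>|lborel. iexp (x \<bullet> \<xi>) * \<phi> ((2 powi - j) *\<^sub>R \<xi>)) /\<^sub>R \<bar>2 powi j\<bar> ^ DIM(real^'n)"
    by (rule lborel_integral_affine[OF p])
  moreover have "(2 powi - j) *\<^sub>R (0 + (2 powi j) *\<^sub>R \<xi>) = \<xi>" for \<xi> :: "real^'n"
    by (simp add: power_int_minus)
  ultimately have "(LINT \<xi>|lborel. iexp (x \<bullet> \<xi>) * \<phi> ((2 powi - j) *\<^sub>R \<xi>)) = (2 powi j) ^ CARD('n) *\<^sub>R (LINT \<xi>|lborel. iexp ((2 powi j *\<^sub>R x) \<bullet> \<xi>) * \<phi> \<xi>)"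
    using p by simp
  then show ?thesis unfolding lp_kernel_def inverse_fourier_def by (simp add: scaleR_conv_of_real)
qed

text \<open>All kernels are dilations of one rapidly decreasing function, whose integral is \<open>\<phi> 0 = 0\<close> by
inversion.\<close>

lemma lp_kernel_moment:
  fixes \<phi> :: "real^'n \<Rightarrow> complex"
  assumes \<phi>: "littlewood_paley \<phi>" and sg: "0 < \<sigma>" "\<sigma> \<le> 1"
  shows "\<exists>C>0. \<forall>j. integrable lborel (lp_kernel \<phi> j) \<and> (LINT x|lborel. lp_kernel \<phi> j x) = 0 \<and>
     integrable lborel (\<lambda>x. norm x powr \<sigma> * norm (lp_kernel \<phi> j x)) \<and>
     (LINT x|lborel. norm x powr \<sigma> * norm (lp_kernel \<phi> j x)) \<le> C * 2 powr (- \<sigma> * of_int j)"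
proof -
  have t: "test_function \<phi>" and supp: "closure {\<xi>. \<phi> \<xi> \<noteq> 0} \<subseteq> {\<xi>. 1/2 \<le> norm \<xi> \<and> norm \<xi> \<le> 2}"
    using \<phi> by (auto simp: littlewood_paley_def)
  have \<phi>0: "\<phi> 0 = 0" using supp closure_subset[of "{\<xi>. \<phi> \<xi> \<noteq> 0}"] by force
  have c1: "c1_compact \<phi>" using test_function_c1_compact[OF t, of "[]"] by simp
  have \<phi>i: "integrable lborel \<phi>" and \<phi>c: "continuous_on UNIV \<phi>" using c1_compact_integrable[OF c1] c1_compact_continuous[OF c1] by auto
  obtain B where B: "\<And>x. norm (\<phi> x) \<le> B" using c1_compact_integrable(3)[OF c1] by blast
  let ?k = "inverse_fourier \<phi>"
  have km [measurable]: "?k \<in> borel_measurable borel" using \<phi>i by (intro inverse_fourier_measurable1) auto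
  obtain C0 where C0: "\<And>x. norm (?k x) * (1 + (norm x)\<^sup>2) ^ CARD('n) \<le> C0" using inverse_fourier_test_decay[OF t] by blast
  obtain C1 where C1: "\<And>x. norm (?k x) * (1 + (norm x)\<^sup>2) ^ (CARD('n) + 1) \<le> C1" using inverse_fourier_test_decay[OF t] by blast
  have ki: "integrable lborel ?k" by (rule integrable_decay[where C = C0]) (use C0 in auto)
  have mi: "integrable lborel (\<lambda>x. norm x powr \<sigma> * norm (?k x))"
  proof (rule integrable_decay[where C = C1])
    fix x :: "real^'n"
    have "norm x powr \<sigma> \<le> 1 + (norm x)\<^sup>2"
    proof (cases "norm x \<le> 1")
      case True
      then have "norm x powr \<sigma> \<le> 1" using sg by (intro powr_le1) auto
      then show ?thesis by (simp add: add_increasing2)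
    next
      case False
      then have "norm x powr \<sigma> \<le> norm x powr 1" using sg by (intro powr_mono) auto
      then show ?thesis using le_one_plus_sq[of "norm x"] by simp
    qed
    then have "norm (?k x) * (1 + (norm x)\<^sup>2) ^ CARD('n) * norm x powr \<sigma> \<le> norm (?k x) * (1 + (norm x)\<^sup>2) ^ CARD('n) * (1 + (norm x)\<^sup>2)"
      by (intro mult_left_mono) auto
    also have "\<dots> \<le> C1" using C1[of x] by (simp add: mult_ac)
    finally show "norm (norm x powr \<sigma> * norm (?k x)) * (1 + (norm x)\<^sup>2) ^ DIM(real^'n) \<le> C1"
      by (simp add: mult_ac abs_mult)
  qed measurable
  have "fourier ?k 0 = \<phi> 0" by (rule fourier_inversion[OF \<phi>i B \<phi>c ki])
  then have k0: "(LINT x|lborel. ?k x) = 0" by (simp add: fourier_def \<phi>0)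
  define A where "A = (LINT x|lborel. norm x powr \<sigma> * norm (?k x))"
  have A0: "A \<ge> 0" unfolding A_def by (intro integral_nonneg_AE) auto
  have "integrable lborel (lp_kernel \<phi> j) \<and> (LINT x|lborel. lp_kernel \<phi> j x) = 0 \<and>
     integrable lborel (\<lambda>x. norm x powr \<sigma> * norm (lp_kernel \<phi> j x)) \<and>
     (LINT x|lborel. norm x powr \<sigma> * norm (lp_kernel \<phi> j x)) \<le> (A + 1) * 2 powr (- \<sigma> * of_int j)" for j
  proof -
    define s where "s = (2::real) powi j"
    have s: "s > 0" by (simp add: s_def)
    have e: "lp_kernel \<phi> j = (\<lambda>x. of_real (s ^ CARD('n)) * ?k (0 + s *\<^sub>R x))"
      by (simp add: lp_kernel_scale s_def fun_eq_iff)
    have 1: "integrable lborel (lp_kernel \<phi> j)" unfolding e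
      using s by (intro integrable_mult_right lborel_integrable_affine ki) auto
    have 2: "(LINT x|lborel. lp_kernel \<phi> j x) = 0" unfolding e integral_mult_right_zero
      using lborel_integral_affine[of s ?k 0] s k0 by simp
    have "has_bochner_integral lborel (\<lambda>x. norm x powr \<sigma> * norm (?k x)) A"
      unfolding A_def has_bochner_integral_iff using mi by simp
    then have "has_bochner_integral lborel (\<lambda>x. norm (0 + s *\<^sub>R x) powr \<sigma> * norm (?k (0 + s *\<^sub>R x))) (A /\<^sub>R \<bar>s\<bar> ^ DIM(real^'n))"
      by (rule lborel_has_bochner_integral_affine) (use s in auto)
    then have "has_bochner_integral lborel (\<lambda>x. s powr (- \<sigma>) * s ^ CARD('n) * (norm (0 + s *\<^sub>R x) powr \<sigma> * norm (?k (0 + s *\<^sub>R x)))) (s powr (- \<sigma>) * s ^ CARD('n) * (A /\<^sub>R \<bar>s\<bar> ^ DIM(real^'n)))"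
      by (intro has_bochner_integral_mult_right)
    moreover have "s powr (- \<sigma>) * s ^ CARD('n) * (norm (0 + s *\<^sub>R x) powr \<sigma> * norm (?k (0 + s *\<^sub>R x))) = norm x powr \<sigma> * norm (lp_kernel \<phi> j x)" for x
    proof -
      have "s powr (- \<sigma>) * s powr \<sigma> = 1" using s by (simp flip: powr_add)
      then have "s powr (- \<sigma>) * s ^ CARD('n) * ((s powr \<sigma> * norm x powr \<sigma>) * norm (?k (0 + s *\<^sub>R x))) = norm x powr \<sigma> * (s ^ CARD('n) * norm (?k (0 + s *\<^sub>R x)))"
        by (simp add: mult_ac)
      then show ?thesis using s by (simp add: e norm_mult norm_power powr_mult)
    qed
    moreover have "s powr (- \<sigma>) * s ^ CARD('n) * (A /\<^sub>R \<bar>s\<bar> ^ DIM(real^'n)) = A * s powr (- \<sigma>)" using s by simp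
    moreover have "s powr (- \<sigma>) = 2 powr (- \<sigma> * of_int j)"
      unfolding s_def by (simp add: powr_real_of_int'[symmetric] powr_powr mult_ac)
    ultimately have 3: "has_bochner_integral lborel (\<lambda>x. norm x powr \<sigma> * norm (lp_kernel \<phi> j x)) (A * 2 powr (- \<sigma> * of_int j))" by (simp only:)
    have "A * 2 powr (- \<sigma> * of_int j) \<le> (A + 1) * 2 powr (- \<sigma> * of_int j)" by (intro mult_right_mono) auto
    then show ?thesis using 1 2 3 by (auto simp: has_bochner_integral_iff)
  qed
  then show ?thesis using A0 by (intro exI[of _ "A + 1"]) auto
qed

lemma borel_measurable_vec_lambda_components:
  fixes f :: "'a \<Rightarrow> 'b::euclidean_space^'n"
  assumes "\<And>i. (\<lambda>x. f x $ i) \<in> borel_measurable M"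
  shows "f \<in> borel_measurable M"
proof -
  have "(\<lambda>x. f x \<bullet> b) \<in> borel_measurable M" if bB: "b \<in> Basis" for b
  proof -
    obtain i u where b: "b = axis i u" "u \<in> Basis" using bB unfolding Basis_vec_def by blast
    show ?thesis unfolding b inner_axis using assms[of i] by measurable
  qed
  then show ?thesis using borel_measurable_euclidean_space by blast
qed

lemma linf_norm_le:
  assumes "f \<in> borel_measurable borel" "\<And>x. norm (f x) \<le> B" shows "linf_norm f \<le> ennreal B"
  unfolding linf_norm_def using assms by (intro esssup_I) (auto intro!: ennreal_leI)

text \<open>The kernels have integral zero, so a block at \<open>x\<close> is the integral of \<open>(f y - f x)\<close> against the
kernel. The moment of order \<open>\<sigma>\<close> contributes \<open>2 powr (-\<sigma> j)\<close>, which the Besov weight cancels.\<close>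

lemma besov_norm_le_hoelder:
  fixes \<phi> :: "real^'n \<Rightarrow> complex"
  assumes \<phi>: "littlewood_paley \<phi>" and sg: "0 < \<sigma>" "\<sigma> \<le> 1"
  shows "\<exists>C>0. \<forall>(f::real^'n \<Rightarrow> real^'n) B H. f \<in> borel_measurable borel \<longrightarrow> (\<forall>x. norm (f x) \<le> B) \<longrightarrow>
     (\<forall>x y. norm (f x - f y) \<le> H * norm (x - y) powr \<sigma>) \<longrightarrow> besov_norm \<phi> \<sigma> f \<le> ennreal (C * H)"
proof -
  obtain C where C: "C > 0" and K: "\<And>j. integrable lborel (lp_kernel \<phi> j)" "\<And>j. (LINT x|lborel. lp_kernel \<phi> j x) = 0"
    "\<And>j. integrable lborel (\<lambda>x. norm x powr \<sigma> * norm (lp_kernel \<phi> j x))"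
    "\<And>j. (LINT x|lborel. norm x powr \<sigma> * norm (lp_kernel \<phi> j x)) \<le> C * 2 powr (- \<sigma> * of_int j)"
    using lp_kernel_moment[OF \<phi> sg] by auto
  have "besov_norm \<phi> \<sigma> f \<le> ennreal (CARD('n) * C * H)"
    if f [measurable]: "f \<in> borel_measurable borel" and B: "\<And>x. norm (f x) \<le> B" and H: "\<And>x y. norm (f x - f y) \<le> H * norm (x - y) powr \<sigma>"
    for f :: "real^'n \<Rightarrow> real^'n" and B H
    unfolding besov_norm_def
  proof (rule SUP_least)
    fix j :: int
    have H0: "H \<ge> 0" using order_trans[OF norm_ge_zero H[of "axis undefined 1" 0]] by simp
    define k where "k = lp_kernel \<phi> j"
    note K = K(1-4)[of j, folded k_def]
    have km [measurable]: "k \<in> borel_measurable borel" using K(1) by simp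
    have fim [measurable]: "(\<lambda>x. f x $ i) \<in> borel_measurable borel" for i
      using f by (rule measurable_compose) (simp add: borel_measurable_continuous_onI continuous_on_component)
    have kx: "integrable lborel (\<lambda>y. k (x - y))" "(LINT y|lborel. k (x - y)) = 0"
      "integrable lborel (\<lambda>y. norm (x - y) powr \<sigma> * norm (k (x - y)))"
      "(LINT y|lborel. norm (x - y) powr \<sigma> * norm (k (x - y))) \<le> C * 2 powr (- \<sigma> * of_int j)" for x
      using lborel_integrable_affine[OF K(1), of "-1" x] lborel_integral_affine[of "-1" k x] K(2)
        lborel_integrable_affine[OF K(3), of "-1" x] lborel_integral_affine[of "-1" "\<lambda>x. norm x powr \<sigma> * norm (k x)" x] K(4)
      by simp_all
    have conv_i: "integrable lborel (\<lambda>y. (f y $ i) *\<^sub>R k (x - y))" for i x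
    proof (rule Bochner_Integration.integrable_bound)
      show "integrable lborel (\<lambda>y. B * norm (k (x - y)))" using kx(1) by (intro integrable_mult_right integrable_norm)
      have "norm ((f y $ i) *\<^sub>R k (x - y)) \<le> norm (B * norm (k (x - y)))" for y
        using order_trans[OF component_le_norm_cart B, of y i] by (auto simp: abs_mult intro!: mult_right_mono)
      then show "AE y in lborel. norm ((f y $ i) *\<^sub>R k (x - y)) \<le> norm (B * norm (k (x - y)))" by simp
    qed measurable
    have comp: "norm (conv k (\<lambda>y. f y $ i) x) \<le> H * (C * 2 powr (- \<sigma> * of_int j))" for i x
    proof -
      have "conv k (\<lambda>y. f y $ i) x = (LINT y|lborel. (f y $ i) *\<^sub>R k (x - y)) - (f x $ i) *\<^sub>R (LINT y|lborel. k (x - y))"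
        unfolding conv_def kx(2) by simp
      also have "\<dots> = (LINT y|lborel. (f y $ i - f x $ i) *\<^sub>R k (x - y))"
        using conv_i kx(1) by (simp add: scaleR_diff_left)
      finally have "norm (conv k (\<lambda>y. f y $ i) x) \<le> (LINT y|lborel. norm ((f y $ i - f x $ i) *\<^sub>R k (x - y)))"
        using integral_norm_bound[of lborel "\<lambda>y. (f y $ i - f x $ i) *\<^sub>R k (x - y)"] by simp
      also have "\<dots> \<le> (LINT y|lborel. H * (norm (x - y) powr \<sigma> * norm (k (x - y))))"
      proof (rule integral_mono)
        have "integrable lborel (\<lambda>y. (f y $ i) *\<^sub>R k (x - y) - (f x $ i) *\<^sub>R k (x - y))"
          using conv_i kx(1) by simp
        then show "integrable lborel (\<lambda>y. norm ((f y $ i - f x $ i) *\<^sub>R k (x - y)))"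
          by (intro integrable_norm) (simp add: scaleR_diff_left)
        show "integrable lborel (\<lambda>y. H * (norm (x - y) powr \<sigma> * norm (k (x - y))))" using kx(3) by simp
        fix y
        have "\<bar>f y $ i - f x $ i\<bar> \<le> H * norm (x - y) powr \<sigma>"
          using order_trans[OF component_le_norm_cart[of "f y - f x" i] H] by (simp add: norm_minus_commute)
        then show "norm ((f y $ i - f x $ i) *\<^sub>R k (x - y)) \<le> H * (norm (x - y) powr \<sigma> * norm (k (x - y)))"
          by (simp add: mult_right_mono flip: mult.assoc)
      qed
      also have "\<dots> \<le> H * (C * 2 powr (- \<sigma> * of_int j))"
        using kx(4) H0 by (simp add: mult_left_mono)
      finally show ?thesis .
    qed
    have "norm (lp_block \<phi> j f x) \<le> CARD('n) * (H * (C * 2 powr (- \<sigma> * of_int j)))" for x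
    proof -
      have "norm (lp_block \<phi> j f x) \<le> (\<Sum>i\<in>UNIV. norm (lp_block \<phi> j f x $ i))"
        unfolding norm_vec_def by (rule L2_set_le_sum) simp
      also have "\<dots> \<le> (\<Sum>i\<in>(UNIV::'n set). H * (C * 2 powr (- \<sigma> * of_int j)))"
        unfolding lp_block_def k_def[symmetric] by (intro sum_mono) (simp only: vec_lambda_beta comp)
      finally show ?thesis by simp
    qed
    moreover have "lp_block \<phi> j f \<in> borel_measurable borel"
    proof -
      have "(\<lambda>x. conv k (\<lambda>y. f y $ i) x) \<in> borel_measurable borel" for i
        unfolding conv_def by measurable
      then have "(\<lambda>x. lp_block \<phi> j f x $ i) \<in> borel_measurable borel" for i
        unfolding lp_block_def k_def[symmetric] by simp
      then show ?thesis by (rule borel_measurable_vec_lambda_components)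
    qed
    ultimately have L: "linf_norm (lp_block \<phi> j f) \<le> ennreal (CARD('n) * (H * (C * 2 powr (- \<sigma> * of_int j))))"
      by (intro linf_norm_le)
    have conv: "\<forall>i. convolvable k (\<lambda>y. f y $ i)" unfolding convolvable_def using conv_i by simp
    have "ennreal (2 powr (\<sigma> * of_int j)) * linf_norm (lp_block \<phi> j f) \<le> ennreal (2 powr (\<sigma> * of_int j)) * ennreal (CARD('n) * (H * (C * 2 powr (- \<sigma> * of_int j))))"
      by (intro mult_left_mono L) auto
    also have "\<dots> = ennreal (CARD('n) * C * H)"
    proof -
      have "2 powr (\<sigma> * of_int j) * 2 powr (- \<sigma> * of_int j) = (1::real)" by (simp flip: powr_add)
      then have "2 powr (\<sigma> * of_int j) * (CARD('n) * (H * (C * 2 powr (- \<sigma> * of_int j)))) = CARD('n) * C * H" by (simp add: mult_ac)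
      then show ?thesis using H0 C by (subst ennreal_mult[symmetric]) auto
    qed
    finally show "ennreal (2 powr (\<sigma> * of_int j)) * (if \<forall>i. convolvable (lp_kernel \<phi> j) (\<lambda>y. f y $ i) then linf_norm (lp_block \<phi> j f) else top) \<le> ennreal (CARD('n) * C * H)"
      using conv unfolding k_def by simp
  qed
  then show ?thesis using C by (intro exI[of _ "CARD('n) * C"]) auto
qed

section \<open>Divergence of the Oseen kernel\<close>

text \<open>By Parseval the sum becomes an integral whose integrand contains \<open>\<Sum>\<^sub>j \<xi>\<^sub>j P\<^sub>j\<^sub>k(\<xi>) = 0\<close>.\<close>

lemma oseen_kernel_divergence:
  fixes \<psi> :: "real^'n \<Rightarrow> real"
  assumes \<psi>: "test_function \<psi>" and t: "t > 0" and \<beta>: "0 < \<beta>" "\<beta> < 1"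
  shows "(\<Sum>j\<in>UNIV. LINT x|lborel. oseen_kernel \<beta> t j k l (x - y) * partial j \<psi> x) = 0"
proof -
  define f where "f = (\<lambda>x. complex_of_real (\<psi> (x + y)))"
  have c: "c1_compact (\<lambda>x. \<psi> (x + y))" using test_function_c1_compact[OF test_function_shift[OF \<psi>], of "[]"] by simp
  have f: "c1_compact f" unfolding f_def by (rule c1_compact_of_real[OF c])
  have s: "smooth \<psi>" using \<psi> by (simp add: test_function_def)
  have pf: "partial j f x = of_real (partial j \<psi> (x + y))" for j x
    unfolding f_def c1_compact_of_real(2)[OF c] using partial_shift[OF smooth_differentiable[OF s]] by simp
  define m where "m = (\<lambda>j \<xi>. heat_symbol \<beta> t \<xi> * leray_symbol j k \<xi> * deriv_symbol l \<xi> :: complex)"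
  have mi: "integrable lborel (m j)" for j unfolding m_def by (rule oseen_symbol_integrable[OF t \<beta>(1)])
  define G where "G = (\<lambda>\<xi>. of_real (1 / (2 * pi) ^ CARD('n)) * (LINT x|lborel. iexp (x \<bullet> \<xi>) * f x))"
  have pfi: "integrable lborel (partial j f)" for j using c1_compact_integrable(2)[OF f] .
  have sh: "(LINT x|lborel. oseen_kernel \<beta> t j k l (x - y) * partial j \<psi> x) = (LINT x|lborel. oseen_kernel \<beta> t j k l x * partial j \<psi> (x + y))" for j
    using lborel_integral_affine[of 1 "\<lambda>x. oseen_kernel \<beta> t j k l (x - y) * partial j \<psi> x" y] by (simp add: add.commute)
  have zero: "(\<Sum>j\<in>UNIV. - \<i> * of_real (\<xi> $ j) * G \<xi> * m j \<xi>) = 0" for \<xi>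
  proof -
    have "(\<Sum>j\<in>UNIV. of_real (\<xi> $ j) * leray_symbol j k \<xi>) = (0 :: complex)"
    proof (cases "\<xi> = 0")
      case False
      have n: "(\<Sum>j\<in>UNIV. (\<xi> $ j) * (\<xi> $ j)) = norm \<xi> * norm \<xi>"
        by (simp add: norm_vec_def L2_set_def sum_nonneg power2_eq_square)
      have "of_real (\<xi> $ j) * leray_symbol j k \<xi> = (if j = k then of_real (\<xi> $ j) else 0) - of_real ((\<xi> $ j) * (\<xi> $ j)) * (of_real (\<xi> $ k) / of_real (norm \<xi> * norm \<xi>) :: complex)" for j
        by (simp add: leray_symbol_def riesz_symbol_def deriv_symbol_def algebra_simps)
      then have "(\<Sum>j\<in>UNIV. of_real (\<xi> $ j) * leray_symbol j k \<xi>) = (\<Sum>j\<in>UNIV. (if j = k then of_real (\<xi> $ j) else 0)) - (\<Sum>j\<in>UNIV. of_real ((\<xi> $ j) * (\<xi> $ j))) * (of_real (\<xi> $ k) / of_real (norm \<xi> * norm \<xi>) :: complex)"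
        by (simp only: sum_subtractf sum_distrib_right)
      also have "(\<Sum>j\<in>UNIV. of_real ((\<xi> $ j) * (\<xi> $ j))) = (of_real (norm \<xi> * norm \<xi>) :: complex)"
        unfolding n[symmetric] by (simp only: of_real_sum)
      finally show ?thesis using False by simp
    qed simp
    moreover have "(\<Sum>j\<in>UNIV. - \<i> * of_real (\<xi> $ j) * G \<xi> * m j \<xi>) = - \<i> * G \<xi> * heat_symbol \<beta> t \<xi> * deriv_symbol l \<xi> * (\<Sum>j\<in>UNIV. of_real (\<xi> $ j) * leray_symbol j k \<xi>)"
      unfolding m_def sum_distrib_left by (rule sum.cong) (simp_all add: mult_ac)
    ultimately show ?thesis by simp
  qed
  have "complex_of_real (LINT x|lborel. oseen_kernel \<beta> t j k l x * partial j \<psi> (x + y)) = (LINT \<xi>|lborel. - \<i> * of_real (\<xi> $ j) * G \<xi> * m j \<xi>)" for j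
  proof -
    have "complex_of_real (LINT x|lborel. oseen_kernel \<beta> t j k l x * partial j \<psi> (x + y)) = (LINT x|lborel. partial j f x * inverse_fourier (m j) x)"
      unfolding pf m_def oseen_kernel_complex by (simp add: mult.commute flip: of_real_mult)
    also have "\<dots> = (LINT \<xi>|lborel. of_real (1 / (2 * pi) ^ CARD('n)) * (LINT x|lborel. iexp (x \<bullet> \<xi>) * partial j f x) * m j \<xi>)"
      by (rule integral_mult_inverse_fourier[OF pfi mi])
    also have "\<dots> = (LINT \<xi>|lborel. - \<i> * of_real (\<xi> $ j) * G \<xi> * m j \<xi>)"
      unfolding G_def using c1_compact_fourier_partial[OF f] by (simp add: inner_commute mult_ac)
    finally show ?thesis .
  qed
  moreover have "integrable lborel (\<lambda>\<xi>. - \<i> * of_real (\<xi> $ j) * G \<xi> * m j \<xi>)" for j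
  proof -
    define GB where "GB = 1 / (2 * pi) ^ CARD('n) * (LINT x|lborel. norm (f x))"
    have GB: "norm (G \<xi>) \<le> GB" for \<xi>
      using inverse_fourier_bound[of f \<xi>] unfolding G_def GB_def inverse_fourier_def by (simp add: inner_commute)
    have GB0: "GB \<ge> 0" using order_trans[OF norm_ge_zero GB] .
    have fm [measurable]: "f \<in> borel_measurable borel" using c1_compact_integrable(1)[OF f] by simp
    have [measurable]: "G \<in> borel_measurable borel" unfolding G_def by measurable
    have "integrable lborel (\<lambda>\<xi>. (- \<i> * of_real (\<xi> $ j) * G \<xi> * (leray_symbol j k \<xi> * deriv_symbol l \<xi>)) * heat_symbol \<beta> t \<xi>)"
    proof (rule integrable_poly_heat_symbol[OF _ _ t \<beta>(1), where A = "2 * GB" and N = 2])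
      fix \<xi> :: "real^'n"
      have "norm (- \<i> * of_real (\<xi> $ j) * G \<xi> * (leray_symbol j k \<xi> * deriv_symbol l \<xi>)) \<le> (1 + (norm \<xi>)\<^sup>2) * GB * (2 * (1 + (norm \<xi>)\<^sup>2) ^ 1)"
        unfolding norm_mult[of _ "leray_symbol j k \<xi> * deriv_symbol l \<xi>"] norm_mult[of _ "G \<xi>"]
        using order_trans[OF component_le_norm_cart le_one_plus_sq, of \<xi> j] GB0
        by (intro mult_mono oseen_symbol_bound GB) (auto simp: norm_mult)
      then show "norm (- \<i> * of_real (\<xi> $ j) * G \<xi> * (leray_symbol j k \<xi> * deriv_symbol l \<xi>)) \<le> 2 * GB * (1 + (norm \<xi>)\<^sup>2) ^ 2"
        by (simp only: power_one_right power2_eq_square mult_ac)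
    qed measurable
    then show ?thesis unfolding m_def by (simp add: mult_ac)
  qed
  ultimately have "complex_of_real (\<Sum>j\<in>UNIV. LINT x|lborel. oseen_kernel \<beta> t j k l (x - y) * partial j \<psi> x)
     = (LINT \<xi>|lborel. (\<Sum>j\<in>UNIV. - \<i> * of_real (\<xi> $ j) * G \<xi> * m j \<xi>))"
    unfolding sh of_real_sum by simp
  also have "\<dots> = 0" unfolding zero by simp
  finally show ?thesis by (simp only: of_real_eq_0_iff)
qed

section \<open>Convolution\<close>

lemma conv_flip:
  fixes k :: "real^'n \<Rightarrow> real"
  shows "conv k f x = (LINT z|lborel. k z * f (x - z))"
  unfolding conv_def using lborel_integral_affine[of "-1" "\<lambda>y. f y *\<^sub>R k (x - y)" x] by (simp add: mult.commute)

lemma lborel_integrable_flip: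
  fixes k :: "'a::euclidean_space \<Rightarrow> 'b::{banach, second_countable_topology}"
  assumes "integrable lborel k"
  shows "integrable lborel (\<lambda>y. k (x - y))" "(LINT y|lborel. k (x - y)) = (LINT y|lborel. k y)"
  using lborel_integrable_affine[OF assms, of "-1" x] lborel_integral_affine[of "-1" k x] by simp_all

lemma conv_bounded:
  fixes k g :: "real^'n \<Rightarrow> real"
  assumes k: "integrable lborel k" and g [measurable]: "g \<in> borel_measurable borel" and G: "\<And>y. \<bar>g y\<bar> \<le> G"
  shows "integrable lborel (\<lambda>y. g y * k (x - y))" "\<bar>conv k g x\<bar> \<le> G * (LINT y|lborel. \<bar>k y\<bar>)"
proof -
  have [measurable]: "k \<in> borel_measurable borel" using k by simp
  have G0: "G \<ge> 0" using order_trans[OF abs_ge_zero G] .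
  have ik: "integrable lborel (\<lambda>y. \<bar>k (x - y)\<bar>)" "(LINT y|lborel. \<bar>k (x - y)\<bar>) = (LINT y|lborel. \<bar>k y\<bar>)"
    using lborel_integrable_flip[OF integrable_abs[OF k]] by auto
  have b: "\<bar>g y * k (x - y)\<bar> \<le> G * \<bar>k (x - y)\<bar>" for y
    unfolding abs_mult by (intro mult_right_mono G) auto
  show i: "integrable lborel (\<lambda>y. g y * k (x - y))"
  proof (rule Bochner_Integration.integrable_bound)
    show "integrable lborel (\<lambda>y. G * \<bar>k (x - y)\<bar>)" using ik by simp
    show "AE y in lborel. norm (g y * k (x - y)) \<le> norm (G * \<bar>k (x - y)\<bar>)"
      using b G0 by (simp add: abs_mult)
  qed measurable
  have "\<bar>conv k g x\<bar> \<le> (LINT y|lborel. \<bar>g y * k (x - y)\<bar>)"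
    unfolding conv_def using integral_abs_bound[of lborel "\<lambda>y. g y * k (x - y)"] by simp
  also have "\<dots> \<le> (LINT y|lborel. G * \<bar>k (x - y)\<bar>)"
    using i ik b by (intro integral_mono) auto
  finally show "\<bar>conv k g x\<bar> \<le> G * (LINT y|lborel. \<bar>k y\<bar>)" using ik by simp
qed

lemma conv_assoc:
  fixes K L g :: "real^'n \<Rightarrow> real"
  assumes i: "integrable (lborel \<Otimes>\<^sub>M lborel) (\<lambda>(z, y). g y * (K z * L (x - y - z)))"
  shows "conv (\<lambda>x. LINT z|lborel. K z * L (x - z)) g x = conv K (conv L g) x"
proof -
  have "conv (\<lambda>x. LINT z|lborel. K z * L (x - z)) g x = (LINT y|lborel. LINT z|lborel. g y * (K z * L (x - y - z)))"
    unfolding conv_def by simp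
  also have "\<dots> = (LINT z|lborel. LINT y|lborel. g y * (K z * L (x - y - z)))"
    using lborel_pair.Fubini_integral[OF i] by simp
  also have "\<dots> = (LINT z|lborel. K z * (LINT y|lborel. g y * L (x - z - y)))"
    unfolding integral_mult_right_zero[symmetric] by (simp add: mult_ac diff_diff_eq add.commute)
  finally show ?thesis unfolding conv_flip[of K] by (simp add: conv_def)
qed

text \<open>Initial data may be unbounded, so \<open>g\<close> is controlled only through its convolutions with \<open>\<bar>L\<bar>\<close>.\<close>

lemma conv_assoc_L1:
  fixes K L g :: "real^'n \<Rightarrow> real"
  assumes K: "integrable lborel K" and [measurable]: "L \<in> borel_measurable borel" "g \<in> borel_measurable borel"
    and i: "\<And>x. integrable lborel (\<lambda>y. g y * L (x - y))" and G: "\<And>x. (LINT y|lborel. \<bar>g y * L (x - y)\<bar>) \<le> G"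
  shows "conv (\<lambda>x. LINT z|lborel. K z * L (x - z)) g x = conv K (conv L g) x"
proof (rule conv_assoc)
  have [measurable]: "K \<in> borel_measurable borel" using K by auto
  have e: "g y * (K z * L (x - y - z)) = K z * (g y * L ((x - z) - y))" for y z
    by (simp add: mult_ac diff_diff_eq add.commute)
  show "integrable (lborel \<Otimes>\<^sub>M lborel) (\<lambda>(z, y). g y * (K z * L (x - y - z)))"
    unfolding e
  proof (rule lborel_pair.Fubini_integrable)
    show "AE z in lborel. integrable lborel (\<lambda>y. case (z, y) of (z, y) \<Rightarrow> K z * (g y * L (x - z - y)))"
      using i by simp
    have b: "(LINT y|lborel. \<bar>K z * (g y * L (x - z - y))\<bar>) \<le> \<bar>K z\<bar> * G" for z
      unfolding abs_mult[of "K z"] integral_mult_right_zero by (intro mult_left_mono G) auto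
    show "integrable lborel (\<lambda>z. LINT y|lborel. norm (case (z, y) of (z, y) \<Rightarrow> K z * (g y * L (x - z - y))))"
    proof (rule Bochner_Integration.integrable_bound)
      show "integrable lborel (\<lambda>z. \<bar>K z\<bar> * G)" using K by simp
      show "AE z in lborel. norm (LINT y|lborel. norm (case (z, y) of (z, y) \<Rightarrow> K z * (g y * L (x - z - y)))) \<le> norm (\<bar>K z\<bar> * G)"
      proof (rule AE_I2)
        fix z
        have "0 \<le> (LINT y|lborel. \<bar>K z * (g y * L (x - z - y))\<bar>)" by simp
        then show "norm (LINT y|lborel. norm (case (z, y) of (z, y) \<Rightarrow> K z * (g y * L (x - z - y)))) \<le> norm (\<bar>K z\<bar> * G)"
          using b[of z] unfolding real_norm_def prod.case by linarith
      qed
    qed measurable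
  qed measurable
qed

lemma conv_commute_L1:
  fixes K L g :: "real^'n \<Rightarrow> real"
  assumes K: "integrable lborel K" and L: "integrable lborel L" and g: "g \<in> borel_measurable borel"
    and "\<And>x. integrable lborel (\<lambda>y. g y * L (x - y))" "\<And>x. (LINT y|lborel. \<bar>g y * L (x - y)\<bar>) \<le> G"
    and "\<And>x. integrable lborel (\<lambda>y. g y * K (x - y))" "\<And>x. (LINT y|lborel. \<bar>g y * K (x - y)\<bar>) \<le> H"
  shows "conv K (conv L g) x = conv L (conv K g) x"
proof -
  have e: "(\<lambda>x. LINT z|lborel. K z * L (x - z)) = (\<lambda>x. LINT z|lborel. L z * K (x - z))"
  proof
    fix x
    show "(LINT z|lborel. K z * L (x - z)) = (LINT z|lborel. L z * K (x - z))"
      using lborel_integral_affine[of "-1" "\<lambda>z. K z * L (x - z)" x] by (simp add: mult.commute)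
  qed
  have m: "K \<in> borel_measurable borel" "L \<in> borel_measurable borel" using K L by auto
  show ?thesis using conv_assoc_L1[OF K m(2) g assms(4,5), of x] conv_assoc_L1[OF L m(1) g assms(6,7), of x] e by simp
qed

lemma conv_abs_bounded:
  fixes L g :: "real^'n \<Rightarrow> real"
  assumes L: "integrable lborel L" and g: "g \<in> borel_measurable borel" and G: "\<And>y. \<bar>g y\<bar> \<le> G"
  shows "(LINT y|lborel. \<bar>g y * L (x - y)\<bar>) \<le> G * (LINT y|lborel. \<bar>L y\<bar>)"
proof -
  have "\<bar>conv (\<lambda>y. \<bar>L y\<bar>) (\<lambda>y. \<bar>g y\<bar>) x\<bar> \<le> G * (LINT y|lborel. \<bar>\<bar>L y\<bar>\<bar>)"
    by (rule conv_bounded) (use L G g in auto)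
  then show ?thesis unfolding conv_def by (simp add: abs_mult)
qed

lemma conv_assoc_bounded:
  fixes K L g :: "real^'n \<Rightarrow> real"
  assumes K: "integrable lborel K" and L: "integrable lborel L" and g: "g \<in> borel_measurable borel" and G: "\<And>y. \<bar>g y\<bar> \<le> G"
  shows "conv (\<lambda>x. LINT z|lborel. K z * L (x - z)) g x = conv K (conv L g) x"
  by (rule conv_assoc_L1[OF K _ g conv_bounded(1)[OF L g G] conv_abs_bounded[OF L g G]]) (use L in simp)

text \<open>A bounded function becomes as regular as the kernel is under translation in \<open>L\<^sup>1\<close>.\<close>

lemma conv_modulus:
  fixes K h :: "real^'n \<Rightarrow> real"
  assumes K: "integrable lborel K" and h [measurable]: "h \<in> borel_measurable borel" and G: "\<And>y. \<bar>h y\<bar> \<le> G"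
  shows "\<bar>conv K h x - conv K h x'\<bar> \<le> G * (LINT z|lborel. \<bar>K (z + (x - x')) - K z\<bar>)"
proof -
  let ?D = "\<lambda>z. K (z + (x - x')) - K z"
  have D: "integrable lborel ?D"
    using K lborel_integrable_affine[OF K, of 1 "x - x'"] by (simp add: add.commute)
  have "conv K h x - conv K h x' = conv ?D h x'"
    unfolding conv_def using conv_bounded(1)[OF K h G, of x] conv_bounded(1)[OF K h G, of x']
    by (simp add: right_diff_distrib algebra_simps flip: Bochner_Integration.integral_diff)
  then show ?thesis using conv_bounded(2)[OF D h G, of x'] by simp
qed

lemma borel_measurable_vec_nth [measurable (raw)]:
  fixes f :: "'a \<Rightarrow> real^'n"
  assumes "f \<in> borel_measurable M" shows "(\<lambda>x. f x $ i) \<in> borel_measurable M"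
  using assms by (rule measurable_compose) (simp add: borel_measurable_continuous_onI continuous_on_component)

section \<open>Bilinear kernel estimates\<close>

lemma heat_leray_div_nth:
  "heat_leray_div \<beta> t u v x $ j = (\<Sum>k\<in>UNIV. \<Sum>l\<in>UNIV. conv (oseen_kernel \<beta> t j k l) (\<lambda>y. u y $ l * v y $ k) x)"
  unfolding heat_leray_div_def by simp

lemma norm_vec_le_sum: "norm (x::real^'n) \<le> (\<Sum>j\<in>UNIV. \<bar>x $ j\<bar>)"
  by (rule norm_le_l1_cart)

lemma abs_component_mult_le:
  fixes u v :: "real^'n"
  assumes "norm u \<le> A" "norm v \<le> B"
  shows "\<bar>u $ l * v $ k\<bar> \<le> A * B"
  unfolding abs_mult using assms order_trans[OF norm_ge_zero assms(1)]
  by (intro mult_mono order_trans[OF component_le_norm_cart]) auto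

lemma heat_leray_div_bound_gen:
  fixes u v :: "real^'n \<Rightarrow> real^'n"
  assumes "\<And>j k l. \<bar>conv (oseen_kernel \<beta> t j k l) (\<lambda>y. u y $ l * v y $ k) x - conv (oseen_kernel \<beta> t j k l) (\<lambda>y. u y $ l * v y $ k) x'\<bar> \<le> M"
  shows "norm (heat_leray_div \<beta> t u v x - heat_leray_div \<beta> t u v x') \<le> real CARD('n) ^ 3 * M"
proof -
  have "norm (heat_leray_div \<beta> t u v x - heat_leray_div \<beta> t u v x') \<le> (\<Sum>j\<in>UNIV. \<bar>(heat_leray_div \<beta> t u v x - heat_leray_div \<beta> t u v x') $ j\<bar>)"
    by (rule norm_vec_le_sum)
  also have "\<dots> \<le> (\<Sum>j\<in>(UNIV::'n set). \<Sum>k\<in>(UNIV::'n set). \<Sum>l\<in>(UNIV::'n set). M)"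
    unfolding vector_minus_component heat_leray_div_nth sum_subtractf[symmetric]
    by (intro sum_mono order_trans[OF sum_abs] assms)
  also have "\<dots> = real CARD('n) ^ 3 * M" by (simp add: power3_eq_cube mult_ac)
  finally show ?thesis .
qed

lemma heat_leray_div_bound_gen0:
  fixes u v :: "real^'n \<Rightarrow> real^'n"
  assumes "\<And>j k l. \<bar>conv (oseen_kernel \<beta> t j k l) (\<lambda>y. u y $ l * v y $ k) x\<bar> \<le> M"
  shows "norm (heat_leray_div \<beta> t u v x) \<le> real CARD('n) ^ 3 * M"
proof -
  have "norm (heat_leray_div \<beta> t u v x) \<le> (\<Sum>j\<in>UNIV. \<bar>heat_leray_div \<beta> t u v x $ j\<bar>)"
    by (rule norm_vec_le_sum)
  also have "\<dots> \<le> (\<Sum>j\<in>(UNIV::'n set). \<Sum>k\<in>(UNIV::'n set). \<Sum>l\<in>(UNIV::'n set). M)"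
    unfolding heat_leray_div_nth
    by (intro sum_mono order_trans[OF sum_abs] assms)
  also have "\<dots> = real CARD('n) ^ 3 * M" by (simp add: power3_eq_cube mult_ac)
  finally show ?thesis .
qed

text \<open>Three estimates for \<open>exp(-t(-\<triangle>)\<^sup>\<beta>) P \<nabla>\<cdot>(u \<otimes> v)\<close>: the sup bound; a Hoelder bound from sup norms
alone, which costs \<open>t powr (-\<sigma>/(2\<beta>))\<close>; and a Hoelder bound in terms of those of \<open>u\<close> and \<open>v\<close>, at no
extra cost.\<close>

definition leray_bounds :: "'n::finite itself \<Rightarrow> real \<Rightarrow> real \<Rightarrow> real \<Rightarrow> bool" where
  "leray_bounds _ \<beta> \<sigma> C \<longleftrightarrow> (\<forall>t>0. \<forall>u v :: real^'n \<Rightarrow> real^'n. \<forall>A B. u \<in> borel_measurable borel \<longrightarrow> v \<in> borel_measurable borel \<longrightarrow>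
      (\<forall>y. norm (u y) \<le> A) \<longrightarrow> (\<forall>y. norm (v y) \<le> B) \<longrightarrow>
      (\<forall>x. norm (heat_leray_div \<beta> t u v x) \<le> C * t powr (- (1 / (2 * \<beta>))) * (A * B)) \<and>
      (\<forall>x x'. norm (heat_leray_div \<beta> t u v x - heat_leray_div \<beta> t u v x') \<le> C * t powr (- (\<sigma> / (2 * \<beta>)) - 1 / (2 * \<beta>)) * (A * B) * norm (x - x') powr \<sigma>) \<and>
      (\<forall>Hu Hv. (\<forall>y y'. norm (u y - u y') \<le> Hu * norm (y - y') powr \<sigma>) \<longrightarrow> (\<forall>y y'. norm (v y - v y') \<le> Hv * norm (y - y') powr \<sigma>) \<longrightarrow>
        (\<forall>x x'. norm (heat_leray_div \<beta> t u v x - heat_leray_div \<beta> t u v x') \<le> C * t powr (- (1 / (2 * \<beta>))) * (A * Hv + B * Hu) * norm (x - x') powr \<sigma>)))"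

lemma leray_boundsD:
  fixes u v :: "real^'n \<Rightarrow> real^'n"
  assumes L: "leray_bounds TYPE('n) \<beta> \<sigma> C" and t: "t > 0" and m: "u \<in> borel_measurable borel" "v \<in> borel_measurable borel"
    and A: "\<And>y. norm (u y) \<le> A" and B: "\<And>y. norm (v y) \<le> B"
  shows "norm (heat_leray_div \<beta> t u v x) \<le> C * t powr (- (1 / (2 * \<beta>))) * (A * B)"
    "norm (heat_leray_div \<beta> t u v x - heat_leray_div \<beta> t u v x') \<le> C * t powr (- (\<sigma> / (2 * \<beta>)) - 1 / (2 * \<beta>)) * (A * B) * norm (x - x') powr \<sigma>"
    "(\<And>y y'. norm (u y - u y') \<le> Hu * norm (y - y') powr \<sigma>) \<Longrightarrow> (\<And>y y'. norm (v y - v y') \<le> Hv * norm (y - y') powr \<sigma>) \<Longrightarrow>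
      norm (heat_leray_div \<beta> t u v x - heat_leray_div \<beta> t u v x') \<le> C * t powr (- (1 / (2 * \<beta>))) * (A * Hv + B * Hu) * norm (x - x') powr \<sigma>"
  using L[unfolded leray_bounds_def, rule_format, OF t m A B] by blast+

text \<open>For the second estimate half of the time goes to the heat kernel and its translation modulus. For
the third the translation acts on the product \<open>u\<^sub>l v\<^sub>k\<close>.\<close>

lemma heat_leray_div_bound:
  fixes dummy :: "'n::finite"
  assumes \<beta>: "0 < \<beta>" "\<beta> < 1" and sg: "0 < \<sigma>" "\<sigma> \<le> 1"
  shows "\<exists>C>0. leray_bounds TYPE('n) \<beta> \<sigma> C"
proof -
  obtain C0 where C0: "C0 > 0" and O: "\<And>t j k l. t > 0 \<Longrightarrow> integrable lborel (oseen_kernel \<beta> t j k (l::'n))"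
    "\<And>t j k l. t > 0 \<Longrightarrow> (LINT x|lborel. \<bar>oseen_kernel \<beta> t j k (l::'n) x\<bar>) \<le> C0 * t powr (- (1 / (2 * \<beta>)))"
    using oseen_kernel_L1[OF \<beta>, where 'n='n] by auto
  obtain C1 where C1: "C1 > 0" and Kmod: "\<And>t h. t > 0 \<Longrightarrow> (LINT x|lborel. \<bar>heat_kernel \<beta> t (x + h) - heat_kernel \<beta> t (x::real^'n)\<bar>) \<le> C1 * norm h powr \<sigma> * t powr (- (\<sigma> / (2 * \<beta>)))"
    using heat_kernel_modulus[OF \<beta> sg, where 'n='n] by auto
  define q where "q = 1 / (2 * \<beta>)"
  define r where "r = \<sigma> / (2 * \<beta>)"
  define C2 where "C2 = C0 * C1 * 2 powr (r + q)"
  define C where "C = real CARD('n) ^ 3 * (C0 + C2)"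
  have C2: "C2 > 0" using C0 C1 by (simp add: C2_def)
  have C: "C > 0" using C0 C2 by (simp add: C_def)
  have CC: "real CARD('n) ^ 3 * C0 \<le> C" "real CARD('n) ^ 3 * C2 \<le> C" using C0 C2 by (simp_all add: C_def mult_left_mono)
  have "(\<forall>x. norm (heat_leray_div \<beta> t u v x) \<le> C * t powr (- q) * (A * B)) \<and>
      (\<forall>x x'. norm (heat_leray_div \<beta> t u v x - heat_leray_div \<beta> t u v x') \<le> C * t powr (- r - q) * (A * B) * norm (x - x') powr \<sigma>) \<and>
      (\<forall>Hu Hv. (\<forall>y y'. norm (u y - u y') \<le> Hu * norm (y - y') powr \<sigma>) \<longrightarrow> (\<forall>y y'. norm (v y - v y') \<le> Hv * norm (y - y') powr \<sigma>) \<longrightarrow>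
        (\<forall>x x'. norm (heat_leray_div \<beta> t u v x - heat_leray_div \<beta> t u v x') \<le> C * t powr (- q) * (A * Hv + B * Hu) * norm (x - x') powr \<sigma>))"
    if t: "t > 0" and um [measurable]: "u \<in> borel_measurable borel" and vm [measurable]: "v \<in> borel_measurable borel"
      and A: "\<And>y. norm (u y) \<le> A" and B: "\<And>y. norm (v y) \<le> B" for t A B and u v :: "real^'n \<Rightarrow> real^'n"
  proof (intro conjI allI impI)
    have AB: "A \<ge> 0" "B \<ge> 0" using order_trans[OF norm_ge_zero A] order_trans[OF norm_ge_zero B] by auto
    have g: "\<bar>u y $ l * v y $ k\<bar> \<le> A * B" for y l k by (rule abs_component_mult_le[OF A B])
    have gm: "(\<lambda>y. u y $ l * v y $ k) \<in> borel_measurable borel" for l k by measurable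
    fix x
    have b0: "\<bar>conv (oseen_kernel \<beta> s j k l) (\<lambda>y. u y $ l * v y $ k) x\<bar> \<le> (A * B) * (C0 * s powr (- q))" if "s > 0" for s j k l x
      by (rule order_trans[OF conv_bounded(2)[OF O(1)[OF that] gm g]]) (use O(2)[OF that] AB in \<open>auto simp: q_def intro!: mult_left_mono\<close>)
    have "norm (heat_leray_div \<beta> t u v x) \<le> real CARD('n) ^ 3 * ((A * B) * (C0 * t powr (- q)))"
      by (rule heat_leray_div_bound_gen0[OF b0[OF t]])
    also have "\<dots> = (real CARD('n) ^ 3 * C0) * (t powr (- q) * (A * B))" by (simp add: mult_ac)
    also have "\<dots> \<le> C * (t powr (- q) * (A * B))" using AB by (intro mult_right_mono CC) auto
    finally show "norm (heat_leray_div \<beta> t u v x) \<le> C * t powr (- q) * (A * B)" by (simp add: mult_ac)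
    fix x'
    have t2: "t / 2 > 0" using t by simp
    have b1: "\<bar>conv (oseen_kernel \<beta> t j k l) (\<lambda>y. u y $ l * v y $ k) x - conv (oseen_kernel \<beta> t j k l) (\<lambda>y. u y $ l * v y $ k) x'\<bar>
      \<le> C2 * t powr (- r - q) * (A * B) * norm (x - x') powr \<sigma>" for j k l
    proof -
      define G where "G = conv (oseen_kernel \<beta> (t/2) j k l) (\<lambda>y. u y $ l * v y $ k)"
      have Gm: "G \<in> borel_measurable borel" unfolding G_def conv_def by measurable
      have Gb: "\<bar>G y\<bar> \<le> (A * B) * (C0 * (t/2) powr (- q))" for y unfolding G_def by (rule b0[OF t2])
      have "oseen_kernel \<beta> t j k l = (\<lambda>x. LINT z|lborel. heat_kernel \<beta> (t/2) z * oseen_kernel \<beta> (t/2) j k l (x - z))"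
        using oseen_kernel_semigroup[OF \<beta> t2 t2, of j k l] by auto
      then have e: "conv (oseen_kernel \<beta> t j k l) (\<lambda>y. u y $ l * v y $ k) x = conv (heat_kernel \<beta> (t/2)) G x" for x
        unfolding G_def using conv_assoc_bounded[OF heat_kernel_L1(1)[OF \<beta> t2] O(1)[OF t2] gm g] by simp
      have "\<bar>conv (heat_kernel \<beta> (t/2)) G x - conv (heat_kernel \<beta> (t/2)) G x'\<bar> \<le> (A * B) * (C0 * (t/2) powr (- q)) * (LINT z|lborel. \<bar>heat_kernel \<beta> (t/2) (z + (x - x')) - heat_kernel \<beta> (t/2) z\<bar>)"
        by (rule conv_modulus[OF heat_kernel_L1(1)[OF \<beta> t2] Gm Gb])
      also have "\<dots> \<le> (A * B) * (C0 * (t/2) powr (- q)) * (C1 * norm (x - x') powr \<sigma> * (t/2) powr (- r))"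
        using Kmod[OF t2, of "x - x'"] AB C0 unfolding r_def by (intro mult_left_mono) auto
      also have "\<dots> = C0 * C1 * ((t/2) powr (- q) * (t/2) powr (- r)) * (A * B) * norm (x - x') powr \<sigma>" by (simp add: mult_ac)
      also have "(t/2) powr (- q) * (t/2) powr (- r) = 2 powr (r + q) * t powr (- r - q)"
        using t by (simp add: powr_divide powr_minus powr_diff powr_add field_simps)
      finally show ?thesis unfolding e C2_def by (simp add: mult_ac)
    qed
    have "norm (heat_leray_div \<beta> t u v x - heat_leray_div \<beta> t u v x') \<le> real CARD('n) ^ 3 * (C2 * t powr (- r - q) * (A * B) * norm (x - x') powr \<sigma>)"
      by (rule heat_leray_div_bound_gen[OF b1])
    also have "\<dots> = (real CARD('n) ^ 3 * C2) * (t powr (- r - q) * (A * B) * norm (x - x') powr \<sigma>)" by (simp add: mult_ac)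
    also have "\<dots> \<le> C * (t powr (- r - q) * (A * B) * norm (x - x') powr \<sigma>)" using AB by (intro mult_right_mono CC) auto
    finally show "norm (heat_leray_div \<beta> t u v x - heat_leray_div \<beta> t u v x') \<le> C * t powr (- r - q) * (A * B) * norm (x - x') powr \<sigma>" by (simp add: mult_ac)
    fix Hu Hv
    assume Hu: "\<forall>y y'. norm (u y - u y') \<le> Hu * norm (y - y') powr \<sigma>" and Hv: "\<forall>y y'. norm (v y - v y') \<le> Hv * norm (y - y') powr \<sigma>"
    have H0: "Hu \<ge> 0" "Hv \<ge> 0"
      using order_trans[OF norm_ge_zero Hu[rule_format, of "axis undefined 1" 0]] order_trans[OF norm_ge_zero Hv[rule_format, of "axis undefined 1" 0]] by auto
    have b2: "\<bar>conv (oseen_kernel \<beta> t j k l) (\<lambda>y. u y $ l * v y $ k) x - conv (oseen_kernel \<beta> t j k l) (\<lambda>y. u y $ l * v y $ k) x'\<bar>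
      \<le> C0 * t powr (- q) * ((A * Hv + B * Hu) * norm (x - x') powr \<sigma>)" for j k l
    proof -
      let ?g = "\<lambda>y. u y $ l * v y $ k"
      have d: "\<bar>?g y - ?g y'\<bar> \<le> (A * Hv + B * Hu) * norm (y - y') powr \<sigma>" for y y'
      proof -
        have "?g y - ?g y' = u y $ l * (v y - v y') $ k + (u y - u y') $ l * v y' $ k" by (simp add: algebra_simps)
        then have "\<bar>?g y - ?g y'\<bar> \<le> \<bar>u y $ l * (v y - v y') $ k\<bar> + \<bar>(u y - u y') $ l * v y' $ k\<bar>"
          by (simp only: abs_triangle_ineq)
        also have "\<dots> \<le> A * (Hv * norm (y - y') powr \<sigma>) + (Hu * norm (y - y') powr \<sigma>) * B"
          by (intro add_mono abs_component_mult_le A B Hu[rule_format] Hv[rule_format])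
        finally have "\<bar>?g y - ?g y'\<bar> \<le> A * (Hv * norm (y - y') powr \<sigma>) + (Hu * norm (y - y') powr \<sigma>) * B" .
        then show ?thesis by (simp add: algebra_simps)
      qed
      define dx where "dx = (\<lambda>y. ?g (y + (x - x')) - ?g y)"
      have dxm: "dx \<in> borel_measurable borel" unfolding dx_def by measurable
      have dxb: "\<bar>dx y\<bar> \<le> (A * Hv + B * Hu) * norm (x - x') powr \<sigma>" for y
        using d[of "y + (x - x')" y] by (simp add: dx_def)
      have "conv (oseen_kernel \<beta> t j k l) ?g x - conv (oseen_kernel \<beta> t j k l) ?g x' = conv (oseen_kernel \<beta> t j k l) dx x'"
      proof -
        have i: "integrable lborel (\<lambda>z. oseen_kernel \<beta> t j k l z * ?g (x - z))" for x
        proof -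
          have "integrable lborel (\<lambda>y. ?g (x - (x - y)) * oseen_kernel \<beta> t j k l (x - y))"
            using conv_bounded(1)[OF O(1)[OF t, of j k l] gm[of l k] g[of _ l k], of x] by simp
          from lborel_integrable_flip(1)[OF this, of x] show ?thesis by (simp add: mult.commute)
        qed
        have "dx (x' - z) = ?g (x - z) - ?g (x' - z)" for z by (simp add: dx_def algebra_simps)
        then show ?thesis unfolding conv_flip using i by (simp add: right_diff_distrib)
      qed
      moreover have "\<bar>conv (oseen_kernel \<beta> t j k l) dx x'\<bar> \<le> ((A * Hv + B * Hu) * norm (x - x') powr \<sigma>) * (C0 * t powr (- q))"
        by (rule order_trans[OF conv_bounded(2)[OF O(1)[OF t] dxm dxb]])
           (use O(2)[OF t] AB H0 in \<open>auto simp: q_def intro!: mult_left_mono mult_nonneg_nonneg\<close>)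
      ultimately show ?thesis by (simp add: mult_ac)
    qed
    have "norm (heat_leray_div \<beta> t u v x - heat_leray_div \<beta> t u v x') \<le> real CARD('n) ^ 3 * (C0 * t powr (- q) * ((A * Hv + B * Hu) * norm (x - x') powr \<sigma>))"
      by (rule heat_leray_div_bound_gen[OF b2])
    also have "\<dots> = (real CARD('n) ^ 3 * C0) * (t powr (- q) * ((A * Hv + B * Hu) * norm (x - x') powr \<sigma>))" by (simp add: mult_ac)
    also have "\<dots> \<le> C * (t powr (- q) * ((A * Hv + B * Hu) * norm (x - x') powr \<sigma>))" using AB H0 by (intro mult_right_mono CC) auto
    finally show "norm (heat_leray_div \<beta> t u v x - heat_leray_div \<beta> t u v x') \<le> C * t powr (- q) * (A * Hv + B * Hu) * norm (x - x') powr \<sigma>" by (simp add: mult_ac)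
  qed
  note main = this
  have "leray_bounds TYPE('n) \<beta> \<sigma> C"
    unfolding leray_bounds_def q_def[symmetric] r_def[symmetric]
    by (intro allI impI) (rule main; blast)
  then show ?thesis using C by blast
qed

section \<open>The Duhamel term in critical weights\<close>

text \<open>The Beta integral, rescaled from \<open>(0,1)\<close> to \<open>(0,t)\<close>.\<close>

lemma time_weight_integral:
  fixes e q t :: real
  assumes e: "e < 1" and q: "q < 1" and t: "t > 0"
  shows "has_bochner_integral lborel (\<lambda>s. indicator {0<..<t} s * ((t - s) powr (- e) * s powr (- q))) (t powr (1 - e - q) * Beta (1 - q) (1 - e))"
proof -
  have H: "((\<lambda>s. s powr ((1 - q) - 1) * (1 - s) powr ((1 - e) - 1)) has_integral Beta (1 - q) (1 - e)) {0..1}"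
    by (rule has_integral_Beta_real) (use e q in auto)
  then have "(\<lambda>s. s powr ((1 - q) - 1) * (1 - s) powr ((1 - e) - 1)) absolutely_integrable_on {0..1}"
    by (intro nonnegative_absolutely_integrable_1) (auto simp: integrable_on_def)
  then have "set_integrable lebesgue {0..1} (\<lambda>s. s powr ((1 - q) - 1) * (1 - s) powr ((1 - e) - 1))" .
  then have si: "set_integrable lborel {0..1} (\<lambda>s. s powr ((1 - q) - 1) * (1 - s) powr ((1 - e) - 1) :: real)"
    unfolding set_integrable_def by (subst (asm) integrable_completion) auto
  have "(LINT s:{0..1}|lborel. s powr ((1 - q) - 1) * (1 - s) powr ((1 - e) - 1)) = Beta (1 - q) (1 - e)"
    using set_borel_integral_eq_integral(2)[OF si] integral_unique[OF H] by simp
  then have hb: "has_bochner_integral lborel (\<lambda>s. indicator {0..1} s *\<^sub>R (s powr ((1 - q) - 1) * (1 - s) powr ((1 - e) - 1))) (Beta (1 - q) (1 - e))"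
    using si unfolding set_integrable_def set_lebesgue_integral_def has_bochner_integral_iff by simp
  have "has_bochner_integral lborel (\<lambda>s. indicator {0<..<1} s *\<^sub>R (s powr (- q) * (1 - s) powr (- e))) (Beta (1 - q) (1 - e))"
  proof (rule has_bochner_integral_cong_AE[THEN iffD1, OF _ _ _ hb])
    have "AE s in lborel. s \<noteq> 0 \<and> s \<noteq> (1::real)" using AE_lborel_singleton[of 0] AE_lborel_singleton[of 1] by eventually_elim auto
    then show "AE s in lborel. indicator {0..1} s *\<^sub>R (s powr ((1 - q) - 1) * (1 - s) powr ((1 - e) - 1)) = indicator {0<..<1} s *\<^sub>R (s powr (- q) * (1 - s) powr (- e))"
      by eventually_elim (auto simp: indicator_def)
  qed measurable
  from lborel_has_bochner_integral_affine[OF this, of "1 / t" 0] t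
  have "has_bochner_integral lborel (\<lambda>s. indicator {0<..<1} (s / t) *\<^sub>R ((s / t) powr (- q) * (1 - s / t) powr (- e))) (t * Beta (1 - q) (1 - e))"
    by simp
  then have "has_bochner_integral lborel (\<lambda>s. t powr (- e - q) * (indicator {0<..<1} (s / t) *\<^sub>R ((s / t) powr (- q) * (1 - s / t) powr (- e)))) (t powr (- e - q) * (t * Beta (1 - q) (1 - e)))"
    by (rule has_bochner_integral_mult_right)
  moreover have "t powr (- e - q) * (indicator {0<..<1} (s / t) *\<^sub>R ((s / t) powr (- q) * (1 - s / t) powr (- e))) = indicator {0<..<t} s * ((t - s) powr (- e) * s powr (- q))" for s
  proof (cases "0 < s \<and> s < t")
    case True
    have "1 - s / t = (t - s) / t" using t by (simp add: field_simps)
    then have "(s / t) powr (- q) * (1 - s / t) powr (- e) = t powr (q + e) * (s powr (- q) * (t - s) powr (- e))"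
      using True t by (simp add: powr_divide powr_minus powr_add field_simps)
    moreover have "t powr (- e - q) * t powr (q + e) = 1" using t by (simp flip: powr_add)
    ultimately show ?thesis using True t by (simp add: mult_ac)
  next
    case False
    then have "s / t \<notin> {0<..<1}" using t by (auto simp: field_simps zero_less_divide_iff)
    then show ?thesis using False by (auto simp: indicator_def)
  qed
  moreover have "t powr (- e - q) * (t * Beta (1 - q) (1 - e)) = t powr (1 - e - q) * Beta (1 - q) (1 - e)"
    using t by (simp add: powr_diff powr_minus powr_add field_simps)
  ultimately show ?thesis by (simp only:)
qed

lemma Beta_pos: "0 < x \<Longrightarrow> 0 < y \<Longrightarrow> 0 < Beta x (y::real)"
  unfolding Beta_def by simp

definition jointly_measurable :: "(real \<Rightarrow> real^'n \<Rightarrow> real^'n) \<Rightarrow> bool" where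
  "jointly_measurable u \<longleftrightarrow> (\<lambda>(t, x). u t x) \<in> borel_measurable (borel \<Otimes>\<^sub>M borel)"

lemma jointly_measurableD:
  assumes "jointly_measurable u" "f \<in> borel_measurable M" "g \<in> borel_measurable M"
  shows "(\<lambda>p. u (f p) (g p)) \<in> borel_measurable M"
  using measurable_compose[OF measurable_Pair[OF assms(2,3)] assms(1)[unfolded jointly_measurable_def]] by simp

lemma jointly_measurable_slice: "jointly_measurable u \<Longrightarrow> u t \<in> borel_measurable borel"
  using jointly_measurableD[of u "\<lambda>_. t" borel "\<lambda>x. x"] by simp

lemma heat_leray_div_measurable:
  assumes u: "jointly_measurable u" and v: "jointly_measurable v"
    and m [measurable]: "f \<in> borel_measurable M" "g \<in> borel_measurable M" "X \<in> borel_measurable M"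
  shows "(\<lambda>p. heat_leray_div \<beta> (f p) (u (g p)) (v (g p)) (X p)) \<in> borel_measurable M"
proof (rule borel_measurable_vec_lambda_components)
  fix j
  note jointly_measurableD[OF u, measurable (raw)] jointly_measurableD[OF v, measurable (raw)]
  show "(\<lambda>p. heat_leray_div \<beta> (f p) (u (g p)) (v (g p)) (X p) $ j) \<in> borel_measurable M"
    unfolding heat_leray_div_nth conv_def by measurable
qed

lemma duhamel_measurable:
  assumes u: "jointly_measurable u" and v: "jointly_measurable v"
  shows "jointly_measurable (duhamel \<beta> u v)"
  unfolding jointly_measurable_def duhamel_def set_lebesgue_integral_def case_prod_unfold
proof (rule lborel.borel_measurable_lebesgue_integral)
  note heat_leray_div_measurable[OF u v, measurable (raw)]
  have "(\<lambda>p::(real \<times> (real, 'a) vec) \<times> real. indicator {0<..<fst (fst p)} (snd p) *\<^sub>R heat_leray_div \<beta> (fst (fst p) - snd p) (u (snd p)) (v (snd p)) (snd (fst p)))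
     \<in> borel_measurable ((borel \<Otimes>\<^sub>M borel) \<Otimes>\<^sub>M lborel)"
    unfolding greaterThanLessThan_iff indicator_def by measurable
  then show "(\<lambda>(x, s). indicator {0<..<fst x} s *\<^sub>R heat_leray_div \<beta> (fst x - s) (u s) (v s) (snd x)) \<in> borel_measurable ((borel \<Otimes>\<^sub>M borel) \<Otimes>\<^sub>M lborel)"
    by (simp add: case_prod_unfold)
qed

lemma time_integral_bound:
  fixes h :: "real \<Rightarrow> 'b::{banach, second_countable_topology}"
  assumes e: "e < 1" and q: "q < 1" and t: "t > 0" and h: "h \<in> borel_measurable borel"
    and b: "\<And>s. 0 < s \<Longrightarrow> s < t \<Longrightarrow> norm (h s) \<le> M * ((t - s) powr (- e) * s powr (- q))"
  shows "set_integrable lborel {0<..<t} h" "norm (LINT s:{0<..<t}|lborel. h s) \<le> M * (t powr (1 - e - q) * Beta (1 - q) (1 - e))"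
proof -
  note W = has_bochner_integral_mult_right[OF time_weight_integral[OF e q t], of M]
  have b': "norm (indicator {0<..<t} s *\<^sub>R h s) \<le> M * (indicator {0<..<t} s * ((t - s) powr (- e) * s powr (- q)))" for s
    using b[of s] by (auto simp: indicator_def)
  show i: "set_integrable lborel {0<..<t} h"
    unfolding set_integrable_def
  proof (rule Bochner_Integration.integrable_bound)
    show "integrable lborel (\<lambda>s. M * (indicator {0<..<t} s * ((t - s) powr (- e) * s powr (- q))))" using W by (auto simp: has_bochner_integral_iff)
    show "(\<lambda>s. indicator {0<..<t} s *\<^sub>R h s) \<in> borel_measurable lborel" using h by measurable
    show "AE s in lborel. norm (indicator {0<..<t} s *\<^sub>R h s) \<le> norm (M * (indicator {0<..<t} s * ((t - s) powr (- e) * s powr (- q))))"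
      by (intro AE_I2 order_trans[OF b']) (simp only: real_norm_def abs_ge_self)
  qed
  have "norm (LINT s:{0<..<t}|lborel. h s) \<le> (LINT s|lborel. norm (indicator {0<..<t} s *\<^sub>R h s))"
    unfolding set_lebesgue_integral_def by (rule integral_norm_bound)
  also have "\<dots> \<le> (LINT s|lborel. M * (indicator {0<..<t} s * ((t - s) powr (- e) * s powr (- q))))"
    by (intro integral_mono integrable_norm b') (use i W in \<open>auto simp: set_integrable_def has_bochner_integral_iff\<close>)
  also have "\<dots> = M * (t powr (1 - e - q) * Beta (1 - q) (1 - e))"
    using W by (auto simp: has_bochner_integral_iff)
  finally show "norm (LINT s:{0<..<t}|lborel. h s) \<le> M * (t powr (1 - e - q) * Beta (1 - q) (1 - e))" .
qed

text \<open>The exponent for which \<open>sup\<^sub>t t powr crit_exp \<beta> * \<parallel>u t\<parallel>\<^sub>\<infinity>\<close> is invariant under the scaling of the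
equations.\<close>

definition crit_exp :: "real \<Rightarrow> real" where "crit_exp \<beta> = (2 * \<beta> - 1) / (2 * \<beta>)"

lemma crit_exp:
  assumes "1/2 < \<beta>" "\<beta> < 1"
  shows "1 / (2 * \<beta>) < 1" "0 < crit_exp \<beta>" "2 * crit_exp \<beta> < 1" "crit_exp \<beta> < 1" "1 - 1 / (2 * \<beta>) = crit_exp \<beta>"
  using assms by (auto simp: crit_exp_def field_simps)

definition sup_class :: "real \<Rightarrow> real \<Rightarrow> (real \<Rightarrow> real^'n \<Rightarrow> real^'n) \<Rightarrow> bool" where
  "sup_class \<beta> R u \<longleftrightarrow> jointly_measurable u \<and> (\<forall>t>0. \<forall>x. norm (u t x) \<le> R * t powr (- crit_exp \<beta>))"

definition hoelder_class :: "real \<Rightarrow> real \<Rightarrow> real \<Rightarrow> (real \<Rightarrow> real^'n \<Rightarrow> real^'n) \<Rightarrow> bool" where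
  "hoelder_class \<beta> \<sigma> R u \<longleftrightarrow>
     (\<forall>t>0. \<forall>x y. norm (u t x - u t y) \<le> R * t powr (- crit_exp \<beta> - \<sigma> / (2 * \<beta>)) * norm (x - y) powr \<sigma>)"

text \<open>A bound on the gauge norm of each \<open>u t\<close>, uniform in \<open>t\<close> and with every null set removed.\<close>

definition gauge_class :: "real \<Rightarrow> real \<Rightarrow> (real \<Rightarrow> real^'n \<Rightarrow> real^'n) \<Rightarrow> bool" where
  "gauge_class \<beta> R u \<longleftrightarrow>
     (\<forall>t>0. \<forall>\<tau>>0. \<forall>x. conv (heat_kernel \<beta> \<tau>) (\<lambda>y. norm (u t y)) x \<le> R * \<tau> powr (- crit_exp \<beta>))"

lemma sup_class_nonneg: assumes "sup_class \<beta> R u" shows "R \<ge> 0"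
proof -
  have "0 \<le> norm (u 1 0)" by simp
  also have "\<dots> \<le> R * 1 powr (- crit_exp \<beta>)" using assms unfolding sup_class_def by (metis zero_less_one)
  finally show ?thesis by simp
qed

lemma sup_classD:
  assumes "sup_class \<beta> R u"
  shows "jointly_measurable u" "t > 0 \<Longrightarrow> norm (u t x) \<le> R * t powr (- crit_exp \<beta>)" "u t \<in> borel_measurable borel"
  using assms jointly_measurable_slice by (auto simp: sup_class_def)

lemma crit_exp_sq: "s powr (- crit_exp \<beta>) * s powr (- crit_exp \<beta>) = s powr (- (2 * crit_exp \<beta>))"
  by (simp flip: powr_add)

lemma duhamel_integrable:
  fixes u v :: "real \<Rightarrow> real^'n \<Rightarrow> real^'n"
  assumes \<beta>: "1/2 < \<beta>" "\<beta> < 1" and u: "sup_class \<beta> A u" and v: "sup_class \<beta> B v" and t: "t > 0"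
  shows "set_integrable lborel {0<..<t} (\<lambda>s. heat_leray_div \<beta> (t - s) (u s) (v s) x)"
proof -
  have \<beta>0: "0 < \<beta>" using \<beta> by simp
  obtain C where C: "C > 0" and L: "leray_bounds TYPE('n) \<beta> 1 C"
    using heat_leray_div_bound[OF \<beta>0 \<beta>(2), of 1, where 'n='n] by auto
  note H = leray_boundsD(1)[OF L]
  show ?thesis
  proof (rule time_integral_bound(1)[where e = "1 / (2 * \<beta>)" and q = "2 * crit_exp \<beta>" and M = "C * (A * B)"])
    show "(\<lambda>s. heat_leray_div \<beta> (t - s) (u s) (v s) x) \<in> borel_measurable borel"
      by (rule heat_leray_div_measurable[OF sup_classD(1)[OF u] sup_classD(1)[OF v]]) auto
    fix s :: real assume s: "0 < s" "s < t"
    have "norm (heat_leray_div \<beta> (t - s) (u s) (v s) x) \<le> C * (t - s) powr (- (1 / (2 * \<beta>))) * ((A * s powr (- crit_exp \<beta>)) * (B * s powr (- crit_exp \<beta>)))"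
      by (rule H) (use s sup_classD[OF u] sup_classD[OF v] in auto)
    also have "\<dots> = C * (A * B) * ((t - s) powr (- (1 / (2 * \<beta>))) * s powr (- (2 * crit_exp \<beta>)))"
      unfolding crit_exp_sq[symmetric] by (simp only: mult_ac)
    finally show "norm (heat_leray_div \<beta> (t - s) (u s) (v s) x) \<le> C * (A * B) * ((t - s) powr - (1 / (2 * \<beta>)) * s powr - (2 * crit_exp \<beta>))" .
  qed (use crit_exp[OF \<beta>] t in auto)
qed

text \<open>The exponents add up to \<open>1 - 1/(2\<beta>) - 2 a = - a\<close> with \<open>a = crit_exp \<beta>\<close>: the bilinear term keeps the
weight of its arguments.\<close>

lemma duhamel_bound:
  fixes dummy :: "'n::finite"
  assumes \<beta>: "1/2 < \<beta>" "\<beta> < 1"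
  shows "\<exists>C>0. \<forall>(u::real \<Rightarrow> real^'n \<Rightarrow> real^'n) v A B. sup_class \<beta> A u \<longrightarrow> sup_class \<beta> B v \<longrightarrow>
    (\<forall>t>0. \<forall>x. norm (duhamel \<beta> u v t x) \<le> C * (A * B) * t powr (- crit_exp \<beta>))"
proof -
  have \<beta>0: "0 < \<beta>" using \<beta> by simp
  obtain C where C: "C > 0" and L: "leray_bounds TYPE('n) \<beta> 1 C"
    using heat_leray_div_bound[OF \<beta>0 \<beta>(2), of 1, where 'n='n] by auto
  note H = leray_boundsD(1)[OF L]
  let ?e = "1 / (2 * \<beta>)" and ?q = "2 * crit_exp \<beta>"
  let ?B = "Beta (1 - ?q) (1 - ?e)"
  have Bp: "?B > 0" using crit_exp[OF \<beta>] by (intro Beta_pos) auto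
  have "norm (duhamel \<beta> u v t x) \<le> (C * ?B) * (A * B) * t powr (- crit_exp \<beta>)"
    if u: "sup_class \<beta> A u" and v: "sup_class \<beta> B v" and t: "t > 0" for u v :: "real \<Rightarrow> real^'n \<Rightarrow> real^'n" and A B t x
  proof -
    have "norm (duhamel \<beta> u v t x) \<le> C * (A * B) * (t powr (1 - ?e - ?q) * ?B)"
      unfolding duhamel_def
    proof (rule time_integral_bound(2))
      show "(\<lambda>s. heat_leray_div \<beta> (t - s) (u s) (v s) x) \<in> borel_measurable borel"
        by (rule heat_leray_div_measurable[OF sup_classD(1)[OF u] sup_classD(1)[OF v]]) auto
      fix s :: real assume s: "0 < s" "s < t"
      have "norm (heat_leray_div \<beta> (t - s) (u s) (v s) x) \<le> C * (t - s) powr (- ?e) * ((A * s powr (- crit_exp \<beta>)) * (B * s powr (- crit_exp \<beta>)))"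
        by (rule H) (use s sup_classD[OF u] sup_classD[OF v] in auto)
      also have "\<dots> = C * (A * B) * ((t - s) powr (- ?e) * s powr (- ?q))"
        unfolding crit_exp_sq[symmetric] by (simp only: mult_ac)
      finally show "norm (heat_leray_div \<beta> (t - s) (u s) (v s) x) \<le> C * (A * B) * ((t - s) powr (- ?e) * s powr (- ?q))" .
    qed (use crit_exp[OF \<beta>] t in auto)
    also have "1 - ?e - ?q = - crit_exp \<beta>" using crit_exp(5)[OF \<beta>] by simp
    finally show ?thesis by (simp add: mult_ac)
  qed
  then show ?thesis using C Bp by (intro exI[of _ "C * ?B"]) auto
qed

lemma oseen_integrand_integrable:
  fixes u v :: "real \<Rightarrow> real^'n \<Rightarrow> real^'n"
  assumes \<beta>: "1/2 < \<beta>" "\<beta> < 1" and u: "sup_class \<beta> A u" and v: "sup_class \<beta> B v" and t: "t > 0"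
  shows "set_integrable lborel ({0<..<t} \<times> UNIV) (\<lambda>(s, y). u s y $ l * v s y $ k * oseen_kernel \<beta> (t - s) j k l (x - y))"
proof -
  have \<beta>0: "0 < \<beta>" using \<beta> by simp
  let ?e = "1 / (2 * \<beta>)" and ?q = "2 * crit_exp \<beta>"
  obtain C where C: "C > 0" and Oi: "\<And>t j k l. t > 0 \<Longrightarrow> integrable lborel (oseen_kernel \<beta> t j k (l::'n))"
    "\<And>t j k l. t > 0 \<Longrightarrow> (LINT x|lborel. \<bar>oseen_kernel \<beta> t j k (l::'n) x\<bar>) \<le> C * t powr (- ?e)"
    using oseen_kernel_L1[OF \<beta>0 \<beta>(2), where 'n='n] by auto
  note jointly_measurableD[OF sup_classD(1)[OF u], measurable (raw)] jointly_measurableD[OF sup_classD(1)[OF v], measurable (raw)]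
  let ?F = "\<lambda>s y. indicator {0<..<t} s * (u s y $ l * v s y $ k * oseen_kernel \<beta> (t - s) j k l (x - y))"
  have slice: "integrable lborel (?F s) \<and> (LINT y|lborel. \<bar>?F s y\<bar>) \<le> (A * B * C) * (indicator {0<..<t} s * ((t - s) powr (- ?e) * s powr (- ?q)))" for s
  proof (cases "0 < s \<and> s < t")
    case True
    have gm: "(\<lambda>y. u s y $ l * v s y $ k) \<in> borel_measurable borel" by measurable
    have g: "\<bar>u s y $ l * v s y $ k\<bar> \<le> (A * s powr (- crit_exp \<beta>)) * (B * s powr (- crit_exp \<beta>))" for y
      using True by (intro abs_component_mult_le sup_classD[OF u] sup_classD[OF v]) auto
    have ts: "t - s > 0" using True by simp
    have "(LINT y|lborel. \<bar>u s y $ l * v s y $ k * oseen_kernel \<beta> (t - s) j k l (x - y)\<bar>) \<le> (A * s powr (- crit_exp \<beta>)) * (B * s powr (- crit_exp \<beta>)) * (C * (t - s) powr (- ?e))"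
      by (rule order_trans[OF conv_abs_bounded[OF Oi(1)[OF ts] gm g]])
         (use Oi(2)[OF ts] sup_class_nonneg[OF u] sup_class_nonneg[OF v] in \<open>auto intro!: mult_left_mono\<close>)
    also have "\<dots> = (A * B * C) * ((t - s) powr (- ?e) * s powr (- ?q))"
      unfolding crit_exp_sq[symmetric] by (simp only: mult_ac)
    finally show ?thesis using True conv_bounded(1)[OF Oi(1)[OF ts] gm g] by simp
  qed (auto simp: indicator_def)
  have "integrable (lborel \<Otimes>\<^sub>M lborel) (\<lambda>(s, y). ?F s y)"
  proof (rule lborel_pair.Fubini_integrable)
    show "AE s in lborel. integrable lborel (\<lambda>y. case (s, y) of (s, y) \<Rightarrow> ?F s y)" using slice by simp
    show "integrable lborel (\<lambda>s. LINT y|lborel. norm (case (s, y) of (s, y) \<Rightarrow> ?F s y))"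
    proof (rule Bochner_Integration.integrable_bound)
      show "integrable lborel (\<lambda>s. (A * B * C) * (indicator {0<..<t} s * ((t - s) powr (- ?e) * s powr (- ?q))))"
        by (intro integrable_mult_right integrable.intros[OF time_weight_integral]) (use crit_exp[OF \<beta>] t in auto)
      show "AE s in lborel. norm (LINT y|lborel. norm (case (s, y) of (s, y) \<Rightarrow> ?F s y)) \<le> norm ((A * B * C) * (indicator {0<..<t} s * ((t - s) powr (- ?e) * s powr (- ?q))))"
      proof (rule AE_I2)
        fix s
        have "0 \<le> (LINT y|lborel. \<bar>?F s y\<bar>)" by simp
        then show "norm (LINT y|lborel. norm (case (s, y) of (s, y) \<Rightarrow> ?F s y)) \<le> norm ((A * B * C) * (indicator {0<..<t} s * ((t - s) powr (- ?e) * s powr (- ?q))))"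
          using slice[of s] unfolding real_norm_def prod.case by linarith
      qed
    qed measurable
  qed measurable
  moreover have "(\<lambda>(s, y). ?F s y) = (\<lambda>p. indicator ({0<..<t} \<times> UNIV) p *\<^sub>R (case p of (s, y) \<Rightarrow> u s y $ l * v s y $ k * oseen_kernel \<beta> (t - s) j k l (x - y)))"
    by (auto simp: fun_eq_iff indicator_def)
  ultimately show ?thesis unfolding set_integrable_def lborel_prod by simp
qed

lemma heat_leray_div_diff:
  fixes u u' v v' :: "real^'n \<Rightarrow> real^'n"
  assumes \<beta>: "0 < \<beta>" "\<beta> < 1" and t: "t > 0"
    and m [measurable]: "u \<in> borel_measurable borel" "u' \<in> borel_measurable borel" "v \<in> borel_measurable borel" "v' \<in> borel_measurable borel"
    and b: "\<And>y. norm (u y) \<le> A" "\<And>y. norm (u' y) \<le> A" "\<And>y. norm (v y) \<le> A" "\<And>y. norm (v' y) \<le> A"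
  shows "heat_leray_div \<beta> t u v x - heat_leray_div \<beta> t u' v' x = heat_leray_div \<beta> t (\<lambda>y. u y - u' y) v x + heat_leray_div \<beta> t u' (\<lambda>y. v y - v' y) x"
proof -
  obtain C where Oi: "\<And>j k l. integrable lborel (oseen_kernel \<beta> t j k (l::'n))"
    using oseen_kernel_L1[OF \<beta>, where 'n='n] t by auto
  have i: "integrable lborel (\<lambda>y. f y $ l * g y $ k * oseen_kernel \<beta> t j k l (x - y))"
    if [measurable]: "f \<in> borel_measurable borel" "g \<in> borel_measurable borel" and "\<And>y. norm (f y) \<le> A" "\<And>y. norm (g y) \<le> A" for f g :: "real^'n \<Rightarrow> real^'n" and j k l
    by (rule conv_bounded(1)[OF Oi _ abs_component_mult_le[OF that(3,4)]]) measurable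
  have "conv (oseen_kernel \<beta> t j k l) (\<lambda>y. u y $ l * v y $ k) x - conv (oseen_kernel \<beta> t j k l) (\<lambda>y. u' y $ l * v' y $ k) x
      = conv (oseen_kernel \<beta> t j k l) (\<lambda>y. (u y - u' y) $ l * v y $ k) x + conv (oseen_kernel \<beta> t j k l) (\<lambda>y. u' y $ l * (v y - v' y) $ k) x" for j k l
    unfolding conv_def using i[OF m(1,3) b(1,3)] i[OF m(2,4) b(2,4)] i[OF m(2,3) b(2,3)]
    by (simp add: left_diff_distrib right_diff_distrib)
  then show ?thesis
    by (simp add: vec_eq_iff heat_leray_div_nth flip: sum_subtractf sum.distrib)
qed

text \<open>Bilinearity: \<open>u v - u' v' = (u - u') v + u' (v - v')\<close>.\<close>

lemma duhamel_diff_bound: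
  fixes dummy :: "'n::finite"
  assumes \<beta>: "1/2 < \<beta>" "\<beta> < 1"
  shows "\<exists>C>0. \<forall>(u::real \<Rightarrow> real^'n \<Rightarrow> real^'n) v u' v' R \<delta>. sup_class \<beta> R u \<longrightarrow> sup_class \<beta> R v \<longrightarrow> sup_class \<beta> R u' \<longrightarrow> sup_class \<beta> R v' \<longrightarrow>
    sup_class \<beta> \<delta> (\<lambda>t x. u t x - u' t x) \<longrightarrow> sup_class \<beta> \<delta> (\<lambda>t x. v t x - v' t x) \<longrightarrow>
    (\<forall>t>0. \<forall>x. norm (duhamel \<beta> u v t x - duhamel \<beta> u' v' t x) \<le> C * R * \<delta> * t powr (- crit_exp \<beta>))"
proof -
  obtain C where C: "C > 0" and D: "\<And>(u::real \<Rightarrow> real^'n \<Rightarrow> real^'n) v A B t x. sup_class \<beta> A u \<Longrightarrow> sup_class \<beta> B v \<Longrightarrow> t > 0 \<Longrightarrow>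
      norm (duhamel \<beta> u v t x) \<le> C * (A * B) * t powr (- crit_exp \<beta>)"
    using duhamel_bound[OF \<beta>, where 'n='n] by auto
  have \<beta>0: "0 < \<beta>" using \<beta> by simp
  have "norm (duhamel \<beta> u v t x - duhamel \<beta> u' v' t x) \<le> (2 * C) * R * \<delta> * t powr (- crit_exp \<beta>)"
    if u: "sup_class \<beta> R u" and v: "sup_class \<beta> R v" and u': "sup_class \<beta> R u'" and v': "sup_class \<beta> R v'"
      and d1: "sup_class \<beta> \<delta> (\<lambda>t x. u t x - u' t x)" and d2: "sup_class \<beta> \<delta> (\<lambda>t x. v t x - v' t x)" and t: "t > 0"
    for u v u' v' :: "real \<Rightarrow> real^'n \<Rightarrow> real^'n" and R \<delta> t x
  proof -
    have e: "heat_leray_div \<beta> (t - s) (u s) (v s) x - heat_leray_div \<beta> (t - s) (u' s) (v' s) x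
        = heat_leray_div \<beta> (t - s) (\<lambda>y. u s y - u' s y) (v s) x + heat_leray_div \<beta> (t - s) (u' s) (\<lambda>y. v s y - v' s y) x" if "s \<in> {0<..<t}" for s
      by (rule heat_leray_div_diff[where A = "R * s powr (- crit_exp \<beta>)"])
         (use that \<beta>0 \<beta> sup_classD[OF u] sup_classD[OF v] sup_classD[OF u'] sup_classD[OF v'] in auto)
    have "duhamel \<beta> u v t x - duhamel \<beta> u' v' t x = (LINT s:{0<..<t}|lborel. heat_leray_div \<beta> (t - s) (u s) (v s) x - heat_leray_div \<beta> (t - s) (u' s) (v' s) x)"
      unfolding duhamel_def
      by (rule set_integral_diff(2)[symmetric]) (intro duhamel_integrable[OF \<beta> u v t] duhamel_integrable[OF \<beta> u' v' t])+
    also have "\<dots> = (LINT s:{0<..<t}|lborel. heat_leray_div \<beta> (t - s) (\<lambda>y. u s y - u' s y) (v s) x + heat_leray_div \<beta> (t - s) (u' s) (\<lambda>y. v s y - v' s y) x)"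
      by (rule set_lebesgue_integral_cong) (use e in auto)
    also have "\<dots> = duhamel \<beta> (\<lambda>t x. u t x - u' t x) v t x + duhamel \<beta> u' (\<lambda>t x. v t x - v' t x) t x"
      unfolding duhamel_def
      by (rule set_integral_add(2)) (intro duhamel_integrable[OF \<beta> d1 v t] duhamel_integrable[OF \<beta> u' d2 t])+
    also have "norm \<dots> \<le> C * (\<delta> * R) * t powr (- crit_exp \<beta>) + C * (R * \<delta>) * t powr (- crit_exp \<beta>)"
      by (intro norm_triangle_mono D d1 v u' d2 t)
    finally show ?thesis by (simp add: mult_ac)
  qed
  note main = this
  show ?thesis by (intro exI[of _ "2 * C"] conjI allI impI, simp add: C, rule main; assumption)
qed

text \<open>For \<open>s \<le> t/2\<close> the kernel has age at least \<open>t/2\<close> and does the smoothing; for \<open>s > t/2\<close> the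
regularity of \<open>u s\<close> and \<open>v s\<close> is available. Either way the loss is \<open>t powr (-\<sigma>/(2\<beta>))\<close>, and the Beta
integral of the sup bound remains.\<close>

lemma duhamel_hoelder:
  fixes dummy :: "'n::finite"
  assumes \<beta>: "1/2 < \<beta>" "\<beta> < 1" and sg: "0 < \<sigma>" "\<sigma> \<le> 1"
  shows "\<exists>C>0. \<forall>(u::real \<Rightarrow> real^'n \<Rightarrow> real^'n) v R. sup_class \<beta> R u \<longrightarrow> sup_class \<beta> R v \<longrightarrow> hoelder_class \<beta> \<sigma> R u \<longrightarrow> hoelder_class \<beta> \<sigma> R v \<longrightarrow>
     hoelder_class \<beta> \<sigma> (C * (R * R)) (duhamel \<beta> u v)"
proof -
  have \<beta>0: "0 < \<beta>" using \<beta> by simp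
  let ?e = "1 / (2 * \<beta>)" and ?q = "2 * crit_exp \<beta>"
  define r where "r = \<sigma> / (2 * \<beta>)"
  have r: "r > 0" using sg \<beta>0 by (simp add: r_def)
  obtain C where C: "C > 0" and L: "leray_bounds TYPE('n) \<beta> \<sigma> C"
    using heat_leray_div_bound[OF \<beta>0 \<beta>(2) sg, where 'n='n] by auto
  note H1 = leray_boundsD(2)[OF L, folded r_def] and H2 = leray_boundsD(3)[OF L]
  let ?B = "Beta (1 - ?q) (1 - ?e)"
  have Bp: "?B > 0" using crit_exp[OF \<beta>] by (intro Beta_pos) auto
  define C' where "C' = 2 * C * 2 powr r"
  have "norm (duhamel \<beta> u v t x - duhamel \<beta> u v t x') \<le> (C' * ?B) * (R * R) * t powr (- crit_exp \<beta> - r) * norm (x - x') powr \<sigma>"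
    if u: "sup_class \<beta> R u" and v: "sup_class \<beta> R v" and hu: "hoelder_class \<beta> \<sigma> R u" and hv: "hoelder_class \<beta> \<sigma> R v" and t: "t > 0"
    for u v :: "real \<Rightarrow> real^'n \<Rightarrow> real^'n" and R t x x'
  proof -
    have R: "R \<ge> 0" by (rule sup_class_nonneg[OF u])
    define M where "M = C' * (R * R) * t powr (- r) * norm (x - x') powr \<sigma>"
    have "duhamel \<beta> u v t x - duhamel \<beta> u v t x' = (LINT s:{0<..<t}|lborel. heat_leray_div \<beta> (t - s) (u s) (v s) x - heat_leray_div \<beta> (t - s) (u s) (v s) x')"
      unfolding duhamel_def
      by (rule set_integral_diff(2)[symmetric]) (intro duhamel_integrable[OF \<beta> u v t])+
    also have "norm \<dots> \<le> M * (t powr (1 - ?e - ?q) * ?B)"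
    proof (rule time_integral_bound(2))
      show "(\<lambda>s. heat_leray_div \<beta> (t - s) (u s) (v s) x - heat_leray_div \<beta> (t - s) (u s) (v s) x') \<in> borel_measurable borel"
        by (intro borel_measurable_diff heat_leray_div_measurable[OF sup_classD(1)[OF u] sup_classD(1)[OF v]]) auto
      fix s :: real assume s: "0 < s" "s < t"
      let ?A = "R * s powr (- crit_exp \<beta>)"
      have q2: "2 powr r * t powr (- r) = (t / 2) powr (- r)" using t by (simp add: powr_divide powr_minus field_simps)
      show "norm (heat_leray_div \<beta> (t - s) (u s) (v s) x - heat_leray_div \<beta> (t - s) (u s) (v s) x') \<le> M * ((t - s) powr (- ?e) * s powr (- ?q))"
      proof (cases "s \<le> t / 2")
        case True
        have "norm (heat_leray_div \<beta> (t - s) (u s) (v s) x - heat_leray_div \<beta> (t - s) (u s) (v s) x') \<le> C * (t - s) powr (- r - ?e) * (?A * ?A) * norm (x - x') powr \<sigma>"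
          by (rule H1) (use s sup_classD[OF u] sup_classD[OF v] in auto)
        also have "(t - s) powr (- r - ?e) = (t - s) powr (- r) * (t - s) powr (- ?e)" by (simp flip: powr_add)
        also have "C * ((t - s) powr (- r) * (t - s) powr (- ?e)) * (?A * ?A) * norm (x - x') powr \<sigma>
            = (t - s) powr (- r) * (C * (R * R) * norm (x - x') powr \<sigma> * ((t - s) powr (- ?e) * s powr (- ?q)))"
          unfolding crit_exp_sq[symmetric] by (simp only: mult_ac)
        also have "\<dots> \<le> (2 * (2 powr r * t powr (- r))) * (C * (R * R) * norm (x - x') powr \<sigma> * ((t - s) powr (- ?e) * s powr (- ?q)))"
        proof (rule mult_right_mono)
          have "(t - s) powr (- r) \<le> (t / 2) powr (- r)" using True t r s by (intro powr_mono2') auto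
          also have "\<dots> \<le> 2 * (t / 2) powr (- r)" by simp
          finally show "(t - s) powr (- r) \<le> 2 * (2 powr r * t powr (- r))" unfolding q2 .
        qed (use C in auto)
        finally show ?thesis unfolding M_def C'_def by (simp only: mult_ac)
      next
        case False
        have hb: "norm (u s y - u s y') \<le> (?A * s powr (- r)) * norm (y - y') powr \<sigma>" "norm (v s y - v s y') \<le> (?A * s powr (- r)) * norm (y - y') powr \<sigma>" for y y'
          using hu hv s unfolding hoelder_class_def r_def[symmetric] diff_conv_add_uminus powr_add by (simp_all add: mult_ac)
        have "norm (heat_leray_div \<beta> (t - s) (u s) (v s) x - heat_leray_div \<beta> (t - s) (u s) (v s) x') \<le> C * (t - s) powr (- ?e) * (?A * (?A * s powr (- r)) + ?A * (?A * s powr (- r))) * norm (x - x') powr \<sigma>"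
          by (rule H2) (use s sup_classD[OF u] sup_classD[OF v] hb in auto)
        also have "?A * (?A * s powr (- r)) + ?A * (?A * s powr (- r)) = 2 * (?A * (?A * s powr (- r)))" by simp
        also have "C * (t - s) powr (- ?e) * (2 * (?A * (?A * s powr (- r)))) * norm (x - x') powr \<sigma>
            = s powr (- r) * (2 * C * (R * R) * norm (x - x') powr \<sigma> * ((t - s) powr (- ?e) * s powr (- ?q)))"
          unfolding crit_exp_sq[symmetric] by (simp only: mult_ac)
        also have "\<dots> \<le> (2 powr r * t powr (- r)) * (2 * C * (R * R) * norm (x - x') powr \<sigma> * ((t - s) powr (- ?e) * s powr (- ?q)))"
        proof (rule mult_right_mono)
          show "s powr (- r) \<le> 2 powr r * t powr (- r)" unfolding q2 using False t r s by (intro powr_mono2') auto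
        qed (use C in auto)
        finally show ?thesis unfolding M_def C'_def by (simp only: mult_ac)
      qed
    qed (use crit_exp[OF \<beta>] t in auto)
    also have "1 - ?e - ?q = - crit_exp \<beta>" using crit_exp(5)[OF \<beta>] by simp
    also have "M * (t powr (- crit_exp \<beta>) * ?B) = (C' * ?B) * (R * R) * (t powr (- crit_exp \<beta>) * t powr (- r)) * norm (x - x') powr \<sigma>"
      unfolding M_def by (simp only: mult_ac)
    also have "t powr (- crit_exp \<beta>) * t powr (- r) = t powr (- crit_exp \<beta> - r)" by (simp flip: powr_add)
    finally show ?thesis .
  qed
  note main = this
  show ?thesis
  proof (intro exI[of _ "C' * ?B"] conjI allI impI)
    show "0 < C' * ?B" using C Bp by (simp add: C'_def)
    fix u v :: "real \<Rightarrow> real^'n \<Rightarrow> real^'n" and R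
    assume h: "sup_class \<beta> R u" "sup_class \<beta> R v" "hoelder_class \<beta> \<sigma> R u" "hoelder_class \<beta> \<sigma> R v"
    show "hoelder_class \<beta> \<sigma> (C' * ?B * (R * R)) (duhamel \<beta> u v)"
      unfolding hoelder_class_def r_def[symmetric] using main[OF h] by blast
  qed
qed

section \<open>Propagation of the gauge norm\<close>

lemma conv_mono_nonneg:
  fixes K f g :: "real^'n \<Rightarrow> real"
  assumes K: "integrable lborel K" "\<And>x. 0 \<le> K x" and f: "f \<in> borel_measurable borel" "\<And>y. \<bar>f y\<bar> \<le> F" and g: "g \<in> borel_measurable borel" "\<And>y. \<bar>g y\<bar> \<le> G"
    and le: "\<And>y. f y \<le> g y"
  shows "conv K f x \<le> conv K g x"
  unfolding conv_def real_scaleR_def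
  by (intro integral_mono conv_bounded(1)[OF K(1) f] conv_bounded(1)[OF K(1) g] mult_right_mono le K(2))

text \<open>The gauge quantity \<open>\<Gamma>\<close> is attached to \<open>u\<close> alone; \<open>v\<close> contributes its sup norm.\<close>

definition leray_gauge_bound :: "'n::finite itself \<Rightarrow> real \<Rightarrow> real \<Rightarrow> bool" where
  "leray_gauge_bound _ \<beta> C \<longleftrightarrow> (\<forall>t>0. \<forall>\<tau>>0. \<forall>(u::real^'n \<Rightarrow> real^'n) v A B \<Gamma>. u \<in> borel_measurable borel \<longrightarrow> v \<in> borel_measurable borel \<longrightarrow>
    (\<forall>y. norm (u y) \<le> A) \<longrightarrow> (\<forall>y. norm (v y) \<le> B) \<longrightarrow> (\<forall>x. conv (heat_kernel \<beta> \<tau>) (\<lambda>y. norm (u y)) x \<le> \<Gamma>) \<longrightarrow>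
    (\<forall>x. conv (heat_kernel \<beta> \<tau>) (\<lambda>y. norm (heat_leray_div \<beta> t u v y)) x \<le> C * t powr (- (1 / (2 * \<beta>))) * (\<Gamma> * B)))"

text \<open>Pointwise, the bilinear term is at most \<open>B\<close> times the convolution of \<open>\<bar>u\<bar>\<close> with moduli of Oseen
kernels. Convolution with the positive heat kernel at time \<open>\<tau>\<close> preserves this bound and commutes
with those convolutions, so it falls on \<open>\<bar>u\<bar>\<close>.\<close>

lemma heat_leray_div_gauge:
  fixes dummy :: "'n::finite"
  assumes \<beta>: "0 < \<beta>" "\<beta> < 1"
  shows "\<exists>C>0. leray_gauge_bound TYPE('n) \<beta> C"
proof -
  obtain C0 where C0: "C0 > 0" and Oi: "\<And>t j k l. t > 0 \<Longrightarrow> integrable lborel (oseen_kernel \<beta> t j k (l::'n))"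
    "\<And>t j k l. t > 0 \<Longrightarrow> (LINT x|lborel. \<bar>oseen_kernel \<beta> t j k (l::'n) x\<bar>) \<le> C0 * t powr (- (1 / (2 * \<beta>)))"
    using oseen_kernel_L1[OF \<beta>, where 'n='n] by auto
  have main: "conv (heat_kernel \<beta> \<tau>) (\<lambda>y. norm (heat_leray_div \<beta> t u v y)) x \<le> (real CARD('n) ^ 3 * C0) * t powr (- (1 / (2 * \<beta>))) * (\<Gamma> * B)"
    if t: "t > 0" and \<tau>: "\<tau> > 0" and um: "u \<in> borel_measurable borel" and vm: "v \<in> borel_measurable borel"
      and A: "\<forall>y. norm (u y) \<le> A" and B: "\<forall>y. norm (v y) \<le> B" and \<Gamma>: "\<forall>x. conv (heat_kernel \<beta> \<tau>) (\<lambda>y. norm (u y)) x \<le> \<Gamma>"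
    for t \<tau> A B \<Gamma> x and u v :: "real^'n \<Rightarrow> real^'n"
  proof -
    note [measurable] = um vm
    let ?K = "heat_kernel \<beta> \<tau> :: real^'n \<Rightarrow> real"
    have K: "integrable lborel ?K" "\<And>x. 0 \<le> ?K x" using heat_kernel_L1(1)[OF \<beta> \<tau>] heat_kernel_nonneg[OF \<beta> \<tau>] by auto
    have A': "\<bar>norm (u y)\<bar> \<le> A" for y using A by simp
    have AB: "A \<ge> 0" "B \<ge> 0" using order_trans[OF norm_ge_zero] A B by blast+
    have num: "(\<lambda>y. norm (u y)) \<in> borel_measurable borel" by measurable
    define Ok where "Ok = (\<lambda>j k l (x::real^'n). \<bar>oseen_kernel \<beta> t j k l x\<bar>)"
    have Oint: "integrable lborel (Ok j k l)" "(LINT x|lborel. \<bar>Ok j k l x\<bar>) \<le> C0 * t powr (- (1 / (2 * \<beta>)))" for j k l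
      using Oi[OF t, of j k l] by (auto simp: Ok_def)
    define U where "U = (\<lambda>j k l. conv (Ok j k l) (\<lambda>y. norm (u y)))"
    have Um [measurable]: "U j k l \<in> borel_measurable borel" for j k l unfolding U_def conv_def Ok_def by measurable
    define UB where "UB = A * (C0 * t powr (- (1 / (2 * \<beta>))))"
    have Ub: "\<bar>U j k l y\<bar> \<le> UB" for j k l y
      unfolding U_def UB_def by (rule order_trans[OF conv_bounded(2)[OF Oint(1) num A']]) (intro mult_left_mono Oint(2) AB)
    have KU: "conv ?K (U j k l) x \<le> \<Gamma> * (C0 * t powr (- (1 / (2 * \<beta>))))" for j k l
    proof -
      have "conv ?K (U j k l) x = conv (Ok j k l) (conv ?K (\<lambda>y. norm (u y))) x"
        unfolding U_def
        by (rule conv_commute_L1[OF K(1) Oint(1) num conv_bounded(1)[OF Oint(1) num A'] conv_abs_bounded[OF Oint(1) num A'] conv_bounded(1)[OF K(1) num A'] conv_abs_bounded[OF K(1) num A']])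
      also have "\<dots> \<le> \<bar>conv (Ok j k l) (conv ?K (\<lambda>y. norm (u y))) x\<bar>" by (rule abs_ge_self)
      also have "\<dots> \<le> \<Gamma> * (LINT x|lborel. \<bar>Ok j k l x\<bar>)"
      proof (rule conv_bounded(2)[OF Oint(1)])
        show "conv ?K (\<lambda>y. norm (u y)) \<in> borel_measurable borel" unfolding conv_def by measurable
        have "0 \<le> conv ?K (\<lambda>y. norm (u y)) y" for y unfolding conv_def using K(2) by (intro integral_nonneg_AE) auto
        then show "\<bar>conv ?K (\<lambda>y. norm (u y)) y\<bar> \<le> \<Gamma>" for y using \<Gamma> by simp
      qed
      also have "\<dots> \<le> \<Gamma> * (C0 * t powr (- (1 / (2 * \<beta>))))"
      proof (rule mult_left_mono[OF Oint(2)])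
        have "0 \<le> conv ?K (\<lambda>y. norm (u y)) x" unfolding conv_def using K(2) by (intro integral_nonneg_AE) auto
        then show "0 \<le> \<Gamma>" using \<Gamma> order_trans by blast
      qed
      finally show ?thesis .
    qed
    define W where "W = (\<lambda>y. \<Sum>j\<in>UNIV. \<Sum>k\<in>UNIV. \<Sum>l\<in>UNIV. B * U j k l y)"
    have Wm: "W \<in> borel_measurable borel" unfolding W_def by measurable
    have c: "\<bar>conv (oseen_kernel \<beta> t j k l) (\<lambda>y. u y $ l * v y $ k) y\<bar> \<le> B * U j k l y" for j k l y
    proof -
      have g: "\<bar>u y $ l * v y $ k\<bar> \<le> A * B" for y using A B by (intro abs_component_mult_le) auto
      have gm: "(\<lambda>y. u y $ l * v y $ k) \<in> borel_measurable borel" by measurable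
      note i = conv_bounded(1)[OF Oi(1)[OF t, of j k l] gm g, of y]
      have "\<bar>conv (oseen_kernel \<beta> t j k l) (\<lambda>y. u y $ l * v y $ k) y\<bar> \<le> (LINT z|lborel. \<bar>u z $ l * v z $ k * oseen_kernel \<beta> t j k l (y - z)\<bar>)"
        unfolding conv_def using integral_abs_bound[of lborel "\<lambda>z. u z $ l * v z $ k * oseen_kernel \<beta> t j k l (y - z)"] by simp
      also have "\<dots> \<le> (LINT z|lborel. B * (norm (u z) * Ok j k l (y - z)))"
      proof (rule integral_mono[OF integrable_abs[OF i] integrable_mult_right[OF conv_bounded(1)[OF Oint(1) num A']]])
        fix z
        have "\<bar>u z $ l * v z $ k\<bar> \<le> norm (u z) * B" using B by (intro abs_component_mult_le) auto
        from mult_right_mono[OF this, of "\<bar>oseen_kernel \<beta> t j k l (y - z)\<bar>"]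
        show "\<bar>u z $ l * v z $ k * oseen_kernel \<beta> t j k l (y - z)\<bar> \<le> B * (norm (u z) * Ok j k l (y - z))"
          unfolding Ok_def by (simp add: abs_mult mult_ac)
      qed
      finally show ?thesis unfolding U_def conv_def by simp
    qed
    have hW: "norm (heat_leray_div \<beta> t u v y) \<le> W y" for y
    proof -
      have "norm (heat_leray_div \<beta> t u v y) \<le> (\<Sum>j\<in>UNIV. \<bar>heat_leray_div \<beta> t u v y $ j\<bar>)" by (rule norm_vec_le_sum)
      also have "\<dots> \<le> W y" unfolding heat_leray_div_nth W_def by (intro sum_mono order_trans[OF sum_abs] c)
      finally show ?thesis .
    qed
    have Wb: "\<bar>W y\<bar> \<le> real CARD('n) ^ 3 * (B * UB)" for y
    proof -
      have "\<bar>W y\<bar> \<le> (\<Sum>j\<in>(UNIV::'n set). \<Sum>k\<in>(UNIV::'n set). \<Sum>l\<in>(UNIV::'n set). B * UB)"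
        unfolding W_def using AB Ub by (intro order_trans[OF sum_abs] sum_mono) (auto simp: abs_mult intro!: mult_left_mono)
      then show ?thesis by (simp add: power3_eq_cube mult_ac)
    qed
    have hm: "(\<lambda>y. norm (heat_leray_div \<beta> t u v y)) \<in> borel_measurable borel"
    proof -
      have "jointly_measurable (\<lambda>_. u)" "jointly_measurable (\<lambda>_. v)" unfolding jointly_measurable_def by measurable
      from heat_leray_div_measurable[OF this, of "\<lambda>_. t" borel "\<lambda>_. 0" "\<lambda>y. y"] show ?thesis by simp
    qed
    have hb: "\<bar>norm (heat_leray_div \<beta> t u v y)\<bar> \<le> real CARD('n) ^ 3 * (B * UB)" for y
      using hW[of y] Wb[of y] by simp
    have "conv ?K (\<lambda>y. norm (heat_leray_div \<beta> t u v y)) x \<le> conv ?K W x"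
      by (rule conv_mono_nonneg[OF K hm hb Wm Wb hW])
    also have "\<dots> = (\<Sum>j\<in>UNIV. \<Sum>k\<in>UNIV. \<Sum>l\<in>UNIV. B * conv ?K (U j k l) x)"
      unfolding conv_def W_def using conv_bounded(1)[OF K(1) Um Ub]
      by (simp add: sum_distrib_right mult.assoc Bochner_Integration.integral_sum Bochner_Integration.integrable_sum)
    also have "\<dots> \<le> (\<Sum>j\<in>(UNIV::'n set). \<Sum>k\<in>(UNIV::'n set). \<Sum>l\<in>(UNIV::'n set). B * (\<Gamma> * (C0 * t powr (- (1 / (2 * \<beta>))))))"
      by (intro sum_mono mult_left_mono KU AB)
    also have "\<dots> = (real CARD('n) ^ 3 * C0) * t powr (- (1 / (2 * \<beta>))) * (\<Gamma> * B)"
      by (simp add: power3_eq_cube mult_ac)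
    finally show ?thesis .
  qed
  have "leray_gauge_bound TYPE('n) \<beta> (real CARD('n) ^ 3 * C0)"
    unfolding leray_gauge_bound_def by (intro allI impI) (rule main; assumption)
  moreover have "real CARD('n) ^ 3 * C0 > 0" using C0 by simp
  ultimately show ?thesis by blast
qed

text \<open>Only one factor \<open>s powr (-a)\<close> is left in the time integral, since \<open>u\<close> is measured at the external
time \<open>\<tau>\<close>. The integral is then independent of \<open>t\<close>, because \<open>1 - 1/(2\<beta>) - a = 0\<close>.\<close>

lemma duhamel_gauge:
  fixes dummy :: "'n::finite"
  assumes \<beta>: "1/2 < \<beta>" "\<beta> < 1"
  shows "\<exists>C>0. \<forall>(u::real \<Rightarrow> real^'n \<Rightarrow> real^'n) v R. sup_class \<beta> R u \<longrightarrow> sup_class \<beta> R v \<longrightarrow> gauge_class \<beta> R u \<longrightarrow>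
     gauge_class \<beta> (C * (R * R)) (duhamel \<beta> u v)"
proof -
  have \<beta>0: "0 < \<beta>" using \<beta> by simp
  let ?e = "1 / (2 * \<beta>)" and ?a = "crit_exp \<beta>"
  obtain C where C: "C > 0" and LG: "leray_gauge_bound TYPE('n) \<beta> C"
    using heat_leray_div_gauge[OF \<beta>0 \<beta>(2), where 'n='n] by auto
  note H = LG[unfolded leray_gauge_bound_def, rule_format]
  obtain D where D: "D > 0" and L: "leray_bounds TYPE('n) \<beta> 1 D"
    using heat_leray_div_bound[OF \<beta>0 \<beta>(2), of 1, where 'n='n] by auto
  let ?B = "Beta (1 - ?a) (1 - ?e)"
  have Bp: "?B > 0" using crit_exp[OF \<beta>] by (intro Beta_pos) auto
  have main: "conv (heat_kernel \<beta> \<tau>) (\<lambda>y. norm (duhamel \<beta> u v t y)) x \<le> (C * ?B) * (R * R) * \<tau> powr (- ?a)"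
    if u: "sup_class \<beta> R u" and v: "sup_class \<beta> R v" and g: "gauge_class \<beta> R u" and t: "t > 0" and \<tau>: "\<tau> > 0"
    for u v :: "real \<Rightarrow> real^'n \<Rightarrow> real^'n" and R t \<tau> x
  proof -
    have R: "R \<ge> 0" by (rule sup_class_nonneg[OF u])
    let ?K = "heat_kernel \<beta> \<tau> :: real^'n \<Rightarrow> real"
    have K: "integrable lborel ?K" "\<And>x. 0 \<le> ?K x" using heat_kernel_L1(1)[OF \<beta>0 \<beta>(2) \<tau>] heat_kernel_nonneg[OF \<beta>0 \<beta>(2) \<tau>] by auto
    note heat_leray_div_measurable[OF sup_classD(1)[OF u] sup_classD(1)[OF v], measurable (raw)]
    define P where "P = (\<lambda>y s. ?K (x - y) * (indicator {0<..<t} s * norm (heat_leray_div \<beta> (t - s) (u s) (v s) y)))"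
    define Q where "Q = (\<lambda>s. D * (R * R) * (indicator {0<..<t} s * ((t - s) powr (- ?e) * s powr (- (2 * ?a)))))"
    have Qi: "integrable lborel Q" unfolding Q_def
      by (intro integrable_mult_right integrable.intros[OF time_weight_integral]) (use crit_exp[OF \<beta>] t in auto)
    have hb: "norm (heat_leray_div \<beta> (t - s) (u s) (v s) y) \<le> D * (R * R) * ((t - s) powr (- ?e) * s powr (- (2 * ?a)))" if "0 < s" "s < t" for s y
    proof -
      have "norm (heat_leray_div \<beta> (t - s) (u s) (v s) y) \<le> D * (t - s) powr (- ?e) * ((R * s powr (- ?a)) * (R * s powr (- ?a)))"
        by (rule leray_boundsD(1)[OF L]) (use that sup_classD[OF u] sup_classD[OF v] in auto)
      also have "\<dots> = D * (R * R) * ((t - s) powr (- ?e) * s powr (- (2 * ?a)))"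
        unfolding crit_exp_sq[symmetric] by (simp only: mult_ac)
      finally show ?thesis .
    qed
    have P1: "indicator {0<..<t} s * norm (heat_leray_div \<beta> (t - s) (u s) (v s) y) \<le> Q s" for s y
      using hb[of s y] by (auto simp: Q_def indicator_def)
    have Kx: "integrable lborel (\<lambda>y. ?K (x - y))" by (rule lborel_integrable_flip[OF K(1)])
    have Pm [measurable]: "(\<lambda>(y, s). P y s) \<in> borel_measurable (lborel \<Otimes>\<^sub>M lborel)" unfolding P_def by measurable
    have Pi: "integrable (lborel \<Otimes>\<^sub>M lborel) (\<lambda>(y, s). P y s)"
    proof (rule integrable_pair_bound[OF Pm Kx Qi])
      show "norm (P y s) \<le> ?K (x - y) * Q s" for y s
        unfolding P_def using K(2)[of "x - y"] P1[of s y] by (simp add: abs_mult mult_left_mono)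
    qed
    have Nb: "norm (duhamel \<beta> u v t y) \<le> (LINT s|lborel. indicator {0<..<t} s * norm (heat_leray_div \<beta> (t - s) (u s) (v s) y))" for y
      unfolding duhamel_def set_lebesgue_integral_def
      using integral_norm_bound[of lborel "\<lambda>s. indicator {0<..<t} s *\<^sub>R heat_leray_div \<beta> (t - s) (u s) (v s) y"] by simp
    have "conv ?K (\<lambda>y. norm (duhamel \<beta> u v t y)) x \<le> (LINT y|lborel. LINT s|lborel. P y s)"
      unfolding conv_def
    proof (rule integral_mono')
      show "integrable lborel (\<lambda>y. LINT s|lborel. P y s)" using lborel_pair.integrable_fst[OF Pi] by simp
      show "0 \<le> (LINT s|lborel. P y s)" for y unfolding P_def using K(2) by (intro integral_nonneg_AE) auto
      show "norm (duhamel \<beta> u v t y) *\<^sub>R ?K (x - y) \<le> (LINT s|lborel. P y s)" for y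
        unfolding P_def integral_mult_right_zero real_scaleR_def
        by (subst mult.commute) (intro mult_left_mono Nb K(2))
    qed
    also have "\<dots> = (LINT s|lborel. LINT y|lborel. P y s)"
      using lborel_pair.Fubini_integral[OF Pi] by simp
    also have "\<dots> = (LINT s:{0<..<t}|lborel. conv ?K (\<lambda>y. norm (heat_leray_div \<beta> (t - s) (u s) (v s) y)) x)"
    proof -
      have "(LINT y|lborel. P y s) = indicator {0<..<t} s *\<^sub>R conv ?K (\<lambda>y. norm (heat_leray_div \<beta> (t - s) (u s) (v s) y)) x" for s
        unfolding P_def conv_def real_scaleR_def integral_mult_right_zero[symmetric] by (simp only: mult_ac)
      then show ?thesis unfolding set_lebesgue_integral_def by simp
    qed
    also have "\<dots> \<le> norm (LINT s:{0<..<t}|lborel. conv ?K (\<lambda>y. norm (heat_leray_div \<beta> (t - s) (u s) (v s) y)) x)" by simp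
    also have "\<dots> \<le> (C * (R * R) * \<tau> powr (- ?a)) * (t powr (1 - ?e - ?a) * ?B)"
    proof (rule time_integral_bound(2))
      show "(\<lambda>s. conv ?K (\<lambda>y. norm (heat_leray_div \<beta> (t - s) (u s) (v s) y)) x) \<in> borel_measurable borel"
        unfolding conv_def by measurable
      fix s :: real assume s: "0 < s" "s < t"
      have "conv ?K (\<lambda>y. norm (heat_leray_div \<beta> (t - s) (u s) (v s) y)) x \<le> C * (t - s) powr (- ?e) * ((R * \<tau> powr (- ?a)) * (R * s powr (- ?a)))"
        by (rule H) (use s \<tau> sup_classD[OF u] sup_classD[OF v] g in \<open>auto simp: gauge_class_def\<close>)
      also have "\<dots> = (C * (R * R) * \<tau> powr (- ?a)) * ((t - s) powr (- ?e) * s powr (- ?a))" by (simp only: mult_ac)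
      finally have "conv ?K (\<lambda>y. norm (heat_leray_div \<beta> (t - s) (u s) (v s) y)) x \<le> (C * (R * R) * \<tau> powr (- ?a)) * ((t - s) powr (- ?e) * s powr (- ?a))" .
      moreover have "0 \<le> conv ?K (\<lambda>y. norm (heat_leray_div \<beta> (t - s) (u s) (v s) y)) x"
        unfolding conv_def using K(2) by (intro integral_nonneg_AE) auto
      ultimately show "norm (conv ?K (\<lambda>y. norm (heat_leray_div \<beta> (t - s) (u s) (v s) y)) x) \<le> (C * (R * R) * \<tau> powr (- ?a)) * ((t - s) powr (- ?e) * s powr (- ?a))"
        by simp
    qed (use crit_exp[OF \<beta>] t in auto)
    also have "1 - ?e - ?a = 0" using crit_exp(5)[OF \<beta>] by simp
    finally show ?thesis using t by (simp add: mult_ac)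
  qed
  show ?thesis
  proof (intro exI[of _ "C * ?B"] conjI allI impI)
    show "0 < C * ?B" using C Bp by simp
    fix u v :: "real \<Rightarrow> real^'n \<Rightarrow> real^'n" and R
    assume h: "sup_class \<beta> R u" "sup_class \<beta> R v" "gauge_class \<beta> R u"
    show "gauge_class \<beta> (C * ?B * (R * R)) (duhamel \<beta> u v)"
      unfolding gauge_class_def using main[OF h] by blast
  qed
qed

section \<open>Initial data in the gauge space\<close>

text \<open>The content of \<open>G_norm \<le> A\<close> with almost everywhere replaced by everywhere.\<close>

definition data_class :: "real \<Rightarrow> real \<Rightarrow> (real^'n \<Rightarrow> real^'n) \<Rightarrow> bool" where
  "data_class \<beta> A f \<longleftrightarrow> f \<in> borel_measurable borel \<and>
     (\<forall>t>0. \<forall>x. integrable lborel (\<lambda>y. norm (f y) * heat_kernel \<beta> t (x - y)) \<and>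
        conv (heat_kernel \<beta> t) (\<lambda>y. norm (f y)) x \<le> A * t powr (- crit_exp \<beta>))"

lemma AE_lborel_dense:
  fixes x :: "'a::euclidean_space"
  assumes P: "AE x in lborel. P x" and r: "r > 0"
  shows "\<exists>y\<in>ball x r. P y"
proof (rule ccontr)
  assume n: "\<not> (\<exists>y\<in>ball x r. P y)"
  obtain N where N: "N \<in> null_sets lborel" "{x. \<not> P x} \<subseteq> N"
    using P unfolding eventually_ae_filter by auto
  have "N \<in> null_sets lebesgue" using N(1) null_sets_completionI by blast
  then have "negligible N" by (simp add: negligible_iff_null_sets)
  moreover have "ball x r \<subseteq> N" using n N(2) by blast
  ultimately have "negligible (ball x r)" using negligible_subset by blast
  then show False using open_not_negligible[of "ball x r"] r by auto
qed

lemma gauge_weight_exponent: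
  assumes "\<beta> > 0"
  shows "real_of_ereal (ereal ((2 * \<beta> - 1) * real CARD('n::finite)) / (2 * ereal (real CARD('n)) * ereal \<beta>)) = crit_exp \<beta>"
proof -
  have "2 * ereal (real CARD('n)) * ereal \<beta> = ereal (2 * real CARD('n) * \<beta>)" by simp
  then show ?thesis using assms by (simp add: crit_exp_def)
qed

text \<open>The norm bounds the convolution only almost everywhere. Every point is a limit of good points, and
Fatou's lemma applies because the kernel is continuous and nonnegative.\<close>

lemma G_norm_data_class:
  fixes f :: "real^'n \<Rightarrow> real^'n"
  assumes \<beta>: "1/2 < \<beta>" "\<beta> < 1" and f: "f \<in> borel_measurable borel"
    and G: "G_norm \<beta> (ereal (real CARD('n))) (2 * \<beta> - 1) f \<le> ennreal A" and A: "A \<ge> 0"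
  shows "data_class \<beta> A f"
  unfolding data_class_def
proof (intro conjI allI impI f)
  have \<beta>0: "0 < \<beta>" using \<beta> by simp
  fix t :: real and x assume t: "t > 0"
  let ?K = "heat_kernel \<beta> t :: real^'n \<Rightarrow> real" and ?g = "\<lambda>y. norm (f y)"
  note f [measurable]
  have K0: "0 \<le> ?K x" for x by (rule heat_kernel_nonneg[OF \<beta>0 \<beta>(2) t])
  have Kc: "continuous_on UNIV ?K" by (rule heat_kernel_continuous[OF t \<beta>0])
  let ?X = "if convolvable ?K ?g then linf_norm (conv ?K ?g) else top"
  define ta where "ta = t powr crit_exp \<beta>"
  have ta: "ta > 0" using t by (simp add: ta_def)
  have X: "ennreal ta * ?X \<le> ennreal A"
    using order_trans[OF SUP_upper[of t "{0<..}"] G[unfolded G_norm_def gauge_weight_exponent[OF \<beta>0]]] t unfolding ta_def by simp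
  have cv: "convolvable ?K ?g"
  proof (rule ccontr)
    assume "\<not> convolvable ?K ?g"
    then have "ennreal ta * top \<le> ennreal A" using X by simp
    then show False using ta by (simp add: ennreal_mult_top top_unique)
  qed
  have lin: "linf_norm (conv ?K ?g) \<le> ennreal (A / ta)"
  proof -
    have "ennreal ta * linf_norm (conv ?K ?g) \<le> ennreal A" using X cv by simp
    then have "ennreal (1 / ta) * (ennreal ta * linf_norm (conv ?K ?g)) \<le> ennreal (1 / ta) * ennreal A" by (rule mult_left_mono) simp
    then show ?thesis using ta A by (simp add: mult.assoc[symmetric] flip: ennreal_mult)
  qed
  define F where "F = (\<lambda>x. \<integral>\<^sup>+y. ennreal (?g y * ?K (x - y)) \<partial>lborel)"
  \<comment> \<open>with values in \<open>[0,\<infinity>]\<close> the convolution makes sense at every point, integrable or not\<close>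
  have ae: "AE x in lborel. F x \<le> ennreal (A / ta)"
  proof -
    have "AE x in lborel. ennreal (norm (conv ?K ?g x)) \<le> linf_norm (conv ?K ?g)"
      unfolding linf_norm_def by (rule esssup_AE)
    moreover have "AE x in lborel. integrable lborel (\<lambda>y. ?g y *\<^sub>R ?K (x - y))" using cv unfolding convolvable_def .
    ultimately show ?thesis
    proof eventually_elim
      case (elim x)
      have "F x = ennreal (conv ?K ?g x)"
        unfolding F_def conv_def using elim(2) K0 by (subst nn_integral_eq_integral) auto
      also have "\<dots> \<le> ennreal (norm (conv ?K ?g x))" by (intro ennreal_leI) simp
      finally show ?case using elim(1) lin by (meson order_trans)
    qed
  qed
  have Fx: "F x \<le> ennreal (A / ta)"
  proof -
    have "\<exists>y\<in>ball x (1 / real (Suc i)). F y \<le> ennreal (A / ta)" for i :: nat by (rule AE_lborel_dense[OF ae]) simp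
    then obtain X where X: "\<And>i. X i \<in> ball x (1 / real (Suc i))" "\<And>i. F (X i) \<le> ennreal (A / ta)" by metis
    have Xx: "X \<longlonglongrightarrow> x"
    proof (rule metric_LIMSEQ_I)
      fix r :: real assume "r > 0"
      then obtain N where N: "1 / real (Suc N) < r" using nat_approx_posE by blast
      have "dist (X i) x < r" if "i \<ge> N" for i
      proof -
        have "dist (X i) x < 1 / real (Suc i)" using X(1)[of i] by (simp add: dist_commute)
        also have "\<dots> \<le> 1 / real (Suc N)" using that by (simp add: frac_le)
        finally show ?thesis using N by simp
      qed
      then show "\<exists>no. \<forall>n\<ge>no. dist (X n) x < r" by blast
    qed
    have "F x = (\<integral>\<^sup>+y. liminf (\<lambda>i. ennreal (?g y * ?K (X i - y))) \<partial>lborel)"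
      unfolding F_def
    proof (rule nn_integral_cong)
      fix y
      have "(\<lambda>i. ?K (X i - y)) \<longlonglongrightarrow> ?K (x - y)"
        using Kc Xx by (intro isCont_tendsto_compose[of _ ?K] tendsto_intros) (auto simp: continuous_on_eq_continuous_at)
      then have "(\<lambda>i. ennreal (?g y * ?K (X i - y))) \<longlonglongrightarrow> ennreal (?g y * ?K (x - y))"
        by (intro tendsto_ennrealI tendsto_intros)
      then show "ennreal (?g y * ?K (x - y)) = liminf (\<lambda>i. ennreal (?g y * ?K (X i - y)))"
        by (simp add: lim_imp_Liminf)
    qed
    also have "\<dots> \<le> liminf (\<lambda>i. F (X i))" unfolding F_def by (rule nn_integral_liminf) measurable
    also have "\<dots> \<le> ennreal (A / ta)"
      using X(2) by (intro Liminf_le) auto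
    finally show ?thesis .
  qed
  have i: "integrable lborel (\<lambda>y. ?g y * ?K (x - y))"
    by (rule integrableI_nonneg) (use Fx K0 in \<open>auto simp: F_def top.not_eq_extremum intro: le_less_trans\<close>)
  then show "integrable lborel (\<lambda>y. ?g y * ?K (x - y))" .
  have "ennreal (conv ?K ?g x) = F x"
    unfolding F_def conv_def using i K0 by (subst nn_integral_eq_integral) auto
  then have "ennreal (conv ?K ?g x) \<le> ennreal (A / ta)" using Fx by simp
  then have "conv ?K ?g x \<le> A / ta" using A ta by (simp add: ennreal_le_iff)
  then show "conv ?K ?g x \<le> A * t powr (- crit_exp \<beta>)" by (simp add: ta_def powr_minus divide_inverse)
qed

lemma G_norm_le:
  fixes f :: "real^'n \<Rightarrow> real^'n"
  assumes \<beta>: "1/2 < \<beta>" "\<beta> < 1" and f: "f \<in> borel_measurable borel" and B: "\<And>y. norm (f y) \<le> B"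
    and R: "\<And>\<tau> x. \<tau> > 0 \<Longrightarrow> conv (heat_kernel \<beta> \<tau>) (\<lambda>y. norm (f y)) x \<le> R * \<tau> powr (- crit_exp \<beta>)"
  shows "G_norm \<beta> (ereal (real CARD('n))) (2 * \<beta> - 1) f \<le> ennreal R"
proof -
  have \<beta>0: "0 < \<beta>" using \<beta> by simp
  note f [measurable]
  show ?thesis unfolding G_norm_def gauge_weight_exponent[OF \<beta>0]
  proof (rule SUP_least)
    fix t :: real assume "t \<in> {0<..}"
    then have t: "t > 0" by simp
    let ?K = "heat_kernel \<beta> t :: real^'n \<Rightarrow> real" and ?g = "\<lambda>y. norm (f y)"
    have gB: "\<bar>?g y\<bar> \<le> B" for y using B by simp
    have gm: "?g \<in> borel_measurable borel" by measurable
    have cv: "convolvable ?K ?g"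
      unfolding convolvable_def using conv_bounded(1)[OF heat_kernel_L1(1)[OF \<beta>0 \<beta>(2) t] gm gB] by simp
    have "linf_norm (conv ?K ?g) \<le> ennreal (R * t powr (- crit_exp \<beta>))"
    proof (rule linf_norm_le)
      show "conv ?K ?g \<in> borel_measurable borel" unfolding conv_def by measurable
      have "0 \<le> ?K z" for z by (rule heat_kernel_nonneg[OF \<beta>0 \<beta>(2) t])
      then have "0 \<le> conv ?K ?g x" for x unfolding conv_def by (intro integral_nonneg_AE) auto
      then show "norm (conv ?K ?g x) \<le> R * t powr (- crit_exp \<beta>)" for x using R[OF t] by simp
    qed
    then have "ennreal (t powr crit_exp \<beta>) * linf_norm (conv ?K ?g) \<le> ennreal (t powr crit_exp \<beta>) * ennreal (R * t powr (- crit_exp \<beta>))"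
      by (rule mult_left_mono) simp
    also have "\<dots> = ennreal R"
    proof -
      have "t powr crit_exp \<beta> * (R * t powr (- crit_exp \<beta>)) = R" using t by (simp add: powr_minus field_simps)
      then show ?thesis by (subst ennreal_mult'[symmetric]) (simp, simp only:)
    qed
    finally show "ennreal (t powr crit_exp \<beta>) * (if convolvable ?K ?g then linf_norm (conv ?K ?g) else top) \<le> ennreal R" using cv by simp
  qed
qed

lemma heat_measurable:
  assumes [measurable]: "f \<in> borel_measurable borel"
  shows "jointly_measurable (\<lambda>t. heat \<beta> t f)"
  unfolding jointly_measurable_def
proof (rule borel_measurable_vec_lambda_components)
  fix i
  show "(\<lambda>x. (case x of (t, x) \<Rightarrow> heat \<beta> t f x) $ i) \<in> borel_measurable (borel \<Otimes>\<^sub>M borel)"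
    unfolding heat_def conv_def case_prod_unfold by simp
qed

lemma data_classD:
  assumes \<beta>: "1/2 < \<beta>" "\<beta> < 1" and d: "data_class \<beta> A f" and t: "t > 0"
  shows "integrable lborel (\<lambda>y. norm (f y) * heat_kernel \<beta> t (x - y))"
    "(LINT y|lborel. norm (f y) * heat_kernel \<beta> t (x - y)) \<le> A * t powr (- crit_exp \<beta>)"
    "integrable lborel (\<lambda>y. f y $ j * heat_kernel \<beta> t (x - y))"
    "(LINT y|lborel. \<bar>f y $ j * heat_kernel \<beta> t (x - y)\<bar>) \<le> A * t powr (- crit_exp \<beta>)"
    "A \<ge> 0"
proof -
  have \<beta>0: "0 < \<beta>" using \<beta> by simp
  have K0: "0 \<le> heat_kernel \<beta> t x" for x :: "real^'a" by (rule heat_kernel_nonneg[OF \<beta>0 \<beta>(2) t])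
  have f [measurable]: "f \<in> borel_measurable borel" using d by (simp add: data_class_def)
  show 1: "integrable lborel (\<lambda>y. norm (f y) * heat_kernel \<beta> t (x - y))" and 2: "(LINT y|lborel. norm (f y) * heat_kernel \<beta> t (x - y)) \<le> A * t powr (- crit_exp \<beta>)"
    using d t by (auto simp: data_class_def conv_def)
  have b: "\<bar>f y $ j * heat_kernel \<beta> t (x - y)\<bar> \<le> norm (f y) * heat_kernel \<beta> t (x - y)" for y
    unfolding abs_mult using K0[of "x - y"] by (simp add: mult_right_mono component_le_norm_cart)
  show 3: "integrable lborel (\<lambda>y. f y $ j * heat_kernel \<beta> t (x - y))"
    by (rule Bochner_Integration.integrable_bound[OF 1]) (use b K0 in \<open>auto simp: abs_mult\<close>)
  have "(LINT y|lborel. \<bar>f y $ j * heat_kernel \<beta> t (x - y)\<bar>) \<le> (LINT y|lborel. norm (f y) * heat_kernel \<beta> t (x - y))"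
    by (intro integral_mono integrable_abs 3 1 b)
  then show "(LINT y|lborel. \<bar>f y $ j * heat_kernel \<beta> t (x - y)\<bar>) \<le> A * t powr (- crit_exp \<beta>)" using 2 by simp
  have "0 \<le> (LINT y|lborel. norm (f y) * heat_kernel \<beta> t (x - y))" using K0 by (intro integral_nonneg_AE) auto
  then have "0 \<le> A * t powr (- crit_exp \<beta>)" using 2 by simp
  then show "A \<ge> 0" using t by (simp add: zero_le_mult_iff)
qed

lemma heat_nth: "heat \<beta> t f x $ j = conv (heat_kernel \<beta> t) (\<lambda>y. f y $ j) x"
  unfolding heat_def by simp

text \<open>Positivity of the kernel lets the modulus pass under the convolution in each component.\<close>

lemma heat_le:
  fixes f :: "real^'n \<Rightarrow> real^'n"
  assumes \<beta>: "1/2 < \<beta>" "\<beta> < 1" and d: "data_class \<beta> A f" and t: "t > 0"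
  shows "norm (heat \<beta> t f x) \<le> real CARD('n) * conv (heat_kernel \<beta> t) (\<lambda>y. norm (f y)) x"
proof -
  have \<beta>0: "0 < \<beta>" using \<beta> by simp
  have K0: "0 \<le> heat_kernel \<beta> t x" for x :: "real^'n" by (rule heat_kernel_nonneg[OF \<beta>0 \<beta>(2) t])
  have "\<bar>conv (heat_kernel \<beta> t) (\<lambda>y. f y $ j) x\<bar> \<le> conv (heat_kernel \<beta> t) (\<lambda>y. norm (f y)) x" for j
  proof -
    have "\<bar>conv (heat_kernel \<beta> t) (\<lambda>y. f y $ j) x\<bar> \<le> (LINT y|lborel. \<bar>f y $ j * heat_kernel \<beta> t (x - y)\<bar>)"
      unfolding conv_def using integral_abs_bound[of lborel "\<lambda>y. f y $ j * heat_kernel \<beta> t (x - y)"] by simp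
    also have "\<dots> \<le> (LINT y|lborel. norm (f y) * heat_kernel \<beta> t (x - y))"
    proof (rule integral_mono[OF integrable_abs[OF data_classD(3)[OF \<beta> d t]] data_classD(1)[OF \<beta> d t]])
      show "\<bar>f y $ j * heat_kernel \<beta> t (x - y)\<bar> \<le> norm (f y) * heat_kernel \<beta> t (x - y)" for y
        unfolding abs_mult using K0[of "x - y"] by (simp add: mult_right_mono component_le_norm_cart)
    qed
    finally show ?thesis by (simp add: conv_def)
  qed
  then have "(\<Sum>j\<in>UNIV. \<bar>heat \<beta> t f x $ j\<bar>) \<le> (\<Sum>j\<in>(UNIV::'n set). conv (heat_kernel \<beta> t) (\<lambda>y. norm (f y)) x)"
    unfolding heat_nth by (intro sum_mono)
  then show ?thesis using norm_vec_le_sum[of "heat \<beta> t f x"] by simp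
qed

lemma heat_sup_class:
  fixes f :: "real^'n \<Rightarrow> real^'n"
  assumes \<beta>: "1/2 < \<beta>" "\<beta> < 1" and d: "data_class \<beta> A f"
  shows "sup_class \<beta> (real CARD('n) * A) (\<lambda>t. heat \<beta> t f)"
  unfolding sup_class_def
proof (intro conjI allI impI)
  show "jointly_measurable (\<lambda>t. heat \<beta> t f)" by (rule heat_measurable) (use d in \<open>simp add: data_class_def\<close>)
  fix t :: real and x assume t: "t > 0"
  have "norm (heat \<beta> t f x) \<le> real CARD('n) * conv (heat_kernel \<beta> t) (\<lambda>y. norm (f y)) x" by (rule heat_le[OF \<beta> d t])
  also have "\<dots> \<le> real CARD('n) * (A * t powr (- crit_exp \<beta>))"
    using d t by (intro mult_left_mono) (auto simp: data_class_def)
  finally show "norm (heat \<beta> t f x) \<le> real CARD('n) * A * t powr (- crit_exp \<beta>)" by simp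
qed

text \<open>The heat kernels at times \<open>t\<close> and \<open>\<tau>\<close> commute, and the former has mass at most one.\<close>

lemma heat_gauge_class:
  fixes f :: "real^'n \<Rightarrow> real^'n"
  assumes \<beta>: "1/2 < \<beta>" "\<beta> < 1" and d: "data_class \<beta> A f"
  shows "gauge_class \<beta> (real CARD('n) * A) (\<lambda>t. heat \<beta> t f)"
  unfolding gauge_class_def
proof (intro allI impI)
  have \<beta>0: "0 < \<beta>" using \<beta> by simp
  fix t \<tau> :: real and x :: "real^'n" assume t: "t > 0" and \<tau>: "\<tau> > 0"
  let ?K = "heat_kernel \<beta> \<tau> :: real^'n \<Rightarrow> real" and ?L = "heat_kernel \<beta> t :: real^'n \<Rightarrow> real" and ?g = "\<lambda>y. norm (f y)"
  have f [measurable]: "f \<in> borel_measurable borel" using d by (simp add: data_class_def)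
  have Ki: "integrable lborel ?K" and Li: "integrable lborel ?L" using heat_kernel_L1(1)[OF \<beta>0 \<beta>(2)] t \<tau> by auto
  have K0: "0 \<le> ?K x" "0 \<le> ?L x" for x using heat_kernel_nonneg[OF \<beta>0 \<beta>(2)] t \<tau> by auto
  have a: "(LINT y|lborel. \<bar>?g y * heat_kernel \<beta> s (x - y)\<bar>) \<le> A * s powr (- crit_exp \<beta>)" if "s > 0" for s x
  proof -
    have "0 \<le> heat_kernel \<beta> s z" for z :: "real^'n" by (rule heat_kernel_nonneg[OF \<beta>0 \<beta>(2) that])
    then show ?thesis using data_classD(2)[OF \<beta> d that, of x] by (simp add: abs_mult)
  qed
  have gm: "?g \<in> borel_measurable borel" by measurable
  have nn: "0 \<le> conv (heat_kernel \<beta> s) ?g y" if "s > 0" for s y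
  proof -
    have "0 \<le> heat_kernel \<beta> s z" for z :: "real^'n" by (rule heat_kernel_nonneg[OF \<beta>0 \<beta>(2) that])
    then show ?thesis unfolding conv_def by (intro integral_nonneg_AE) auto
  qed
  have cb: "\<bar>conv (heat_kernel \<beta> s) ?g y\<bar> \<le> A * s powr (- crit_exp \<beta>)" if "s > 0" for s y
    using d nn[OF that] that by (auto simp: data_class_def)
  have cm: "conv (heat_kernel \<beta> s) ?g \<in> borel_measurable borel" for s unfolding conv_def by measurable
  have "conv ?K (\<lambda>y. norm (heat \<beta> t f y)) x \<le> conv ?K (\<lambda>y. real CARD('n) * conv ?L ?g y) x"
  proof (rule conv_mono_nonneg[OF Ki K0(1)])
    show "(\<lambda>y. norm (heat \<beta> t f y)) \<in> borel_measurable borel"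
      using jointly_measurable_slice[OF heat_measurable[OF f]] by measurable
    show "\<bar>norm (heat \<beta> t f y)\<bar> \<le> real CARD('n) * (A * t powr (- crit_exp \<beta>))" for y
      using sup_classD(2)[OF heat_sup_class[OF \<beta> d] t, of y] by simp
    show "(\<lambda>y. real CARD('n) * conv ?L ?g y) \<in> borel_measurable borel" using cm[of t] by measurable
    show "\<bar>real CARD('n) * conv ?L ?g y\<bar> \<le> real CARD('n) * (A * t powr (- crit_exp \<beta>))" for y
      using cb[OF t, of y] by (simp add: abs_mult)
    show "norm (heat \<beta> t f y) \<le> real CARD('n) * conv ?L ?g y" for y by (rule heat_le[OF \<beta> d t])
  qed
  also have "\<dots> = real CARD('n) * conv ?K (conv ?L ?g) x" unfolding conv_def[of ?K] by (simp add: mult.assoc)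
  also have "conv ?K (conv ?L ?g) x = conv ?L (conv ?K ?g) x"
    by (rule conv_commute_L1[OF Ki Li gm data_classD(1)[OF \<beta> d t] a[OF t] data_classD(1)[OF \<beta> d \<tau>] a[OF \<tau>]])
  also have "real CARD('n) * conv ?L (conv ?K ?g) x \<le> real CARD('n) * (A * \<tau> powr (- crit_exp \<beta>))"
  proof (rule mult_left_mono)
    have "conv ?L (conv ?K ?g) x \<le> \<bar>conv ?L (conv ?K ?g) x\<bar>" by simp
    also have "\<dots> \<le> (A * \<tau> powr (- crit_exp \<beta>)) * (LINT y|lborel. \<bar>?L y\<bar>)" by (rule conv_bounded(2)[OF Li cm cb[OF \<tau>]])
    also have "\<dots> \<le> (A * \<tau> powr (- crit_exp \<beta>)) * 1"
      using heat_kernel_L1(2)[OF \<beta>0 \<beta>(2) t, where 'n='n] data_classD(5)[OF \<beta> d t] by (intro mult_left_mono) auto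
    finally show "conv ?L (conv ?K ?g) x \<le> A * \<tau> powr (- crit_exp \<beta>)" by simp
  qed simp
  finally show "conv ?K (\<lambda>y. norm (heat \<beta> t f y)) x \<le> real CARD('n) * A * \<tau> powr (- crit_exp \<beta>)" by simp
qed

text \<open>Half of the time makes the data bounded, the other half makes them regular.\<close>

lemma heat_hoelder_class:
  fixes dummy :: "'n::finite"
  assumes \<beta>: "1/2 < \<beta>" "\<beta> < 1" and sg: "0 < \<sigma>" "\<sigma> \<le> 1"
  shows "\<exists>C>0. \<forall>A (f::real^'n \<Rightarrow> real^'n). data_class \<beta> A f \<longrightarrow> hoelder_class \<beta> \<sigma> (C * A) (\<lambda>t. heat \<beta> t f)"
proof -
  have \<beta>0: "0 < \<beta>" using \<beta> by simp
  let ?a = "crit_exp \<beta>"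
  define r where "r = \<sigma> / (2 * \<beta>)"
  obtain C1 where C1: "C1 > 0" and Kmod: "\<And>t h. t > 0 \<Longrightarrow> (LINT x|lborel. \<bar>heat_kernel \<beta> t (x + h) - heat_kernel \<beta> t (x::real^'n)\<bar>) \<le> C1 * norm h powr \<sigma> * t powr (- r)"
    using heat_kernel_modulus[OF \<beta>0 \<beta>(2) sg, where 'n='n] unfolding r_def by auto
  define C where "C = real CARD('n) * (C1 * 2 powr (?a + r))"
  have main: "norm (heat \<beta> t f x - heat \<beta> t f x') \<le> C * A * t powr (- ?a - r) * norm (x - x') powr \<sigma>"
    if d: "data_class \<beta> A f" and t: "t > 0" for A t x x' and f :: "real^'n \<Rightarrow> real^'n"
  proof -
    have t2: "t / 2 > 0" using t by simp
    let ?K = "heat_kernel \<beta> (t / 2) :: real^'n \<Rightarrow> real"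
    have f [measurable]: "f \<in> borel_measurable borel" using d by (simp add: data_class_def)
    have Ki: "integrable lborel ?K" by (rule heat_kernel_L1(1)[OF \<beta>0 \<beta>(2) t2])
    have A: "A \<ge> 0" by (rule data_classD(5)[OF \<beta> d t])
    have c: "\<bar>heat \<beta> t f x $ j - heat \<beta> t f x' $ j\<bar> \<le> (A * (t/2) powr (- ?a)) * (C1 * norm (x - x') powr \<sigma> * (t/2) powr (- r))" for j
    proof -
      define G where "G = conv ?K (\<lambda>y. f y $ j)"
      have Gm: "G \<in> borel_measurable borel" unfolding G_def conv_def by measurable
      have Gb: "\<bar>G y\<bar> \<le> A * (t/2) powr (- ?a)" for y
        unfolding G_def conv_def real_scaleR_def by (rule order_trans[OF integral_abs_bound data_classD(4)[OF \<beta> d t2]])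
      have e: "heat \<beta> t f x $ j = conv ?K G x" for x
      proof -
        have "heat_kernel \<beta> t = (\<lambda>x. LINT z|lborel. ?K z * ?K (x - z))"
          using heat_kernel_semigroup[OF \<beta>0 \<beta>(2) t2 t2] by auto
        then show ?thesis unfolding heat_nth G_def
          using conv_assoc_L1[OF Ki _ _ data_classD(3)[OF \<beta> d t2, where j = j] data_classD(4)[OF \<beta> d t2, where j = j]] by simp
      qed
      have "\<bar>conv ?K G x - conv ?K G x'\<bar> \<le> (A * (t/2) powr (- ?a)) * (LINT z|lborel. \<bar>?K (z + (x - x')) - ?K z\<bar>)"
        by (rule conv_modulus[OF Ki Gm Gb])
      also have "\<dots> \<le> (A * (t/2) powr (- ?a)) * (C1 * norm (x - x') powr \<sigma> * (t/2) powr (- r))"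
        using A by (intro mult_left_mono Kmod t2) auto
      finally show ?thesis unfolding e .
    qed
    have "norm (heat \<beta> t f x - heat \<beta> t f x') \<le> (\<Sum>j\<in>UNIV. \<bar>(heat \<beta> t f x - heat \<beta> t f x') $ j\<bar>)" by (rule norm_vec_le_sum)
    also have "\<dots> \<le> (\<Sum>j\<in>(UNIV::'n set). (A * (t/2) powr (- ?a)) * (C1 * norm (x - x') powr \<sigma> * (t/2) powr (- r)))"
      unfolding vector_minus_component by (intro sum_mono c)
    also have "\<dots> = real CARD('n) * C1 * ((t/2) powr (- ?a) * (t/2) powr (- r)) * A * norm (x - x') powr \<sigma>" by simp
    also have "(t/2) powr (- ?a) * (t/2) powr (- r) = 2 powr (?a + r) * t powr (- ?a - r)"
      using t by (simp add: powr_divide powr_minus powr_diff powr_add field_simps)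
    finally show ?thesis unfolding C_def by (simp add: mult_ac)
  qed
  show ?thesis
  proof (intro exI[of _ C] conjI allI impI)
    show "0 < C" using C1 by (simp add: C_def)
    fix A and f :: "real^'n \<Rightarrow> real^'n" assume d: "data_class \<beta> A f"
    show "hoelder_class \<beta> \<sigma> (C * A) (\<lambda>t. heat \<beta> t f)"
      unfolding hoelder_class_def r_def[symmetric] using main[OF d] by blast
  qed
qed

section \<open>Divergence-free terms\<close>

text \<open>By Fubini the heat kernel is moved onto the test function, and translates of test functions are
test functions.\<close>

lemma heat_divergence_free:
  fixes f :: "real^'n \<Rightarrow> real^'n"
  assumes \<beta>: "1/2 < \<beta>" "\<beta> < 1" and d: "data_class \<beta> A f" and t: "t > 0" and div: "divergence_free f"
  shows "divergence_free (heat \<beta> t f)"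
  unfolding divergence_free_def
proof (intro allI impI)
  have \<beta>0: "0 < \<beta>" using \<beta> by simp
  fix \<psi> :: "real^'n \<Rightarrow> real" assume \<psi>: "test_function \<psi>"
  have c1: "c1_compact \<psi>" using test_function_c1_compact[OF \<psi>, of "[]"] by simp
  have s: "smooth \<psi>" using \<psi> by (simp add: test_function_def)
  have pi: "integrable lborel (partial k \<psi>)" for k by (rule c1_compact_integrable(2)[OF c1])
  have pm [measurable]: "partial k \<psi> \<in> borel_measurable borel" for k using pi by auto
  have f [measurable]: "f \<in> borel_measurable borel" using d by (simp add: data_class_def)
  let ?K = "heat_kernel \<beta> t :: real^'n \<Rightarrow> real"
  let ?h = "\<lambda>k x z. partial k \<psi> x * (?K z * f (x - z) $ k)"
  have flip: "integrable lborel (\<lambda>z. ?K z * f (x - z) $ k)" "(LINT z|lborel. \<bar>?K z * f (x - z) $ k\<bar>) \<le> A * t powr (- crit_exp \<beta>)" for x k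
    using lborel_integrable_flip(1)[OF data_classD(3)[OF \<beta> d t, where x=x and j=k], of x]
      lborel_integrable_flip(2)[OF integrable_abs[OF data_classD(3)[OF \<beta> d t, where x=x and j=k]], of x] data_classD(4)[OF \<beta> d t, where x=x and j=k]
    by (simp_all add: mult.commute)
  have hi: "integrable (lborel \<Otimes>\<^sub>M lborel) (\<lambda>(x, z). ?h k x z)" for k
  proof (rule lborel_pair.Fubini_integrable)
    show "AE x in lborel. integrable lborel (\<lambda>z. case (x, z) of (x, z) \<Rightarrow> ?h k x z)" using flip(1) by simp
    show "integrable lborel (\<lambda>x. LINT z|lborel. norm (case (x, z) of (x, z) \<Rightarrow> ?h k x z))"
    proof (rule Bochner_Integration.integrable_bound)
      show "integrable lborel (\<lambda>x. \<bar>partial k \<psi> x\<bar> * (A * t powr (- crit_exp \<beta>)))" using pi by simp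
      show "AE x in lborel. norm (LINT z|lborel. norm (case (x, z) of (x, z) \<Rightarrow> ?h k x z)) \<le> norm (\<bar>partial k \<psi> x\<bar> * (A * t powr (- crit_exp \<beta>)))"
      proof (rule AE_I2)
        fix x
        have "0 \<le> (LINT z|lborel. \<bar>?h k x z\<bar>)" by simp
        moreover have "(LINT z|lborel. \<bar>?h k x z\<bar>) \<le> \<bar>partial k \<psi> x\<bar> * (A * t powr (- crit_exp \<beta>))"
          unfolding abs_mult[of "partial k \<psi> x"] integral_mult_right_zero by (intro mult_left_mono flip(2)) auto
        ultimately show "norm (LINT z|lborel. norm (case (x, z) of (x, z) \<Rightarrow> ?h k x z)) \<le> norm (\<bar>partial k \<psi> x\<bar> * (A * t powr (- crit_exp \<beta>)))"
          unfolding real_norm_def prod.case by linarith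
      qed
    qed measurable
  qed measurable
  have hx: "heat \<beta> t f x $ k * partial k \<psi> x = (LINT z|lborel. ?h k x z)" for x k
    unfolding heat_nth conv_flip integral_mult_right_zero by (simp add: mult.commute)
  have "(LINT x|lborel. (\<Sum>k\<in>UNIV. heat \<beta> t f x $ k * partial k \<psi> x)) = (\<Sum>k\<in>UNIV. LINT x|lborel. LINT z|lborel. ?h k x z)"
    unfolding hx using lborel_pair.integrable_fst[OF hi] by (intro Bochner_Integration.integral_sum) simp
  also have "\<dots> = (\<Sum>k\<in>UNIV. LINT z|lborel. LINT x|lborel. ?h k x z)"
    using lborel_pair.Fubini_integral[OF hi] by simp
  also have "\<dots> = (LINT z|lborel. (\<Sum>k\<in>UNIV. LINT x|lborel. ?h k x z))"
    using lborel_pair.integrable_snd[OF hi] by (intro Bochner_Integration.integral_sum[symmetric]) simp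
  also have "\<dots> = (LINT z|(lborel :: (real^'n) measure). 0)"
  proof (rule Bochner_Integration.integral_cong_AE)
    have "AE z in lborel. \<forall>k. integrable lborel (\<lambda>x. ?h k x z)"
      using lborel_pair.AE_integrable_snd[OF hi] by (simp add: AE_all_countable)
    then show "AE z in lborel. (\<Sum>k\<in>UNIV. LINT x|lborel. ?h k x z) = 0"
    proof eventually_elim
      case (elim z)
      have "(\<Sum>k\<in>UNIV. LINT x|lborel. ?h k x z) = (LINT x|lborel. (\<Sum>k\<in>UNIV. ?h k x z))"
        using elim by (intro Bochner_Integration.integral_sum[symmetric]) auto
      also have "\<dots> = ?K z * (LINT x|lborel. (\<Sum>k\<in>UNIV. f (x - z) $ k * partial k \<psi> x))"
        unfolding integral_mult_right_zero[symmetric] sum_distrib_left by (simp only: mult_ac)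
      also have "(LINT x|lborel. (\<Sum>k\<in>UNIV. f (x - z) $ k * partial k \<psi> x)) = (LINT x|lborel. (\<Sum>k\<in>UNIV. f x $ k * partial k \<psi> (x + z)))"
        using lborel_integral_affine[of 1 "\<lambda>x. \<Sum>k\<in>UNIV. f (x - z) $ k * partial k \<psi> x" z] by (simp add: add.commute)
      also have "\<dots> = (LINT x|lborel. (\<Sum>k\<in>UNIV. f x $ k * partial k (\<lambda>x. \<psi> (x + z)) x))"
        using partial_shift[OF smooth_differentiable[OF s]] by simp
      also have "\<dots> = 0" using div test_function_shift[OF \<psi>, of z] unfolding divergence_free_def by blast
      finally show ?case by simp
    qed
  qed (measurable)
  finally show "(LINT x|lborel. (\<Sum>k\<in>UNIV. heat \<beta> t f x $ k * partial k \<psi> x)) = 0" by simp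
qed

lemma heat_leray_div_divergence:
  fixes u v :: "real^'n \<Rightarrow> real^'n"
  assumes \<beta>: "0 < \<beta>" "\<beta> < 1" and t: "t > 0" and m [measurable]: "u \<in> borel_measurable borel" "v \<in> borel_measurable borel"
    and b: "\<And>y. norm (u y) \<le> A" "\<And>y. norm (v y) \<le> B" and \<psi>: "test_function \<psi>"
  shows "(LINT x|lborel. (\<Sum>j\<in>UNIV. heat_leray_div \<beta> t u v x $ j * partial j \<psi> x)) = 0"
proof -
  have c1: "c1_compact \<psi>" using test_function_c1_compact[OF \<psi>, of "[]"] by simp
  have pi: "integrable lborel (partial k \<psi>)" for k by (rule c1_compact_integrable(2)[OF c1])
  have pm [measurable]: "partial k \<psi> \<in> borel_measurable borel" for k using pi by auto
  have Oi: "integrable lborel (oseen_kernel \<beta> t j k (l::'n))" for j k l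
    using oseen_kernel_L1[OF \<beta>, where 'n='n] t by auto
  let ?h = "\<lambda>j k l x y. partial j \<psi> x * (u y $ l * v y $ k * oseen_kernel \<beta> t j k l (x - y))"
  have g: "\<bar>u y $ l * v y $ k\<bar> \<le> A * B" for y l k by (rule abs_component_mult_le[OF b])
  have gm: "(\<lambda>y. u y $ l * v y $ k) \<in> borel_measurable borel" for l k by measurable
  have hi: "integrable (lborel \<Otimes>\<^sub>M lborel) (\<lambda>(x, y). ?h j k l x y)" for j k l
  proof (rule lborel_pair.Fubini_integrable)
    let ?I = "LINT y|lborel. \<bar>oseen_kernel \<beta> t j k l y\<bar>"
    show "AE x in lborel. integrable lborel (\<lambda>y. case (x, y) of (x, y) \<Rightarrow> ?h j k l x y)" using conv_bounded(1)[OF Oi gm g] by simp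
    show "integrable lborel (\<lambda>x. LINT y|lborel. norm (case (x, y) of (x, y) \<Rightarrow> ?h j k l x y))"
    proof (rule Bochner_Integration.integrable_bound)
      show "integrable lborel (\<lambda>x. \<bar>partial j \<psi> x\<bar> * (A * B * ?I))" using pi by simp
      show "AE x in lborel. norm (LINT y|lborel. norm (case (x, y) of (x, y) \<Rightarrow> ?h j k l x y)) \<le> norm (\<bar>partial j \<psi> x\<bar> * (A * B * ?I))"
      proof (rule AE_I2)
        fix x
        have "0 \<le> (LINT y|lborel. \<bar>?h j k l x y\<bar>)" by simp
        moreover have "(LINT y|lborel. \<bar>?h j k l x y\<bar>) \<le> \<bar>partial j \<psi> x\<bar> * (A * B * ?I)"
          unfolding abs_mult[of "partial j \<psi> x"] integral_mult_right_zero by (intro mult_left_mono conv_abs_bounded Oi gm g) auto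
        ultimately show "norm (LINT y|lborel. norm (case (x, y) of (x, y) \<Rightarrow> ?h j k l x y)) \<le> norm (\<bar>partial j \<psi> x\<bar> * (A * B * ?I))"
          unfolding real_norm_def prod.case by linarith
      qed
    qed measurable
  qed measurable
  have e: "heat_leray_div \<beta> t u v x $ j * partial j \<psi> x = (\<Sum>k\<in>UNIV. \<Sum>l\<in>UNIV. LINT y|lborel. ?h j k l x y)" for x j
    unfolding heat_leray_div_nth conv_def real_scaleR_def sum_distrib_right integral_mult_right_zero by (simp only: mult.commute)
  have if1: "integrable lborel (\<lambda>x. LINT y|lborel. ?h j k l x y)" for j k l using lborel_pair.integrable_fst[OF hi] by simp
  have inner: "(\<Sum>j\<in>UNIV. LINT x|lborel. LINT y|lborel. ?h j k l x y) = 0" for k l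
  proof -
    have "(\<Sum>j\<in>UNIV. LINT x|lborel. LINT y|lborel. ?h j k l x y) = (\<Sum>j\<in>UNIV. LINT y|lborel. LINT x|lborel. ?h j k l x y)"
      using lborel_pair.Fubini_integral[OF hi] by simp
    also have "\<dots> = (LINT y|lborel. (\<Sum>j\<in>UNIV. LINT x|lborel. ?h j k l x y))"
      using lborel_pair.integrable_snd[OF hi] by (intro Bochner_Integration.integral_sum[symmetric]) simp
    also have "(\<lambda>y. \<Sum>j\<in>UNIV. LINT x|lborel. ?h j k l x y) = (\<lambda>y. 0)"
    proof
      fix y
      have "(LINT x|lborel. ?h j k l x y) = u y $ l * v y $ k * (LINT x|lborel. oseen_kernel \<beta> t j k l (x - y) * partial j \<psi> x)" for j
        unfolding integral_mult_right_zero[symmetric] by (simp only: mult_ac)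
      then have "(\<Sum>j\<in>UNIV. LINT x|lborel. ?h j k l x y) = u y $ l * v y $ k * (\<Sum>j\<in>UNIV. LINT x|lborel. oseen_kernel \<beta> t j k l (x - y) * partial j \<psi> x)"
        by (simp only: sum_distrib_left)
      then show "(\<Sum>j\<in>UNIV. LINT x|lborel. ?h j k l x y) = 0" unfolding oseen_kernel_divergence[OF \<psi> t \<beta>] by simp
    qed
    finally show "(\<Sum>j\<in>UNIV. LINT x|lborel. LINT y|lborel. ?h j k l x y) = 0" by simp
  qed
  have "(LINT x|lborel. (\<Sum>j\<in>UNIV. heat_leray_div \<beta> t u v x $ j * partial j \<psi> x)) = (\<Sum>j\<in>UNIV. \<Sum>k\<in>UNIV. \<Sum>l\<in>UNIV. LINT x|lborel. LINT y|lborel. ?h j k l x y)"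
    unfolding e using if1 by (simp add: Bochner_Integration.integral_sum Bochner_Integration.integrable_sum del: integral_mult_right_zero integral_mult_left_zero)
  also have "\<dots> = (\<Sum>k\<in>UNIV. \<Sum>l\<in>UNIV. \<Sum>j\<in>UNIV. LINT x|lborel. LINT y|lborel. ?h j k l x y)"
    by (subst sum.swap) (intro sum.cong refl sum.swap)
  also have "\<dots> = 0" by (simp only: inner sum.neutral_const)
  finally show ?thesis .
qed

text \<open>The space-time integral converges absolutely, so the test function may be paired with the kernel at
each time separately.\<close>

lemma duhamel_divergence_free:
  fixes u v :: "real \<Rightarrow> real^'n \<Rightarrow> real^'n"
  assumes \<beta>: "1/2 < \<beta>" "\<beta> < 1" and u: "sup_class \<beta> A u" and v: "sup_class \<beta> B v" and t: "t > 0"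
  shows "divergence_free (duhamel \<beta> u v t)"
  unfolding divergence_free_def
proof (intro allI impI)
  have \<beta>0: "0 < \<beta>" using \<beta> by simp
  fix \<psi> :: "real^'n \<Rightarrow> real" assume \<psi>: "test_function \<psi>"
  have c1: "c1_compact \<psi>" using test_function_c1_compact[OF \<psi>, of "[]"] by simp
  have pi: "integrable lborel (partial k \<psi>)" for k by (rule c1_compact_integrable(2)[OF c1])
  have pm [measurable]: "partial k \<psi> \<in> borel_measurable borel" for k using pi by auto
  let ?e = "1 / (2 * \<beta>)"
  obtain D where D: "D > 0" and L: "leray_bounds TYPE('n) \<beta> 1 D"
    using heat_leray_div_bound[OF \<beta>0 \<beta>(2), of 1, where 'n='n] by auto
  note heat_leray_div_measurable[OF sup_classD(1)[OF u] sup_classD(1)[OF v], measurable (raw)]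
  let ?h = "\<lambda>x s. indicator {0<..<t} s * (\<Sum>j\<in>UNIV. heat_leray_div \<beta> (t - s) (u s) (v s) x $ j * partial j \<psi> x)"
  define Q where "Q = (\<lambda>s. D * (A * B) * (indicator {0<..<t} s * ((t - s) powr (- ?e) * s powr (- (2 * crit_exp \<beta>)))))"
  have Qi: "integrable lborel Q" unfolding Q_def
    by (intro integrable_mult_right integrable.intros[OF time_weight_integral]) (use crit_exp[OF \<beta>] t in auto)
  have hb: "indicator {0<..<t} s * norm (heat_leray_div \<beta> (t - s) (u s) (v s) x) \<le> Q s" for s x
  proof (cases "0 < s \<and> s < t")
    case True
    have "norm (heat_leray_div \<beta> (t - s) (u s) (v s) x) \<le> D * (t - s) powr (- ?e) * ((A * s powr (- crit_exp \<beta>)) * (B * s powr (- crit_exp \<beta>)))"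
      by (rule leray_boundsD(1)[OF L]) (use True sup_classD[OF u] sup_classD[OF v] in auto)
    also have "\<dots> = D * (A * B) * ((t - s) powr (- ?e) * s powr (- (2 * crit_exp \<beta>)))"
      unfolding crit_exp_sq[symmetric] by (simp only: mult_ac)
    finally show ?thesis using True by (simp add: Q_def)
  qed (auto simp: Q_def indicator_def)
  have hm: "(\<lambda>(x, s). ?h x s) \<in> borel_measurable (lborel \<Otimes>\<^sub>M lborel)" by measurable
  have hi: "integrable (lborel \<Otimes>\<^sub>M lborel) (\<lambda>(x, s). ?h x s)"
  proof (rule integrable_pair_bound[OF hm _ Qi])
    show "integrable lborel (\<lambda>x. \<Sum>j\<in>UNIV. \<bar>partial j \<psi> x\<bar>)" using pi by simp
    fix x s
    have "\<bar>?h x s\<bar> \<le> indicator {0<..<t} s * (\<Sum>j\<in>UNIV. norm (heat_leray_div \<beta> (t - s) (u s) (v s) x) * \<bar>partial j \<psi> x\<bar>)"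
      unfolding abs_mult by (auto simp: abs_mult intro!: mult_left_mono order_trans[OF sum_abs] sum_mono mult_right_mono component_le_norm_cart)
    also have "\<dots> = (\<Sum>j\<in>UNIV. \<bar>partial j \<psi> x\<bar>) * (indicator {0<..<t} s * norm (heat_leray_div \<beta> (t - s) (u s) (v s) x))"
      by (simp add: sum_distrib_left sum_distrib_right mult_ac)
    also have "\<dots> \<le> (\<Sum>j\<in>UNIV. \<bar>partial j \<psi> x\<bar>) * Q s" by (intro mult_left_mono hb sum_nonneg) auto
    finally show "norm (?h x s) \<le> (\<Sum>j\<in>UNIV. \<bar>partial j \<psi> x\<bar>) * Q s" by simp
  qed
  have e: "(\<Sum>j\<in>UNIV. duhamel \<beta> u v t x $ j * partial j \<psi> x) = (LINT s|lborel. ?h x s)" for x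
  proof -
    have i: "integrable lborel (\<lambda>s. indicator {0<..<t} s *\<^sub>R heat_leray_div \<beta> (t - s) (u s) (v s) x)"
      using duhamel_integrable[OF \<beta> u v t, of x] by (simp add: set_integrable_def)
    have bl: "bounded_linear (\<lambda>y::real^'n. \<Sum>j\<in>UNIV. y $ j * partial j \<psi> x)"
      by (intro bounded_linear_sum bounded_linear_mult_const bounded_linear_vec_nth)
    have "(\<Sum>j\<in>UNIV. duhamel \<beta> u v t x $ j * partial j \<psi> x) = (LINT s|lborel. (\<Sum>j\<in>UNIV. (indicator {0<..<t} s *\<^sub>R heat_leray_div \<beta> (t - s) (u s) (v s) x) $ j * partial j \<psi> x))"
      unfolding duhamel_def set_lebesgue_integral_def by (rule integral_bounded_linear[OF bl i, symmetric])
    also have "\<dots> = (LINT s|lborel. ?h x s)" by (simp add: sum_distrib_left mult.assoc)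
    finally show ?thesis .
  qed
  have "(LINT x|lborel. (\<Sum>j\<in>UNIV. duhamel \<beta> u v t x $ j * partial j \<psi> x)) = (LINT x|lborel. LINT s|lborel. ?h x s)" unfolding e ..
  also have "\<dots> = (LINT s|lborel. LINT x|lborel. ?h x s)" using lborel_pair.Fubini_integral[OF hi] by simp
  also have "(\<lambda>s. LINT x|lborel. ?h x s) = (\<lambda>s. 0)"
  proof
    fix s
    show "(LINT x|lborel. ?h x s) = 0"
    proof (cases "0 < s \<and> s < t")
      case True
      have "(LINT x|lborel. (\<Sum>j\<in>UNIV. heat_leray_div \<beta> (t - s) (u s) (v s) x $ j * partial j \<psi> x)) = 0"
        by (rule heat_leray_div_divergence[OF \<beta>0 \<beta>(2) _ _ _ sup_classD(2)[OF u] sup_classD(2)[OF v] \<psi>])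
           (use True sup_classD(3)[OF u] sup_classD(3)[OF v] in auto)
      then show ?thesis by simp
    qed (auto simp: indicator_def)
  qed
  finally show "(LINT x|lborel. (\<Sum>j\<in>UNIV. duhamel \<beta> u v t x $ j * partial j \<psi> x)) = 0" by simp
qed

lemma divergence_free_combine:
  fixes f g h :: "real^'n \<Rightarrow> real^'n"
  assumes m: "f \<in> borel_measurable borel" "g \<in> borel_measurable borel" "h \<in> borel_measurable borel"
    and b: "\<And>x. norm (f x) \<le> B" "\<And>x. norm (g x) \<le> B" "\<And>x. norm (h x) \<le> B"
    and d: "divergence_free f" "divergence_free g" "divergence_free h"
  shows "divergence_free (\<lambda>x. f x - g x + h x)"
  unfolding divergence_free_def
proof (intro allI impI)
  fix \<psi> :: "real^'n \<Rightarrow> real" assume \<psi>: "test_function \<psi>"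
  have c1: "c1_compact \<psi>" using test_function_c1_compact[OF \<psi>, of "[]"] by simp
  have pi: "integrable lborel (partial k \<psi>)" for k by (rule c1_compact_integrable(2)[OF c1])
  have i: "integrable lborel (\<lambda>x. \<Sum>k\<in>UNIV. F x $ k * partial k \<psi> x)"
    if [measurable]: "F \<in> borel_measurable borel" and F: "\<And>x. norm (F x) \<le> B" for F :: "real^'n \<Rightarrow> real^'n"
  proof (rule Bochner_Integration.integrable_sum)
    fix k
    have [measurable]: "partial k \<psi> \<in> borel_measurable borel" using pi[of k] by simp
    have B0: "B \<ge> 0" using order_trans[OF norm_ge_zero F] .
    show "integrable lborel (\<lambda>x. F x $ k * partial k \<psi> x)"
    proof (rule Bochner_Integration.integrable_bound)
      show "integrable lborel (\<lambda>x. B * \<bar>partial k \<psi> x\<bar>)" using pi by simp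
      show "AE x in lborel. norm (F x $ k * partial k \<psi> x) \<le> norm (B * \<bar>partial k \<psi> x\<bar>)"
        using B0 by (auto simp: abs_mult intro!: mult_right_mono order_trans[OF component_le_norm_cart F])
    qed measurable
  qed
  have "(LINT x|lborel. (\<Sum>k\<in>UNIV. (f x - g x + h x) $ k * partial k \<psi> x))
     = (LINT x|lborel. (\<Sum>k\<in>UNIV. f x $ k * partial k \<psi> x) - (\<Sum>k\<in>UNIV. g x $ k * partial k \<psi> x) + (\<Sum>k\<in>UNIV. h x $ k * partial k \<psi> x))"
    by (simp add: left_diff_distrib distrib_right sum.distrib sum_subtractf)
  also have "\<dots> = 0"
    using i[OF m(1) b(1)] i[OF m(2) b(2)] i[OF m(3) b(3)] d \<psi> unfolding divergence_free_def by simp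
  finally show "(LINT x|lborel. (\<Sum>k\<in>UNIV. (f x - g x + h x) $ k * partial k \<psi> x)) = 0" .
qed

section \<open>Fixed points under pointwise weights\<close>

text \<open>Banach's iteration for functions compared pointwise with a weight; where \<open>\<omega>\<close> vanishes, all iterates
agree. The set \<open>P\<close> carries whatever bounds are to be inherited by the limit.\<close>

lemma weighted_fixed_point:
  fixes \<Phi> :: "('i \<Rightarrow> 'v::banach) \<Rightarrow> 'i \<Rightarrow> 'v" and \<omega> :: "'i \<Rightarrow> real"
  assumes P0: "P f0" and PS: "\<And>f. P f \<Longrightarrow> P (\<Phi> f)"
    and D0: "\<And>i. norm (\<Phi> f0 i - f0 i) \<le> D * \<omega> i"
    and contr: "\<And>f g \<delta> i. P f \<Longrightarrow> P g \<Longrightarrow> (\<And>i. norm (f i - g i) \<le> \<delta> * \<omega> i) \<Longrightarrow> norm (\<Phi> f i - \<Phi> g i) \<le> \<delta> / 2 * \<omega> i"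
    and closed: "\<And>F f D. (\<And>m. P (F m)) \<Longrightarrow> (\<And>m i. norm (F m i - f i) \<le> D * (1/2) ^ m * \<omega> i) \<Longrightarrow> P f"
  shows "\<exists>f. P f \<and> \<Phi> f = f"
proof -
  define F where "F = (\<lambda>m. (\<Phi> ^^ m) f0)"
  have F0: "F 0 = f0" and FS: "F (Suc m) = \<Phi> (F m)" for m by (simp_all add: F_def)
  have PF: "P (F m)" for m by (induction m) (simp_all add: F0 FS P0 PS)
  have step: "norm (F (Suc m) i - F m i) \<le> D * (1/2) ^ m * \<omega> i" for m i
  proof (induction m arbitrary: i)
    case 0
    then show ?case using D0 by (simp add: F0 FS)
  next
    case (Suc m)
    have "norm (\<Phi> (F (Suc m)) i - \<Phi> (F m) i) \<le> (D * (1/2) ^ m) / 2 * \<omega> i"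
      by (rule contr[OF PF PF Suc.IH])
    then show ?case by (simp add: FS)
  qed
  have summ: "summable (\<lambda>m. F (Suc m) i - F m i)" for i
  proof (rule summable_comparison_test')
    show "summable (\<lambda>m. D * (1/2) ^ m * \<omega> i)" by (intro summable_mult summable_mult2 summable_geometric) simp
    show "norm (F (Suc m) i - F m i) \<le> D * (1/2) ^ m * \<omega> i" for m by (rule step)
  qed
  define f where "f = (\<lambda>i. f0 i + (\<Sum>m. F (Suc m) i - F m i))"
  have lim: "(\<lambda>m. F m i) \<longlonglongrightarrow> f i" for i
  proof -
    have "(\<lambda>m. f0 i + (\<Sum>k<m. F (Suc k) i - F k i)) \<longlonglongrightarrow> f i"
      unfolding f_def using summ[of i] by (intro tendsto_intros summable_LIMSEQ)
    moreover have "f0 i + (\<Sum>k<m. F (Suc k) i - F k i) = F m i" for m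
      by (subst sum_lessThan_telescope) (simp add: F0)
    ultimately show ?thesis by simp
  qed
  have near: "norm (F m i - f i) \<le> (2 * D) * (1/2) ^ m * \<omega> i" for m i
  proof (rule LIMSEQ_le_const2[OF tendsto_norm[OF tendsto_diff[OF tendsto_const lim]]], intro exI allI impI)
    fix k assume "k \<ge> m"
    then show "norm (F m i - F k i) \<le> (2 * D) * (1/2) ^ m * \<omega> i"
    proof -
      have "norm (F m i - F k i) \<le> 2 * D * ((1/2) ^ m - (1/2) ^ k) * \<omega> i" using \<open>k \<ge> m\<close>
      proof (induction k rule: dec_induct)
        case (step k)
        have "norm (F m i - F (Suc k) i) \<le> norm (F m i - F k i) + norm (F (Suc k) i - F k i)"
          using norm_triangle_ineq4[of "F m i - F k i" "F (Suc k) i - F k i"] by simp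
        also have "\<dots> \<le> 2 * D * ((1/2) ^ m - (1/2) ^ k) * \<omega> i + D * (1/2) ^ k * \<omega> i"
          using step.IH \<open>\<And>m i. norm (F (Suc m) i - F m i) \<le> D * (1/2) ^ m * \<omega> i\<close>[of k i] by (intro add_mono)
        also have "\<dots> = 2 * D * ((1/2) ^ m - (1/2) ^ Suc k) * \<omega> i" by (simp add: algebra_simps)
        finally show ?case .
      qed simp
      also have "\<dots> \<le> (2 * D) * (1/2) ^ m * \<omega> i"
      proof -
        have "0 \<le> D * \<omega> i" using order_trans[OF norm_ge_zero D0] .
        then have "0 \<le> 2 * (1/2) ^ k * (D * \<omega> i)" by simp
        then show ?thesis by (simp add: algebra_simps)
      qed
      finally show ?thesis .
    qed
  qed
  have Pf: "P f" by (rule closed[OF PF near])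
  have "\<Phi> f i = f i" for i
  proof -
    have n: "norm (\<Phi> (F m) i - \<Phi> f i) \<le> ((2 * D) * (1/2) ^ m) / 2 * \<omega> i" for m
      by (rule contr[OF PF Pf near])
    have "(\<lambda>m. ((2 * D) * (1/2) ^ m) / 2 * \<omega> i) \<longlonglongrightarrow> ((2 * D) * 0) / 2 * \<omega> i"
      by (intro tendsto_intros LIMSEQ_realpow_zero) auto
    then have "(\<lambda>m. ((2 * D) * (1/2) ^ m) / 2 * \<omega> i) \<longlonglongrightarrow> 0" by simp
    then have "(\<lambda>m. \<Phi> (F m) i - \<Phi> f i) \<longlonglongrightarrow> 0"
      by (rule Lim_null_comparison[rotated, where g = "\<lambda>m. ((2 * D) * (1/2) ^ m) / 2 * \<omega> i"]) (use n in auto)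
    then have "(\<lambda>m. \<Phi> (F m) i) \<longlonglongrightarrow> \<Phi> f i" by (rule LIM_zero_cancel)
    moreover have "(\<lambda>m. \<Phi> (F m) i) \<longlonglongrightarrow> f i" using LIMSEQ_Suc[OF lim] by (simp add: FS)
    ultimately show ?thesis by (rule LIMSEQ_unique)
  qed
  then show ?thesis using Pf by (intro exI[of _ f]) auto
qed

lemma weighted_fixed_point_unique:
  fixes \<Phi> :: "('i \<Rightarrow> 'v::banach) \<Rightarrow> 'i \<Rightarrow> 'v" and \<omega> :: "'i \<Rightarrow> real"
  assumes f: "\<Phi> f = f" and g: "\<Phi> g = g" and D0: "\<And>i. norm (f i - g i) \<le> D * \<omega> i"
    and contr: "\<And>\<delta> i. (\<And>i. norm (f i - g i) \<le> \<delta> * \<omega> i) \<Longrightarrow> norm (\<Phi> f i - \<Phi> g i) \<le> \<delta> / 2 * \<omega> i"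
  shows "f = g"
proof
  fix i
  have b: "norm (f i - g i) \<le> D * (1/2) ^ m * \<omega> i" for m i
  proof (induction m arbitrary: i)
    case (Suc m)
    show ?case using contr[OF Suc.IH, of i] by (simp add: f g)
  qed (simp add: D0)
  have "(\<lambda>m. D * (1/2) ^ m * \<omega> i) \<longlonglongrightarrow> D * 0 * \<omega> i"
    by (intro tendsto_intros LIMSEQ_realpow_zero) auto
  then have "norm (f i - g i) \<le> D * 0 * \<omega> i" by (rule LIMSEQ_le_const) (use b in auto)
  then show "f i = g i" by simp
qed

section \<open>Sums and limits of controlled fields\<close>

lemma jointly_measurable_arith:
  assumes u: "jointly_measurable u" and v: "jointly_measurable v"
  shows "jointly_measurable (\<lambda>t x. u t x + v t x)" "jointly_measurable (\<lambda>t x. u t x - v t x)"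
    "jointly_measurable (\<lambda>t x. if t > 0 then u t x else 0)"
proof -
  note jointly_measurableD[OF u, measurable (raw)] jointly_measurableD[OF v, measurable (raw)]
  show "jointly_measurable (\<lambda>t x. u t x + v t x)" "jointly_measurable (\<lambda>t x. u t x - v t x)"
    "jointly_measurable (\<lambda>t x. if t > 0 then u t x else 0)"
    unfolding jointly_measurable_def by measurable
qed

lemma sup_class_arith:
  assumes u: "sup_class \<beta> A u" and v: "sup_class \<beta> B v"
  shows "sup_class \<beta> (A + B) (\<lambda>t x. u t x + v t x)" "sup_class \<beta> (A + B) (\<lambda>t x. u t x - v t x)"
proof -
  have "norm (u t x + v t x) \<le> (A + B) * t powr (- crit_exp \<beta>)" "norm (u t x - v t x) \<le> (A + B) * t powr (- crit_exp \<beta>)" if "t > 0" for t x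
    using norm_triangle_ineq[of "u t x" "v t x"] norm_triangle_ineq4[of "u t x" "v t x"] sup_classD(2)[OF u that, of x] sup_classD(2)[OF v that, of x]
    unfolding distrib_right by linarith+
  then show "sup_class \<beta> (A + B) (\<lambda>t x. u t x + v t x)" "sup_class \<beta> (A + B) (\<lambda>t x. u t x - v t x)"
    using jointly_measurable_arith sup_classD(1)[OF u] sup_classD(1)[OF v] unfolding sup_class_def by auto
qed

lemma sup_class_cutoff: "sup_class \<beta> A u \<Longrightarrow> sup_class \<beta> A (\<lambda>t x. if t > 0 then u t x else 0)"
  unfolding sup_class_def using jointly_measurable_arith(3)[of u u] by simp

lemma sup_class_mono: "sup_class \<beta> A u \<Longrightarrow> A \<le> B \<Longrightarrow> sup_class \<beta> B u"
  unfolding sup_class_def by (meson mult_right_mono order_trans powr_ge_zero)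

lemma hoelder_class_arith:
  assumes u: "hoelder_class \<beta> \<sigma> A u" and v: "hoelder_class \<beta> \<sigma> B v"
  shows "hoelder_class \<beta> \<sigma> (A + B) (\<lambda>t x. u t x + v t x)" "hoelder_class \<beta> \<sigma> (A + B) (\<lambda>t x. u t x - v t x)"
proof -
  have *: "norm (u t x - u t y) + norm (v t x - v t y) \<le> (A + B) * t powr (- crit_exp \<beta> - \<sigma> / (2 * \<beta>)) * norm (x - y) powr \<sigma>" if "t > 0" for t x y
    using u v that unfolding hoelder_class_def by (simp add: distrib_right add_mono)
  have e1: "norm ((u t x + v t x) - (u t y + v t y)) \<le> norm (u t x - u t y) + norm (v t x - v t y)" for t x y
    using norm_triangle_ineq[of "u t x - u t y" "v t x - v t y"] by (simp add: algebra_simps)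
  have e2: "norm ((u t x - v t x) - (u t y - v t y)) \<le> norm (u t x - u t y) + norm (v t x - v t y)" for t x y
    using norm_triangle_ineq4[of "u t x - u t y" "v t x - v t y"] by (simp add: algebra_simps)
  show "hoelder_class \<beta> \<sigma> (A + B) (\<lambda>t x. u t x + v t x)" "hoelder_class \<beta> \<sigma> (A + B) (\<lambda>t x. u t x - v t x)"
    unfolding hoelder_class_def using order_trans[OF e1 *] order_trans[OF e2 *] by blast+
qed

lemma hoelder_class_cutoff: "hoelder_class \<beta> \<sigma> A u \<Longrightarrow> hoelder_class \<beta> \<sigma> A (\<lambda>t x. if t > 0 then u t x else 0)"
  unfolding hoelder_class_def by simp

lemma hoelder_class_mono: "hoelder_class \<beta> \<sigma> A u \<Longrightarrow> A \<le> B \<Longrightarrow> hoelder_class \<beta> \<sigma> B u"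
  unfolding hoelder_class_def by (meson mult_right_mono order_trans powr_ge_zero)

lemma gauge_class_le:
  fixes u v w :: "real \<Rightarrow> real^'n \<Rightarrow> real^'n"
  assumes \<beta>: "0 < \<beta>" "\<beta> < 1" and su: "sup_class \<beta> A u" and sv: "sup_class \<beta> B v" and sw: "sup_class \<beta> C w"
    and u: "gauge_class \<beta> A' u" and v: "gauge_class \<beta> B' v" and le: "\<And>t x. t > 0 \<Longrightarrow> norm (w t x) \<le> norm (u t x) + norm (v t x)"
  shows "gauge_class \<beta> (A' + B') w"
  unfolding gauge_class_def
proof (intro allI impI)
  fix t \<tau> :: real and x :: "real^'n" assume t: "t > 0" and \<tau>: "\<tau> > 0"
  let ?K = "heat_kernel \<beta> \<tau> :: real^'n \<Rightarrow> real"
  have K: "integrable lborel ?K" "\<And>x. 0 \<le> ?K x" using heat_kernel_L1(1)[OF \<beta> \<tau>] heat_kernel_nonneg[OF \<beta> \<tau>] by auto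
  have m: "(\<lambda>y. norm (u t y)) \<in> borel_measurable borel" "(\<lambda>y. norm (v t y)) \<in> borel_measurable borel" "(\<lambda>y. norm (w t y)) \<in> borel_measurable borel"
    using sup_classD(3)[OF su, of t] sup_classD(3)[OF sv, of t] sup_classD(3)[OF sw, of t] by measurable
  have b: "\<bar>norm (u t y)\<bar> \<le> A * t powr (- crit_exp \<beta>)" "\<bar>norm (v t y)\<bar> \<le> B * t powr (- crit_exp \<beta>)" "\<bar>norm (w t y)\<bar> \<le> C * t powr (- crit_exp \<beta>)" for y
    using sup_classD(2)[OF su t] sup_classD(2)[OF sv t] sup_classD(2)[OF sw t] by auto
  note i = conv_bounded(1)[OF K(1) m(1) b(1)] conv_bounded(1)[OF K(1) m(2) b(2)] conv_bounded(1)[OF K(1) m(3) b(3)]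
  have "conv ?K (\<lambda>y. norm (w t y)) x \<le> (LINT y|lborel. norm (u t y) * ?K (x - y) + norm (v t y) * ?K (x - y))"
    unfolding conv_def real_scaleR_def using i K(2) le[OF t]
    by (intro integral_mono Bochner_Integration.integrable_add) (auto simp: distrib_right[symmetric] intro!: mult_right_mono)
  also have "\<dots> = conv ?K (\<lambda>y. norm (u t y)) x + conv ?K (\<lambda>y. norm (v t y)) x"
    unfolding conv_def using i by simp
  also have "\<dots> \<le> A' * \<tau> powr (- crit_exp \<beta>) + B' * \<tau> powr (- crit_exp \<beta>)"
    using u v t \<tau> unfolding gauge_class_def by (intro add_mono) auto
  finally show "conv ?K (\<lambda>y. norm (w t y)) x \<le> (A' + B') * \<tau> powr (- crit_exp \<beta>)" by (simp add: distrib_right)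
qed

lemma gauge_class_arith:
  fixes u v :: "real \<Rightarrow> real^'n \<Rightarrow> real^'n"
  assumes \<beta>: "0 < \<beta>" "\<beta> < 1" and su: "sup_class \<beta> A u" and sv: "sup_class \<beta> B v"
    and u: "gauge_class \<beta> A' u" and v: "gauge_class \<beta> B' v"
  shows "gauge_class \<beta> (A' + B') (\<lambda>t x. u t x + v t x)" "gauge_class \<beta> (A' + B') (\<lambda>t x. u t x - v t x)"
  by (rule gauge_class_le[OF \<beta> su sv sup_class_arith(1)[OF su sv] u v norm_triangle_ineq])
     (rule gauge_class_le[OF \<beta> su sv sup_class_arith(2)[OF su sv] u v norm_triangle_ineq4])

lemma gauge_class_cutoff: "gauge_class \<beta> A u \<Longrightarrow> gauge_class \<beta> A (\<lambda>t x. if t > 0 then u t x else 0)"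
  unfolding gauge_class_def by simp

lemma gauge_class_mono: "gauge_class \<beta> A u \<Longrightarrow> A \<le> B \<Longrightarrow> gauge_class \<beta> B u"
  unfolding gauge_class_def by (meson mult_right_mono order_trans powr_ge_zero)

definition full_class :: "real \<Rightarrow> real \<Rightarrow> real \<Rightarrow> (real \<Rightarrow> real^'n \<Rightarrow> real^'n) \<Rightarrow> bool" where
  "full_class \<beta> \<sigma> R u \<longleftrightarrow> sup_class \<beta> R u \<and> hoelder_class \<beta> \<sigma> R u \<and> gauge_class \<beta> R u"

lemma full_class_arith:
  assumes "0 < \<beta>" "\<beta> < 1" "full_class \<beta> \<sigma> A u" "full_class \<beta> \<sigma> B v"
  shows "full_class \<beta> \<sigma> (A + B) (\<lambda>t x. u t x + v t x)" "full_class \<beta> \<sigma> (A + B) (\<lambda>t x. u t x - v t x)"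
  using assms unfolding full_class_def
  by (auto intro: sup_class_arith hoelder_class_arith gauge_class_arith)

lemma full_class_cutoff: "full_class \<beta> \<sigma> A u \<Longrightarrow> full_class \<beta> \<sigma> A (\<lambda>t x. if t > 0 then u t x else 0)"
  unfolding full_class_def by (auto intro: sup_class_cutoff hoelder_class_cutoff gauge_class_cutoff)

lemma full_class_mono: "full_class \<beta> \<sigma> A u \<Longrightarrow> A \<le> B \<Longrightarrow> full_class \<beta> \<sigma> B u"
  unfolding full_class_def by (auto intro: sup_class_mono hoelder_class_mono gauge_class_mono)

lemma full_class_zero: "R \<ge> 0 \<Longrightarrow> full_class \<beta> \<sigma> R (\<lambda>t x. 0)"
  unfolding full_class_def sup_class_def hoelder_class_def gauge_class_def jointly_measurable_def conv_def by simp

text \<open>Sup and Hoelder bounds pass to pointwise limits; for the gauge bound the error is uniform in \<open>x\<close> at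
fixed \<open>t\<close> and the kernel has mass at most one.\<close>

lemma full_class_limit:
  fixes U :: "nat \<Rightarrow> real \<Rightarrow> real^'n \<Rightarrow> real^'n"
  assumes \<beta>: "0 < \<beta>" "\<beta> < 1" and U: "\<And>m. full_class \<beta> \<sigma> R (U m)"
    and near: "\<And>m t x. t > 0 \<Longrightarrow> norm (U m t x - u t x) \<le> D * (1/2) ^ m * t powr (- crit_exp \<beta>)"
    and zero: "\<And>m t x. t \<le> 0 \<Longrightarrow> U m t x = u t x"
  shows "full_class \<beta> \<sigma> R u"
proof -
  have e0: "(\<lambda>m. D * (1/2) ^ m * c) \<longlonglongrightarrow> 0" for c
  proof -
    have "(\<lambda>m. D * (1/2) ^ m * c) \<longlonglongrightarrow> D * 0 * c" by (intro tendsto_intros LIMSEQ_realpow_zero) auto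
    then show ?thesis by simp
  qed
  have lim: "(\<lambda>m. U m t x) \<longlonglongrightarrow> u t x" for t x
  proof (cases "t > 0")
    case True
    have "(\<lambda>m. U m t x - u t x) \<longlonglongrightarrow> 0"
      by (rule Lim_null_comparison[OF _ e0[of "t powr (- crit_exp \<beta>)"]]) (use near[OF True] in auto)
    then show ?thesis by (rule LIM_zero_cancel)
  qed (simp add: zero)
  have jm: "jointly_measurable u"
    unfolding jointly_measurable_def
  proof (rule borel_measurable_LIMSEQ_metric)
    show "(\<lambda>(t, x). U m t x) \<in> borel_measurable (borel \<Otimes>\<^sub>M borel)" for m
      using U[of m] unfolding full_class_def sup_class_def jointly_measurable_def by simp
    show "(\<lambda>m. case p of (t, x) \<Rightarrow> U m t x) \<longlonglongrightarrow> (case p of (t, x) \<Rightarrow> u t x)" for p by (cases p) (simp add: lim)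
  qed
  have su: "sup_class \<beta> R u"
    unfolding sup_class_def
  proof (intro conjI allI impI jm)
    fix t :: real and x assume t: "t > 0"
    show "norm (u t x) \<le> R * t powr (- crit_exp \<beta>)"
      by (rule LIMSEQ_le_const2[OF tendsto_norm[OF lim]]) (use U t in \<open>auto simp: full_class_def sup_class_def\<close>)
  qed
  have hu: "hoelder_class \<beta> \<sigma> R u"
    unfolding hoelder_class_def
  proof (intro allI impI)
    fix t :: real and x y assume t: "t > 0"
    show "norm (u t x - u t y) \<le> R * t powr (- crit_exp \<beta> - \<sigma> / (2 * \<beta>)) * norm (x - y) powr \<sigma>"
      by (rule LIMSEQ_le_const2[OF tendsto_norm[OF tendsto_diff[OF lim lim]]]) (use U t in \<open>auto simp: full_class_def hoelder_class_def\<close>)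
  qed
  have gu: "gauge_class \<beta> R u"
    unfolding gauge_class_def
  proof (intro allI impI)
    fix t \<tau> :: real and x :: "real^'n" assume t: "t > 0" and \<tau>: "\<tau> > 0"
    let ?K = "heat_kernel \<beta> \<tau> :: real^'n \<Rightarrow> real"
    have K: "integrable lborel ?K" "\<And>x. 0 \<le> ?K x" using heat_kernel_L1(1)[OF \<beta> \<tau>] heat_kernel_nonneg[OF \<beta> \<tau>] by auto
    have b: "conv ?K (\<lambda>y. norm (u t y)) x \<le> R * \<tau> powr (- crit_exp \<beta>) + D * (1/2) ^ m * t powr (- crit_exp \<beta>)" for m
    proof -
      let ?d = "D * (1/2) ^ m * t powr (- crit_exp \<beta>)"
      have sU: "sup_class \<beta> R (U m)" using U[of m] by (simp add: full_class_def)
      have m: "(\<lambda>y. norm (u t y)) \<in> borel_measurable borel" "(\<lambda>y. norm (U m t y)) \<in> borel_measurable borel"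
        using sup_classD(3)[OF su, of t] sup_classD(3)[OF sU, of t] by measurable
      have bb: "\<bar>norm (u t y)\<bar> \<le> R * t powr (- crit_exp \<beta>)" "\<bar>norm (U m t y)\<bar> \<le> R * t powr (- crit_exp \<beta>)" for y
        using sup_classD(2)[OF su t] sup_classD(2)[OF sU t] by auto
      have d0: "0 \<le> ?d" using order_trans[OF norm_ge_zero near[OF t]] .
      note i = conv_bounded(1)[OF K(1) m(1) bb(1)] conv_bounded(1)[OF K(1) m(2) bb(2)]
      have Kx: "integrable lborel (\<lambda>y. ?K (x - y))" "(LINT y|lborel. ?K (x - y)) = (LINT y|lborel. ?K y)" by (rule lborel_integrable_flip[OF K(1)])+
      have le: "norm (u t y) \<le> norm (U m t y) + ?d" for y
        using norm_triangle_sub[of "u t y" "U m t y"] near[OF t, of m y] by (simp add: norm_minus_commute)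
      have "conv ?K (\<lambda>y. norm (u t y)) x \<le> (LINT y|lborel. norm (U m t y) * ?K (x - y) + ?d * ?K (x - y))"
        unfolding conv_def real_scaleR_def using i Kx(1) K(2) le
        by (intro integral_mono Bochner_Integration.integrable_add integrable_mult_right) (auto simp: distrib_right[symmetric] intro!: mult_right_mono)
      also have "\<dots> = conv ?K (\<lambda>y. norm (U m t y)) x + ?d * (LINT y|lborel. ?K (x - y))"
        unfolding conv_def using i Kx(1) by simp
      also have "\<dots> \<le> R * \<tau> powr (- crit_exp \<beta>) + ?d * 1"
      proof (intro add_mono mult_left_mono d0)
        show "conv ?K (\<lambda>y. norm (U m t y)) x \<le> R * \<tau> powr (- crit_exp \<beta>)"
          using U[of m] t \<tau> by (simp add: full_class_def gauge_class_def)
        show "(LINT y|lborel. ?K (x - y)) \<le> 1"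
          unfolding Kx(2) using heat_kernel_L1(2)[OF \<beta> \<tau>, where 'n='n] K(2) by simp
      qed
      finally show ?thesis by simp
    qed
    have "(\<lambda>m. R * \<tau> powr (- crit_exp \<beta>) + D * (1/2) ^ m * t powr (- crit_exp \<beta>)) \<longlonglongrightarrow> R * \<tau> powr (- crit_exp \<beta>) + 0"
      by (intro tendsto_intros e0)
    then have "conv ?K (\<lambda>y. norm (u t y)) x \<le> R * \<tau> powr (- crit_exp \<beta>) + 0" by (rule LIMSEQ_le_const) (use b in auto)
    then show "conv ?K (\<lambda>y. norm (u t y)) x \<le> R * \<tau> powr (- crit_exp \<beta>)" by simp
  qed
  show ?thesis using su hu gu by (simp add: full_class_def)
qed

section \<open>The Picard map\<close>

text \<open>One constant for all linear and bilinear estimates, in terms of which smallness is expressed.\<close>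

definition mhd_bounds :: "'n::finite itself \<Rightarrow> real \<Rightarrow> real \<Rightarrow> real \<Rightarrow> bool" where
  "mhd_bounds _ \<beta> \<sigma> L \<longleftrightarrow> L \<ge> 1 \<and>
    (\<forall>A (f::real^'n \<Rightarrow> real^'n). data_class \<beta> A f \<longrightarrow> full_class \<beta> \<sigma> (L * A) (\<lambda>t. heat \<beta> t f)) \<and>
    (\<forall>R (u::real \<Rightarrow> real^'n \<Rightarrow> real^'n) v. sup_class \<beta> R u \<longrightarrow> sup_class \<beta> R v \<longrightarrow> sup_class \<beta> (L * R * R) (duhamel \<beta> u v)) \<and>
    (\<forall>R (u::real \<Rightarrow> real^'n \<Rightarrow> real^'n) v. full_class \<beta> \<sigma> R u \<longrightarrow> full_class \<beta> \<sigma> R v \<longrightarrow> full_class \<beta> \<sigma> (L * R * R) (duhamel \<beta> u v)) \<and>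
    (\<forall>(u::real \<Rightarrow> real^'n \<Rightarrow> real^'n) v u' v' R \<delta>. sup_class \<beta> R u \<longrightarrow> sup_class \<beta> R v \<longrightarrow> sup_class \<beta> R u' \<longrightarrow> sup_class \<beta> R v' \<longrightarrow>
      sup_class \<beta> \<delta> (\<lambda>t x. u t x - u' t x) \<longrightarrow> sup_class \<beta> \<delta> (\<lambda>t x. v t x - v' t x) \<longrightarrow>
      (\<forall>t>0. \<forall>x. norm (duhamel \<beta> u v t x - duhamel \<beta> u' v' t x) \<le> L * R * \<delta> * t powr (- crit_exp \<beta>)))"

lemma mhd_bounds_exist:
  fixes dummy :: "'n::finite"
  assumes \<beta>: "1/2 < \<beta>" "\<beta> < 1" and sg: "0 < \<sigma>" "\<sigma> \<le> 1"
  shows "\<exists>L. mhd_bounds TYPE('n) \<beta> \<sigma> L"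
proof -
  obtain C1 where C1: "C1 > 0" and B1: "\<And>(u::real \<Rightarrow> real^'n \<Rightarrow> real^'n) v A B t x. sup_class \<beta> A u \<Longrightarrow> sup_class \<beta> B v \<Longrightarrow> t > 0 \<Longrightarrow>
      norm (duhamel \<beta> u v t x) \<le> C1 * (A * B) * t powr (- crit_exp \<beta>)"
    using duhamel_bound[OF \<beta>, where 'n='n] by auto
  obtain C2 where C2: "C2 > 0" "\<forall>(u::real \<Rightarrow> real^'n \<Rightarrow> real^'n) v u' v' R \<delta>. sup_class \<beta> R u \<longrightarrow> sup_class \<beta> R v \<longrightarrow> sup_class \<beta> R u' \<longrightarrow> sup_class \<beta> R v' \<longrightarrow>
    sup_class \<beta> \<delta> (\<lambda>t x. u t x - u' t x) \<longrightarrow> sup_class \<beta> \<delta> (\<lambda>t x. v t x - v' t x) \<longrightarrow>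
    (\<forall>t>0. \<forall>x. norm (duhamel \<beta> u v t x - duhamel \<beta> u' v' t x) \<le> C2 * R * \<delta> * t powr (- crit_exp \<beta>))"
    using duhamel_diff_bound[OF \<beta>, where 'n='n] by (elim exE conjE)
  obtain C3 where C3: "C3 > 0" "\<forall>(u::real \<Rightarrow> real^'n \<Rightarrow> real^'n) v R. sup_class \<beta> R u \<longrightarrow> sup_class \<beta> R v \<longrightarrow> hoelder_class \<beta> \<sigma> R u \<longrightarrow> hoelder_class \<beta> \<sigma> R v \<longrightarrow>
     hoelder_class \<beta> \<sigma> (C3 * (R * R)) (duhamel \<beta> u v)"
    using duhamel_hoelder[OF \<beta> sg, where 'n='n] by (elim exE conjE)
  obtain C4 where C4: "C4 > 0" "\<forall>(u::real \<Rightarrow> real^'n \<Rightarrow> real^'n) v R. sup_class \<beta> R u \<longrightarrow> sup_class \<beta> R v \<longrightarrow> gauge_class \<beta> R u \<longrightarrow>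
     gauge_class \<beta> (C4 * (R * R)) (duhamel \<beta> u v)"
    using duhamel_gauge[OF \<beta>, where 'n='n] by (elim exE conjE)
  obtain C5 where C5: "C5 > 0" "\<forall>A (f::real^'n \<Rightarrow> real^'n). data_class \<beta> A f \<longrightarrow> hoelder_class \<beta> \<sigma> (C5 * A) (\<lambda>t. heat \<beta> t f)"
    using heat_hoelder_class[OF \<beta> sg, where 'n='n] by (elim exE conjE)
  define L where "L = 1 + C1 + C2 + C3 + C4 + C5 + real CARD('n)"
  have L: "L \<ge> 1" "C1 \<le> L" "C2 \<le> L" "C3 \<le> L" "C4 \<le> L" "C5 \<le> L" "real CARD('n) \<le> L"
    using C1 C2(1) C3(1) C4(1) C5(1) by (simp_all add: L_def)
  have sup: "sup_class \<beta> (L * R * R) (duhamel \<beta> u v)" if u: "sup_class \<beta> R u" and v: "sup_class \<beta> R v" for R and u v :: "real \<Rightarrow> real^'n \<Rightarrow> real^'n"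
    unfolding sup_class_def
  proof (intro conjI allI impI)
    show "jointly_measurable (duhamel \<beta> u v)" by (rule duhamel_measurable[OF sup_classD(1)[OF u] sup_classD(1)[OF v]])
    fix t :: real and x assume t: "t > 0"
    have "C1 * (R * R) * t powr (- crit_exp \<beta>) \<le> L * (R * R) * t powr (- crit_exp \<beta>)"
      by (intro mult_right_mono L) auto
    then show "norm (duhamel \<beta> u v t x) \<le> L * R * R * t powr (- crit_exp \<beta>)" using B1[OF u v t, of x] by (simp add: mult.assoc)
  qed
  show ?thesis unfolding mhd_bounds_def
  proof (intro exI[of _ L] conjI allI impI)
    show "1 \<le> L" by (rule L)
    fix A and f :: "real^'n \<Rightarrow> real^'n" assume d: "data_class \<beta> A f"
    have A: "A \<ge> 0" by (rule data_classD(5)[OF \<beta> d zero_less_one])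
    show "full_class \<beta> \<sigma> (L * A) (\<lambda>t. heat \<beta> t f)"
      unfolding full_class_def
      using sup_class_mono[OF heat_sup_class[OF \<beta> d] mult_right_mono[OF L(7) A]] gauge_class_mono[OF heat_gauge_class[OF \<beta> d] mult_right_mono[OF L(7) A]]
        hoelder_class_mono[OF C5(2)[rule_format, OF d] mult_right_mono[OF L(6) A]] by simp
  next
    fix R and u v :: "real \<Rightarrow> real^'n \<Rightarrow> real^'n" assume "sup_class \<beta> R u" "sup_class \<beta> R v"
    then show "sup_class \<beta> (L * R * R) (duhamel \<beta> u v)" by (rule sup)
  next
    fix R and u v :: "real \<Rightarrow> real^'n \<Rightarrow> real^'n" assume "full_class \<beta> \<sigma> R u" "full_class \<beta> \<sigma> R v"
    then have u: "sup_class \<beta> R u" "hoelder_class \<beta> \<sigma> R u" "gauge_class \<beta> R u" and v: "sup_class \<beta> R v" "hoelder_class \<beta> \<sigma> R v" "gauge_class \<beta> R v"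
      by (auto simp: full_class_def)
    have c: "C3 * (R * R) \<le> L * R * R" "C4 * (R * R) \<le> L * R * R"
      unfolding mult.assoc by (intro mult_right_mono L; simp)+
    show "full_class \<beta> \<sigma> (L * R * R) (duhamel \<beta> u v)"
      unfolding full_class_def
      using sup[OF u(1) v(1)] hoelder_class_mono[OF C3(2)[rule_format, OF u(1) v(1) u(2) v(2)] c(1)]
        gauge_class_mono[OF C4(2)[rule_format, OF u(1) v(1) u(3)] c(2)] by simp
  next
    fix u v u' v' :: "real \<Rightarrow> real^'n \<Rightarrow> real^'n" and R \<delta> t :: real and x
    assume h: "sup_class \<beta> R u" "sup_class \<beta> R v" "sup_class \<beta> R u'" "sup_class \<beta> R v'"
      "sup_class \<beta> \<delta> (\<lambda>t x. u t x - u' t x)" "sup_class \<beta> \<delta> (\<lambda>t x. v t x - v' t x)" and t: "0 < t"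
    have "C2 * (R * \<delta>) * t powr (- crit_exp \<beta>) \<le> L * (R * \<delta>) * t powr (- crit_exp \<beta>)"
      using sup_class_nonneg[OF h(1)] sup_class_nonneg[OF h(5)] by (intro mult_right_mono L) auto
    then show "norm (duhamel \<beta> u v t x - duhamel \<beta> u' v' t x) \<le> L * R * \<delta> * t powr (- crit_exp \<beta>)"
      using C2(2)[rule_format, OF h t, of x] by (simp add: mult.assoc)
  qed
qed

text \<open>The value \<open>0\<close> at times \<open>t \<le> 0\<close> makes fixed points functions on all of space-time that are equal as
soon as they agree for \<open>t > 0\<close>.\<close>

definition picard :: "real \<Rightarrow> (real^'n \<Rightarrow> real^'n) \<Rightarrow> (real^'n \<Rightarrow> real^'n) \<Rightarrow> (real \<times> (real^'n) \<Rightarrow> (real^'n) \<times> (real^'n))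
    \<Rightarrow> real \<times> (real^'n) \<Rightarrow> (real^'n) \<times> (real^'n)" where
  "picard \<beta> u0 b0 f = (\<lambda>(t, x). let u = (\<lambda>t x. fst (f (t, x))); b = (\<lambda>t x. snd (f (t, x))) in
     (if t > 0 then heat \<beta> t u0 x - duhamel \<beta> u u t x + duhamel \<beta> b b t x else 0,
      if t > 0 then heat \<beta> t b0 x - duhamel \<beta> u b t x + duhamel \<beta> b u t x else 0))"

definition critical_weight :: "real \<Rightarrow> real \<times> 'a \<Rightarrow> real" where
  "critical_weight \<beta> = (\<lambda>(t, x). if t > 0 then t powr (- crit_exp \<beta>) else 0)"

definition pair_sup_class :: "real \<Rightarrow> real \<Rightarrow> (real \<times> (real^'n) \<Rightarrow> (real^'n) \<times> (real^'n)) \<Rightarrow> bool" where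
  "pair_sup_class \<beta> R f \<longleftrightarrow> (\<forall>t x. t \<le> 0 \<longrightarrow> f (t, x) = 0) \<and> sup_class \<beta> R (\<lambda>t x. fst (f (t, x))) \<and> sup_class \<beta> R (\<lambda>t x. snd (f (t, x)))"

definition pair_full_class :: "real \<Rightarrow> real \<Rightarrow> real \<Rightarrow> (real \<times> (real^'n) \<Rightarrow> (real^'n) \<times> (real^'n)) \<Rightarrow> bool" where
  "pair_full_class \<beta> \<sigma> R f \<longleftrightarrow> (\<forall>t x. t \<le> 0 \<longrightarrow> f (t, x) = 0) \<and> full_class \<beta> \<sigma> R (\<lambda>t x. fst (f (t, x))) \<and> full_class \<beta> \<sigma> R (\<lambda>t x. snd (f (t, x)))"

lemma pair_full_class_sup: "pair_full_class \<beta> \<sigma> R f \<Longrightarrow> pair_sup_class \<beta> R f"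
  by (simp add: pair_full_class_def pair_sup_class_def full_class_def)

lemma picard_fst_snd:
  "fst (picard \<beta> u0 b0 f (t, x)) = (if t > 0 then heat \<beta> t u0 x - duhamel \<beta> (\<lambda>t x. fst (f (t, x))) (\<lambda>t x. fst (f (t, x))) t x
      + duhamel \<beta> (\<lambda>t x. snd (f (t, x))) (\<lambda>t x. snd (f (t, x))) t x else 0)"
  "snd (picard \<beta> u0 b0 f (t, x)) = (if t > 0 then heat \<beta> t b0 x - duhamel \<beta> (\<lambda>t x. fst (f (t, x))) (\<lambda>t x. snd (f (t, x))) t x
      + duhamel \<beta> (\<lambda>t x. snd (f (t, x))) (\<lambda>t x. fst (f (t, x))) t x else 0)"
  by (simp_all add: picard_def Let_def)

lemma picard_pair_full_class:
  fixes u0 b0 :: "real^'n \<Rightarrow> real^'n"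
  assumes \<beta>: "0 < \<beta>" "\<beta> < 1" and L: "mhd_bounds TYPE('n) \<beta> \<sigma> L" and u0: "data_class \<beta> A u0" and b0: "data_class \<beta> A b0"
    and f: "pair_full_class \<beta> \<sigma> R f"
  shows "pair_full_class \<beta> \<sigma> (L * A + L * R * R + L * R * R) (picard \<beta> u0 b0 f)"
proof -
  let ?u = "\<lambda>t x. fst (f (t, x))" and ?b = "\<lambda>t x. snd (f (t, x))"
  have u: "full_class \<beta> \<sigma> R ?u" and b: "full_class \<beta> \<sigma> R ?b" using f by (auto simp: pair_full_class_def)
  have h: "full_class \<beta> \<sigma> (L * A) (\<lambda>t. heat \<beta> t u0)" "full_class \<beta> \<sigma> (L * A) (\<lambda>t. heat \<beta> t b0)"
    using L u0 b0 by (auto simp: mhd_bounds_def)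
  have d: "full_class \<beta> \<sigma> (L * R * R) (duhamel \<beta> v v')" if "full_class \<beta> \<sigma> R v" "full_class \<beta> \<sigma> R v'" for v v' :: "real \<Rightarrow> real^'n \<Rightarrow> real^'n"
    using L that by (auto simp: mhd_bounds_def)
  show ?thesis unfolding pair_full_class_def picard_fst_snd
  proof (intro conjI allI impI)
    show "picard \<beta> u0 b0 f (t, x) = 0" if "t \<le> 0" for t x using that by (simp add: picard_def Let_def zero_prod_def)
  qed (intro full_class_cutoff full_class_arith[OF \<beta>] h d u b)+
qed

lemma picard_pair_sup_class:
  fixes u0 b0 :: "real^'n \<Rightarrow> real^'n"
  assumes L: "mhd_bounds TYPE('n) \<beta> \<sigma> L" and u0: "data_class \<beta> A u0" and b0: "data_class \<beta> A b0"
    and f: "pair_sup_class \<beta> R f"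
  shows "pair_sup_class \<beta> (L * A + L * R * R + L * R * R) (picard \<beta> u0 b0 f)"
proof -
  let ?u = "\<lambda>t x. fst (f (t, x))" and ?b = "\<lambda>t x. snd (f (t, x))"
  have u: "sup_class \<beta> R ?u" and b: "sup_class \<beta> R ?b" using f by (auto simp: pair_sup_class_def)
  have h: "sup_class \<beta> (L * A) (\<lambda>t. heat \<beta> t u0)" "sup_class \<beta> (L * A) (\<lambda>t. heat \<beta> t b0)"
    using L u0 b0 by (auto simp: mhd_bounds_def full_class_def)
  have d: "sup_class \<beta> (L * R * R) (duhamel \<beta> v v')" if "sup_class \<beta> R v" "sup_class \<beta> R v'" for v v' :: "real \<Rightarrow> real^'n \<Rightarrow> real^'n"
    using L that by (auto simp: mhd_bounds_def)
  show ?thesis unfolding pair_sup_class_def picard_fst_snd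
  proof (intro conjI allI impI)
    show "picard \<beta> u0 b0 f (t, x) = 0" if "t \<le> 0" for t x using that by (simp add: picard_def Let_def zero_prod_def)
  qed (intro sup_class_cutoff sup_class_arith h d u b)+
qed

lemma norm_components_le:
  fixes z :: "'a::real_normed_vector \<times> 'b::real_normed_vector"
  shows "norm (fst z) \<le> norm z" "norm (snd z) \<le> norm z" "norm z \<le> norm (fst z) + norm (snd z)"
  using norm_fst_le[of "fst z" "snd z"] norm_snd_le[of "snd z" "fst z"] norm_Pair_le[of "fst z" "snd z"] by simp_all

text \<open>Four bilinear differences occur, each at most \<open>L * R * \<delta>\<close>; the hypothesis makes their sum at most
\<open>\<delta> / 2\<close>.\<close>

lemma picard_contraction:
  fixes f g :: "real \<times> (real^'n) \<Rightarrow> (real^'n) \<times> (real^'n)"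
  assumes L: "mhd_bounds TYPE('n) \<beta> \<sigma> L" and f: "pair_sup_class \<beta> R f" and g: "pair_sup_class \<beta> R g" and R: "8 * L * R \<le> 1"
    and d: "\<And>i. norm (f i - g i) \<le> \<delta> * critical_weight \<beta> i"
  shows "norm (picard \<beta> u0 b0 f i - picard \<beta> u0 b0 g i) \<le> \<delta> / 2 * critical_weight \<beta> i"
proof (cases i)
  case (Pair t x)
  let ?uf = "\<lambda>t x. fst (f (t, x))" and ?bf = "\<lambda>t x. snd (f (t, x))" and ?ug = "\<lambda>t x. fst (g (t, x))" and ?bg = "\<lambda>t x. snd (g (t, x))"
  have S: "sup_class \<beta> R ?uf" "sup_class \<beta> R ?bf" "sup_class \<beta> R ?ug" "sup_class \<beta> R ?bg"
    using f g by (auto simp: pair_sup_class_def)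
  have D: "sup_class \<beta> \<delta> (\<lambda>t x. ?uf t x - ?ug t x)" "sup_class \<beta> \<delta> (\<lambda>t x. ?bf t x - ?bg t x)"
  proof -
    have "norm (?uf t x - ?ug t x) \<le> \<delta> * t powr (- crit_exp \<beta>)" "norm (?bf t x - ?bg t x) \<le> \<delta> * t powr (- crit_exp \<beta>)" if "t > 0" for t x
      using d[of "(t, x)"] that norm_components_le[of "f (t, x) - g (t, x)"]
      by (auto simp: critical_weight_def)
    then show "sup_class \<beta> \<delta> (\<lambda>t x. ?uf t x - ?ug t x)" "sup_class \<beta> \<delta> (\<lambda>t x. ?bf t x - ?bg t x)"
      using jointly_measurable_arith(2) sup_classD(1)[OF S(1)] sup_classD(1)[OF S(2)] sup_classD(1)[OF S(3)] sup_classD(1)[OF S(4)]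
      unfolding sup_class_def by auto
  qed
  show ?thesis
  proof (cases "t > 0")
    case True
    have dd: "norm (duhamel \<beta> v v' t x - duhamel \<beta> w w' t x) \<le> L * R * \<delta> * t powr (- crit_exp \<beta>)"
      if "sup_class \<beta> R v" "sup_class \<beta> R v'" "sup_class \<beta> R w" "sup_class \<beta> R w'" "sup_class \<beta> \<delta> (\<lambda>t x. v t x - w t x)" "sup_class \<beta> \<delta> (\<lambda>t x. v' t x - w' t x)" for v v' w w' :: "real \<Rightarrow> real^'n \<Rightarrow> real^'n"
      using L that True unfolding mhd_bounds_def by blast
    have tri: "norm ((h - a + b) - (h - a' + b')) \<le> M + M" if "norm (a - a') \<le> M" "norm (b - b') \<le> M" for h a b a' b' :: "real^'n" and M
      using norm_triangle_ineq4[of "b - b'" "a - a'"] that by (simp add: algebra_simps)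
    let ?M = "L * R * \<delta> * t powr (- crit_exp \<beta>)"
    have "norm (picard \<beta> u0 b0 f i - picard \<beta> u0 b0 g i) \<le> norm (fst (picard \<beta> u0 b0 f i - picard \<beta> u0 b0 g i)) + norm (snd (picard \<beta> u0 b0 f i - picard \<beta> u0 b0 g i))"
      by (rule norm_components_le)
    also have "\<dots> \<le> (?M + ?M) + (?M + ?M)"
      unfolding Pair fst_diff snd_diff picard_fst_snd if_P[OF True]
      by (intro add_mono tri dd S D)
    also have "\<dots> = (8 * L * R) * (\<delta> / 2 * t powr (- crit_exp \<beta>))" by simp
    also have "\<dots> \<le> 1 * (\<delta> / 2 * t powr (- crit_exp \<beta>))"
      using sup_class_nonneg[OF D(1)] by (intro mult_right_mono R) auto
    finally show ?thesis using True by (simp add: Pair critical_weight_def)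
  next
    case False
    then show ?thesis by (simp add: Pair critical_weight_def picard_def Let_def)
  qed
qed

text \<open>With \<open>R = 2 * L * A\<close> the smallness of \<open>A\<close> gives both \<open>L * A + 2 * L * R\<^sup>2 \<le> R\<close> and the contraction
condition.\<close>

lemma picard_fixed_point:
  fixes u0 b0 :: "real^'n \<Rightarrow> real^'n"
  assumes \<beta>: "0 < \<beta>" "\<beta> < 1" and L: "mhd_bounds TYPE('n) \<beta> \<sigma> L" and u0: "data_class \<beta> A u0" and b0: "data_class \<beta> A b0"
    and A: "A \<ge> 0" "16 * L * L * A \<le> 1"
  shows "\<exists>f. pair_full_class \<beta> \<sigma> (2 * L * A) f \<and> picard \<beta> u0 b0 f = f"
proof (rule weighted_fixed_point[where P = "pair_full_class \<beta> \<sigma> (2 * L * A)" and \<omega> = "critical_weight \<beta>" and ?f0.0 = "\<lambda>_. 0"])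
  let ?R = "2 * L * A"
  have L1: "L \<ge> 1" using L by (simp add: mhd_bounds_def)
  have R0: "?R \<ge> 0" using A L1 by simp
  have R8: "8 * L * ?R \<le> 1" using A by (simp add: mult_ac)
  have Rs: "L * A + L * ?R * ?R + L * ?R * ?R \<le> ?R"
  proof -
    have "8 * L * ?R * (L * A / 2) \<le> 1 * (L * A / 2)" using L1 A by (intro mult_right_mono R8) auto
    moreover have "0 \<le> L * A" using L1 A by simp
    ultimately have "8 * L * ?R * (L * A / 2) \<le> L * A" by linarith
    then show ?thesis by (simp add: algebra_simps)
  qed
  show P0: "pair_full_class \<beta> \<sigma> ?R (\<lambda>_. 0)" unfolding pair_full_class_def using full_class_zero[OF R0] by simp
  show PS: "pair_full_class \<beta> \<sigma> ?R (picard \<beta> u0 b0 f)" if "pair_full_class \<beta> \<sigma> ?R f" for f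
    using picard_pair_full_class[OF \<beta> L u0 b0 that] full_class_mono[OF _ Rs] by (auto simp: pair_full_class_def)
  show "norm (picard \<beta> u0 b0 (\<lambda>_. 0) i - 0) \<le> (2 * ?R) * critical_weight \<beta> i" for i
  proof (cases i)
    case (Pair t x)
    have F: "pair_sup_class \<beta> ?R (picard \<beta> u0 b0 (\<lambda>_. 0))" by (rule pair_full_class_sup[OF PS[OF P0]])
    show ?thesis
    proof (cases "t > 0")
      case True
      have "norm (picard \<beta> u0 b0 (\<lambda>_. 0) i) \<le> norm (fst (picard \<beta> u0 b0 (\<lambda>_. 0) i)) + norm (snd (picard \<beta> u0 b0 (\<lambda>_. 0) i))"
      by (rule norm_components_le)
      also have "\<dots> \<le> ?R * t powr (- crit_exp \<beta>) + ?R * t powr (- crit_exp \<beta>)"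
        using F True unfolding Pair pair_sup_class_def sup_class_def by (intro add_mono) blast+
      finally show ?thesis using True by (simp add: Pair critical_weight_def mult_ac)
    next
      case False
      then show ?thesis using F by (simp add: Pair critical_weight_def pair_sup_class_def)
    qed
  qed
  show "norm (picard \<beta> u0 b0 f i - picard \<beta> u0 b0 g i) \<le> \<delta> / 2 * critical_weight \<beta> i"
    if "pair_full_class \<beta> \<sigma> ?R f" "pair_full_class \<beta> \<sigma> ?R g" "\<And>i. norm (f i - g i) \<le> \<delta> * critical_weight \<beta> i" for f g \<delta> i
    by (rule picard_contraction[OF L pair_full_class_sup[OF that(1)] pair_full_class_sup[OF that(2)] R8 that(3)])
  show "pair_full_class \<beta> \<sigma> ?R f"
    if F: "\<And>m. pair_full_class \<beta> \<sigma> ?R (F m)" and n: "\<And>m i. norm (F m i - f i) \<le> D * (1/2) ^ m * critical_weight \<beta> i" for F f D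
  proof -
    have z: "f (t, x) = F m (t, x)" if "t \<le> 0" for t x m
      using n[of m "(t, x)"] that by (simp add: critical_weight_def)
    have nf: "norm (fst (F m (t, x)) - fst (f (t, x))) \<le> D * (1/2) ^ m * t powr (- crit_exp \<beta>)"
      "norm (snd (F m (t, x)) - snd (f (t, x))) \<le> D * (1/2) ^ m * t powr (- crit_exp \<beta>)" if "t > 0" for m t x
      using n[of m "(t, x)"] that norm_components_le[of "F m (t, x) - f (t, x)"]
      by (auto simp: critical_weight_def)
    have "full_class \<beta> \<sigma> ?R (\<lambda>t x. fst (f (t, x)))"
      by (rule full_class_limit[OF \<beta>, where U = "\<lambda>m t x. fst (F m (t, x))", OF _ nf(1)]) (use F z in \<open>auto simp: pair_full_class_def\<close>)
    moreover have "full_class \<beta> \<sigma> ?R (\<lambda>t x. snd (f (t, x)))"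
      by (rule full_class_limit[OF \<beta>, where U = "\<lambda>m t x. snd (F m (t, x))", OF _ nf(2)]) (use F z in \<open>auto simp: pair_full_class_def\<close>)
    moreover have "f (t, x) = 0" if "t \<le> 0" for t x
      using z[OF that, of x 0] F[of 0] that by (simp add: pair_full_class_def)
    ultimately show ?thesis by (simp add: pair_full_class_def)
  qed
qed

section \<open>Mild solutions as fixed points\<close>

lemma duhamel_cong_AE:
  fixes u v u' v' :: "real \<Rightarrow> real^'n \<Rightarrow> real^'n"
  assumes m: "\<And>s. s > 0 \<Longrightarrow> u s \<in> borel_measurable borel" "\<And>s. s > 0 \<Longrightarrow> v s \<in> borel_measurable borel"
      "\<And>s. s > 0 \<Longrightarrow> u' s \<in> borel_measurable borel" "\<And>s. s > 0 \<Longrightarrow> v' s \<in> borel_measurable borel"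
    and e: "\<And>s. s > 0 \<Longrightarrow> AE y in lborel. u s y = u' s y" "\<And>s. s > 0 \<Longrightarrow> AE y in lborel. v s y = v' s y"
  shows "duhamel \<beta> u v t x = duhamel \<beta> u' v' t x"
  unfolding duhamel_def
proof (rule set_lebesgue_integral_cong, simp, intro allI impI)
  fix s :: real assume "s \<in> {0<..<t}"
  then have s: "s > 0" by simp
  note [measurable] = m[OF s]
  have "conv (oseen_kernel \<beta> (t - s) j k l) (\<lambda>y. u s y $ l * v s y $ k) x = conv (oseen_kernel \<beta> (t - s) j k l) (\<lambda>y. u' s y $ l * v' s y $ k) x" for j k l
    unfolding conv_def
  proof (rule Bochner_Integration.integral_cong_AE)
    show "AE y in lborel. (u s y $ l * v s y $ k) *\<^sub>R oseen_kernel \<beta> (t - s) j k l (x - y) = (u' s y $ l * v' s y $ k) *\<^sub>R oseen_kernel \<beta> (t - s) j k l (x - y)"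
      using e(1)[OF s] e(2)[OF s] by eventually_elim simp
  qed measurable
  then show "heat_leray_div \<beta> (t - s) (u s) (v s) x = heat_leray_div \<beta> (t - s) (u' s) (v' s) x"
    by (simp add: vec_eq_iff heat_leray_div_nth)
qed

lemma picard_fixed_point_mild_solution:
  fixes u0 b0 :: "real^'n \<Rightarrow> real^'n"
  assumes \<beta>: "1/2 < \<beta>" "\<beta> < 1" and u0: "data_class \<beta> A u0" and b0: "data_class \<beta> A b0"
    and f: "pair_sup_class \<beta> R f" and fixed: "picard \<beta> u0 b0 f = f"
  shows "mild_solution \<beta> u0 b0 (\<lambda>t x. fst (f (t, x))) (\<lambda>t x. snd (f (t, x)))"
proof -
  let ?u = "\<lambda>t x. fst (f (t, x))" and ?b = "\<lambda>t x. snd (f (t, x))"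
  have S: "sup_class \<beta> R v" if "v \<in> {?u, ?b}" for v using f that by (auto simp: pair_sup_class_def)
  have m: "set_borel_measurable borel ({0<..} \<times> UNIV) (\<lambda>(t, x). v t x)" if "v \<in> {?u, ?b}" for v
  proof -
    have [measurable]: "(\<lambda>(t, x). v t x) \<in> borel_measurable borel"
      using sup_classD(1)[OF S[OF that]] unfolding jointly_measurable_def borel_prod .
    have [measurable]: "{0::real<..} \<times> (UNIV :: (real^'n) set) \<in> sets borel" by (intro borel_open open_Times) auto
    show ?thesis unfolding set_borel_measurable_def by measurable
  qed
  have c: "convolvable (heat_kernel \<beta> t) (\<lambda>y. g y $ j)" if "t > 0" "g \<in> {u0, b0}" for t g j
    unfolding convolvable_def real_scaleR_def using data_classD(3)[OF \<beta> u0 that(1)] data_classD(3)[OF \<beta> b0 that(1)] that(2) by auto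
  have d: "duhamel_defined \<beta> v v' t" if "v \<in> {?u, ?b}" "v' \<in> {?u, ?b}" "t > 0" for v v' t
    unfolding duhamel_defined_def using oseen_integrand_integrable[OF \<beta> S[OF that(1)] S[OF that(2)] that(3)] by (intro AE_I2 allI)
  have e: "?u t x = heat \<beta> t u0 x - duhamel \<beta> ?u ?u t x + duhamel \<beta> ?b ?b t x" "?b t x = heat \<beta> t b0 x - duhamel \<beta> ?u ?b t x + duhamel \<beta> ?b ?u t x" if "t > 0" for t x
    using picard_fst_snd[of \<beta> u0 b0 f t x] that unfolding fixed by simp_all
  show ?thesis unfolding mild_solution_def
  proof (intro conjI allI impI)
    show "\<forall>v\<in>{?u, ?b}. set_borel_measurable borel ({0<..} \<times> UNIV) (\<lambda>(t, x). v t x)" using m by (rule ballI)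
    fix t :: real assume t: "t > 0"
    show "\<forall>g\<in>{u0, b0}. \<forall>j. convolvable (heat_kernel \<beta> t) (\<lambda>y. g y $ j)" using c[OF t] by (intro ballI allI)
    show "\<forall>v\<in>{?u, ?b}. \<forall>v'\<in>{?u, ?b}. duhamel_defined \<beta> v v' t" using d t by (intro ballI)
    show "AE x in lborel. ?u t x = heat \<beta> t u0 x - duhamel \<beta> ?u ?u t x + duhamel \<beta> ?b ?b t x" by (rule AE_I2) (rule e(1)[OF t])
    show "AE x in lborel. ?b t x = heat \<beta> t b0 x - duhamel \<beta> ?u ?b t x + duhamel \<beta> ?b ?u t x" by (rule AE_I2) (rule e(2)[OF t])
  qed
qed

text \<open>The weights match since \<open>w/(2\<beta>) = crit_exp \<beta> + \<sigma>/(2\<beta>)\<close> for \<open>\<sigma> = w - (2\<beta>-1)\<close>.\<close>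

lemma full_class_mhd_norm:
  fixes v :: "real \<Rightarrow> real^'n \<Rightarrow> real^'n"
  assumes \<beta>: "1/2 < \<beta>" "\<beta> < 1" and v: "full_class \<beta> (w - (2 * \<beta> - 1)) R v" and t: "t > 0" and CB: "CB > 0"
    and besov: "\<forall>(f::real^'n \<Rightarrow> real^'n) B H. f \<in> borel_measurable borel \<longrightarrow> (\<forall>x. norm (f x) \<le> B) \<longrightarrow>
     (\<forall>x y. norm (f x - f y) \<le> H * norm (x - y) powr (w - (2 * \<beta> - 1))) \<longrightarrow> besov_norm \<phi> (w - (2 * \<beta> - 1)) f \<le> ennreal (CB * H)"
  shows "mhd_norm \<phi> \<beta> w t (v t) \<le> ennreal ((2 + CB) * R)"
proof -
  let ?\<sigma> = "w - (2 * \<beta> - 1)" and ?a = "(2 * \<beta> - 1) / (2 * \<beta>)"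
  let ?H = "R * t powr (- crit_exp \<beta> - ?\<sigma> / (2 * \<beta>))"
  have s: "sup_class \<beta> R v" and h: "hoelder_class \<beta> ?\<sigma> R v" and g: "gauge_class \<beta> R v" using v by (auto simp: full_class_def)
  note R0 = sup_class_nonneg[OF s]
  note m = sup_classD(3)[OF s, of t] and b = sup_classD(2)[OF s t]
  have G: "G_norm \<beta> (ereal (real CARD('n))) (2 * \<beta> - 1) (v t) \<le> ennreal R"
    by (rule G_norm_le[OF \<beta> m b]) (use g t in \<open>auto simp: gauge_class_def\<close>)
  have "ennreal (t powr ?a) * linf_norm (v t) \<le> ennreal (t powr ?a) * ennreal (R * t powr (- crit_exp \<beta>))"
    by (intro mult_left_mono linf_norm_le m b) auto
  also have "\<dots> = ennreal (t powr ?a * (R * t powr (- crit_exp \<beta>)))"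
    by (rule ennreal_mult[symmetric]) (use R0 in auto)
  also have "t powr ?a * (R * t powr (- crit_exp \<beta>)) = R"
    using t by (simp add: crit_exp_def powr_minus field_simps)
  finally have S: "ennreal (t powr ?a) * linf_norm (v t) \<le> ennreal R" .
  have "besov_norm \<phi> ?\<sigma> (v t) \<le> ennreal (CB * ?H)"
    using besov[rule_format, OF m b] h t unfolding hoelder_class_def by blast
  then have "ennreal (t powr (w / (2 * \<beta>))) * besov_norm \<phi> ?\<sigma> (v t) \<le> ennreal (t powr (w / (2 * \<beta>))) * ennreal (CB * ?H)"
    by (intro mult_left_mono) auto
  also have "\<dots> = ennreal (t powr (w / (2 * \<beta>)) * (CB * ?H))"
    by (rule ennreal_mult[symmetric]) (use R0 CB in auto)
  also have "t powr (w / (2 * \<beta>)) * (CB * ?H) = CB * R"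
  proof -
    have "t powr (w / (2 * \<beta>)) * t powr (- crit_exp \<beta> - ?\<sigma> / (2 * \<beta>)) = t powr 0"
      unfolding powr_add[symmetric] crit_exp_def using \<beta> by (simp add: field_simps)
    then show ?thesis using t by simp
  qed
  finally have B: "ennreal (t powr (w / (2 * \<beta>))) * besov_norm \<phi> ?\<sigma> (v t) \<le> ennreal (CB * R)" .
  have "mhd_norm \<phi> \<beta> w t (v t) \<le> ennreal R + ennreal R + ennreal (CB * R)"
    unfolding mhd_norm_def by (intro add_mono G S B)
  also have "\<dots> = ennreal ((2 + CB) * R)"
    using R0 CB by (simp add: ennreal_plus[symmetric] distrib_right del: ennreal_plus)
  finally show ?thesis .
qed

lemma picard_fixed_point_divergence_free:
  fixes u0 b0 :: "real^'n \<Rightarrow> real^'n"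
  assumes \<beta>: "1/2 < \<beta>" "\<beta> < 1" and L: "mhd_bounds TYPE('n) \<beta> \<sigma> L" and u0: "data_class \<beta> A u0" and b0: "data_class \<beta> A b0"
    and div: "divergence_free u0" "divergence_free b0"
    and f: "pair_sup_class \<beta> R f" and fixed: "picard \<beta> u0 b0 f = f" and t: "t > 0"
  shows "divergence_free (\<lambda>x. fst (f (t, x)))" "divergence_free (\<lambda>x. snd (f (t, x)))"
proof -
  let ?u = "\<lambda>t x. fst (f (t, x))" and ?b = "\<lambda>t x. snd (f (t, x))"
  have u: "sup_class \<beta> R ?u" and b: "sup_class \<beta> R ?b" using f by (auto simp: pair_sup_class_def)
  have h: "sup_class \<beta> (L * A) (\<lambda>t. heat \<beta> t g)" if "data_class \<beta> A g" for g :: "real^'n \<Rightarrow> real^'n"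
    using L that by (auto simp: mhd_bounds_def full_class_def)
  have d: "sup_class \<beta> (L * R * R) (duhamel \<beta> v v')" if "sup_class \<beta> R v" "sup_class \<beta> R v'" for v v' :: "real \<Rightarrow> real^'n \<Rightarrow> real^'n"
    using L that by (auto simp: mhd_bounds_def)
  have main: "divergence_free (\<lambda>x. heat \<beta> t g x - duhamel \<beta> v1 v2 t x + duhamel \<beta> v3 v4 t x)"
    if g: "data_class \<beta> A g" "divergence_free g" and v: "sup_class \<beta> R v1" "sup_class \<beta> R v2" "sup_class \<beta> R v3" "sup_class \<beta> R v4"
    for g and v1 v2 v3 v4 :: "real \<Rightarrow> real^'n \<Rightarrow> real^'n"
  proof (rule divergence_free_combine)
    note H = h[OF g(1)] and D1 = d[OF v(1,2)] and D2 = d[OF v(3,4)]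
    let ?B = "max (L * A) (L * R * R) * t powr (- crit_exp \<beta>)"
    show "heat \<beta> t g \<in> borel_measurable borel" "duhamel \<beta> v1 v2 t \<in> borel_measurable borel" "duhamel \<beta> v3 v4 t \<in> borel_measurable borel"
      using sup_classD(3)[OF H] sup_classD(3)[OF D1] sup_classD(3)[OF D2] by auto
    show "norm (heat \<beta> t g x) \<le> ?B" for x by (rule order_trans[OF sup_classD(2)[OF H t]]) (simp add: mult_right_mono)
    show "norm (duhamel \<beta> v1 v2 t x) \<le> ?B" for x by (rule order_trans[OF sup_classD(2)[OF D1 t]]) (simp add: mult_right_mono)
    show "norm (duhamel \<beta> v3 v4 t x) \<le> ?B" for x by (rule order_trans[OF sup_classD(2)[OF D2 t]]) (simp add: mult_right_mono)
    show "divergence_free (heat \<beta> t g)" by (rule heat_divergence_free[OF \<beta> g(1) t g(2)])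
    show "divergence_free (duhamel \<beta> v1 v2 t)" by (rule duhamel_divergence_free[OF \<beta> v(1,2) t])
    show "divergence_free (duhamel \<beta> v3 v4 t)" by (rule duhamel_divergence_free[OF \<beta> v(3,4) t])
  qed
  have "?u t x = heat \<beta> t u0 x - duhamel \<beta> ?u ?u t x + duhamel \<beta> ?b ?b t x" "?b t x = heat \<beta> t b0 x - duhamel \<beta> ?u ?b t x + duhamel \<beta> ?b ?u t x" for x
    using picard_fst_snd[of \<beta> u0 b0 f t x] t unfolding fixed by simp_all
  then show "divergence_free (?u t)" "divergence_free (?b t)"
    using main[OF u0 div(1) u u b b] main[OF b0 div(2) u b b u] by presburger+
qed

text \<open>Values violating the essential bound are set to \<open>0\<close>, which keeps joint measurability and changes
each \<open>u t\<close> on a null set only.\<close>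

lemma bounded_representative:
  fixes u :: "real \<Rightarrow> real^'n \<Rightarrow> real^'n"
  assumes m: "set_borel_measurable borel ({0<..} \<times> UNIV) (\<lambda>(t, x). u t x)" and N: "N \<ge> 0"
    and b: "\<And>t. t > 0 \<Longrightarrow> ennreal (t powr crit_exp \<beta>) * linf_norm (u t) \<le> ennreal N"
  shows "\<exists>v. sup_class \<beta> N v \<and> (\<forall>t\<le>0. \<forall>x. v t x = 0) \<and> (\<forall>t>0. u t \<in> borel_measurable borel \<and> (AE x in lborel. u t x = v t x))"
proof -
  define g where "g = (\<lambda>t x. if t > 0 then u t x else 0)"
  have "(\<lambda>(t, x). g t x) = (\<lambda>x. indicator ({0<..} \<times> UNIV) x *\<^sub>R (case x of (t, x) \<Rightarrow> u t x))" by (auto simp: g_def fun_eq_iff)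
  with m have g: "jointly_measurable g" unfolding jointly_measurable_def borel_prod set_borel_measurable_def by simp
  define v where "v = (\<lambda>t x. if t > 0 \<and> norm (g t x) \<le> N * t powr (- crit_exp \<beta>) then g t x else 0)"
  have "jointly_measurable v"
    unfolding jointly_measurable_def v_def using jointly_measurableD[OF g, measurable (raw)] by measurable
  then have s: "sup_class \<beta> N v" unfolding sup_class_def using N by (auto simp: v_def)
  have "u t \<in> borel_measurable borel \<and> (AE x in lborel. u t x = v t x)" if t: "t > 0" for t
  proof
    have gu: "g t = u t" using t by (simp add: g_def)
    show "u t \<in> borel_measurable borel" using jointly_measurable_slice[OF g, of t] by (simp add: gu)
    have "linf_norm (u t) = ennreal (t powr (- crit_exp \<beta>)) * (ennreal (t powr crit_exp \<beta>) * linf_norm (u t))"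
      using t by (simp add: mult.assoc[symmetric] ennreal_mult[symmetric] powr_add[symmetric])
    also have "\<dots> \<le> ennreal (t powr (- crit_exp \<beta>)) * ennreal N" by (intro mult_left_mono b t) auto
    also have "\<dots> = ennreal (N * t powr (- crit_exp \<beta>))" using N by (simp add: ennreal_mult[symmetric] mult.commute)
    finally have l: "linf_norm (u t) \<le> ennreal (N * t powr (- crit_exp \<beta>))" .
    have "AE x in lborel. ennreal (norm (u t x)) \<le> linf_norm (u t)" unfolding linf_norm_def by (rule esssup_AE)
    then show "AE x in lborel. u t x = v t x"
    proof eventually_elim
      case (elim x)
      then have "ennreal (norm (u t x)) \<le> ennreal (N * t powr (- crit_exp \<beta>))" using l by (rule order_trans)
      then have "norm (u t x) \<le> N * t powr (- crit_exp \<beta>)" using N by (subst (asm) ennreal_le_iff) auto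
      then show ?case using t by (simp add: v_def gu)
    qed
  qed
  then show ?thesis using s by (intro exI[of _ v]) (auto simp: v_def)
qed

text \<open>Let \<open>g\<close> be the bounded representative and \<open>f = picard g\<close>. The mild equations say that \<open>f\<close> equals
\<open>g\<close> almost everywhere at each time, the Duhamel integrals do not see the difference, and so
\<open>picard f = picard g = f\<close> at every point.\<close>

lemma mild_solution_picard_fixed_point:
  fixes u0 b0 :: "real^'n \<Rightarrow> real^'n"
  assumes L: "mhd_bounds TYPE('n) \<beta> \<sigma> L" and u0: "data_class \<beta> A u0" and b0: "data_class \<beta> A b0"
    and mild: "mild_solution \<beta> u0 b0 u b" and N: "N \<ge> 0"
    and bd: "\<And>t v. t > 0 \<Longrightarrow> v \<in> {u, b} \<Longrightarrow> ennreal (t powr crit_exp \<beta>) * linf_norm (v t) \<le> ennreal N"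
  shows "\<exists>f. pair_sup_class \<beta> (L * A + L * N * N + L * N * N) f \<and> picard \<beta> u0 b0 f = f \<and>
    (\<forall>t>0. AE x in lborel. u t x = fst (f (t, x)) \<and> b t x = snd (f (t, x)))"
proof -
  have mu: "set_borel_measurable borel ({0<..} \<times> UNIV) (\<lambda>(t, x). u t x)" and mb: "set_borel_measurable borel ({0<..} \<times> UNIV) (\<lambda>(t, x). b t x)"
    using mild by (auto simp: mild_solution_def)
  have "\<exists>v. sup_class \<beta> N v \<and> (\<forall>t\<le>0. \<forall>x. v t x = 0) \<and> (\<forall>t>0. u t \<in> borel_measurable borel \<and> (AE x in lborel. u t x = v t x))"
    by (rule bounded_representative[OF mu N]) (rule bd; simp)
  then obtain u1 where u1: "sup_class \<beta> N u1" "\<forall>t\<le>0. \<forall>x. u1 t x = 0" and u1': "\<forall>t>0. u t \<in> borel_measurable borel \<and> (AE x in lborel. u t x = u1 t x)"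
    by (elim exE conjE)
  note um = conjunct1[OF u1'[rule_format]] and ue = conjunct2[OF u1'[rule_format]]
  have "\<exists>v. sup_class \<beta> N v \<and> (\<forall>t\<le>0. \<forall>x. v t x = 0) \<and> (\<forall>t>0. b t \<in> borel_measurable borel \<and> (AE x in lborel. b t x = v t x))"
    by (rule bounded_representative[OF mb N]) (rule bd; simp)
  then obtain b1 where b1: "sup_class \<beta> N b1" "\<forall>t\<le>0. \<forall>x. b1 t x = 0" and b1': "\<forall>t>0. b t \<in> borel_measurable borel \<and> (AE x in lborel. b t x = b1 t x)"
    by (elim exE conjE)
  note bm = conjunct1[OF b1'[rule_format]] and be = conjunct2[OF b1'[rule_format]]
  define g where "g = (\<lambda>(t, x). (u1 t x, b1 t x))"
  have g: "pair_sup_class \<beta> N g" using u1(1,2) b1(1,2) by (simp add: pair_sup_class_def g_def zero_prod_def)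
  define f where "f = picard \<beta> u0 b0 g"
  have f: "pair_sup_class \<beta> (L * A + L * N * N + L * N * N) f" unfolding f_def by (rule picard_pair_sup_class[OF L u0 b0 g])
  have mf: "(\<lambda>x. fst (f (t, x))) \<in> borel_measurable borel" "(\<lambda>x. snd (f (t, x))) \<in> borel_measurable borel" for t
    using f sup_classD(3) unfolding pair_sup_class_def by blast+
  have eq: "AE x in lborel. u t x = fst (f (t, x)) \<and> b t x = snd (f (t, x))" if t: "t > 0" for t
  proof -
    have "duhamel \<beta> v v' t x = duhamel \<beta> w w' t x" if "(v, w) \<in> {(u, u1), (b, b1)}" "(v', w') \<in> {(u, u1), (b, b1)}" for v v' w w' x
      by (rule duhamel_cong_AE) (use that um ue bm be sup_classD(3)[OF u1(1)] sup_classD(3)[OF b1(1)] in auto)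
    then have D: "duhamel \<beta> u u t x = duhamel \<beta> u1 u1 t x" "duhamel \<beta> b b t x = duhamel \<beta> b1 b1 t x"
      "duhamel \<beta> u b t x = duhamel \<beta> u1 b1 t x" "duhamel \<beta> b u t x = duhamel \<beta> b1 u1 t x" for x by simp_all
    have "AE x in lborel. u t x = heat \<beta> t u0 x - duhamel \<beta> u u t x + duhamel \<beta> b b t x"
      "AE x in lborel. b t x = heat \<beta> t b0 x - duhamel \<beta> u b t x + duhamel \<beta> b u t x"
      using mild t by (auto simp: mild_solution_def)
    then show ?thesis
      by eventually_elim (use t in \<open>simp add: f_def picard_fst_snd g_def D\<close>)
  qed
  have "picard \<beta> u0 b0 f = picard \<beta> u0 b0 g"
  proof -
    let ?uf = "\<lambda>t x. fst (f (t, x))" and ?bf = "\<lambda>t x. snd (f (t, x))"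
    have "AE y in lborel. fst (f (s, y)) = u1 s y" "AE y in lborel. snd (f (s, y)) = b1 s y" if s: "s > 0" for s
      using eq[OF s] ue[OF s] be[OF s] by (eventually_elim, simp)+
    then have cong: "duhamel \<beta> v v' t x = duhamel \<beta> w w' t x"
      if "(v, w) \<in> {(?uf, u1), (?bf, b1)}" "(v', w') \<in> {(?uf, u1), (?bf, b1)}" for v v' w w' t x
      by (intro duhamel_cong_AE) (use that mf sup_classD(3)[OF u1(1)] sup_classD(3)[OF b1(1)] in auto)
    have D: "duhamel \<beta> ?uf ?uf t x = duhamel \<beta> u1 u1 t x" "duhamel \<beta> ?bf ?bf t x = duhamel \<beta> b1 b1 t x"
      "duhamel \<beta> ?uf ?bf t x = duhamel \<beta> u1 b1 t x" "duhamel \<beta> ?bf ?uf t x = duhamel \<beta> b1 u1 t x" for t x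
      by (rule cong; simp)+
    have "fst (picard \<beta> u0 b0 f (t, x)) = fst (picard \<beta> u0 b0 g (t, x))" "snd (picard \<beta> u0 b0 f (t, x)) = snd (picard \<beta> u0 b0 g (t, x))" for t x
      unfolding picard_fst_snd D by (simp_all add: g_def)
    then show ?thesis by (auto simp: fun_eq_iff prod_eq_iff)
  qed
  then have "picard \<beta> u0 b0 f = f" by (simp add: f_def)
  then show ?thesis using f eq by blast
qed

lemma picard_fixed_point_unique:
  fixes f g :: "real \<times> (real^'n) \<Rightarrow> (real^'n) \<times> (real^'n)"
  assumes L: "mhd_bounds TYPE('n) \<beta> \<sigma> L" and f: "pair_sup_class \<beta> R f" and g: "pair_sup_class \<beta> R g" and R: "8 * L * R \<le> 1"
    and fixed: "picard \<beta> u0 b0 f = f" "picard \<beta> u0 b0 g = g"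
  shows "f = g"
proof (rule weighted_fixed_point_unique[where \<Phi> = "picard \<beta> u0 b0" and \<omega> = "critical_weight \<beta>" and D = "4 * R", OF fixed])
  show "norm (f i - g i) \<le> 4 * R * critical_weight \<beta> i" for i
  proof (cases i)
    case (Pair t x)
    show ?thesis
    proof (cases "t > 0")
      case True
      let ?M = "R * t powr (- crit_exp \<beta>)"
      have b: "norm (h (t, x)) \<le> ?M + ?M" if h: "pair_sup_class \<beta> R h" for h
      proof -
        have "norm (h (t, x)) \<le> norm (fst (h (t, x))) + norm (snd (h (t, x)))" by (rule norm_components_le)
        also have "\<dots> \<le> ?M + ?M" using h True unfolding pair_sup_class_def sup_class_def by (intro add_mono) blast+
        finally show ?thesis .
      qed
      show ?thesis using norm_triangle_ineq4[of "f (t, x)" "g (t, x)"] b[OF f] b[OF g] True by (simp add: Pair critical_weight_def)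
    next
      case False
      then show ?thesis using f g by (simp add: Pair critical_weight_def pair_sup_class_def)
    qed
  qed
  show "norm (picard \<beta> u0 b0 f i - picard \<beta> u0 b0 g i) \<le> \<delta> / 2 * critical_weight \<beta> i"
    if "\<And>i. norm (f i - g i) \<le> \<delta> * critical_weight \<beta> i" for \<delta> i
    by (rule picard_contraction[OF L f g R that])
qed

lemma pair_sup_class_mono: "pair_sup_class \<beta> A f \<Longrightarrow> A \<le> B \<Longrightarrow> pair_sup_class \<beta> B f"
  unfolding pair_sup_class_def by (auto intro: sup_class_mono)

theorem theorem1p5:
  fixes \<beta> w :: real and p :: ereal and \<phi> :: "real^'n \<Rightarrow> complex"
  assumes "CARD('n) \<ge> 2"
    and "1/2 < \<beta>" and "\<beta> < 1"
    and "ereal (real CARD('n)) \<le> p"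
    and "max (2 * \<beta> - 1) (2 - 2 * \<beta>) < w" and "w < 2 * \<beta>"
    and "1 + ereal (real CARD('n)) / p + ereal w < ereal (4 * \<beta>)"
    and "littlewood_paley \<phi>"
  shows "\<exists>\<epsilon>>0. \<exists>C>0.
    \<forall>u0 \<in> G_space \<beta> (ereal (real CARD('n))) (2 * \<beta> - 1).
    \<forall>b0 \<in> G_space \<beta> (ereal (real CARD('n))) (2 * \<beta> - 1).
      divergence_free u0 \<longrightarrow> divergence_free b0 \<longrightarrow>
      G_norm \<beta> (ereal (real CARD('n))) (2 * \<beta> - 1) u0
        + G_norm \<beta> (ereal (real CARD('n))) (2 * \<beta> - 1) b0 \<le> ennreal \<epsilon> \<longrightarrow>
      (let admissible = (\<lambda>(u :: real \<Rightarrow> real^'n \<Rightarrow> real^'n) b.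
             mild_solution \<beta> u0 b0 u b \<and>
             (\<forall>t>0. \<forall>v\<in>{u, b}. mhd_norm \<phi> \<beta> w t (v t)
                \<le> ennreal C * (G_norm \<beta> (ereal (real CARD('n))) (2 * \<beta> - 1) u0
                                 + G_norm \<beta> (ereal (real CARD('n))) (2 * \<beta> - 1) b0)))
       in \<exists>u b. admissible u b \<and>
            (\<forall>t>0. divergence_free (u t) \<and> divergence_free (b t)) \<and>
            (\<forall>u' b'. admissible u' b' \<longrightarrow>
               (\<forall>t>0. AE x in lborel. u' t x = u t x \<and> b' t x = b t x)))"
proof -
  note \<beta> = \<open>1/2 < \<beta>\<close> \<open>\<beta> < 1\<close>
  have \<beta>0: "0 < \<beta>" using \<beta> by simp
  define \<sigma> where "\<sigma> = w - (2 * \<beta> - 1)"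
  have sg: "0 < \<sigma>" "\<sigma> \<le> 1" using assms(5,6) by (simp_all add: \<sigma>_def)
  obtain L where L: "mhd_bounds TYPE('n) \<beta> \<sigma> L" using mhd_bounds_exist[OF \<beta> sg, where 'n='n] by (elim exE)
  then have L1: "L \<ge> 1" by (simp add: mhd_bounds_def)
  obtain CB where CB: "CB > 0" and besov: "\<forall>(f::real^'n \<Rightarrow> real^'n) B H. f \<in> borel_measurable borel \<longrightarrow> (\<forall>x. norm (f x) \<le> B) \<longrightarrow>
     (\<forall>x y. norm (f x - f y) \<le> H * norm (x - y) powr \<sigma>) \<longrightarrow> besov_norm \<phi> \<sigma> f \<le> ennreal (CB * H)"
    using besov_norm_le_hoelder[OF assms(8) sg] by (elim exE conjE)
  \<comment> \<open>the solution lies in the ball of radius \<open>2 * L * A\<close>, and its three norms add up to at most \<open>2 + CB\<close> times the radius\<close>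
  define C where "C = (2 + CB) * (2 * L)"
  have "C > 0" unfolding C_def using CB L1 by (intro mult_pos_pos) auto
  moreover have "2 * (2 * L) \<le> C" unfolding C_def using CB L1 by (intro mult_right_mono) auto
  ultimately have C: "C > 0" "4 * L \<le> C" by simp_all
  \<comment> \<open>chosen so that the Picard map contracts on the ball of radius \<open>C * A\<close>, which holds every competing solution\<close>
  define \<epsilon> where "\<epsilon> = 1 / (8 * L * C)"
  have \<epsilon>: "\<epsilon> > 0" using C L1 by (simp add: \<epsilon>_def)
  let ?G = "G_norm \<beta> (ereal (real CARD('n))) (2 * \<beta> - 1) :: (real^'n \<Rightarrow> real^'n) \<Rightarrow> ennreal"
  let ?X = "G_space \<beta> (ereal (real CARD('n))) (2 * \<beta> - 1) :: (real^'n \<Rightarrow> real^'n) set"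
  let ?adm = "\<lambda>u0 b0 (u :: real \<Rightarrow> real^'n \<Rightarrow> real^'n) b. mild_solution \<beta> u0 b0 u b \<and> (\<forall>t>0. \<forall>v\<in>{u, b}. mhd_norm \<phi> \<beta> w t (v t) \<le> ennreal C * (?G u0 + ?G b0))"
  have main: "\<exists>u b. ?adm u0 b0 u b \<and> (\<forall>t>0. divergence_free (u t) \<and> divergence_free (b t)) \<and>
      (\<forall>u' b'. ?adm u0 b0 u' b' \<longrightarrow> (\<forall>t>0. AE x in lborel. u' t x = u t x \<and> b' t x = b t x))"
    if X: "u0 \<in> ?X" "b0 \<in> ?X" and div: "divergence_free u0" "divergence_free b0" and small: "?G u0 + ?G b0 \<le> ennreal \<epsilon>" for u0 b0
  proof -
    define A where "A = enn2real (?G u0 + ?G b0)"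
    have GA: "?G u0 + ?G b0 = ennreal A"
      unfolding A_def by (rule ennreal_enn2real[symmetric]) (rule le_less_trans[OF small ennreal_less_top])
    have A0: "A \<ge> 0" by (simp add: A_def)
    have "A \<le> \<epsilon>" using small \<epsilon> by (simp add: GA ennreal_le_iff)
    define N where "N = C * A"
    have NC: "N = (2 + CB) * (2 * L * A)" by (simp add: N_def C_def)
    have N0: "N \<ge> 0" using C A0 by (simp add: N_def)
    have "8 * L * C * A \<le> 8 * L * C * \<epsilon>" using \<open>A \<le> \<epsilon>\<close> C L1 by (intro mult_left_mono) auto
    also have "\<dots> = 1" using C L1 by (simp add: \<epsilon>_def)
    finally have N8: "8 * L * N \<le> 1" by (simp add: N_def mult_ac)
    have LA: "4 * (L * A) \<le> N" using mult_right_mono[OF C(2) A0] by (simp add: N_def mult_ac)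
    have A16: "16 * L * L * A \<le> 1"
    proof -
      have "4 * L * (4 * (L * A)) \<le> 4 * L * N" by (intro mult_left_mono LA) (use L1 in auto)
      also have "\<dots> \<le> 8 * L * N" using L1 N0 by (intro mult_right_mono) auto
      also note N8
      finally show ?thesis by (simp add: mult_ac)
    qed
    have bm: "u0 \<in> borel_measurable borel" "b0 \<in> borel_measurable borel" using X by (simp_all add: G_space_def)
    have "?G u0 \<le> ennreal A" "?G b0 \<le> ennreal A" by (simp_all add: GA[symmetric])
    then have u0: "data_class \<beta> A u0" and b0: "data_class \<beta> A b0"
      using G_norm_data_class[OF \<beta> bm(1) _ A0] G_norm_data_class[OF \<beta> bm(2) _ A0] by simp_all
    obtain f where f: "pair_full_class \<beta> \<sigma> (2 * L * A) f" and ff: "picard \<beta> u0 b0 f = f"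
      using picard_fixed_point[OF \<beta>0 \<beta>(2) L u0 b0 A0 A16] by blast
    note fs = pair_full_class_sup[OF f]
    define u b where "u = (\<lambda>t x. fst (f (t, x)))" and "b = (\<lambda>t x. snd (f (t, x)))"
    have fc: "full_class \<beta> (w - (2 * \<beta> - 1)) (2 * L * A) v" if "v \<in> {u, b}" for v
      using f that by (auto simp: pair_full_class_def u_def b_def \<sigma>_def)
    have cN: "ennreal C * (?G u0 + ?G b0) = ennreal N" using C A0 by (simp add: GA N_def ennreal_mult)
    have adm: "?adm u0 b0 u b"
    proof (intro conjI allI impI ballI)
      show "mild_solution \<beta> u0 b0 u b" unfolding u_def b_def by (rule picard_fixed_point_mild_solution[OF \<beta> u0 b0 fs ff])
      fix t :: real and v assume t: "t > 0" and v: "v \<in> {u, b}"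
      show "mhd_norm \<phi> \<beta> w t (v t) \<le> ennreal C * (?G u0 + ?G b0)"
        unfolding cN NC by (rule full_class_mhd_norm[OF \<beta> fc[OF v] t CB besov[unfolded \<sigma>_def]])
    qed
    have dv: "divergence_free (u t) \<and> divergence_free (b t)" if t: "t > 0" for t
      unfolding u_def b_def using picard_fixed_point_divergence_free[OF \<beta> L u0 b0 div fs ff t] by simp
    have "AE x in lborel. u' t x = u t x \<and> b' t x = b t x" if adm': "?adm u0 b0 u' b'" and t: "t > 0" for u' b' t
    proof -
      have bd: "ennreal (s powr crit_exp \<beta>) * linf_norm (v s) \<le> ennreal N" if "s > 0" "v \<in> {u', b'}" for s v
      proof -
        have "ennreal (s powr crit_exp \<beta>) * linf_norm (v s) \<le> mhd_norm \<phi> \<beta> w s (v s)"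
          unfolding mhd_norm_def crit_exp_def by (simp add: add.assoc add.left_commute[of "G_norm _ _ _ _"])
        also have "\<dots> \<le> ennreal N" using adm' that unfolding cN by blast
        finally show ?thesis .
      qed
      have "\<exists>g. pair_sup_class \<beta> (L * A + L * N * N + L * N * N) g \<and> picard \<beta> u0 b0 g = g \<and>
          (\<forall>t>0. AE x in lborel. u' t x = fst (g (t, x)) \<and> b' t x = snd (g (t, x)))"
        by (rule mild_solution_picard_fixed_point[OF L u0 b0 conjunct1[OF adm'] N0]) (rule bd; assumption)
      then obtain g where g: "pair_sup_class \<beta> (L * A + L * N * N + L * N * N) g" and gf: "picard \<beta> u0 b0 g = g"
        and e: "\<forall>t>0. AE x in lborel. u' t x = fst (g (t, x)) \<and> b' t x = snd (g (t, x))"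
        by (elim exE conjE)
      have "8 * L * N * N \<le> 1 * N" by (rule mult_right_mono[OF N8 N0])
      then have "L * A + L * N * N + L * N * N \<le> N" "2 * L * A \<le> N" using LA N0 A0 L1 by (simp_all add: algebra_simps)
      then have "pair_sup_class \<beta> N g" "pair_sup_class \<beta> N f" using pair_sup_class_mono g fs by blast+
      then have "g = f" by (rule picard_fixed_point_unique[OF L _ _ N8 gf ff])
      then show ?thesis using e t by (simp add: u_def b_def)
    qed
    then have uniq: "\<forall>u' b'. ?adm u0 b0 u' b' \<longrightarrow> (\<forall>t>0. AE x in lborel. u' t x = u t x \<and> b' t x = b t x)" by (intro allI impI)
    have dv': "\<forall>t>0. divergence_free (u t) \<and> divergence_free (b t)" using dv by (intro allI impI)
    show ?thesis by (rule exI[of _ u], rule exI[of _ b], rule conjI[OF adm conjI[OF dv' uniq]])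
  qed
  show ?thesis
    unfolding Let_def
    by (rule exI[of _ \<epsilon>], rule conjI[OF \<epsilon>], rule exI[of _ C], rule conjI[OF C(1)], intro ballI impI, rule main)
qed

end
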